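(* Fix $m\in\mathbb{Z}_{\ge0}$. (1) Let $n$ be squarefree and $(V,Q)$ a nondegenerate quadratic space over $\mathbb{Z}/n\mathbb{Z}$ with $\operatorname{rank}V\ge2m+2$. Then the number of orbits of $\mathrm{O}(Q)$ acting diagonally on $V^m$ is $\prod_{\ell\mid n\text{ prime}}(1+\ell)(1+\ell^2)\cdots(1+\ell^m)$. (2) In the setting of (1), the orbits of $\Omega(Q)$ on $V^m$ coincide with those of $\mathrm{O}(Q)$. (3) Let $\ell$ be prime and $(V,Q)$ a split quadratic space over $\mathbb{F}_\ell$ of dimension $r=2m$. Then the number of orbits of $\mathrm{O}(Q)$ on $V^m$ is $(1+\ell)(1+\ell^2)\cdots(1+\ell^m)$. (4) In the setting of (3), the number of orbits of $\mathrm{SO}(Q)$ on $V^m$ equals the number of orbits of $\mathrm{O}(Q)$ on $V^m$ plus $1$.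
   Context: Over $\mathbb{Z}/n\mathbb{Z}$ with $n$ squarefree, $(V,Q)$ is a free module with a quadratic form, nondegenerate if its reduction modulo each prime $\ell\mid n$ is nondegenerate (smooth quadric), and $\mathrm{O}(Q)=\prod_{\ell\mid n}\mathrm{O}(Q\bmod\ell)$. Over $\mathbb{F}_\ell$: with $B(x,y)=Q(x+y)-Q(x)-Q(y)$ and reflections $r_v(w)=w-\frac{B(w,v)}{Q(v)}v$ ($Q(v)\ne0$), the Dickson invariant is $(1-\det)/2$ for $\ell$ odd and, for $\ell=2$, sends a product of $s$ reflections to $s\bmod2$; the ($-1$-)spinor norm is the homomorphism to $\mathbb{F}_\ell^\times/(\mathbb{F}_\ell^\times)^2$ with $r_v\mapsto[-Q(v)]$ (trivial for $\ell=2$). $\Omega(Q)$ is the product over $\ell\mid n$ of the joint kernels of Dickson invariant and spinor norm; $\mathrm{SO}(Q)$ is the kernel of the Dickson invariant. A split quadratic space of dimension $2m$ is one isomorphic to $\mathbb{F}_\ell^{2m}$ with $Q=\sum_{i=1}^mx_iy_i$.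
   Formalization: In (1),(2), if n is even and m>0, rank V is assumed even: for odd rank over F_2 the radical vector is fixed, so (1) fails (rank 5, m=1: 4 orbits, not 3) and the Dickson invariant is ill-defined. In (4), m>0 is assumed: for m=0 both groups have one orbit. *)

theory Defs
  imports
    "HOL-Algebra.Group_Action"
    "HOL-Algebra.Module"
    "HOL-Computational_Algebra.Squarefree"
    "HOL-Number_Theory.Residues"
    "Jordan_Normal_Form.Determinant"
begin

section \<open>Free modules over \<open>\<int>/n\<close>\<close>

text \<open>
  Elements of \<open>\<int>/n\<close> are represented by the integers \<open>0, \<dots>, n - 1\<close>. The unit of
  \<^const>\<open>residue_ring\<close> is the integer 1 even for \<open>n = 1\<close>, where it lies outside the carrier; the
  update makes \<open>\<int>/1\<close> the zero ring.
\<close>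

definition zmod :: "nat \<Rightarrow> int ring" where
  "zmod n = (residue_ring (int n))\<lparr>one := 1 mod int n\<rparr>"

definition lin_comb :: "(int, 'v) module \<Rightarrow> 'v list \<Rightarrow> (nat \<Rightarrow> int) \<Rightarrow> 'v" where
  "lin_comb V bs a = (\<Oplus>\<^bsub>V\<^esub>i\<in>{..<length bs}. a i \<odot>\<^bsub>V\<^esub> (bs ! i))"

definition is_basis :: "nat \<Rightarrow> (int, 'v) module \<Rightarrow> 'v list \<Rightarrow> bool" where
  "is_basis n V bs \<longleftrightarrow> set bs \<subseteq> carrier V \<and>
     bij_betw (lin_comb V bs) ({..<length bs} \<rightarrow>\<^sub>E carrier (zmod n)) (carrier V)"

definition free_of_rank :: "nat \<Rightarrow> (int, 'v) module \<Rightarrow> nat \<Rightarrow> bool" where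
  "free_of_rank n V r \<longleftrightarrow> module (zmod n) V \<and> (\<exists>bs. is_basis n V bs \<and> length bs = r)"

definition coords :: "nat \<Rightarrow> (int, 'v) module \<Rightarrow> 'v list \<Rightarrow> 'v \<Rightarrow> nat \<Rightarrow> int" where
  "coords n V bs = inv_into ({..<length bs} \<rightarrow>\<^sub>E carrier (zmod n)) (lin_comb V bs)"

definition lin_auts :: "nat \<Rightarrow> (int, 'v) module \<Rightarrow> ('v \<Rightarrow> 'v) set" where
  "lin_auts n V = {g \<in> Bij (carrier V).
     (\<forall>x\<in>carrier V. \<forall>y\<in>carrier V. g (x \<oplus>\<^bsub>V\<^esub> y) = g x \<oplus>\<^bsub>V\<^esub> g y) \<and>
     (\<forall>a\<in>carrier (zmod n). \<forall>x\<in>carrier V. g (a \<odot>\<^bsub>V\<^esub> x) = a \<odot>\<^bsub>V\<^esub> g x)}"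

text \<open>
  The determinant of an endomorphism of a free module, computed from its matrix (of integer
  representatives) in some basis; it does not depend on the basis.
\<close>

definition lin_det :: "nat \<Rightarrow> (int, 'v) module \<Rightarrow> ('v \<Rightarrow> 'v) \<Rightarrow> int" where
  "lin_det n V g = (let bs = SOME bs. is_basis n V bs; r = length bs in
     det (mat r r (\<lambda>(i, j). coords n V bs (g (bs ! j)) i)) mod int n)"


section \<open>Quadratic forms\<close>

definition polar :: "nat \<Rightarrow> (int, 'v) module \<Rightarrow> ('v \<Rightarrow> int) \<Rightarrow> 'v \<Rightarrow> 'v \<Rightarrow> int" where
  "polar n V Q x y = (Q (x \<oplus>\<^bsub>V\<^esub> y) - Q x - Q y) mod int n"

definition quadratic_form :: "nat \<Rightarrow> (int, 'v) module \<Rightarrow> ('v \<Rightarrow> int) \<Rightarrow> bool" where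
  "quadratic_form n V Q \<longleftrightarrow>
     Q \<in> carrier V \<rightarrow> carrier (zmod n) \<and>
     (\<forall>a\<in>carrier (zmod n). \<forall>x\<in>carrier V. Q (a \<odot>\<^bsub>V\<^esub> x) = (a\<^sup>2 * Q x) mod int n) \<and>
     (\<forall>x\<in>carrier V. \<forall>y\<in>carrier V. \<forall>z\<in>carrier V.
        polar n V Q (x \<oplus>\<^bsub>V\<^esub> y) z = (polar n V Q x z + polar n V Q y z) mod int n) \<and>
     (\<forall>a\<in>carrier (zmod n). \<forall>x\<in>carrier V. \<forall>z\<in>carrier V.
        polar n V Q (a \<odot>\<^bsub>V\<^esub> x) z = (a * polar n V Q x z) mod int n)"

text \<open>
  Smoothness of the projective quadric \<open>Q = 0\<close> over \<open>\<F>\<^sub>l\<close>, by the Jacobian criterion at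
  points with coordinates in arbitrary extension fields \<open>K\<close>. With respect to a basis \<open>b\<close>, the
  equation of the quadric is
  \<open>\<Sum>\<^sub>i Q(b\<^sub>i) x\<^sub>i\<^sup>2 + \<Sum>\<^sub>i\<^sub><\<^sub>j B(b\<^sub>i, b\<^sub>j) x\<^sub>i x\<^sub>j\<close>, and since \<open>B(b\<^sub>k, b\<^sub>k) = 2 Q(b\<^sub>k)\<close> its \<open>k\<close>-th partial derivative is
  \<open>\<Sum>\<^sub>j B(b\<^sub>k, b\<^sub>j) x\<^sub>j\<close>. Fields with carrier in \<^typ>\<open>int\<close> suffice: the algebraic closure of \<open>\<F>\<^sub>l\<close>
  is countable.
\<close>

definition form_at :: "int ring \<Rightarrow> (int \<Rightarrow> int) \<Rightarrow> nat \<Rightarrow> (int, 'v) module \<Rightarrow> ('v \<Rightarrow> int) \<Rightarrow>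
    'v list \<Rightarrow> (nat \<Rightarrow> int) \<Rightarrow> int" where
  "form_at K \<phi> l V Q bs x =
     (\<Oplus>\<^bsub>K\<^esub>i\<in>{..<length bs}. \<phi> (Q (bs ! i)) \<otimes>\<^bsub>K\<^esub> (x i \<otimes>\<^bsub>K\<^esub> x i)) \<oplus>\<^bsub>K\<^esub>
     (\<Oplus>\<^bsub>K\<^esub>j\<in>{..<length bs}. \<Oplus>\<^bsub>K\<^esub>i\<in>{..<j}.
        \<phi> (polar l V Q (bs ! i) (bs ! j)) \<otimes>\<^bsub>K\<^esub> (x i \<otimes>\<^bsub>K\<^esub> x j))"

definition partial_at :: "int ring \<Rightarrow> (int \<Rightarrow> int) \<Rightarrow> nat \<Rightarrow> (int, 'v) module \<Rightarrow> ('v \<Rightarrow> int) \<Rightarrow>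
    'v list \<Rightarrow> nat \<Rightarrow> (nat \<Rightarrow> int) \<Rightarrow> int" where
  "partial_at K \<phi> l V Q bs k x =
     (\<Oplus>\<^bsub>K\<^esub>j\<in>{..<length bs}. \<phi> (polar l V Q (bs ! k) (bs ! j)) \<otimes>\<^bsub>K\<^esub> x j)"

definition smooth_quadric :: "nat \<Rightarrow> (int, 'v) module \<Rightarrow> ('v \<Rightarrow> int) \<Rightarrow> bool" where
  "smooth_quadric l V Q \<longleftrightarrow> (\<exists>bs. is_basis l V bs \<and>
     (\<forall>(K :: int ring) \<phi>. field K \<longrightarrow> \<phi> \<in> Ring.ring_hom (zmod l) K \<longrightarrow>
       (\<forall>x\<in>{..<length bs} \<rightarrow> carrier K.
          form_at K \<phi> l V Q bs x = \<zero>\<^bsub>K\<^esub> \<longrightarrow>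
          (\<forall>k<length bs. partial_at K \<phi> l V Q bs k x = \<zero>\<^bsub>K\<^esub>) \<longrightarrow>
          (\<forall>i<length bs. x i = \<zero>\<^bsub>K\<^esub>))))"

text \<open>The basis below lists \<open>e\<^sub>1, \<dots>, e\<^sub>m, f\<^sub>1, \<dots>, f\<^sub>m\<close>, with coordinates \<open>x\<^sub>1, \<dots>, x\<^sub>m, y\<^sub>1, \<dots>, y\<^sub>m\<close>.\<close>

definition split_space :: "nat \<Rightarrow> (int, 'v) module \<Rightarrow> ('v \<Rightarrow> int) \<Rightarrow> nat \<Rightarrow> bool" where
  "split_space l V Q m \<longleftrightarrow> module (zmod l) V \<and> quadratic_form l V Q \<and>
     (\<exists>bs. is_basis l V bs \<and> length bs = 2 * m \<and>
        (\<forall>x\<in>{..<2 * m} \<rightarrow>\<^sub>E carrier (zmod l).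
           Q (lin_comb V bs x) = (\<Sum>i<m. x i * x (m + i)) mod int l))"


section \<open>Orthogonal groups over \<open>\<F>\<^sub>l\<close>\<close>

definition orth :: "nat \<Rightarrow> (int, 'v) module \<Rightarrow> ('v \<Rightarrow> int) \<Rightarrow> ('v \<Rightarrow> 'v) monoid" where
  "orth l V Q =
     BijGroup (carrier V)\<lparr>carrier := {g \<in> lin_auts l V. \<forall>x\<in>carrier V. Q (g x) = Q x}\<rparr>"

definition reflection :: "nat \<Rightarrow> (int, 'v) module \<Rightarrow> ('v \<Rightarrow> int) \<Rightarrow> 'v \<Rightarrow> 'v \<Rightarrow> 'v" where
  "reflection l V Q v = (\<lambda>w\<in>carrier V.
     w \<ominus>\<^bsub>V\<^esub> (polar l V Q w v \<otimes>\<^bsub>zmod l\<^esub> inv\<^bsub>zmod l\<^esub> (Q v)) \<odot>\<^bsub>V\<^esub> v)"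

definition is_reflection_product ::
    "nat \<Rightarrow> (int, 'v) module \<Rightarrow> ('v \<Rightarrow> int) \<Rightarrow> 'v list \<Rightarrow> ('v \<Rightarrow> 'v) \<Rightarrow> bool" where
  "is_reflection_product l V Q vs g \<longleftrightarrow> (\<forall>v\<in>set vs. v \<in> carrier V \<and> Q v \<noteq> 0) \<and>
     g = foldr (\<lambda>v h. reflection l V Q v \<otimes>\<^bsub>orth l V Q\<^esub> h) vs \<one>\<^bsub>orth l V Q\<^esub>"

definition rank_minus_id :: "nat \<Rightarrow> (int, 'v) module \<Rightarrow> ('v \<Rightarrow> 'v) \<Rightarrow> nat" where
  "rank_minus_id l V g =
     (THE k. free_of_rank l (V\<lparr>carrier := (\<lambda>x. g x \<ominus>\<^bsub>V\<^esub> x) ` carrier V\<rparr>) k)"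

text \<open>
  The Dickson invariant, with values 0 and 1. For odd \<open>l\<close> it is \<open>(1 - det g)/2\<close>, where
  \<open>det g = \<plusminus>1\<close>. For \<open>l = 2\<close> it is the parity of the number of reflections in an expression of
  \<open>g\<close> as a product of reflections. The reflections generate the orthogonal group of every
  nondegenerate space over \<open>\<F>\<^sub>2\<close> except the split one of dimension 4, where they generate a
  subgroup of index 2 and their images do not determine the invariant on the rest of the group;
  the last case is the standard formula \<open>rk(g - 1) mod 2\<close>, which in even dimension agrees with
  the parity of the number of reflections whenever \<open>g\<close> is a product of reflections. In odd
  dimension over \<open>\<F>\<^sub>2\<close> the reflection in a radical vector is the identity, so that the invariant
  is 0 throughout.
\<close>

definition dickson :: "nat \<Rightarrow> (int, 'v) module \<Rightarrow> ('v \<Rightarrow> int) \<Rightarrow> ('v \<Rightarrow> 'v) \<Rightarrow> nat" where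
  "dickson l V Q g =
     (if odd l then (if lin_det l V g = 1 then 0 else 1)
      else if \<exists>vs. is_reflection_product l V Q vs g \<and> even (length vs) then 0
      else if \<exists>vs. is_reflection_product l V Q vs g \<and> odd (length vs) then 1
      else rank_minus_id l V g mod 2)"

definition unit_squares :: "nat \<Rightarrow> int set" where
  "unit_squares l = {x \<otimes>\<^bsub>zmod l\<^esub> x | x. x \<in> Units (zmod l)}"

definition square_classes :: "nat \<Rightarrow> int set monoid" where
  "square_classes l = units_of (zmod l) Mod unit_squares l"

text \<open>
  The homomorphism below is unique on the orthogonal group for \<open>l\<close> odd, because reflections
  generate, and for \<open>l = 2\<close>, because its target is trivial; the choice operator only fixes its
  irrelevant values off the carrier.
\<close>

definition spinor_norm ::
    "nat \<Rightarrow> (int, 'v) module \<Rightarrow> ('v \<Rightarrow> int) \<Rightarrow> ('v \<Rightarrow> 'v) \<Rightarrow> int set" where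
  "spinor_norm l V Q = (SOME \<theta>. \<theta> \<in> hom (orth l V Q) (square_classes l) \<and>
     (\<forall>v\<in>carrier V. Q v \<noteq> 0 \<longrightarrow>
        \<theta> (reflection l V Q v) = unit_squares l #>\<^bsub>units_of (zmod l)\<^esub> (\<ominus>\<^bsub>zmod l\<^esub> Q v)))"

definition special_orth :: "nat \<Rightarrow> (int, 'v) module \<Rightarrow> ('v \<Rightarrow> int) \<Rightarrow> ('v \<Rightarrow> 'v) monoid" where
  "special_orth l V Q =
     (orth l V Q)\<lparr>carrier := {g \<in> carrier (orth l V Q). dickson l V Q g = 0}\<rparr>"

definition omega :: "nat \<Rightarrow> (int, 'v) module \<Rightarrow> ('v \<Rightarrow> int) \<Rightarrow> ('v \<Rightarrow> 'v) monoid" where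
  "omega l V Q =
     (orth l V Q)\<lparr>carrier := {g \<in> carrier (orth l V Q).
        dickson l V Q g = 0 \<and> spinor_norm l V Q g = \<one>\<^bsub>square_classes l\<^esub>}\<rparr>"


section \<open>Reduction modulo primes and groups over \<open>\<int>/n\<close>\<close>

definition multiples :: "nat \<Rightarrow> (int, 'v) module \<Rightarrow> 'v set" where
  "multiples l V = {[l] \<cdot>\<^bsub>V\<^esub> x | x. x \<in> carrier V}"

text \<open>
  The quotient \<open>V/lV\<close> as a module over \<open>\<int>/l\<close>, for \<open>V\<close> a module over \<open>\<int>/n\<close> with \<open>l\<close> dividing
  \<open>n\<close>; the multiplicative fields of the record play no role.
\<close>

definition reduced_module :: "nat \<Rightarrow> (int, 'v) module \<Rightarrow> (int, 'v set) module" where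
  "reduced_module l V =
     \<lparr>carrier = a_rcosets\<^bsub>V\<^esub> (multiples l V),
      monoid.mult = undefined,
      one = undefined,
      ring.zero = multiples l V,
      ring.add = set_add V,
      module.smult = (\<lambda>a C. \<Union>x\<in>C. multiples l V +>\<^bsub>V\<^esub> (a \<odot>\<^bsub>V\<^esub> x))\<rparr>"

definition reduced_form :: "nat \<Rightarrow> ('v \<Rightarrow> int) \<Rightarrow> 'v set \<Rightarrow> int" where
  "reduced_form l Q C = the_elem ((\<lambda>x. Q x mod int l) ` C)"

definition reduced_map :: "nat \<Rightarrow> (int, 'v) module \<Rightarrow> ('v \<Rightarrow> 'v) \<Rightarrow> 'v set \<Rightarrow> 'v set" where
  "reduced_map l V g = (\<lambda>C\<in>carrier (reduced_module l V). g ` C)"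

definition nondegenerate :: "nat \<Rightarrow> (int, 'v) module \<Rightarrow> ('v \<Rightarrow> int) \<Rightarrow> bool" where
  "nondegenerate n V Q \<longleftrightarrow>
     (\<forall>l. prime l \<longrightarrow> l dvd n \<longrightarrow> smooth_quadric l (reduced_module l V) (reduced_form l Q))"

text \<open>
  For \<open>n\<close> squarefree, \<open>V\<close> is the product of its reductions \<open>V/lV\<close>, so a family of linear
  automorphisms of the reductions is the same as a linear automorphism of \<open>V\<close>. The group below is
  the product over the primes \<open>l\<close> dividing \<open>n\<close> of the groups \<open>G l\<close> of automorphisms of \<open>V/lV\<close>,
  as it acts on \<open>V\<close>.
\<close>

definition product_over_primes ::
    "nat \<Rightarrow> (int, 'v) module \<Rightarrow> (nat \<Rightarrow> ('v set \<Rightarrow> 'v set) monoid) \<Rightarrow> ('v \<Rightarrow> 'v) monoid" where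
  "product_over_primes n V G =
     BijGroup (carrier V)\<lparr>carrier := {g \<in> lin_auts n V.
        \<forall>l. prime l \<longrightarrow> l dvd n \<longrightarrow> reduced_map l V g \<in> carrier (G l)}\<rparr>"

definition orth_n :: "nat \<Rightarrow> (int, 'v) module \<Rightarrow> ('v \<Rightarrow> int) \<Rightarrow> ('v \<Rightarrow> 'v) monoid" where
  "orth_n n V Q =
     product_over_primes n V (\<lambda>l. orth l (reduced_module l V) (reduced_form l Q))"

definition omega_n :: "nat \<Rightarrow> (int, 'v) module \<Rightarrow> ('v \<Rightarrow> int) \<Rightarrow> ('v \<Rightarrow> 'v) monoid" where
  "omega_n n V Q =
     product_over_primes n V (\<lambda>l. omega l (reduced_module l V) (reduced_form l Q))"


section \<open>Diagonal action on tuples\<close>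

definition tuples :: "nat \<Rightarrow> (int, 'v) module \<Rightarrow> (nat \<Rightarrow> 'v) set" where
  "tuples m V = {..<m} \<rightarrow>\<^sub>E carrier V"

definition diag_act :: "nat \<Rightarrow> ('v \<Rightarrow> 'v) \<Rightarrow> (nat \<Rightarrow> 'v) \<Rightarrow> nat \<Rightarrow> 'v" where
  "diag_act m g x = (\<lambda>i\<in>{..<m}. g (x i))"

end

theory Submission
  imports Defs "HOL-Number_Theory.Euler_Criterion" "HOL-Combinatorics.Permutations"
begin

text \<open>
  Over \<open>\<F>\<^sub>l\<close>, reflections and Eichler transformations give a Witt extension step: two vectors outside
  a subspace \<open>X\<close> are conjugate under the pointwise stabilizer of \<open>X\<close> as soon as they have the same
  norm and the same products with \<open>X\<close>. Up to the stabilizer, a tuple with span \<open>X\<close> therefore extends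
  in \<open>|X|\<close> ways inside \<open>X\<close> and in \<open>l |X|\<close> ways outside it. Weighting every orbit with \<open>|X|\<^sup>j\<close> turns
  this into a recursion in \<open>j\<close>, solved by the product of the \<open>1 + l\<^sup>i\<close>.

  In rank at least \<open>2m + 2\<close> the pointwise stabilizer of an \<open>m\<close>-tuple contains reflections in vectors of
  every norm, which correct the Dickson invariant and the spinor norm. The existence of the spinor
  norm for odd \<open>l\<close> is obtained from the sign of the permutation of the vectors of a fixed norm.

  In the split space of dimension \<open>2m\<close>, the Dickson invariant of \<open>g\<close> is the parity of the codimension
  of \<open>E \<inter> g E\<close> in a Lagrangian \<open>E\<close>. Hence the elements fixing a basis of a Lagrangian have trivial
  invariant and the orbit of such bases splits into two; every other \<open>m\<close>-tuple is fixed by a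
  reflection. The case of squarefree \<open>n\<close> follows by the Chinese remainder theorem.
\<close>

text \<open>A smooth quadric does not always have a nondegenerate polar form \<open>B\<close>. Over
  the field with two elements in odd rank \<open>B\<close> has a radical line, whose nonzero vector
  is fixed by the orthogonal group; already for \<open>m = 1\<close> this vector is an orbit of its
  own and the count becomes 4 instead of 3. The condition that \<open>r\<close> be even when
  \<open>n\<close> is even and \<open>m > 0\<close> excludes this. Otherwise \<open>B\<close> is
  nondegenerate, and the extension step and the count do not distinguish odd from even
  characteristic. The rank \<open>2 * m + 2\<close> guarantees a totally singular subspace of
  dimension \<open>m\<close>, which is larger than the span of any shorter tuple; this is what
  provides extensions of every type. A Lagrangian of the split space of dimension
  \<open>2 * m\<close> has the same dimension, hence the same count. Reflections need not generate
  the orthogonal group over the field with two elements, so inductions over its elements end at maps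
  \<open>u\<close> for which the image of \<open>u - 1\<close> is totally singular. For odd
  \<open>l\<close> the target of the spinor norm has order 2, so a sign character with the right
  values on reflections takes the place of the Clifford algebra.\<close>

section \<open>Counting by fibres; inverses modulo a prime\<close>

lemma card_eq_card_image_mult:
  assumes "finite A" and "\<And>c. c \<in> f ` A \<Longrightarrow> card {x \<in> A. f x = c} = k"
  shows "card A = card (f ` A) * k"
proof -
  have "card A = (\<Sum>c\<in>f ` A. card {x \<in> A. f x = c})"
    using assms(1) sum.image_gen[of A "\<lambda>_. 1::nat" f] by simp
  then show ?thesis using assms(2) by simp
qed

text \<open>Both images are in bijection with the classes of one equivalence relation on
  \<open>T\<close>. This later replaces the orbits over \<open>\<int>/n\<close> by families of
  orbits over the prime fields.\<close>

lemma card_image_eq_card_image: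
  assumes "\<And>x y. x \<in> T \<Longrightarrow> y \<in> T \<Longrightarrow> f x = f y \<longleftrightarrow> h x = h y"
  shows "card (f ` T) = card (h ` T)"
proof (rule bij_betw_same_card)
  have inv: "inv_into T f (f x) \<in> T \<and> f (inv_into T f (f x)) = f x" if "x \<in> T" for x
    using that by (simp add: f_inv_into_f inv_into_into)
  show "bij_betw (\<lambda>z. h (inv_into T f z)) (f ` T) (h ` T)"
  proof (rule bij_betw_imageI)
    show "inj_on (\<lambda>z. h (inv_into T f z)) (f ` T)"
      using inv assms by (intro inj_onI) (metis (no_types, lifting) imageE)
    have "h (inv_into T f (f x)) = h x" if "x \<in> T" for x
      using inv[OF that] assms that by blast
    then show "(\<lambda>z. h (inv_into T f z)) ` f ` T = h ` T"
      by (auto simp: image_image)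
  qed
qed

lemma prime_inverse_mod:
  fixes a :: int
  assumes "prime l" and "a mod int l \<noteq> 0"
  obtains i where "(a * i) mod int l = 1" and "i mod int l \<noteq> 0"
proof -
  have "\<not> int l dvd a" using assms(2) by auto
  then have "coprime a (int l)"
    using assms(1) prime_imp_coprime[of "int l" a] by (simp add: coprime_commute)
  then obtain i where i: "[a * i = 1] (mod int l)" by (auto dest: cong_solve_coprime_int)
  have "1 < int l" using assms(1) prime_gt_1_nat by simp
  then have 1: "(a * i) mod int l = 1" using i by (simp add: cong_def)
  moreover have "i mod int l \<noteq> 0"
    using 1 by (metis mod_mult_right_eq mult_zero_right mod_0 zero_neq_one)
  ultimately show thesis using that by blast
qed

lemma prime_mult_mod_eq_0:
  fixes a b :: int
  assumes "prime l" and "(a * b) mod int l = 0"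
  shows "a mod int l = 0 \<or> b mod int l = 0"
  using assms by (metis dvd_imp_mod_0 mod_0_imp_dvd prime_dvd_mult_iff prime_nat_int_transfer)

subsection \<open>Modules over \<open>\<int>/n\<close> with integer scalars\<close>

lemma zmod_simps [simp]:
  "carrier (zmod n) = {0..<int n}"
  "x \<oplus>\<^bsub>zmod n\<^esub> y = (x + y) mod int n"
  "x \<otimes>\<^bsub>zmod n\<^esub> y = (x * y) mod int n"
  "\<zero>\<^bsub>zmod n\<^esub> = 0"
  "\<one>\<^bsub>zmod n\<^esub> = 1 mod int n"
  by (auto simp: zmod_def residue_ring_def)

lemma zmod_prime_eq: "prime l \<Longrightarrow> zmod l = residue_ring (int l)"
  using prime_gt_1_nat[of l] by (simp add: zmod_def residue_ring_def)

locale zmod_module =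
  fixes n :: nat and V :: "(int, 'v) module" (structure)
  assumes n_pos: "n > 0" and is_module: "module (zmod n) V"
begin

sublocale abelian_group V
  using is_module by (simp add: module_def)

text \<open>Scalars are arbitrary integers, reduced on entry. The module laws then hold for all
  integers, with no membership conditions on scalars and with ordinary integer arithmetic in the
  exponents and coefficients.\<close>

definition sc :: "int \<Rightarrow> 'v \<Rightarrow> 'v" (infixr \<open>\<star>\<close> 75) where
  "a \<star> x = (a mod int n) \<odot> x"

lemma mod_carrier: "a mod int n \<in> carrier (zmod n)"
  using n_pos by simp

lemma sc_closed [simp, intro]: "x \<in> carrier V \<Longrightarrow> a \<star> x \<in> carrier V"
  unfolding sc_def by (intro module.smult_closed[OF is_module] mod_carrier)

lemma sc_cong: "a mod int n = b mod int n \<Longrightarrow> a \<star> x = b \<star> x"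
  by (simp add: sc_def)

lemma smult_eq_sc: "a \<in> {0..<int n} \<Longrightarrow> a \<odot> x = a \<star> x"
  by (simp add: sc_def)

lemma sc_mod [simp]: "(a mod int n) \<star> x = a \<star> x"
  by (simp add: sc_def)

lemma sc_add_left: "x \<in> carrier V \<Longrightarrow> (a + b) \<star> x = a \<star> x \<oplus> b \<star> x"
  using module.smult_l_distr[OF is_module mod_carrier mod_carrier, of x a b]
  by (simp add: sc_def mod_add_eq)

lemma sc_add_right: "x \<in> carrier V \<Longrightarrow> y \<in> carrier V \<Longrightarrow> a \<star> (x \<oplus> y) = a \<star> x \<oplus> a \<star> y"
  using module.smult_r_distr[OF is_module mod_carrier] by (simp add: sc_def)

lemma sc_sc: "x \<in> carrier V \<Longrightarrow> a \<star> b \<star> x = (a * b) \<star> x"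
  using module.smult_assoc1[OF is_module mod_carrier mod_carrier, of x a b]
  by (simp add: sc_def mod_mult_eq)

lemma sc_one [simp]: "x \<in> carrier V \<Longrightarrow> 1 \<star> x = x"
  using module.smult_one[OF is_module] by (simp add: sc_def)

lemma sc_zero [simp]: "x \<in> carrier V \<Longrightarrow> 0 \<star> x = \<zero>"
  using module.smult_l_null[OF is_module] by (simp add: sc_def)

lemma sc_zero_right [simp]: "a \<star> \<zero> = \<zero>"
  using module.smult_r_null[OF is_module mod_carrier] by (simp add: sc_def)

lemma sc_cancel: "x \<in> carrier V \<Longrightarrow> (a * b) mod int n = 1 mod int n \<Longrightarrow> a \<star> b \<star> x = x"
  using sc_cong[of "a * b" 1 x] by (simp add: sc_sc)

lemma add_sc_minus [simp]: "x \<in> carrier V \<Longrightarrow> x \<oplus> (-1) \<star> x = \<zero>"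
  using sc_add_left[of x 1 "-1"] by simp

lemma minus_eq_sc: "x \<in> carrier V \<Longrightarrow> \<ominus> x = (-1) \<star> x"
  by (metis add.inv_unique' add_sc_minus minus_equality add.m_comm sc_closed)

lemma a_minus_eq_sc: "x \<in> carrier V \<Longrightarrow> y \<in> carrier V \<Longrightarrow> x \<ominus> y = x \<oplus> (-1) \<star> y"
  by (simp add: a_minus_def minus_eq_sc)

lemma add_sc_minus_cancel [simp]:
  assumes "x \<in> carrier V" "y \<in> carrier V"
  shows "(x \<oplus> (-1) \<star> y) \<oplus> y = x" "y \<oplus> (x \<oplus> (-1) \<star> y) = x"
        "(x \<oplus> y) \<oplus> (-1) \<star> y = x" "y \<oplus> (x \<oplus> (-1) \<star> y) = x"
        "(-1) \<star> y \<oplus> (y \<oplus> x) = x" "(-1) \<star> y \<oplus> (x \<oplus> y) = x" "y \<oplus> ((-1) \<star> y \<oplus> x) = x"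
proof -
  have [simp]: "y \<oplus> (-1) \<star> y = \<zero>" "(-1) \<star> y \<oplus> y = \<zero>"
    using assms add_sc_minus[of y] by (simp_all add: a_comm)
  show "(x \<oplus> (-1) \<star> y) \<oplus> y = x" "(x \<oplus> y) \<oplus> (-1) \<star> y = x" using assms by (simp_all add: a_assoc)
  show "(-1) \<star> y \<oplus> (y \<oplus> x) = x" "y \<oplus> ((-1) \<star> y \<oplus> x) = x" using assms by (simp_all flip: a_assoc)
  show "(-1) \<star> y \<oplus> (x \<oplus> y) = x" "y \<oplus> (x \<oplus> (-1) \<star> y) = x" "y \<oplus> (x \<oplus> (-1) \<star> y) = x"
    using assms by (simp_all add: a_lcomm[of _ x])
qed

lemma add_sc_minus_eq_zero_iff:
  assumes "x \<in> carrier V" "y \<in> carrier V"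
  shows "x \<oplus> (-1) \<star> y = \<zero> \<longleftrightarrow> x = y"
  using assms add_sc_minus_cancel(1)[of x y] by (metis add_sc_minus l_zero)

definition subsp :: "'v set \<Rightarrow> bool" where
  "subsp X \<longleftrightarrow> X \<subseteq> carrier V \<and> \<zero> \<in> X \<and> (\<forall>x\<in>X. \<forall>y\<in>X. x \<oplus> y \<in> X) \<and> (\<forall>a. \<forall>x\<in>X. a \<star> x \<in> X)"

lemma subspI:
  assumes "X \<subseteq> carrier V" "\<zero> \<in> X" "\<And>x y. x \<in> X \<Longrightarrow> y \<in> X \<Longrightarrow> x \<oplus> y \<in> X"
    "\<And>a x. x \<in> X \<Longrightarrow> a \<star> x \<in> X"
  shows "subsp X"
  using assms by (auto simp: subsp_def)

lemma
  assumes "subsp X"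
  shows subsp_carrier: "x \<in> X \<Longrightarrow> x \<in> carrier V"
    and subsp_subset: "X \<subseteq> carrier V"
    and subsp_zero: "\<zero> \<in> X"
    and subsp_add: "x \<in> X \<Longrightarrow> y \<in> X \<Longrightarrow> x \<oplus> y \<in> X"
    and subsp_sc: "x \<in> X \<Longrightarrow> a \<star> x \<in> X"
  using assms by (auto simp: subsp_def)

lemma subsp_carrier_V [simp]: "subsp (carrier V)"
  by (auto intro!: subspI)

lemma subsp_trivial [simp]: "subsp {\<zero>}"
  by (auto intro!: subspI)

lemma subsp_Int: "subsp X \<Longrightarrow> subsp Y \<Longrightarrow> subsp (X \<inter> Y)"
  by (auto simp: subsp_def)

definition splus :: "'v set \<Rightarrow> 'v set \<Rightarrow> 'v set" where
  "splus X Y = {x \<oplus> y | x y. x \<in> X \<and> y \<in> Y}"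

lemma splus_memI: "x \<in> X \<Longrightarrow> y \<in> Y \<Longrightarrow> x \<oplus> y \<in> splus X Y"
  by (auto simp: splus_def)

lemma subsp_splus:
  assumes "subsp X" "subsp Y" shows "subsp (splus X Y)"
proof (rule subspI)
  show "splus X Y \<subseteq> carrier V" using assms by (auto simp: splus_def subsp_carrier)
  show "\<zero> \<in> splus X Y" using splus_memI[of \<zero> X \<zero> Y] assms by (simp add: subsp_zero)
  show "a \<star> z \<in> splus X Y" if "z \<in> splus X Y" for a z
    using that assms by (fastforce simp: splus_def sc_add_right subsp_carrier subsp_sc)
  show "z \<oplus> w \<in> splus X Y" if zw: "z \<in> splus X Y" "w \<in> splus X Y" for z w
  proof -
    obtain x y x' y' where *: "z = x \<oplus> y" "w = x' \<oplus> y'" "x \<in> X" "x' \<in> X" "y \<in> Y" "y' \<in> Y"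
      using zw by (auto simp: splus_def)
    then have "z \<oplus> w = (x \<oplus> x') \<oplus> (y \<oplus> y')"
      using assms subsp_carrier by (simp add: a_ac)
    then show ?thesis using * assms splus_memI subsp_add by auto
  qed
qed

lemma splus_upper:
  assumes "subsp X" "subsp Y" shows "X \<subseteq> splus X Y" "Y \<subseteq> splus X Y"
proof -
  show "X \<subseteq> splus X Y"
    using splus_memI[of _ X \<zero> Y] assms subsp_carrier subsp_zero by (metis r_zero subsetI)
  show "Y \<subseteq> splus X Y"
    using splus_memI[of \<zero> X _ Y] assms subsp_carrier subsp_zero by (metis l_zero subsetI)
qed

lemma splus_least: "subsp Z \<Longrightarrow> X \<subseteq> Z \<Longrightarrow> Y \<subseteq> Z \<Longrightarrow> splus X Y \<subseteq> Z"
  by (auto simp: splus_def subset_iff subsp_add)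

text \<open>The first isomorphism theorem as a count. Only the fibres of \<open>f\<close> are
  described, as cosets of \<open>K\<close>, so \<open>f\<close> may take values in any type, for
  instance in restricted functions.\<close>

lemma card_subsp_fibres:
  assumes X: "subsp X" "finite X" and K: "subsp K" "K \<subseteq> X"
    and f: "\<And>x y. x \<in> X \<Longrightarrow> y \<in> X \<Longrightarrow> f x = f y \<longleftrightarrow> x \<oplus> (-1) \<star> y \<in> K"
  shows "card X = card (f ` X) * card K"
proof (rule card_eq_card_image_mult[OF X(2)])
  fix c assume "c \<in> f ` X"
  then obtain y where y: "y \<in> X" "c = f y" by auto
  have yV: "y \<in> carrier V" using X y subsp_carrier by blast
  have "bij_betw (\<lambda>k. k \<oplus> y) K {x \<in> X. f x = c}"
  proof (rule bij_betw_imageI)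
    show "inj_on (\<lambda>k. k \<oplus> y) K"
      using yV K subsp_carrier by (auto intro!: inj_onI)
    show "(\<lambda>k. k \<oplus> y) ` K = {x \<in> X. f x = c}"
    proof safe
      fix k assume k: "k \<in> K"
      then have kV: "k \<in> carrier V" using K subsp_carrier by blast
      show kX: "k \<oplus> y \<in> X" using X K k y by (auto intro: subsp_add)
      show "f (k \<oplus> y) = c" using f[OF kX y(1)] k kV yV y by simp
    next
      fix x assume x: "x \<in> X" "c = f x"
      then have "x \<oplus> (-1) \<star> y \<in> K" using f[OF x(1) y(1)] y by simp
      moreover have "x = (x \<oplus> (-1) \<star> y) \<oplus> y" using x yV X subsp_carrier by simp
      ultimately show "x \<in> (\<lambda>k. k \<oplus> y) ` K" by blast
    qed
  qed
  then show "card {x \<in> X. f x = c} = card K" by (simp add: bij_betw_same_card)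
qed

end

section \<open>Finite vector spaces over a prime field\<close>

locale fin_space = zmod_module l V for l :: nat and V :: "(int, 'v) module" (structure) +
  assumes prime_l: "prime l" and finite_V: "finite (carrier V)"
begin

notation sc (infixr \<open>\<star>\<close> 75)

lemma l_gt_1: "1 < int l" using prime_gt_1_nat[OF prime_l] by simp

lemma one_mod_l [simp]: "1 mod int l = 1" using l_gt_1 by simp

lemma finite_subsp: "subsp X \<Longrightarrow> finite X"
  using finite_V finite_subset subsp_subset by blast

lemma card_subsp_pos: "subsp X \<Longrightarrow> card X > 0"
  using finite_subsp subsp_zero card_gt_0_iff by blast

text \<open>The fibre of addition over \<open>x0 \<oplus> y0\<close> consists of the pairs
  \<open>(x0 + z, y0 - z)\<close> with \<open>z \<in> X \<inter> Y\<close>, so all fibres have the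
  size of the intersection.\<close>

lemma card_splus:
  assumes "subsp X" "subsp Y"
  shows "card (splus X Y) * card (X \<inter> Y) = card X * card Y"
proof -
  have "card (X \<times> Y) = card ((\<lambda>(x, y). x \<oplus> y) ` (X \<times> Y)) * card (X \<inter> Y)"
  proof (rule card_eq_card_image_mult)
    show "finite (X \<times> Y)" using assms finite_subsp by blast
    fix c assume "c \<in> (\<lambda>(x, y). x \<oplus> y) ` (X \<times> Y)"
    then obtain x0 y0 where c: "c = x0 \<oplus> y0" "x0 \<in> X" "y0 \<in> Y" by auto
    have V: "x0 \<in> carrier V" "y0 \<in> carrier V" using c assms subsp_carrier by auto
    have "bij_betw (\<lambda>z. (x0 \<oplus> z, y0 \<oplus> (-1) \<star> z)) (X \<inter> Y) {p \<in> X \<times> Y. (case p of (x, y) \<Rightarrow> x \<oplus> y) = c}"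
    proof (rule bij_betw_imageI)
      show "inj_on (\<lambda>z. (x0 \<oplus> z, y0 \<oplus> (-1) \<star> z)) (X \<inter> Y)"
        using V assms subsp_carrier by (auto intro!: inj_onI)
      show "(\<lambda>z. (x0 \<oplus> z, y0 \<oplus> (-1) \<star> z)) ` (X \<inter> Y) = {p \<in> X \<times> Y. (case p of (x, y) \<Rightarrow> x \<oplus> y) = c}"
      proof (rule Set.set_eqI, rule iffI)
        fix p assume "p \<in> (\<lambda>z. (x0 \<oplus> z, y0 \<oplus> (-1) \<star> z)) ` (X \<inter> Y)"
        then obtain z where z: "z \<in> X" "z \<in> Y" and p: "p = (x0 \<oplus> z, y0 \<oplus> (-1) \<star> z)" by blast
        have zV: "z \<in> carrier V" using z assms subsp_carrier by blast
        have "x0 \<oplus> z \<in> X" "y0 \<oplus> (-1) \<star> z \<in> Y" using z c assms by (auto intro: subsp_add subsp_sc)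
        moreover have "x0 \<oplus> z \<oplus> (y0 \<oplus> (-1) \<star> z) = x0 \<oplus> (z \<oplus> (y0 \<oplus> (-1) \<star> z))"
          using V zV by (simp add: a_assoc)
        then have "x0 \<oplus> z \<oplus> (y0 \<oplus> (-1) \<star> z) = c" using V zV c by simp
        ultimately show "p \<in> {p \<in> X \<times> Y. (case p of (x, y) \<Rightarrow> x \<oplus> y) = c}" using p by simp
      next
        fix p assume "p \<in> {p \<in> X \<times> Y. (case p of (x, y) \<Rightarrow> x \<oplus> y) = c}"
        then obtain x y where xy: "x \<in> X" "y \<in> Y" "x \<oplus> y = c" and p: "p = (x, y)" by auto
        have xyV: "x \<in> carrier V" "y \<in> carrier V" using xy assms subsp_carrier by auto
        define z where "z = x \<oplus> (-1) \<star> x0"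
        have zX: "z \<in> X" unfolding z_def using xy c assms by (auto intro: subsp_add subsp_sc)
        then have zV: "z \<in> carrier V" using assms subsp_carrier by blast
        have x: "x = x0 \<oplus> z" unfolding z_def using V xyV by simp
        have "x0 \<oplus> (z \<oplus> y) = x0 \<oplus> y0" using xy(3) c x V zV xyV by (simp add: a_assoc)
        then have zy: "z \<oplus> y = y0" using V zV xyV by simp
        have "y0 \<oplus> (-1) \<star> y = z" unfolding zy[symmetric] using xyV zV by simp
        then have zY: "z \<in> Y" using c xy assms by (auto intro: subsp_add subsp_sc)
        have "y = y0 \<oplus> (-1) \<star> z" unfolding zy[symmetric] using xyV zV by (simp add: a_comm)
        then show "p \<in> (\<lambda>z. (x0 \<oplus> z, y0 \<oplus> (-1) \<star> z)) ` (X \<inter> Y)" using p x zX zY by blast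
      qed
    qed
    then show "card {p \<in> X \<times> Y. (case p of (x, y) \<Rightarrow> x \<oplus> y) = c} = card (X \<inter> Y)"
      by (simp add: bij_betw_same_card)
  qed
  moreover have "(\<lambda>(x, y). x \<oplus> y) ` (X \<times> Y) = splus X Y" by (auto simp: splus_def)
  ultimately show ?thesis by (simp add: card_cartesian_product)
qed

definition line :: "'v \<Rightarrow> 'v set" where
  "line x = range (\<lambda>a. a \<star> x)"

lemma subsp_line: "x \<in> carrier V \<Longrightarrow> subsp (line x)"
proof (rule subspI)
  assume x: "x \<in> carrier V"
  show "line x \<subseteq> carrier V" "\<zero> \<in> line x"
    using x by (auto simp: line_def intro!: image_eqI[of _ _ 0])
  show "y \<oplus> z \<in> line x" if "y \<in> line x" "z \<in> line x" for y z
    using that x by (auto simp: line_def simp flip: sc_add_left)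
  show "a \<star> y \<in> line x" if "y \<in> line x" for a y using that x by (auto simp: line_def sc_sc)
qed

lemma line_self: "x \<in> carrier V \<Longrightarrow> x \<in> line x"
  by (metis line_def rangeI sc_one)

lemma sc_mem_cancel:
  assumes "subsp X" "a mod int l \<noteq> 0" "a \<star> x \<in> X" "x \<in> carrier V"
  shows "x \<in> X"
proof -
  obtain i where "(a * i) mod int l = 1" using prime_inverse_mod[OF prime_l assms(2)] by blast
  then have "i \<star> a \<star> x = x" using assms(4) by (intro sc_cancel) (simp_all add: mult.commute)
  then show ?thesis using subsp_sc[OF assms(1,3), of i] by simp
qed

lemma card_line:
  assumes x: "x \<in> carrier V" "x \<noteq> \<zero>"
  shows "card (line x) = l"
proof -
  have eq: "a mod int l = b mod int l" if "a \<star> x = b \<star> x" for a b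
  proof (rule ccontr)
    assume "a mod int l \<noteq> b mod int l"
    then have "(a - b) mod int l \<noteq> 0" by (simp add: mod_eq_dvd_iff dvd_eq_mod_eq_0)
    moreover have "(a - b) \<star> x = \<zero>"
    proof -
      have "(a - b) \<star> x = a \<star> x \<oplus> (-b) \<star> x" using x sc_add_left[of x a "-b"] by simp
      also have "\<dots> = (b + - b) \<star> x" using x that sc_add_left[of x b "-b"] by simp
      also have "\<dots> = \<zero>" using x by simp
      finally show ?thesis .
    qed
    ultimately show False using sc_mem_cancel[OF subsp_trivial] x by auto
  qed
  have "line x = (\<lambda>a. a \<star> x) ` {0..<int l}"
  proof
    show "line x \<subseteq> (\<lambda>a. a \<star> x) ` {0..<int l}"
    proof
      fix y assume "y \<in> line x"
      then obtain a where "y = a \<star> x" by (auto simp: line_def)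
      then have "y = (a mod int l) \<star> x" by simp
      moreover have "a mod int l \<in> {0..<int l}" using l_gt_1 by simp
      ultimately show "y \<in> (\<lambda>a. a \<star> x) ` {0..<int l}" by blast
    qed
  qed (auto simp: line_def)
  moreover have "inj_on (\<lambda>a. a \<star> x) {0..<int l}"
    using eq by (intro inj_onI) fastforce
  ultimately show ?thesis by (simp add: card_image)
qed

definition adj :: "'v \<Rightarrow> 'v set \<Rightarrow> 'v set" where "adj x X = splus (line x) X"

lemma adjI: "y \<in> X \<Longrightarrow> a \<star> x \<oplus> y \<in> adj x X"
  unfolding adj_def by (rule splus_memI) (auto simp: line_def)

lemma adjE: "z \<in> adj x X \<Longrightarrow> (\<And>a y. z = a \<star> x \<oplus> y \<Longrightarrow> y \<in> X \<Longrightarrow> thesis) \<Longrightarrow> thesis"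
  by (auto simp: adj_def splus_def line_def)

lemma subsp_adj: "subsp X \<Longrightarrow> x \<in> carrier V \<Longrightarrow> subsp (adj x X)"
  by (simp add: adj_def subsp_splus subsp_line)

lemma adj_upper: "subsp X \<Longrightarrow> x \<in> carrier V \<Longrightarrow> X \<subseteq> adj x X"
  by (simp add: adj_def splus_upper subsp_line)

lemma adj_self: "subsp X \<Longrightarrow> x \<in> carrier V \<Longrightarrow> x \<in> adj x X"
  using splus_upper[OF subsp_line, of x X] line_self by (auto simp: adj_def)

lemma adj_least: "subsp Z \<Longrightarrow> X \<subseteq> Z \<Longrightarrow> x \<in> Z \<Longrightarrow> adj x X \<subseteq> Z"
  unfolding adj_def by (rule splus_least) (auto simp: line_def subsp_sc)

lemma adj_absorb: "subsp X \<Longrightarrow> x \<in> X \<Longrightarrow> adj x X = X"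
  by (meson adj_least adj_upper order_antisym subset_refl subsp_carrier)

lemma card_adj:
  assumes X: "subsp X" and x: "x \<in> carrier V" "x \<notin> X"
  shows "card (adj x X) = l * card X"
proof -
  have "line x \<inter> X = {\<zero>}"
  proof -
    have "y = \<zero>" if y: "y \<in> line x" "y \<in> X" for y
    proof -
      obtain a where a: "y = a \<star> x" using y(1) unfolding line_def by blast
      have "a mod int l = 0" using sc_mem_cancel[OF X _ _ x(1)] x(2) a y(2) by blast
      then have "a \<star> x = 0 \<star> x" by (intro sc_cong) simp
      then show ?thesis using a x by simp
    qed
    then show ?thesis using X subsp_line[OF x(1)] subsp_zero by blast
  qed
  then show ?thesis
    using card_splus[OF subsp_line[OF x(1)] X] card_line[OF x(1)] x X subsp_zero
    by (auto simp: adj_def)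
qed

lemma card_adj_le: "subsp X \<Longrightarrow> x \<in> carrier V \<Longrightarrow> card (adj x X) \<le> l * card X"
  using card_adj[of X x] adj_absorb[of X x] prime_gt_0_nat[OF prime_l] by (cases "x \<in> X") auto

text \<open>Among the subspaces of \<open>Y\<close> with property \<open>P\<close>, one of maximal
  size must be \<open>Y\<close> itself, since another vector could be adjoined otherwise. Finiteness
  takes the place of a choice of basis.\<close>

lemma subsp_induct [consumes 1, case_names trivial adj]:
  assumes Y: "subsp Y" and "P {\<zero>}"
    and step: "\<And>X x. subsp X \<Longrightarrow> X \<subseteq> Y \<Longrightarrow> P X \<Longrightarrow> x \<in> Y \<Longrightarrow> x \<notin> X \<Longrightarrow> P (adj x X)"
  shows "P Y"
proof -
  let ?S = "{X. subsp X \<and> X \<subseteq> Y \<and> P X}"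
  have fin: "finite ?S" using finite_subsp[OF Y] by (rule_tac finite_subset[of _ "Pow Y"]) auto
  have ne: "?S \<noteq> {}" using Y assms(2) subsp_zero[OF Y] subsp_trivial by blast
  define M where "M = Max (card ` ?S)"
  have "M \<in> card ` ?S" unfolding M_def using fin ne by (intro Max_in) auto
  then obtain X where X: "X \<in> ?S" and XM: "M = card X" by blast
  have mx: "card Z \<le> card X" if "Z \<in> ?S" for Z
    unfolding XM[symmetric] M_def using fin that by (intro Max_ge finite_imageI imageI) auto
  have "X = Y"
  proof (rule ccontr)
    assume "X \<noteq> Y"
    then obtain x where x: "x \<in> Y" "x \<notin> X" using X by blast
    have xV: "x \<in> carrier V" using x Y subsp_carrier by blast
    have "adj x X \<in> ?S" using X x xV step Y adj_least subsp_adj by simp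
    then have "card (adj x X) \<le> card X" using mx by blast
    then show False using card_adj[OF _ xV x(2)] X card_subsp_pos[of X] prime_gt_1_nat[OF prime_l] by auto
  qed
  then show ?thesis using X by simp
qed

lemma card_subsp_power:
  assumes "subsp Y" shows "\<exists>k. card Y = l ^ k"
  using assms
proof (induction rule: subsp_induct)
  case trivial show ?case by (auto intro: exI[of _ 0])
next
  case (adj X x)
  then have "x \<in> carrier V" using adj_least subsp_carrier assms by blast
  then show ?case using adj card_adj[of X x] by (metis power_Suc)
qed

text \<open>Values are the representatives \<open>0, ..., l - 1\<close>, so that equality of values
  is the same as congruence; linearity is required only on \<open>X\<close>.\<close>

definition functional_on :: "'v set \<Rightarrow> ('v \<Rightarrow> int) \<Rightarrow> bool" where
  "functional_on X f \<longleftrightarrow> (\<forall>x\<in>X. f x \<in> {0..<int l}) \<and>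
     (\<forall>x\<in>X. \<forall>y\<in>X. f (x \<oplus> y) = (f x + f y) mod int l) \<and> (\<forall>a. \<forall>x\<in>X. f (a \<star> x) = (a * f x) mod int l)"

lemma functional_on_subset: "functional_on X f \<Longrightarrow> Y \<subseteq> X \<Longrightarrow> functional_on Y f"
  unfolding functional_on_def by blast

lemma functional_on_zero: "functional_on X f \<Longrightarrow> subsp X \<Longrightarrow> f \<zero> = 0"
  unfolding functional_on_def using subsp_zero[of X] sc_zero_right[of 0] by (metis mod_0 mult_zero_left)

lemma subsp_kernel:
  assumes "subsp X" "functional_on X f" shows "subsp {x \<in> X. f x = 0}"
  using assms functional_on_zero[OF assms(2,1)]
  by (intro subspI) (auto simp: subsp_carrier subsp_zero subsp_add subsp_sc functional_on_def)

lemma functional_attains: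
  assumes "subsp X" "functional_on X f" "x \<in> X" "f x \<noteq> 0"
  shows "\<exists>y\<in>X. f y = c mod int l"
proof -
  have "f x mod int l \<noteq> 0" using assms by (simp add: functional_on_def)
  then obtain i where i: "(f x * i) mod int l = 1" using prime_inverse_mod[OF prime_l] by blast
  have "f ((c * i) \<star> x) = (c * i * f x) mod int l" using assms by (simp add: functional_on_def)
  also have "c * i * f x = c * (f x * i)" by (simp add: algebra_simps)
  also have "(c * (f x * i)) mod int l = c mod int l"
    by (metis i mod_mult_right_eq mult.right_neutral)
  finally show ?thesis using assms subsp_sc by blast
qed

text \<open>A functional that is not zero takes all \<open>l\<close> values, and its fibres are
  cosets of its kernel.\<close>

lemma card_kernel:
  assumes X: "subsp X" and f: "functional_on X f" and x: "x \<in> X" "f x \<noteq> 0"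
  shows "card X = l * card {x \<in> X. f x = 0}"
proof -
  have "f ` X = {0..<int l}"
  proof
    show "{0..<int l} \<subseteq> f ` X"
    proof
      fix c assume "c \<in> {0..<int l}"
      then have "c = c mod int l" by simp
      then show "c \<in> f ` X" using functional_attains[OF X f x, of c] by auto
    qed
  qed (use f in \<open>auto simp: functional_on_def\<close>)
  then have im: "card (f ` X) = l" by simp
  have "f u = f v \<longleftrightarrow> u \<oplus> (-1) \<star> v \<in> {x \<in> X. f x = 0}" if uv: "u \<in> X" "v \<in> X" for u v
  proof -
    have "f (u \<oplus> (-1) \<star> v) = (f u - f v) mod int l"
      using f uv X by (simp add: functional_on_def subsp_sc mod_simps)
    moreover have "(f u - f v) mod int l = 0 \<longleftrightarrow> f u mod int l = f v mod int l"
      by (simp add: mod_eq_dvd_iff dvd_eq_mod_eq_0)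
    moreover have "f u mod int l = f u" "f v mod int l = f v"
      using f uv by (auto simp: functional_on_def)
    ultimately show ?thesis using uv X by (auto simp: subsp_add subsp_sc)
  qed
  from card_subsp_fibres[OF X finite_subsp[OF X] subsp_kernel[OF X f] _ this]
  show ?thesis using im by auto
qed

end

text \<open>A device for equations of residues with nested reductions. Resolving the two congruences
  with \<open>cong_strip\<close> constructs \<open>E'\<close> and \<open>F'\<close> from
  \<open>E\<close> and \<open>F\<close> by erasing every inner \<open>mod m\<close>; what remains is
  an identity of integers.\<close>

lemma mod_strip:
  fixes E :: int
  assumes "[E = E'] (mod m)" "[F = F'] (mod m)" "E' = F'"
  shows "E mod m = F mod m"
  using assms by (simp add: cong_def)

lemma mod_strip':
  fixes E :: int
  assumes "F = F mod m" "[E = E'] (mod m)" "E' = F"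
  shows "E mod m = F"
  using assms by (simp add: cong_def)

lemma int_cong_uminus: "[a = b] (mod m) \<Longrightarrow> [- a = - b] (mod m)" for a :: int
  by (simp add: cong_minus_minus_iff)

lemma cong_mod_drop: "[a = b] (mod m) \<Longrightarrow> [a mod m = b] (mod m)" for a :: int
  by (simp add: cong_def)

lemmas cong_strip = cong_add cong_diff cong_mult cong_pow int_cong_uminus cong_mod_drop cong_refl

section \<open>Quadratic forms and orthogonal complements\<close>

locale form_space = fin_space l V for l :: nat and V :: "(int, 'v) module" (structure) +
  fixes Q :: "'v \<Rightarrow> int"
  assumes quad: "quadratic_form l V Q"
begin

notation sc (infixr \<open>\<star>\<close> 75)

abbreviation B :: "'v \<Rightarrow> 'v \<Rightarrow> int" where "B \<equiv> polar l V Q"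

lemma Q_range: "x \<in> carrier V \<Longrightarrow> Q x \<in> {0..<int l}"
  using quad by (auto simp: quadratic_form_def Pi_def)

lemma Q_mod [simp]: "x \<in> carrier V \<Longrightarrow> Q x mod int l = Q x"
  using Q_range[of x] by auto

lemma B_range: "B x y \<in> {0..<int l}"
  using l_gt_1 by (simp add: polar_def)

lemma B_mod [simp]: "B x y mod int l = B x y"
  by (simp add: polar_def)

lemma Q_add: "x \<in> carrier V \<Longrightarrow> y \<in> carrier V \<Longrightarrow> Q (x \<oplus> y) = (Q x + Q y + B x y) mod int l"
  by (simp add: polar_def mod_simps)

lemma B_sym: "x \<in> carrier V \<Longrightarrow> y \<in> carrier V \<Longrightarrow> B x y = B y x"
  by (simp add: polar_def a_comm algebra_simps)

lemma Q_sc: "x \<in> carrier V \<Longrightarrow> Q (a \<star> x) = (a\<^sup>2 * Q x) mod int l"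
proof -
  assume x: "x \<in> carrier V"
  have "Q ((a mod int l) \<odot> x) = ((a mod int l)\<^sup>2 * Q x) mod int l"
    using quad x mod_carrier[of a] unfolding quadratic_form_def by blast
  then show ?thesis by (simp add: sc_def) (rule mod_strip, (rule cong_strip)+, simp)
qed

lemma B_add_left: "x \<in> carrier V \<Longrightarrow> y \<in> carrier V \<Longrightarrow> z \<in> carrier V \<Longrightarrow>
    B (x \<oplus> y) z = (B x z + B y z) mod int l"
  using quad unfolding quadratic_form_def by blast

lemma B_add_right: "x \<in> carrier V \<Longrightarrow> y \<in> carrier V \<Longrightarrow> z \<in> carrier V \<Longrightarrow>
    B z (x \<oplus> y) = (B z x + B z y) mod int l"
  using B_add_left[of x y z] by (simp add: B_sym)

lemma B_sc_left: "x \<in> carrier V \<Longrightarrow> z \<in> carrier V \<Longrightarrow> B (a \<star> x) z = (a * B x z) mod int l"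
proof -
  assume x: "x \<in> carrier V" "z \<in> carrier V"
  have "B ((a mod int l) \<odot> x) z = ((a mod int l) * B x z) mod int l"
    using quad x mod_carrier[of a] unfolding quadratic_form_def by blast
  then show ?thesis by (simp add: sc_def mod_simps)
qed

lemma B_sc_right: "x \<in> carrier V \<Longrightarrow> z \<in> carrier V \<Longrightarrow> B z (a \<star> x) = (a * B z x) mod int l"
  using B_sc_left[of x z a] by (simp add: B_sym)

lemma Q_zero [simp]: "Q \<zero> = 0"
  using Q_sc[of \<zero> 0] by simp

lemma B_zero_left [simp]: "x \<in> carrier V \<Longrightarrow> B \<zero> x = 0"
  using B_sc_left[of \<zero> x 0] by simp

lemma B_zero_right [simp]: "x \<in> carrier V \<Longrightarrow> B x \<zero> = 0"
  using B_sc_right[of \<zero> x 0] by simp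

lemma B_self: "x \<in> carrier V \<Longrightarrow> B x x = (2 * Q x) mod int l"
proof -
  assume x: "x \<in> carrier V"
  have "x \<oplus> x = 2 \<star> x" using x sc_add_left[of x 1 1] by simp
  then show ?thesis using Q_sc[OF x, of 2] by (simp add: polar_def mod_simps)
qed

lemmas B_simps = Q_add Q_sc B_add_left B_add_right B_sc_left B_sc_right B_self

lemma functional_B: "x \<in> carrier V \<Longrightarrow> functional_on (carrier V) (B x)"
  using B_range by (auto simp: functional_on_def B_add_right B_sc_right)

lemma functional_B': "x \<in> carrier V \<Longrightarrow> functional_on (carrier V) (\<lambda>y. B y x)"
  using B_range by (auto simp: functional_on_def B_add_left B_sc_left)

definition perp :: "'v set \<Rightarrow> 'v set" where "perp S = {y \<in> carrier V. \<forall>x\<in>S. B x y = 0}"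

lemma perp_carrier: "x \<in> perp S \<Longrightarrow> x \<in> carrier V"
  by (simp add: perp_def)

lemma subsp_perp: "S \<subseteq> carrier V \<Longrightarrow> subsp (perp S)"
  by (rule subspI) (auto simp: perp_def B_add_right B_sc_right subset_iff)

lemma perp_antimono: "S \<subseteq> T \<Longrightarrow> perp T \<subseteq> perp S"
  by (auto simp: perp_def)

lemma perp_sym: "S \<subseteq> carrier V \<Longrightarrow> T \<subseteq> perp S \<Longrightarrow> S \<subseteq> perp T"
  by (auto simp: perp_def subset_iff B_sym)

lemma perp_splus:
  assumes "subsp X" "subsp Y" shows "perp (splus X Y) = perp X \<inter> perp Y"
proof
  show "perp (splus X Y) \<subseteq> perp X \<inter> perp Y"
    using perp_antimono splus_upper[OF assms] by simp
  show "perp X \<inter> perp Y \<subseteq> perp (splus X Y)"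
    using assms by (auto simp: perp_def splus_def B_add_left subsp_carrier)
qed

lemma perp_adj:
  assumes "subsp X" "x \<in> carrier V" shows "perp (adj x X) = {y \<in> perp X. B x y = 0}"
proof
  show "perp (adj x X) \<subseteq> {y \<in> perp X. B x y = 0}"
    using perp_antimono[OF adj_upper[OF assms]] adj_self[OF assms] by (auto simp: perp_def)
  show "{y \<in> perp X. B x y = 0} \<subseteq> perp (adj x X)"
    using assms by (auto simp: perp_def elim!: adjE) (simp add: B_add_left B_sc_left subsp_carrier)
qed

definition tot_sing :: "'v set \<Rightarrow> bool" where "tot_sing X \<longleftrightarrow> (\<forall>x\<in>X. Q x = 0)"

lemma tot_sing_B:
  assumes "subsp X" "tot_sing X" "x \<in> X" "y \<in> X" shows "B x y = 0"
  using assms subsp_add[OF assms(1,3,4)] by (auto simp: tot_sing_def polar_def)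

lemma tot_sing_subset_perp: "subsp X \<Longrightarrow> tot_sing X \<Longrightarrow> X \<subseteq> perp X"
  using tot_sing_B subsp_carrier by (auto simp: perp_def)

end

section \<open>Spaces with nondegenerate polar form: duality of subspaces\<close>

locale quad_space = form_space l V Q for l :: nat and V :: "(int, 'v) module" (structure) and Q +
  assumes nondeg: "\<And>x. x \<in> carrier V \<Longrightarrow> (\<And>y. y \<in> carrier V \<Longrightarrow> B x y = 0) \<Longrightarrow> x = \<zero>"
begin

notation sc (infixr \<open>\<star>\<close> 75)

text \<open>Vectors are compared through their products with all others. Identities between linear
  maps thereby become congruences of integers.\<close>

lemma vec_eqI:
  assumes xy: "x \<in> carrier V" "y \<in> carrier V" and "\<And>z. z \<in> carrier V \<Longrightarrow> B x z = B y z"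
  shows "x = y"
proof -
  have "x \<oplus> (-1) \<star> y = \<zero>" using assms by (intro nondeg) (auto simp: B_simps mod_simps)
  then show ?thesis using add_sc_minus_eq_zero_iff[OF xy] by simp
qed

text \<open>Half of the double orthogonality theorem, proved without dimensions: a vector outside
  \<open>X\<close> is detected by \<open>perp X\<close>. The induction adjoins one vector
  \<open>x\<close> at a time, and a vector \<open>p\<close> of \<open>perp Y\<close> dual to
  \<open>x\<close> serves to correct both \<open>w\<close> and its witness.\<close>

lemma ex_perp_not_orth:
  assumes "subsp X" "w \<in> carrier V" "w \<notin> X"
  shows "\<exists>p\<in>perp X. B w p = 1"
proof -
  have "\<forall>w\<in>carrier V. w \<notin> X \<longrightarrow> (\<exists>p\<in>perp X. B w p \<noteq> 0)"
    using assms(1)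
  proof (induction rule: subsp_induct)
    case trivial
    have "perp {\<zero>} = carrier V" by (auto simp: perp_def)
    then show ?case using nondeg by auto
  next
    case (adj Y x)
    have xV: "x \<in> carrier V" using adj assms subsp_carrier by blast
    obtain p0 where p0: "p0 \<in> perp Y" "B x p0 \<noteq> 0" using adj xV by blast
    obtain p where p: "p \<in> perp Y" "B x p = 1"
      using functional_attains[of "perp Y" "B x" p0 1] functional_on_subset[OF functional_B[OF xV]]
        subsp_perp[OF subsp_subset[OF adj(1)]] perp_carrier p0 by (auto simp: subset_iff)
    have pV: "p \<in> carrier V" using p perp_carrier by blast
    show ?case
    proof (intro ballI impI)
      fix w assume w: "w \<in> carrier V" "w \<notin> adj x Y"
      \<comment> \<open>This is \<open>w\<close> with its product with \<open>p\<close> removed by a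
        multiple of \<open>x\<close>. It stays outside \<open>Y\<close> because \<open>w\<close>
        lies outside the span of \<open>x\<close> and \<open>Y\<close>.\<close>
      define w' where "w' = w \<oplus> (- B w p) \<star> x"
      have w'V: "w' \<in> carrier V" unfolding w'_def using w xV by simp
      have "w' \<notin> Y"
      proof
        assume "w' \<in> Y"
        then have "B w p \<star> x \<oplus> w' \<in> adj x Y" by (rule adjI)
        moreover have "B w p \<star> x \<oplus> w' = w"
          unfolding w'_def using w xV by (intro vec_eqI) (auto simp: B_simps mod_simps)
        ultimately show False using w by simp
      qed
      then obtain q where q: "q \<in> perp Y" "B w' q \<noteq> 0" using adj w'V by blast
      have qV: "q \<in> carrier V" using q perp_carrier by blast
      \<comment> \<open>The witness is made orthogonal to \<open>x\<close> by a multiple of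
        \<open>p\<close>. The two corrections are adjoint to each other, which gives
        \<open>B w q' = B w' q\<close>.\<close>
      define q' where "q' = q \<oplus> (- B x q) \<star> p"
      have Y: "Y \<subseteq> carrier V" using adj subsp_subset by blast
      have "q' \<in> perp Y" unfolding q'_def
        using subsp_perp[OF Y] q p by (intro subsp_add subsp_sc) auto
      moreover have "B x q' = 0"
        unfolding q'_def using xV qV pV p by (simp add: B_simps mod_simps)
      ultimately have "q' \<in> perp (adj x Y)" using perp_adj[OF adj(1) xV] by simp
      moreover have "B w q' = B w' q"
        unfolding q'_def w'_def using xV qV pV p w by (simp add: B_simps mod_simps algebra_simps)
      ultimately show "\<exists>p\<in>perp (adj x Y). B w p \<noteq> 0" using q by (intro bexI[of _ q']) simp_all
    qed
  qed
  then obtain p where "p \<in> perp X" "B w p \<noteq> 0" using assms by blast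
  then show ?thesis
    using functional_attains[of "perp X" "B w" p 1] functional_on_subset[OF functional_B[OF assms(2)]]
      subsp_perp[OF subsp_subset[OF assms(1)]] perp_carrier by (auto simp: subset_iff)
qed

text \<open>Adjoining \<open>x\<close> to \<open>Y\<close> multiplies the size of \<open>Y\<close>
  by \<open>l\<close> and cuts \<open>perp Y\<close> down to the kernel of the functional
  \<open>B x\<close>, which is nonzero on \<open>perp Y\<close> by
  \<open>ex_perp_not_orth\<close>.\<close>

lemma card_perp:
  assumes "subsp X" shows "card X * card (perp X) = card (carrier V)"
  using assms
proof (induction rule: subsp_induct)
  case trivial
  have "perp {\<zero>} = carrier V" by (auto simp: perp_def)
  then show ?case by simp
next
  case (adj Y x)
  have xV: "x \<in> carrier V" using adj assms subsp_carrier by blast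
  obtain p where p: "p \<in> perp Y" "B x p = 1" using ex_perp_not_orth[OF adj(1) xV adj(4)] by blast
  have "card (perp Y) = l * card {y \<in> perp Y. B x y = 0}"
    using adj(1) xV p perp_carrier
    by (intro card_kernel[of _ _ p] functional_on_subset[OF functional_B] subsp_perp)
      (auto simp: subsp_subset)
  then show ?case using adj card_adj[OF adj(1) xV adj(4)] perp_adj[OF adj(1) xV] by (simp add: mult_ac)
qed

lemma perp_perp:
  assumes "subsp X" shows "perp (perp X) = X"
proof
  show "X \<subseteq> perp (perp X)" using perp_sym[of X "perp X"] subsp_subset[OF assms] by blast
  show "perp (perp X) \<subseteq> X"
  proof
    fix w assume w: "w \<in> perp (perp X)"
    show "w \<in> X"
    proof (rule ccontr)
      assume "w \<notin> X"
      then obtain p where "p \<in> perp X" "B w p = 1"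
        using ex_perp_not_orth[OF assms] w perp_carrier by blast
      moreover have "B p w = 0" using w \<open>p \<in> perp X\<close> by (auto simp: perp_def)
      ultimately show False using B_sym[of p w] w perp_carrier by auto
    qed
  qed
qed

text \<open>If \<open>Q\<close> vanished on \<open>perp X\<close>, then \<open>perp X\<close> would
  be totally singular and so contained in its own complement \<open>X\<close>. The bound on the size
  forces \<open>perp X = X\<close>, and \<open>X\<close> would be a totally singular space of half
  dimension, the excluded case.\<close>

lemma ex_nonsingular_perp:
  assumes X: "subsp X" and "card X * card X \<le> card (carrier V)"
    and "\<not> (tot_sing X \<and> card X * card X = card (carrier V))"
  shows "\<exists>v\<in>perp X. Q v \<noteq> 0"
proof (rule ccontr)
  assume "\<not> ?thesis"
  then have ts: "tot_sing (perp X)" by (auto simp: tot_sing_def)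
  have sp: "subsp (perp X)" using X subsp_perp subsp_subset by blast
  have sub: "perp X \<subseteq> X" using tot_sing_subset_perp[OF sp ts] perp_perp[OF X] by simp
  have "card X * card X \<le> card X * card (perp X)" using card_perp[OF X] assms(2) by simp
  then have "card X \<le> card (perp X)" using card_subsp_pos[OF X] by simp
  then have "perp X = X" using sub finite_subsp[OF X] by (meson card_seteq)
  then show False using ts card_perp[OF X] assms(3) by simp
qed

section \<open>The orthogonal group\<close>

definition refls :: "'v set" where "refls = {v \<in> carrier V. Q v \<noteq> 0}"

abbreviation Og :: "('v \<Rightarrow> 'v) set" where "Og \<equiv> carrier (orth l V Q)"

text \<open>Bijectivity comes for free: a map that preserves a nondegenerate \<open>B\<close> is
  injective, and the space is finite.\<close>

lemma orthI:
  assumes ext: "g \<in> extensional (carrier V)" and cl: "\<And>x. x \<in> carrier V \<Longrightarrow> g x \<in> carrier V"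
    and add: "\<And>x y. x \<in> carrier V \<Longrightarrow> y \<in> carrier V \<Longrightarrow> g (x \<oplus> y) = g x \<oplus> g y"
    and sc: "\<And>a x. x \<in> carrier V \<Longrightarrow> g (a \<star> x) = a \<star> g x"
    and Q: "\<And>x. x \<in> carrier V \<Longrightarrow> Q (g x) = Q x"
  shows "g \<in> Og"
proof -
  have B: "B (g x) (g y) = B x y" if "x \<in> carrier V" "y \<in> carrier V" for x y
    using that by (simp add: polar_def Q flip: add)
  have "inj_on g (carrier V)"
  proof (rule inj_onI)
    fix x y assume xy: "x \<in> carrier V" "y \<in> carrier V" "g x = g y"
    have "B x z = B y z" if "z \<in> carrier V" for z
      using B[OF xy(1) that] B[OF xy(2) that] xy(3) by simp
    then show "x = y" by (rule vec_eqI[OF xy(1,2)])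
  qed
  moreover have "g ` carrier V = carrier V"
    using calculation cl finite_V by (intro endo_inj_surj) auto
  ultimately have "g \<in> Bij (carrier V)" using ext by (simp add: Bij_def bij_betw_def)
  moreover have "g (a \<odot> x) = a \<odot> g x" if "a \<in> carrier (zmod l)" "x \<in> carrier V" for a x
    using that sc[of x a] by (simp add: smult_eq_sc)
  ultimately show ?thesis using add Q by (auto simp: orth_def lin_auts_def)
qed

lemma
  assumes g: "g \<in> Og"
  shows orth_Bij: "g \<in> Bij (carrier V)"
    and orth_ext: "g \<in> extensional (carrier V)"
    and orth_closed: "x \<in> carrier V \<Longrightarrow> g x \<in> carrier V"
    and orth_add: "x \<in> carrier V \<Longrightarrow> y \<in> carrier V \<Longrightarrow> g (x \<oplus> y) = g x \<oplus> g y"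
    and orth_sc: "x \<in> carrier V \<Longrightarrow> g (a \<star> x) = a \<star> g x"
    and orth_Q: "x \<in> carrier V \<Longrightarrow> Q (g x) = Q x"
    and orth_B: "x \<in> carrier V \<Longrightarrow> y \<in> carrier V \<Longrightarrow> B (g x) (g y) = B x y"
    and orth_inj: "x \<in> carrier V \<Longrightarrow> y \<in> carrier V \<Longrightarrow> g x = g y \<Longrightarrow> x = y"
    and orth_surj: "g ` carrier V = carrier V"
    and orth_lin: "g \<in> lin_auts l V"
proof -
  show Bij: "g \<in> Bij (carrier V)" and "g \<in> lin_auts l V" using g by (auto simp: orth_def lin_auts_def)
  then show "g \<in> extensional (carrier V)" "g ` carrier V = carrier V"
    "x \<in> carrier V \<Longrightarrow> g x \<in> carrier V"
    "x \<in> carrier V \<Longrightarrow> y \<in> carrier V \<Longrightarrow> g x = g y \<Longrightarrow> x = y"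
    by (auto simp: Bij_def bij_betw_def inj_on_def)
  show add: "x \<in> carrier V \<Longrightarrow> y \<in> carrier V \<Longrightarrow> g (x \<oplus> y) = g x \<oplus> g y" for x y
    using g by (auto simp: orth_def lin_auts_def)
  show "x \<in> carrier V \<Longrightarrow> g (a \<star> x) = a \<star> g x"
    using g mod_carrier[of a] unfolding sc_def by (auto simp: orth_def lin_auts_def)
  show Q: "x \<in> carrier V \<Longrightarrow> Q (g x) = Q x" for x using g by (auto simp: orth_def)
  show "x \<in> carrier V \<Longrightarrow> y \<in> carrier V \<Longrightarrow> B (g x) (g y) = B x y"
    by (simp add: polar_def Q flip: add)
qed

lemma orth_eqI:
  assumes "g \<in> Og" "h \<in> Og" "\<And>x. x \<in> carrier V \<Longrightarrow> g x = h x"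
  shows "g = h"
  by (rule extensionalityI[OF orth_ext[OF assms(1)] orth_ext[OF assms(2)] assms(3)])

lemma orth_one: "\<one>\<^bsub>orth l V Q\<^esub> = (\<lambda>x\<in>carrier V. x)"
  by (simp add: orth_def BijGroup_def)

lemma id_orth: "(\<lambda>x\<in>carrier V. x) \<in> Og"
  by (rule orthI) simp_all

lemma compose_apply: "x \<in> carrier V \<Longrightarrow> compose (carrier V) g h x = g (h x)"
  by (simp add: compose_def)

lemma compose_orth: "g \<in> Og \<Longrightarrow> h \<in> Og \<Longrightarrow> compose (carrier V) g h \<in> Og"
  by (rule orthI) (simp_all add: compose_apply orth_closed orth_add orth_sc orth_Q)

lemma orth_mult: "g \<in> Og \<Longrightarrow> h \<in> Og \<Longrightarrow> g \<otimes>\<^bsub>orth l V Q\<^esub> h = compose (carrier V) g h"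
  by (simp add: orth_def BijGroup_def lin_auts_def)

lemma orth_inverse:
  assumes g: "g \<in> Og"
  shows "\<exists>h\<in>Og. (\<forall>x\<in>carrier V. h (g x) = x) \<and> (\<forall>x\<in>carrier V. g (h x) = x)"
proof -
  define h where "h = (\<lambda>x\<in>carrier V. inv_into (carrier V) g x)"
  have gh: "g (h x) = x" and hV: "h x \<in> carrier V" if "x \<in> carrier V" for x
    using that orth_surj[OF g] by (auto simp: h_def f_inv_into_f inv_into_into)
  have hI: "h x = y" if "x \<in> carrier V" "y \<in> carrier V" "g y = x" for x y
    by (rule orth_inj[OF g hV[OF that(1)] that(2)]) (simp add: gh[OF that(1)] that(3))
  have hg: "h (g x) = x" if "x \<in> carrier V" for x
    by (rule hI[OF orth_closed[OF g that] that refl])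
  have "h \<in> Og"
  proof (rule orthI)
    show "h \<in> extensional (carrier V)" by (simp add: h_def)
    show "h (x \<oplus> y) = h x \<oplus> h y" if "x \<in> carrier V" "y \<in> carrier V" for x y
      by (rule hI) (simp_all add: that hV gh orth_add[OF g])
    show "h (a \<star> x) = a \<star> h x" if "x \<in> carrier V" for a x
      by (rule hI) (simp_all add: that hV gh orth_sc[OF g])
    show "Q (h x) = Q x" if "x \<in> carrier V" for x
      using orth_Q[OF g hV[OF that]] by (simp add: gh[OF that])
  qed (rule hV)
  then show ?thesis using gh hg by blast
qed

subsection \<open>Reflections\<close>

lemma zmod_inverse:
  assumes "a \<in> {0..<int l}" "a \<noteq> 0"
  shows "(a * inv\<^bsub>zmod l\<^esub> a) mod int l = 1" "inv\<^bsub>zmod l\<^esub> a \<in> {0..<int l}" "a \<in> Units (zmod l)"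
proof -
  interpret R: cring "zmod l" using is_module by (simp add: module_def)
  obtain i where i: "(a * i) mod int l = 1" using prime_inverse_mod[OF prime_l, of a] assms by auto
  then have "a \<otimes>\<^bsub>zmod l\<^esub> (i mod int l) = \<one>\<^bsub>zmod l\<^esub>" "(i mod int l) \<otimes>\<^bsub>zmod l\<^esub> a = \<one>\<^bsub>zmod l\<^esub>"
    by (simp_all add: mod_simps mult.commute)
  then show u: "a \<in> Units (zmod l)" using assms l_gt_1 unfolding Units_def
    by (simp only: zmod_simps mem_Collect_eq) (metis atLeastLessThan_iff mod_carrier zmod_simps(1))
  show "(a * inv\<^bsub>zmod l\<^esub> a) mod int l = 1" "inv\<^bsub>zmod l\<^esub> a \<in> {0..<int l}"
    using R.Units_r_inv[OF u] R.Units_inv_closed[OF u] by simp_all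
qed

lemma
  assumes v: "v \<in> refls" and w: "w \<in> carrier V"
  shows refl_apply: "reflection l V Q v w = w \<oplus> (- (B w v * inv\<^bsub>zmod l\<^esub> (Q v))) \<star> v"
    and refl_Q_inv: "(Q v * inv\<^bsub>zmod l\<^esub> (Q v)) mod int l = 1"
proof -
  have v: "v \<in> carrier V" "Q v \<noteq> 0" using v by (auto simp: refls_def)
  show "(Q v * inv\<^bsub>zmod l\<^esub> (Q v)) mod int l = 1" using zmod_inverse(1)[OF Q_range] v by simp
  have "(B w v * inv\<^bsub>zmod l\<^esub> (Q v)) mod int l \<in> {0..<int l}" using l_gt_1 by simp
  then show "reflection l V Q v w = w \<oplus> (- (B w v * inv\<^bsub>zmod l\<^esub> (Q v))) \<star> v"
    using v w by (simp add: reflection_def smult_eq_sc a_minus_eq_sc sc_sc)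
qed

lemma refl_orth:
  assumes v: "v \<in> refls" shows "reflection l V Q v \<in> Og"
proof -
  define i where "i = inv\<^bsub>zmod l\<^esub> (Q v)"
  have vV: "v \<in> carrier V" using v by (simp add: refls_def)
  have ap: "reflection l V Q v w = w \<oplus> (- (B w v * i)) \<star> v" if "w \<in> carrier V" for w
    using refl_apply[OF v that] by (simp add: i_def)
  have "(Q v * i) mod int l = 1" using refl_Q_inv[OF v] vV i_def by blast
  \<comment> \<open>The inverse of \<open>Q v\<close> is lifted to the integers together with its
    error term, so that the invariance of \<open>Q\<close> becomes a polynomial identity in the
    presence of this one equation.\<close>
  then obtain k where k: "Q v * i = 1 + int l * k" by (metis mult_div_mod_eq add.commute)
  show ?thesis
  proof (rule orthI)
    show "reflection l V Q v \<in> extensional (carrier V)" by (simp add: reflection_def)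
    fix x assume x: "x \<in> carrier V"
    show "reflection l V Q v x \<in> carrier V" using x vV by (simp add: ap)
    have "Q (reflection l V Q v x) = (Q x + (B x v * i)\<^sup>2 * Q v - B x v * i * B x v) mod int l"
      using x vV by (simp add: ap B_simps) (rule mod_strip, (rule cong_strip)+, Groebner_Basis.algebra)
    also have "Q x + (B x v * i)\<^sup>2 * Q v - B x v * i * B x v = Q x + int l * ((B x v)\<^sup>2 * i * k)"
      using k by Groebner_Basis.algebra
    finally show "Q (reflection l V Q v x) = Q x" using x by simp
    show "reflection l V Q v (a \<star> x) = a \<star> reflection l V Q v x" for a
      using x vV
      by (intro vec_eqI; simp add: ap B_simps) (rule mod_strip, (rule cong_strip)+, simp add: algebra_simps)
    fix y assume y: "y \<in> carrier V"
    show "reflection l V Q v (x \<oplus> y) = reflection l V Q v x \<oplus> reflection l V Q v y"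
      using x y vV
      by (intro vec_eqI; simp add: ap B_simps) (rule mod_strip, (rule cong_strip)+, simp add: algebra_simps)
  qed
qed

lemma refl_fix: "v \<in> refls \<Longrightarrow> w \<in> carrier V \<Longrightarrow> B w v = 0 \<Longrightarrow> reflection l V Q v w = w"
  by (simp add: refl_apply) (simp add: refls_def)

text \<open>Equality of the norms of \<open>w\<close> and \<open>w'\<close> gives
  \<open>B w z = - Q z\<close> for the difference \<open>z\<close>, and the formula of the
  reflection then adds exactly \<open>z\<close> to \<open>w\<close>.\<close>

lemma refl_swap:
  assumes w: "w \<in> carrier V" "w' \<in> carrier V" "Q w = Q w'" and z: "z = w' \<oplus> (-1) \<star> w" "Q z \<noteq> 0"
  shows "reflection l V Q z w = w'"
proof -
  have zr: "z \<in> refls" and zV: "z \<in> carrier V" using w z by (auto simp: refls_def)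
  define i where "i = inv\<^bsub>zmod l\<^esub> (Q z)"
  have i: "(Q z * i) mod int l = 1" using refl_Q_inv[OF zr w(1)] i_def by simp
  have Bw: "B w z = (- Q z) mod int l"
    unfolding z(1) using w by (simp add: B_simps mod_simps B_sym[of w' w])
  have "- (B w z * i) mod int l = (Q z * i) mod int l" unfolding Bw
    by (rule mod_strip, (rule cong_strip)+, Groebner_Basis.algebra)
  then have "(- (B w z * i)) \<star> z = 1 \<star> z" using i by (intro sc_cong) simp
  then have "reflection l V Q z w = w \<oplus> z" using refl_apply[OF zr w(1)] zV i_def by simp
  then show ?thesis unfolding z(1) using w by simp
qed

lemma refl_invol:
  assumes v: "v \<in> refls" and w: "w \<in> carrier V"
  shows "reflection l V Q v (reflection l V Q v w) = w"
proof -
  define i where "i = inv\<^bsub>zmod l\<^esub> (Q v)"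
  have vV: "v \<in> carrier V" using v by (simp add: refls_def)
  have ap: "reflection l V Q v w = w \<oplus> (- (B w v * i)) \<star> v" if "w \<in> carrier V" for w
    using refl_apply[OF v that] by (simp add: i_def)
  have "(Q v * i) mod int l = 1" using refl_Q_inv[OF v] vV i_def by blast
  then obtain k where k: "Q v * i = 1 + int l * k" by (metis mult_div_mod_eq add.commute)
  show ?thesis
  proof (rule vec_eqI)
    fix z assume z: "z \<in> carrier V"
    have "B (reflection l V Q v (reflection l V Q v w)) z =
      (B w z - B w v * i * B v z - (B w v - B w v * i * (2 * Q v)) * i * B v z) mod int l"
      using w vV z by (simp add: ap B_simps) (rule mod_strip, (rule cong_strip)+, Groebner_Basis.algebra)
    also have "B w z - B w v * i * B v z - (B w v - B w v * i * (2 * Q v)) * i * B v z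
       = B w z + int l * (2 * k * B w v * i * B v z)" using k by Groebner_Basis.algebra
    finally show "B (reflection l V Q v (reflection l V Q v w)) z = B w z" by simp
  qed (use w orth_closed[OF refl_orth[OF v]] in auto)
qed

end

section \<open>Eichler transformations and the Witt extension step\<close>

context quad_space
begin

text \<open>The Eichler (or Siegel) transformation attached to a singular vector \<open>z\<close>
  and a vector \<open>p\<close> orthogonal to it. It fixes all vectors orthogonal to both and is
  available exactly where a difference vector is singular and has no reflection.\<close>

lemma eichler:
  assumes z: "z \<in> carrier V" "Q z = 0" and p: "p \<in> carrier V" "B z p = 0"
  shows "(\<lambda>x\<in>carrier V. (x \<oplus> (- B x z) \<star> p) \<oplus> (B x p - Q p * B x z) \<star> z) \<in> Og"
proof -
  define E where "E = (\<lambda>x\<in>carrier V. (x \<oplus> (- B x z) \<star> p) \<oplus> (B x p - Q p * B x z) \<star> z)"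
  have pz: "B p z = 0" using z p B_sym by simp
  have EV: "E x \<in> carrier V" if "x \<in> carrier V" for x using that z p by (simp add: E_def)
  have BE: "B (E x) t = (B x t - B x z * B p t + (B x p - Q p * B x z) * B z t) mod int l"
    if "x \<in> carrier V" "t \<in> carrier V" for x t
    using that z p
    by (simp add: E_def B_simps) (rule mod_strip, (rule cong_strip)+, simp add: algebra_simps)
  have "E \<in> Og"
  proof (rule orthI)
    fix x assume x: "x \<in> carrier V"
    show "E x \<in> carrier V" using x by (rule EV)
    show "Q (E x) = Q x"
      using x z p pz by (simp add: E_def B_simps)
        (rule mod_strip', simp, (rule cong_strip)+, simp add: algebra_simps power2_eq_square)
    show "E (a \<star> x) = a \<star> E x" for a
    proof (rule vec_eqI)
      fix t assume t: "t \<in> carrier V"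
      show "B (E (a \<star> x)) t = B (a \<star> E x) t"
        using x t z p EV by (simp add: BE B_sc_left)
          (rule mod_strip, (rule cong_strip)+, simp add: algebra_simps)
    qed (use x EV in auto)
    fix y assume y: "y \<in> carrier V"
    show "E (x \<oplus> y) = E x \<oplus> E y"
    proof (rule vec_eqI)
      fix t assume t: "t \<in> carrier V"
      show "B (E (x \<oplus> y)) t = B (E x \<oplus> E y) t"
        using x y t z p EV by (simp add: BE B_add_left)
          (rule mod_strip, (rule cong_strip)+, simp add: algebra_simps)
    qed (use x y EV in auto)
  qed (simp add: E_def)
  then show ?thesis by (simp add: E_def)
qed

text \<open>Everything depends on the difference \<open>z = w' - w\<close>, which is orthogonal to
  \<open>W\<close>. If \<open>z\<close> is nonsingular, its reflection works. If \<open>z\<close> is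
  singular, an Eichler transformation adds \<open>z\<close> to \<open>w\<close>, provided that some
  \<open>p\<close> orthogonal to \<open>z\<close> and \<open>W\<close> has \<open>B w p = 1\<close>.
  This fails exactly when \<open>w\<close> lies in the span of \<open>z\<close> and
  \<open>W\<close>; then \<open>z\<close> itself is rescaled by two reflections.\<close>

lemma witt_step:
  assumes W: "subsp W" and w: "w \<in> carrier V" "w \<notin> W" and w': "w' \<in> carrier V" "w' \<notin> W"
    and Qw: "Q w = Q w'" and Bw: "\<And>u. u \<in> W \<Longrightarrow> B w u = B w' u"
  shows "\<exists>g\<in>Og. (\<forall>u\<in>W. g u = u) \<and> g w = w'"
proof -
  define z where "z = w' \<oplus> (-1) \<star> w"
  have z: "z \<in> carrier V" using w w' by (simp add: z_def)
  have WV: "u \<in> W \<Longrightarrow> u \<in> carrier V" for u using W subsp_carrier by blast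
  have Bzu: "B u z = 0" if "u \<in> W" for u
    using that w w' WV[OF that] Bw[OF that] by (simp add: z_def B_simps mod_simps B_sym[of u])
  have Bwz: "B w z = (- Q z) mod int l"
    unfolding z_def using w w' Qw by (simp add: B_simps mod_simps B_sym[of w' w])
  have zp: "z \<in> perp W" using z Bzu by (simp add: perp_def)
  have pW: "subsp (perp W)" using W subsp_perp subsp_subset by blast
  consider "z = \<zero>" | "Q z \<noteq> 0" | "z \<noteq> \<zero>" "Q z = 0" by blast
  then show ?thesis
  proof cases
    case 1
    then have "w = w'" using add_sc_minus_eq_zero_iff w w' by (simp add: z_def)
    then show ?thesis using id_orth w WV by (intro bexI[of _ "\<lambda>x\<in>carrier V. x"]) auto
  next
    case 2
    then have zr: "z \<in> refls" using z by (simp add: refls_def)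
    have "reflection l V Q z w = w'" using refl_swap[OF w(1) w'(1) Qw z_def 2] .
    moreover have "reflection l V Q z u = u" if "u \<in> W" for u
      by (rule refl_fix[OF zr WV[OF that] Bzu[OF that]])
    ultimately show ?thesis using refl_orth[OF zr] by blast
  next
    case 3
    have Bwz0: "B w z = 0" using Bwz 3 by simp
    show ?thesis
    proof (cases "w \<in> adj z W")
      case False
      then obtain p where p: "p \<in> perp (adj z W)" "B w p = 1"
        using ex_perp_not_orth[OF subsp_adj[OF W z] w(1)] by blast
      have p': "p \<in> carrier V" "p \<in> perp W" "B z p = 0" using p perp_adj[OF W z] by (auto simp: perp_def)
      define g where "g = (\<lambda>x\<in>carrier V. (x \<oplus> (- B x z) \<star> p) \<oplus> (B x p - Q p * B x z) \<star> z)"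
      have "g \<in> Og" unfolding g_def using eichler[OF z 3(2) p'(1,3)] .
      moreover have "g u = u" if "u \<in> W" for u
        using that WV[OF that] p' Bzu[OF that] z by (simp add: g_def perp_def)
      moreover have "g w = w \<oplus> z" using w z p p' Bwz0 by (simp add: g_def)
      then have "g w = w'" unfolding z_def using w w' by simp
      ultimately show ?thesis by blast
    next
      case True
      \<comment> \<open>Modulo \<open>W\<close> the vectors \<open>w\<close> and \<open>w'\<close>
        are \<open>t z\<close> and \<open>(t + 1) z\<close>. Neither lies in \<open>W\<close>, so
        \<open>t\<close> and \<open>t + 1\<close> are invertible, and it suffices to multiply
        \<open>z\<close> by \<open>(t + 1) / t\<close> while \<open>W\<close> stays fixed.\<close>
      then obtain t w0 where t: "w = t \<star> z \<oplus> w0" "w0 \<in> W" by (rule adjE)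
      have w0: "w0 \<in> carrier V" using t WV by simp
      have w't: "w' = (t + 1) \<star> z \<oplus> w0"
      proof -
        have "w' = z \<oplus> w" unfolding z_def using w w' by simp
        also have "\<dots> = (t + 1) \<star> z \<oplus> w0" unfolding t(1) using z w0 by (simp add: sc_add_left a_ac)
        finally show ?thesis .
      qed
      have t0: "t mod int l \<noteq> 0"
      proof
        assume "t mod int l = 0"
        then have "t \<star> z = 0 \<star> z" by (intro sc_cong) simp
        then show False using t w z w0 by simp
      qed
      have t1: "(t + 1) mod int l \<noteq> 0"
      proof
        assume "(t + 1) mod int l = 0"
        then have "(t + 1) \<star> z = 0 \<star> z" by (intro sc_cong) simp
        then show False using t w't w' z w0 by simp
      qed
      have "z \<notin> W" using t w W by (auto intro: subsp_add subsp_sc)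
      then obtain f0 where f0: "f0 \<in> perp W" "B z f0 = 1" using ex_perp_not_orth[OF W z] by blast
      have f0V: "f0 \<in> carrier V" using f0 perp_carrier by blast
      define f where "f = f0 \<oplus> (- Q f0) \<star> z"
      have fV: "f \<in> carrier V" using f0V z by (simp add: f_def)
      have fp: "f \<in> perp W" unfolding f_def using f0 zp pW by (intro subsp_add subsp_sc)
      have Qf: "Q f = 0" using f0V z f0 3 by (simp add: f_def B_simps mod_simps B_sym[of f0 z])
      have Bzf: "B z f = 1" "B f z = 1"
        using f0V z f0 3 by (simp_all add: f_def B_simps mod_simps B_sym[of f0 z])
      obtain s where s: "(t * s) mod int l = 1" "s mod int l \<noteq> 0"
        using prime_inverse_mod[OF prime_l t0] by blast
      define c where "c = (t + 1) * s"
      have c0: "c mod int l \<noteq> 0"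
        using prime_mult_mod_eq_0[OF prime_l, of "t + 1" s] t1 s(2) by (auto simp: c_def)
      \<comment> \<open>The vectors \<open>z\<close> and \<open>f\<close> form a hyperbolic pair in
        \<open>perp W\<close>. The reflections in \<open>f - z\<close> and in
        \<open>c z - f\<close>, of norms \<open>-1\<close> and \<open>-c\<close>, send
        \<open>z\<close> to \<open>f\<close> and \<open>f\<close> to \<open>c z\<close>.\<close>
      define v1 where "v1 = f \<oplus> (-1) \<star> z"
      define v2 where "v2 = c \<star> z \<oplus> (-1) \<star> f"
      have "Q v1 = (- 1) mod int l" using fV z Qf Bzf 3 by (simp add: v1_def B_simps mod_simps)
      then have Qv1: "Q v1 \<noteq> 0" using l_gt_1 by (simp add: zmod_zminus1_eq_if)
      have "Q v2 = (- c) mod int l" using fV z Qf Bzf 3 by (simp add: v2_def B_simps mod_simps)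
      then have Qv2: "Q v2 \<noteq> 0" using c0 by (simp add: mod_eq_0_iff_dvd)
      have v12: "v1 \<in> refls" "v2 \<in> refls" using Qv1 Qv2 fV z by (auto simp: refls_def v1_def v2_def)
      have vp: "v1 \<in> perp W" "v2 \<in> perp W"
        unfolding v1_def v2_def using fp zp pW by (auto intro: subsp_add subsp_sc)
      have r1: "reflection l V Q v1 z = f" using refl_swap[OF z fV _ v1_def Qv1] Qf 3 by simp
      have r2: "reflection l V Q v2 f = c \<star> z"
        using refl_swap[OF fV _ _ v2_def Qv2] Qf 3 z by (simp add: Q_sc)
      define g where "g = compose (carrier V) (reflection l V Q v2) (reflection l V Q v1)"
      have g: "g \<in> Og" unfolding g_def using compose_orth refl_orth v12 by blast
      have gu: "g u = u" if "u \<in> W" for u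
      proof -
        have "B u v1 = 0" "B u v2 = 0" using vp that by (auto simp: perp_def)
        then show ?thesis
          unfolding g_def compose_apply[OF WV[OF that]]
          by (simp add: refl_fix[OF v12(1) WV[OF that]] refl_fix[OF v12(2) WV[OF that]])
      qed
      have gz: "g z = c \<star> z" using z r1 r2 by (simp add: g_def compose_apply)
      have "g w = (t * c) \<star> z \<oplus> w0"
        using t g z w0 gu[OF t(2)] gz by (simp add: orth_add orth_sc sc_sc)
      also have "(t * c) \<star> z = (t + 1) \<star> z"
      proof (rule sc_cong)
        have "(t * c) mod int l = ((t + 1) * ((t * s) mod int l)) mod int l"
          by (rule mod_strip, (rule cong_strip)+, simp add: c_def algebra_simps)
        then show "(t * c) mod int l = (t + 1) mod int l" using s by simp
      qed
      finally show ?thesis using g gu w't by auto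
    qed
  qed
qed

end

section \<open>Vectors of prescribed norm, totally singular subspaces, hyperbolic pairs\<close>

text \<open>The prime divides \<open>x - y\<close> or \<open>x + y\<close>, and both are smaller
  than \<open>l\<close> in absolute value. In the second case both numbers are 0.\<close>

lemma prime_dvd_int_cases:
  assumes "prime l" and "(x\<^sup>2 - y\<^sup>2) mod int l = 0" and "0 \<le> x" "0 \<le> y" "2 * x < int l" "2 * y < int l"
  shows "x = y"
proof -
  have "((x - y) * (x + y)) mod int l = 0"
    using assms(2) by (simp add: power2_eq_square algebra_simps)
  then have "(x - y) mod int l = 0 \<or> (x + y) mod int l = 0" by (rule prime_mult_mod_eq_0[OF assms(1)])
  then consider "(x - y) mod int l = 0" | "(x + y) mod int l = 0" by blast
  then show ?thesis
  proof cases
    case 1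
    then have "int l dvd \<bar>x - y\<bar>" by (simp add: mod_eq_0_iff_dvd)
    moreover have "\<bar>x - y\<bar> < int l" using assms(3-6) by linarith
    ultimately show ?thesis using zdvd_not_zless[of "\<bar>x - y\<bar>" "int l"] by auto
  next
    case 2
    then have "int l dvd x + y" by (simp add: mod_eq_0_iff_dvd)
    moreover have "x + y < int l" using assms(3-6) by linarith
    ultimately have "\<not> 0 < x + y" using zdvd_not_zless[of "x + y" "int l"] by auto
    then show ?thesis using assms(3,4) by linarith
  qed
qed

text \<open>The two sides \<open>a x\<^sup>2\<close> and \<open>c - b y\<^sup>2\<close> each take \<open>(l + 1) / 2\<close> values, so they have one in common.\<close>

lemma ex_two_squares:
  fixes a b c :: int
  assumes l: "prime l" "odd l" and a: "a mod int l \<noteq> 0" and b: "b mod int l \<noteq> 0"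
  shows "\<exists>x y. (a * x\<^sup>2 + b * y\<^sup>2) mod int l = c mod int l"
proof -
  define h where "h = (int l - 1) div 2"
  have l2: "int l = 2 * h + 1" using l(2) by (simp add: h_def)
  have h: "0 \<le> h" using l2 by linarith
  let ?H = "{0..h}"
  define f where "f = (\<lambda>x. (a * x\<^sup>2) mod int l)"
  define g where "g = (\<lambda>y. (c - b * y\<^sup>2) mod int l)"
  have inj: "x = y" if "x \<in> ?H" "y \<in> ?H" "d mod int l \<noteq> 0" "(d * (x\<^sup>2 - y\<^sup>2)) mod int l = 0" for d x y
    using prime_mult_mod_eq_0[OF l(1) that(4)] prime_dvd_int_cases[OF l(1), of x y] that l2 by auto
  have "inj_on f ?H"
  proof (rule inj_onI)
    fix x y assume xy: "x \<in> ?H" "y \<in> ?H" "f x = f y"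
    have "(a * x\<^sup>2 - a * y\<^sup>2) mod int l = 0"
      using xy(3) by (simp add: f_def mod_eq_dvd_iff mod_eq_0_iff_dvd)
    then show "x = y" using inj[OF xy(1,2) a] by (simp add: algebra_simps)
  qed
  moreover have "inj_on g ?H"
  proof (rule inj_onI)
    fix x y assume xy: "x \<in> ?H" "y \<in> ?H" "g x = g y"
    have "(b * y\<^sup>2 - b * x\<^sup>2) mod int l = 0"
      using xy(3) by (simp add: g_def mod_eq_dvd_iff mod_eq_0_iff_dvd algebra_simps)
    then show "x = y" using inj[OF xy(2,1) b] by (simp add: algebra_simps)
  qed
  ultimately have cards: "card (f ` ?H) = nat (h + 1)" "card (g ` ?H) = nat (h + 1)"
    by (simp_all add: card_image)
  have sub: "f ` ?H \<union> g ` ?H \<subseteq> {0..<int l}"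
    using prime_gt_0_nat[OF l(1)] by (auto simp: f_def g_def)
  have "f ` ?H \<inter> g ` ?H \<noteq> {}"
  proof
    assume "f ` ?H \<inter> g ` ?H = {}"
    then have "card (f ` ?H \<union> g ` ?H) = 2 * nat (h + 1)" using cards by (simp add: card_Un_disjoint)
    moreover have "card (f ` ?H \<union> g ` ?H) \<le> l" using card_mono[OF _ sub] by simp
    ultimately show False using l2 h by linarith
  qed
  then obtain x y where "f x = g y" by blast
  then have "(a * x\<^sup>2 + b * y\<^sup>2) mod int l = c mod int l"
    by (simp add: f_def g_def mod_eq_dvd_iff algebra_simps)
  then show ?thesis by blast
qed

context quad_space
begin

lemma perp_mem: "u \<in> S \<Longrightarrow> v \<in> perp S \<Longrightarrow> B u v = 0"
  by (simp add: perp_def)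

lemma even_l: "even l \<Longrightarrow> l = 2"
  using prime_l primes_dvd_imp_eq two_is_prime_nat by blast

lemma perp_adj_D:
  assumes "subsp X" "x \<in> carrier V" "y \<in> perp (adj x X)"
  shows "y \<in> perp X" "B x y = 0" "y \<in> carrier V"
  using assms perp_adj perp_carrier by auto

lemma not_tot_sing_adj:
  assumes "subsp X" "x \<in> carrier V" "Q x \<noteq> 0" shows "\<not> tot_sing (adj x X)"
  using assms adj_self by (auto simp: tot_sing_def)

text \<open>The factor \<open>l ^ 2\<close> leaves room for two orthogonal nonsingular vectors in
  \<open>perp W\<close>, and a binary diagonal form represents everything for odd \<open>l\<close>.
  For \<open>l = 2\<close> a single nonsingular vector is enough, since 1 is the only nonzero
  norm.\<close>

lemma perp_represents:
  assumes W: "subsp W" and cd: "card W * card W * l ^ 2 \<le> card (carrier V)" and c: "c \<in> {1..<int l}"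
  shows "\<exists>v\<in>perp W. Q v = c"
proof -
  have l1: "l > 1" using prime_gt_1_nat[OF prime_l] .
  have pW: "subsp (perp W)" using W subsp_perp subsp_subset by blast
  have "card W * card W < card W * card W * l ^ 2" using card_subsp_pos[OF W] one_less_power[OF l1, of 2] by simp
  then have "card W * card W < card (carrier V)" using cd by linarith
  then obtain a where a: "a \<in> perp W" "Q a \<noteq> 0" using ex_nonsingular_perp[OF W] by auto
  have aV: "a \<in> carrier V" using a perp_carrier by blast
  show ?thesis
  proof (cases "even l")
    case True
    then have "l = 2" by (rule even_l)
    then have "Q a = c" using Q_range[OF aV] a c by auto
    then show ?thesis using a by blast
  next
    case False
    have "card (adj a W) * card (adj a W) \<le> (l * card W) * (l * card W)"
      using card_adj_le[OF W aV] by (rule mult_le_mono) (rule card_adj_le[OF W aV])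
    also have "\<dots> \<le> card (carrier V)" using cd by (simp add: power2_eq_square mult_ac)
    finally obtain b where b: "b \<in> perp (adj a W)" "Q b \<noteq> 0"
      using ex_nonsingular_perp[OF subsp_adj[OF W aV]] not_tot_sing_adj[OF W aV a(2)] by auto
    note b' = perp_adj_D[OF W aV b(1)]
    obtain x y where xy: "(Q a * x\<^sup>2 + Q b * y\<^sup>2) mod int l = c mod int l"
      using ex_two_squares[OF prime_l False, of "Q a" "Q b" c] a(2) b(2) aV b'(3) by auto
    have "x \<star> a \<oplus> y \<star> b \<in> perp W" using a(1) b'(1) pW by (intro subsp_add subsp_sc)
    moreover have "Q (x \<star> a \<oplus> y \<star> b) = (Q a * x\<^sup>2 + Q b * y\<^sup>2) mod int l"
      using aV b' by (simp add: B_simps mod_simps mult_ac)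
    ultimately show ?thesis using xy c by (intro bexI[of _ "x \<star> a \<oplus> y \<star> b"]) auto
  qed
qed

lemma tot_sing_adj:
  assumes E: "subsp E" "tot_sing E" and e: "e \<in> perp E" "Q e = 0"
  shows "tot_sing (adj e E)"
  unfolding tot_sing_def
proof
  fix z assume "z \<in> adj e E"
  then obtain a y where z: "z = a \<star> e \<oplus> y" "y \<in> E" by (rule adjE)
  have eV: "e \<in> carrier V" "y \<in> carrier V" using e perp_carrier E z subsp_carrier by auto
  have "B e y = 0" "Q y = 0" using z e E eV by (auto simp: perp_def tot_sing_def B_sym[of e y])
  then show "Q z = 0" using z eV e by (simp add: B_simps)
qed

text \<open>The factor \<open>l ^ 4\<close> leaves room for three pairwise orthogonal nonsingular
  vectors \<open>a\<close>, \<open>b\<close>, \<open>c\<close> in \<open>perp E\<close>. For odd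
  \<open>l\<close> the norms of the combinations of \<open>a\<close> and \<open>b\<close> include
  \<open>- Q c\<close>. For \<open>l = 2\<close> two orthogonal vectors of norm 1 already have a
  singular sum.\<close>

lemma ex_singular_extension:
  assumes E: "subsp E" "tot_sing E" and cd: "card E * card E * l ^ 4 \<le> card (carrier V)"
  shows "\<exists>e\<in>perp E. e \<notin> E \<and> Q e = 0"
proof -
  have l1: "l > 1" using prime_gt_1_nat[OF prime_l] .
  have pE: "subsp (perp E)" using E subsp_perp subsp_subset by blast
  have "card E * card E < card E * card E * l ^ 4" using card_subsp_pos[OF E(1)] one_less_power[OF l1, of 4] by simp
  then have "card E * card E < card (carrier V)" using cd by linarith
  then obtain a where a: "a \<in> perp E" "Q a \<noteq> 0" using ex_nonsingular_perp[OF E(1)] by auto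
  have aV: "a \<in> carrier V" using a perp_carrier by blast
  define X where "X = adj a E"
  have X: "subsp X" unfolding X_def using E aV subsp_adj by blast
  have cX: "card X \<le> l * card E" unfolding X_def using card_adj_le[OF E(1) aV] .
  have nX: "\<not> tot_sing X" unfolding X_def using not_tot_sing_adj[OF E(1) aV a(2)] .
  have EX: "E \<subseteq> X" "a \<in> X" unfolding X_def using adj_upper adj_self E aV by auto
  have "card X * card X \<le> (l * card E) * (l * card E)" using cX by (rule mult_le_mono) (rule cX)
  also have "\<dots> < (l * card E) * (l * card E) * l\<^sup>2"
    using card_subsp_pos[OF E(1)] l1 one_less_power[OF l1, of 2] by simp
  also have "\<dots> = card E * card E * l ^ 4" by (simp add: power2_eq_square power4_eq_xxxx)
  finally have XX: "card X * card X < card (carrier V)" using cd by linarith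
  show ?thesis
  proof (cases "even l")
    case True
    then have l2: "l = 2" by (rule even_l)
    have "card X * card X < card X * card (perp X)" using XX card_perp[OF X] by simp
    then have "card X < card (perp X)" by simp
    then have "\<not> perp X \<subseteq> X" using card_mono[OF finite_subsp[OF X], of "perp X"] by linarith
    then obtain b where b: "b \<in> perp X" "b \<notin> X" by blast
    have b': "b \<in> perp E" "B a b = 0" "b \<in> carrier V"
      using b perp_adj_D[OF E(1) aV] by (auto simp: X_def)
    show ?thesis
    proof (cases "Q b = 0")
      case True then show ?thesis using b b' EX by blast
    next
      case False
      have q: "Q a = 1" "Q b = 1" using False a(2) Q_range[OF aV] Q_range[OF b'(3)] l2 by auto
      have "Q (a \<oplus> b) = 0" using aV b' q l2 by (simp add: Q_add)
      moreover have "a \<oplus> b \<notin> E"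
      proof
        assume "a \<oplus> b \<in> E"
        then have "(-1) \<star> a \<oplus> (a \<oplus> b) \<in> X" unfolding X_def by (rule adjI)
        then show False using b aV b' by simp
      qed
      ultimately show ?thesis using a(1) b'(1) pE subsp_add by blast
    qed
  next
    case False
    obtain b where b: "b \<in> perp X" "Q b \<noteq> 0" using ex_nonsingular_perp[OF X] XX nX by auto
    have b': "b \<in> perp E" "B a b = 0" "b \<in> carrier V"
      using b perp_adj_D[OF E(1) aV] by (auto simp: X_def)
    have Y: "subsp (adj b X)" using X b' subsp_adj by blast
    have "card (adj b X) \<le> l * (l * card E)"
      using card_adj_le[OF X b'(3)] mult_le_mono2[OF cX, of l] by (rule le_trans)
    then have "card (adj b X) * card (adj b X) \<le> (l * (l * card E)) * (l * (l * card E))"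
      by (rule mult_le_mono) fact
    also have "\<dots> = card E * card E * l ^ 4" by (simp add: power4_eq_xxxx)
    finally have "card (adj b X) * card (adj b X) \<le> card (carrier V)" using cd by linarith
    then obtain c where c: "c \<in> perp (adj b X)" "Q c \<noteq> 0"
      using ex_nonsingular_perp[OF Y] not_tot_sing_adj[OF X b'(3) b(2)] by auto
    have c1: "c \<in> perp X" "B b c = 0" "c \<in> carrier V" using perp_adj_D[OF X b'(3) c(1)] .
    have c2: "c \<in> perp E" "B a c = 0" using perp_adj_D[OF E(1) aV] c1(1) by (auto simp: X_def)
    obtain x y where xy: "(Q a * x\<^sup>2 + Q b * y\<^sup>2) mod int l = (- Q c) mod int l"
      using ex_two_squares[OF prime_l False, of "Q a" "Q b" "- Q c"] a(2) b(2) aV b'(3) by auto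
    define v where "v = x \<star> a \<oplus> y \<star> b \<oplus> c"
    have "v \<in> perp E" unfolding v_def using a(1) b'(1) c2(1) pE by (intro subsp_add subsp_sc)
    moreover have "Q v = ((Q a * x\<^sup>2 + Q b * y\<^sup>2) mod int l + Q c) mod int l"
      using aV b' c1 c2 by (simp add: v_def B_simps)
        (rule mod_strip, (rule cong_strip)+, simp add: algebra_simps)
    then have "Q v = 0" unfolding xy by (simp add: mod_add_left_eq)
    \<comment> \<open>The vector \<open>c\<close> is orthogonal to \<open>E\<close>, whereas
      \<open>B v c = 2 * Q c\<close> is not 0 in odd characteristic.\<close>
    moreover have "v \<notin> E"
    proof
      assume "v \<in> E"
      then have "B v c = 0" using c2(1) by (rule perp_mem)
      moreover have "B v c = (2 * Q c) mod int l"
        using aV b' c1 c2 by (simp add: v_def B_simps)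
      ultimately have "2 mod int l = 0"
        using prime_mult_mod_eq_0[OF prime_l, of 2 "Q c"] c(2) c1(3) by simp
      then have "int l dvd int 2" by (simp add: mod_eq_0_iff_dvd)
      then have "l dvd 2" using int_dvd_int_iff by blast
      then have "l = 2" using primes_dvd_imp_eq[OF prime_l two_is_prime_nat] by blast
      then show False using False by simp
    qed
    ultimately show ?thesis by blast
  qed
qed

text \<open>Passing from dimension \<open>k\<close> to \<open>k + 1\<close> requires rank
  \<open>2 * k + 4\<close>, and \<open>k + 1 \<le> m\<close>; this is where the bound
  \<open>2 * m + 2\<close> enters.\<close>

lemma ex_tot_sing:
  assumes "l ^ (2 * m + 2) \<le> card (carrier V)"
  shows "\<exists>E. subsp E \<and> tot_sing E \<and> card E = l ^ m"
proof -
  have "\<exists>E. subsp E \<and> tot_sing E \<and> card E = l ^ k" if "k \<le> m" for k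
    using that
  proof (induction k)
    case 0
    show ?case by (rule exI[of _ "{\<zero>}"]) (simp add: tot_sing_def)
  next
    case (Suc k)
    then have "k \<le> m" by simp
    from Suc.IH[OF this] obtain E where E: "subsp E" "tot_sing E" "card E = l ^ k" by blast
    have "card E * card E * l ^ 4 = l ^ (k + k + 4)" by (simp only: E(3) power_add)
    also have "\<dots> \<le> l ^ (2 * m + 2)"
      using Suc.prems prime_gt_0_nat[OF prime_l] by (intro power_increasing) auto
    finally have "card E * card E * l ^ 4 \<le> card (carrier V)" using assms by linarith
    from ex_singular_extension[OF E(1,2) this]
    obtain e where e: "e \<in> perp E" "e \<notin> E" "Q e = 0" by blast
    have eV: "e \<in> carrier V" using e perp_carrier by blast
    show ?case
      using tot_sing_adj[OF E(1,2) e(1,3)] card_adj[OF E(1) eV e(2)] subsp_adj[OF E(1) eV] E(3)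
      by (intro exI[of _ "adj e E"]) simp
  qed
  then show ?thesis by blast
qed

text \<open>Duality gives \<open>|E \<inter> perp W| |W| = |E| |perp E \<inter> W|\<close>. If
  \<open>E \<inter> perp W\<close> were contained in \<open>W\<close>, it would be contained in
  \<open>perp E \<inter> W\<close>, and \<open>|E| \<le> |W|\<close> would follow. So some singular
  \<open>e\<close> in \<open>perp W\<close> lies outside \<open>W\<close>, and such a vector has a
  dual vector in \<open>perp W\<close>, which is made singular by a multiple of
  \<open>e\<close>.\<close>

lemma ex_hyperbolic_pair:
  assumes W: "subsp W" and E: "subsp E" "tot_sing E" and cd: "card W < card E"
  shows "\<exists>e\<in>perp W. \<exists>f\<in>perp W. Q e = 0 \<and> Q f = 0 \<and> B e f = 1"
proof -
  have pE: "subsp (perp E)" and pW: "subsp (perp W)" using E W subsp_perp subsp_subset by blast+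
  define k where "k = card (perp E \<inter> W)"
  have k: "k > 0" unfolding k_def using card_subsp_pos subsp_Int pE W by blast
  have eq: "card (E \<inter> perp W) * card W = card E * k"
  proof -
    have "E \<inter> perp W = perp (splus (perp E) W)" using perp_splus[OF pE W] perp_perp[OF E(1)] by simp
    then have 1: "card (splus (perp E) W) * card (E \<inter> perp W) = card E * card (perp E)"
      using card_perp[OF subsp_splus[OF pE W]] card_perp[OF E(1)] by simp
    have 2: "card (splus (perp E) W) * k = card (perp E) * card W"
      using card_splus[OF pE W] by (simp add: k_def)
    have "card (perp E) * (card (E \<inter> perp W) * card W) = card (E \<inter> perp W) * (card (perp E) * card W)"
      by (simp only: mult_ac)
    also have "\<dots> = (card (splus (perp E) W) * card (E \<inter> perp W)) * k"
      unfolding 2[symmetric] by (simp only: mult_ac)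
    also have "\<dots> = card (perp E) * (card E * k)" unfolding 1 by (simp only: mult_ac)
    finally have "card (perp E) * (card (E \<inter> perp W) * card W) = card (perp E) * (card E * k)" .
    then show ?thesis using card_subsp_pos[OF pE] by simp
  qed
  have "\<not> E \<inter> perp W \<subseteq> W"
  proof
    assume "E \<inter> perp W \<subseteq> W"
    then have "E \<inter> perp W \<subseteq> perp E \<inter> W" using tot_sing_subset_perp[OF E] by blast
    then have "card (E \<inter> perp W) \<le> k" unfolding k_def
      using finite_subsp[OF W] by (intro card_mono) auto
    then have "card E * k \<le> k * card W" unfolding eq[symmetric] by (rule mult_le_mono1)
    then show False using k cd by simp
  qed
  then obtain e where e: "e \<in> E" "e \<in> perp W" "e \<notin> W" by blast
  have eV: "e \<in> carrier V" and Qe: "Q e = 0" using e E subsp_carrier by (auto simp: tot_sing_def)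
  obtain f0 where f0: "f0 \<in> perp W" "B e f0 = 1" using ex_perp_not_orth[OF W eV e(3)] by blast
  have f0V: "f0 \<in> carrier V" using f0 perp_carrier by blast
  define f where "f = f0 \<oplus> (- Q f0) \<star> e"
  have "f \<in> perp W" unfolding f_def using f0 e pW by (intro subsp_add subsp_sc)
  moreover have "Q f = 0" using f0V eV f0 Qe by (simp add: f_def B_simps mod_simps B_sym[of f0 e])
  moreover have "B e f = 1" using f0V eV f0 Qe by (simp add: f_def B_simps mod_simps)
  ultimately show ?thesis using e Qe by blast
qed

text \<open>The type of \<open>v\<close> consists of its norm and its products with
  \<open>W\<close>. Adding a combination of a hyperbolic pair orthogonal to \<open>W\<close> changes
  the norm arbitrarily and leaves the products alone, so all \<open>l\<close> norms occur with all
  functionals \<open>B v\<close> on \<open>W\<close>. There are \<open>|W|\<close> of these, because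
  \<open>v\<close> matters only modulo \<open>perp W\<close>.\<close>

lemma card_extension_types:
  assumes W: "subsp W" and E: "subsp E" "tot_sing E" and cd: "card W < card E"
  shows "card ((\<lambda>v. (Q v, restrict (B v) W)) ` (carrier V - W)) = l * card W"
proof -
  obtain e f where ef: "e \<in> perp W" "f \<in> perp W" "Q e = 0" "Q f = 0" "B e f = 1"
    using ex_hyperbolic_pair[OF assms] by blast
  have V: "e \<in> carrier V" "f \<in> carrier V" using ef perp_carrier by auto
  have fe: "B f e = 1" using ef V B_sym by simp
  have WV: "u \<in> carrier V" if "u \<in> W" for u using that W subsp_carrier by blast
  have "(\<lambda>v. (Q v, restrict (B v) W)) ` (carrier V - W) = {0..<int l} \<times> (\<lambda>v. restrict (B v) W) ` carrier V"
  proof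
    show "(\<lambda>v. (Q v, restrict (B v) W)) ` (carrier V - W) \<subseteq> {0..<int l} \<times> (\<lambda>v. restrict (B v) W) ` carrier V"
    proof
      fix p assume "p \<in> (\<lambda>v. (Q v, restrict (B v) W)) ` (carrier V - W)"
      then obtain v where v: "p = (Q v, restrict (B v) W)" "v \<in> carrier V" by auto
      then show "p \<in> {0..<int l} \<times> (\<lambda>v. restrict (B v) W) ` carrier V" using Q_range[OF v(2)] by simp
    qed
    show "{0..<int l} \<times> (\<lambda>v. restrict (B v) W) ` carrier V \<subseteq> (\<lambda>v. (Q v, restrict (B v) W)) ` (carrier V - W)"
    proof
      fix p assume "p \<in> {0..<int l} \<times> (\<lambda>v. restrict (B v) W) ` carrier V"
      then obtain c v0 where p: "p = (c, restrict (B v0) W)" "c \<in> {0..<int l}" "v0 \<in> carrier V" by blast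
      \<comment> \<open>The coefficient \<open>b\<close> of \<open>f\<close> makes
        \<open>B v e = 1\<close>, which keeps \<open>v\<close> outside \<open>W\<close>. The norm of
        \<open>v\<close> then depends on \<open>a\<close> with coefficient
        \<open>B v0 e + b = 1\<close>, so \<open>a\<close> can be solved for.\<close>
      define b where "b = 1 - B v0 e"
      define a where "a = c - Q v0 - b * B v0 f"
      define v where "v = v0 \<oplus> a \<star> e \<oplus> b \<star> f"
      have vV: "v \<in> carrier V" using p V by (simp add: v_def)
      have "Q v = (Q v0 + a * B v0 e + (b * B v0 f + a * b)) mod int l"
        using p V ef
        apply (simp add: v_def B_simps)
        apply (rule mod_strip)
        apply ((rule cong_strip)+)[2]
        apply (simp add: algebra_simps)
        done
      also have "Q v0 + a * B v0 e + (b * B v0 f + a * b) = c"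
        unfolding a_def b_def by (simp add: algebra_simps)
      finally have "Q v = c" using p by simp
      moreover have "B v u = B v0 u" if "u \<in> W" for u
      proof -
        have "B e u = 0" "B f u = 0"
          using perp_mem[OF that ef(1)] perp_mem[OF that ef(2)]
            B_sym[OF V(1) WV[OF that]] B_sym[OF V(2) WV[OF that]] by simp_all
        then show ?thesis using p V WV[OF that] by (simp add: v_def B_simps)
      qed
      then have "restrict (B v) W = restrict (B v0) W" by (rule restrict_ext)
      moreover have "v \<notin> W"
      proof
        assume "v \<in> W"
        then have "B v e = 0" using ef perp_mem by blast
        moreover have "B v e = (B v0 e + b) mod int l" using p V ef fe by (simp add: v_def B_simps mod_simps)
        ultimately show False by (simp add: b_def)
      qed
      ultimately show "p \<in> (\<lambda>v. (Q v, restrict (B v) W)) ` (carrier V - W)"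
        using p(1) vV by (intro image_eqI[of _ _ v]) simp_all
    qed
  qed
  moreover have "card ((\<lambda>v. restrict (B v) W) ` carrier V) = card W"
  proof -
    have "restrict (B x) W = restrict (B y) W \<longleftrightarrow> x \<oplus> (-1) \<star> y \<in> perp W"
      if xy: "x \<in> carrier V" "y \<in> carrier V" for x y
    proof -
      have "B x u = B y u \<longleftrightarrow> B u (x \<oplus> (-1) \<star> y) = 0" if u: "u \<in> W" for u
      proof -
        have "B u (x \<oplus> (-1) \<star> y) = (B x u - B y u) mod int l"
          using xy WV[OF u] by (simp add: B_simps mod_simps B_sym[of u])
        moreover have "(B x u - B y u) mod int l = 0 \<longleftrightarrow> B x u mod int l = B y u mod int l"
          using mod_eq_dvd_iff[of "B x u" "int l" "B y u"] by (simp add: mod_eq_0_iff_dvd)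
        ultimately show ?thesis by simp
      qed
      then have perp: "x \<oplus> (-1) \<star> y \<in> perp W \<longleftrightarrow> (\<forall>u\<in>W. B x u = B y u)"
        using xy by (simp add: perp_def)
      show ?thesis unfolding perp
      proof
        assume eq: "restrict (B x) W = restrict (B y) W"
        have "B x u = B y u" if "u \<in> W" for u using fun_cong[OF eq, of u] that by simp
        then show "\<forall>u\<in>W. B x u = B y u" by blast
      next
        assume "\<forall>u\<in>W. B x u = B y u"
        then show "restrict (B x) W = restrict (B y) W" by (intro restrict_ext) blast
      qed
    qed
    from card_subsp_fibres[OF subsp_carrier_V finite_V _ _ this]
    have "card (carrier V) = card ((\<lambda>v. restrict (B v) W) ` carrier V) * card (perp W)"
      using subsp_perp[OF subsp_subset[OF W]] by (simp add: subsp_subset)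
    then have "card W * card (perp W) = card ((\<lambda>v. restrict (B v) W) ` carrier V) * card (perp W)"
      using card_perp[OF W] by simp
    moreover have "card (perp W) > 0" using card_subsp_pos[OF subsp_perp[OF subsp_subset[OF W]]] .
    ultimately show ?thesis by simp
  qed
  ultimately show ?thesis by (simp add: card_cartesian_product)
qed

end

subsection \<open>Tuples\<close>

lemma tuplesD: "x \<in> tuples k V \<Longrightarrow> i < k \<Longrightarrow> x i \<in> carrier V"
  by (auto simp: tuples_def)

context fin_space
begin

primrec tspan :: "nat \<Rightarrow> (nat \<Rightarrow> 'v) \<Rightarrow> 'v set" where
  "tspan 0 x = {\<zero>}"
| "tspan (Suc k) x = adj (x k) (tspan k x)"

lemma subsp_tspan: "(\<And>i. i < k \<Longrightarrow> x i \<in> carrier V) \<Longrightarrow> subsp (tspan k x)"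
  by (induction k) (simp_all add: subsp_adj)

lemma tspan_cong: "(\<And>i. i < k \<Longrightarrow> x i = y i) \<Longrightarrow> tspan k x = tspan k y"
  by (induction k) simp_all

lemma card_tspan_le: "(\<And>i. i < k \<Longrightarrow> x i \<in> carrier V) \<Longrightarrow> card (tspan k x) \<le> l ^ k"
proof (induction k)
  case (Suc k)
  then have x: "\<And>i. i < k \<Longrightarrow> x i \<in> carrier V" "x k \<in> carrier V" by simp_all
  have "card (tspan (Suc k) x) \<le> l * card (tspan k x)" using card_adj_le[OF subsp_tspan] x by simp
  also have "\<dots> \<le> l * l ^ k" using Suc.IH x by simp
  finally show ?case by simp
qed simp

lemma tspan_mem: "(\<And>i. i < k \<Longrightarrow> x i \<in> carrier V) \<Longrightarrow> i < k \<Longrightarrow> x i \<in> tspan k x"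
proof (induction k)
  case (Suc k)
  then have x: "\<And>i. i < k \<Longrightarrow> x i \<in> carrier V" "x k \<in> carrier V" by simp_all
  show ?case
  proof (cases "i = k")
    case True
    then show ?thesis using adj_self[OF subsp_tspan] x by simp
  next
    case False
    then have "x i \<in> tspan k x" using Suc x by simp
    then show ?thesis using adj_upper[OF subsp_tspan, of k x "x k"] x by auto
  qed
qed simp

lemma tspan_least: "subsp X \<Longrightarrow> (\<And>i. i < k \<Longrightarrow> x i \<in> X) \<Longrightarrow> tspan k x \<subseteq> X"
  by (induction k) (simp_all add: adj_least subsp_zero)

text \<open>Existence of a basis, phrased for the first \<open>k\<close> entries of a sequence;
  independence is expressed by the size of the span.\<close>

lemma ex_tspan:
  assumes "subsp X" shows "\<exists>k x. (\<forall>i<k. x i \<in> carrier V) \<and> tspan k x = X \<and> card X = l ^ k"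
  using assms
proof (induction rule: subsp_induct)
  case trivial
  show ?case by (intro exI[of _ 0]) simp
next
  case (adj Y y)
  then obtain k x where kx: "\<forall>i<k. x i \<in> carrier V" "tspan k x = Y" "card Y = l ^ k" by blast
  have yV: "y \<in> carrier V" using subsp_carrier[OF assms adj(3)] .
  have "tspan k (x(k := y)) = tspan k x" by (rule tspan_cong) simp
  then have "tspan (Suc k) (x(k := y)) = adj y Y" using kx by simp
  moreover have "\<forall>i<Suc k. (x(k := y)) i \<in> carrier V" using kx yV by simp
  moreover have "card (adj y Y) = l ^ Suc k" using card_adj[OF adj(1) yV adj(4)] kx by simp
  ultimately show ?case by blast
qed

end

lemma ex_transversal: "\<exists>C. C \<subseteq> A \<and> inj_on f C \<and> f ` C = f ` A"
  by (metis subset_image_inj order_refl)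

lemma diag_act_apply: "i < k \<Longrightarrow> diag_act k g x i = g (x i)"
  by (simp add: diag_act_def)

lemma diag_act_eq_iff:
  "y \<in> tuples k V \<Longrightarrow> diag_act k g x = y \<longleftrightarrow> (\<forall>i<k. g (x i) = y i)"
  by (fastforce simp: diag_act_def tuples_def fun_eq_iff PiE_def extensional_def)

section \<open>Representatives of the orbits of the orthogonal group\<close>

context quad_space
begin

lemma diag_act_tuples: "g \<in> Og \<Longrightarrow> x \<in> tuples k V \<Longrightarrow> diag_act k g x \<in> tuples k V"
  using orth_closed[of g] by (auto simp: diag_act_def tuples_def)

lemma fix_tspan:
  assumes g: "g \<in> Og" and x: "\<And>i. i < k \<Longrightarrow> x i \<in> carrier V" "\<And>i. i < k \<Longrightarrow> g (x i) = x i"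
  shows "u \<in> tspan k x \<Longrightarrow> g u = u"
proof -
  have "subsp {u \<in> carrier V. g u = u}"
    using orth_sc[OF g, of \<zero> 0] orth_closed[OF g, of \<zero>]
    by (intro subspI) (simp_all add: orth_add[OF g] orth_sc[OF g])
  then have "tspan k x \<subseteq> {u \<in> carrier V. g u = u}" using x by (intro tspan_least) simp_all
  then show "u \<in> tspan k x \<Longrightarrow> g u = u" by blast
qed

lemma orbit_eqI:
  assumes x: "x \<in> tuples k V" and g: "g \<in> Og"
  shows "orbit (orth l V Q) (diag_act k) (diag_act k g x) = orbit (orth l V Q) (diag_act k) x"
proof -
  have comp: "diag_act k h (diag_act k h' x) = diag_act k (compose (carrier V) h h') x"
    if "h \<in> Og" "h' \<in> Og" for h h'
    using tuplesD[OF x] by (auto simp: diag_act_def compose_apply)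
  obtain g' where g': "g' \<in> Og" "\<forall>y\<in>carrier V. g' (g y) = y" using orth_inverse[OF g] by blast
  show ?thesis
  proof
    show "orbit (orth l V Q) (diag_act k) (diag_act k g x) \<subseteq> orbit (orth l V Q) (diag_act k) x"
    proof
      fix y assume "y \<in> orbit (orth l V Q) (diag_act k) (diag_act k g x)"
      then obtain h where h: "h \<in> Og" "y = diag_act k h (diag_act k g x)" by (auto simp: orbit_def)
      then have "y = diag_act k (compose (carrier V) h g) x" using comp g by simp
      then show "y \<in> orbit (orth l V Q) (diag_act k) x"
        using compose_orth[OF h(1) g] by (auto simp: orbit_def)
    qed
    show "orbit (orth l V Q) (diag_act k) x \<subseteq> orbit (orth l V Q) (diag_act k) (diag_act k g x)"
    proof
      fix y assume "y \<in> orbit (orth l V Q) (diag_act k) x"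
      then obtain h where h: "h \<in> Og" "y = diag_act k h x" by (auto simp: orbit_def)
      have "diag_act k (compose (carrier V) h g') (diag_act k g x) = y"
        using tuplesD[OF x] g' h(2) orth_closed[OF g] by (auto simp: diag_act_def compose_apply)
      then show "y \<in> orbit (orth l V Q) (diag_act k) (diag_act k g x)"
        using compose_orth[OF h(1) g'(1)] by (auto simp: orbit_def)
    qed
  qed
qed

text \<open>
  The powers of the size of the span are what makes the induction on the length of the tuples
  close up: a tuple with span \<open>W\<close> extends in \<open>card W\<close> ways inside \<open>W\<close> and in \<open>l * card W\<close> ways
  outside \<open>W\<close>, up to the stabilizer.
\<close>

lemma ex_orbit_representatives:
  assumes E: "subsp E" "tot_sing E" "card E = l ^ m" and "k \<le> m"
  shows "\<exists>R. finite R \<and> R \<subseteq> tuples k V \<and>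
     (\<forall>y\<in>tuples k V. \<exists>x\<in>R. \<exists>g\<in>Og. diag_act k g x = y) \<and>
     (\<forall>x\<in>R. \<forall>x'\<in>R. \<forall>g\<in>Og. diag_act k g x = x' \<longrightarrow> x = x') \<and>
     (\<forall>j. (\<Sum>x\<in>R. card (tspan k x) ^ j) = (\<Prod>i=1..k. 1 + l ^ (i + j)))"
  using assms(4)
proof (induction k)
  case 0
  have T: "tuples 0 V = {\<lambda>_. undefined}" by (simp add: tuples_def)
  have "diag_act 0 (\<lambda>x\<in>carrier V. x) (\<lambda>_. undefined) = (\<lambda>_. undefined)" by (simp add: diag_act_def)
  then show ?case using id_orth by (intro exI[of _ "{\<lambda>_. undefined}"]) (auto simp: T)
next
  case (Suc k)
  then have "k \<le> m" by simp
  from Suc.IH[OF this] obtain R where R: "finite R" "R \<subseteq> tuples k V"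
    and cov: "\<forall>y\<in>tuples k V. \<exists>x\<in>R. \<exists>g\<in>Og. diag_act k g x = y"
    and uniq: "\<forall>x\<in>R. \<forall>x'\<in>R. \<forall>g\<in>Og. diag_act k g x = x' \<longrightarrow> x = x'"
    and sum: "\<forall>j. (\<Sum>x\<in>R. card (tspan k x) ^ j) = (\<Prod>i=1..k. 1 + l ^ (i + j))"
    by (elim exE conjE) (rule that)
  define W where "W = tspan k"
  define key where "key = (\<lambda>x v. (Q v, restrict (B v) (W x)))"
  have xV: "x i \<in> carrier V" if "x \<in> R" "i < k" for x i using tuplesD R that by blast
  have W: "subsp (W x)" if "x \<in> R" for x unfolding W_def using xV[OF that] by (rule subsp_tspan)
  have cW: "card (W x) < card E" if "x \<in> R" for x
  proof -
    have "card (W x) \<le> l ^ k" unfolding W_def using xV[OF that] by (rule card_tspan_le)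
    also have "\<dots> < l ^ m" using Suc.prems prime_gt_1_nat[OF prime_l] by (intro power_strict_increasing) auto
    finally show ?thesis using E by simp
  qed
  define transversal where "transversal = (\<lambda>x C. C \<subseteq> carrier V - W x \<and> inj_on (key x) C \<and>
    key x ` C = key x ` (carrier V - W x))"
  define C where "C = (\<lambda>x. SOME C. transversal x C)"
  have "transversal x (C x)" for x
  proof -
    have "\<exists>C. transversal x C" unfolding transversal_def by (rule ex_transversal)
    then show ?thesis unfolding C_def by (rule someI_ex)
  qed
  then have C: "C x \<subseteq> carrier V - W x" "inj_on (key x) (C x)"
      "key x ` C x = key x ` (carrier V - W x)" for x by (simp_all add: transversal_def)
  have finC: "finite (C x)" for x using C(1)[of x] finite_V finite_subset by blast
  have cC: "card (C x) = l * card (W x)" if "x \<in> R" for x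
  proof -
    have "card (C x) = card (key x ` C x)" by (simp add: card_image[OF C(2)])
    also have "\<dots> = l * card (W x)"
      unfolding C(3) unfolding key_def by (rule card_extension_types[OF W[OF that] E(1,2) cW[OF that]])
    finally show ?thesis .
  qed
  \<comment> \<open>Vectors of \<open>W x\<close> are fixed by the stabilizer of \<open>x\<close>,
    so each of them is an extension of its own. Outside \<open>W x\<close> one vector per type
    suffices, by \<open>witt_step\<close>.\<close>
  define A where "A = (\<lambda>x. W x \<union> C x)"
  define R' where "R' = (\<lambda>(x, v). x(k := v)) ` Sigma R A"
  have AV: "v \<in> carrier V" if "x \<in> R" "v \<in> A x" for x v
    using that C(1)[of x] W[OF that(1)] subsp_carrier by (auto simp: A_def)
  have finA: "finite (A x)" if "x \<in> R" for x using finC finite_subsp[OF W[OF that]] by (simp add: A_def)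
  have R'T: "R' \<subseteq> tuples (Suc k) V"
  proof
    fix y assume "y \<in> R'"
    then obtain x v where y: "y = x(k := v)" "x \<in> R" "v \<in> A x" by (auto simp: R'_def)
    have "x \<in> {..<k} \<rightarrow>\<^sub>E carrier V" using R y by (auto simp: tuples_def)
    then have "x(k := v) \<in> insert k {..<k} \<rightarrow>\<^sub>E carrier V"
      using AV[OF y(2,3)] by (intro PiE_fun_upd)
    then show "y \<in> tuples (Suc k) V" using y by (simp add: tuples_def lessThan_Suc)
  qed
  have und: "x k = undefined" if "x \<in> R" for x using R that by (auto simp: tuples_def PiE_def extensional_def)
  have inj: "inj_on (\<lambda>(x, v). x(k := v)) (Sigma R A)"
  proof (rule inj_onI, clarify)
    fix x v x' v' assume xx: "x \<in> R" "x' \<in> R" and eq: "x(k := v) = x'(k := v')"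
    have "v = v'" using fun_cong[OF eq, of k] by simp
    moreover have "x i = x' i" for i
      using fun_cong[OF eq, of i] und[OF xx(1)] und[OF xx(2)] by (cases "i = k") auto
    ultimately show "x = x' \<and> v = v'" by auto
  qed
  have fixW: "g u = u" if "x \<in> R" "g \<in> Og" "\<forall>i<k. g (x i) = x i" "u \<in> W x" for g x u
    by (rule fix_tspan[OF that(2), of k x]) (use that(3,4) xV[OF that(1)] in \<open>simp_all add: W_def\<close>)
  have cov': "\<exists>x\<in>R'. \<exists>g\<in>Og. diag_act (Suc k) g x = y" if y: "y \<in> tuples (Suc k) V" for y
  proof -
    have yV: "y i \<in> carrier V" if "i < Suc k" for i using tuplesD[OF y that] .
    have y0: "restrict y {..<k} \<in> tuples k V" using yV by (auto simp: tuples_def)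
    from bspec[OF cov y0] obtain x g where xg: "x \<in> R" "g \<in> Og" "diag_act k g x = restrict y {..<k}" by blast
    have gx: "g (x i) = y i" if "i < k" for i
      using diag_act_apply[OF that, of g x] fun_cong[OF xg(3), of i] that by simp
    obtain g' where g': "g' \<in> Og" "\<forall>z\<in>carrier V. g (g' z) = z" using orth_inverse[OF xg(2)] by blast
    \<comment> \<open>The last entry is pulled back along \<open>g\<close>, so that it is compared
      with the extensions of the representative \<open>x\<close> and not with those of the prefix of
      \<open>y\<close>.\<close>
    define v' where "v' = g' (y k)"
    have v'V: "v' \<in> carrier V" and gv': "g v' = y k"
      using orth_closed[OF g'(1)] yV g'(2) by (simp_all add: v'_def)
    have "\<exists>v\<in>A x. \<exists>h\<in>Og. (\<forall>u\<in>W x. h u = u) \<and> h v = v'"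
    proof (cases "v' \<in> W x")
      case True
      then show ?thesis using id_orth W[OF xg(1)] subsp_carrier v'V
        by (intro bexI[of _ v'] bexI[of _ "\<lambda>x\<in>carrier V. x"]) (auto simp: A_def)
    next
      case False
      then have "key x v' \<in> key x ` C x" unfolding C(3) using v'V by blast
      then obtain v where v: "v \<in> C x" "key x v' = key x v" by blast
      have vV: "v \<in> carrier V" "v \<notin> W x" using v C(1)[of x] by auto
      have Qv: "Q v = Q v'" and rs: "restrict (B v) (W x) = restrict (B v') (W x)"
        using v(2) by (simp_all add: key_def)
      have Bv: "B v u = B v' u" if "u \<in> W x" for u using fun_cong[OF rs, of u] that by simp
      from witt_step[OF W[OF xg(1)] vV v'V False Qv Bv]
      obtain h where "h \<in> Og" "\<forall>u\<in>W x. h u = u" "h v = v'" by blast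
      then show ?thesis using v by (auto simp: A_def)
    qed
    then obtain v h where vh: "v \<in> A x" "h \<in> Og" "\<And>u. u \<in> W x \<Longrightarrow> h u = u" "h v = v'" by blast
    have "x i \<in> W x" if "i < k" for i unfolding W_def by (rule tspan_mem[OF _ that]) (rule xV[OF xg(1)])
    then have hx: "h (x i) = x i" if "i < k" for i using that vh(3) by blast
    have "diag_act (Suc k) (compose (carrier V) g h) (x(k := v)) = y"
      unfolding diag_act_eq_iff[OF y]
    proof (intro allI impI)
      fix i assume i: "i < Suc k"
      show "compose (carrier V) g h ((x(k := v)) i) = y i"
        using i hx gx gv' vh AV[OF xg(1) vh(1)] xV[OF xg(1)]
        by (cases "i = k") (simp_all add: compose_apply)
    qed
    moreover have "x(k := v) \<in> R'" unfolding R'_def using xg(1) vh(1) by force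
    ultimately show ?thesis using compose_orth[OF xg(2) vh(2)] by blast
  qed
  have uniq': "y = y'" if y: "y \<in> R'" "y' \<in> R'" and g: "g \<in> Og" and gy: "diag_act (Suc k) g y = y'" for y y' g
  proof -
    obtain x v x' v' where xv: "y = x(k := v)" "x \<in> R" "v \<in> A x" "y' = x'(k := v')" "x' \<in> R" "v' \<in> A x'"
      using y by (auto simp: R'_def)
    have gyi: "g (y i) = y' i" if "i < Suc k" for i using diag_act_apply[OF that, of g y] gy by simp
    have gx: "g (x i) = x' i" if "i < k" for i using gyi[of i] that xv by simp
    have gv: "g v = v'" using gyi[of k] xv by simp
    have "x' \<in> tuples k V" using R xv by blast
    then have "diag_act k g x = x'" using gx diag_act_eq_iff by blast
    then have xx: "x = x'" by (rule uniq[rule_format, OF xv(2) xv(5) g])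
    have fx: "g u = u" if "u \<in> W x" for u using fixW[OF xv(2) g _ that] gx xx by simp
    have vV: "v \<in> carrier V" "v' \<in> carrier V" using AV xv by auto
    have "v = v'"
    proof (cases "v \<in> W x")
      case True then show ?thesis using fx gv by simp
    next
      case False
      have "v' \<notin> W x"
      proof
        assume "v' \<in> W x"
        then have "g v' = g v" using fx gv by simp
        then have "v' = v" using orth_inj[OF g vV(2,1)] by simp
        then show False using False \<open>v' \<in> W x\<close> by simp
      qed
      then have CC: "v \<in> C x" "v' \<in> C x" using xv xx False by (auto simp: A_def)
      have "B v' u = B v u" if "u \<in> W x" for u
      proof -
        have uV: "u \<in> carrier V" using W[OF xv(2)] that subsp_carrier by blast
        show ?thesis using orth_B[OF g vV(1) uV] fx[OF that] gv by simp
      qed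
      then have "restrict (B v') (W x) = restrict (B v) (W x)" by (rule restrict_ext)
      moreover have "Q v' = Q v" using orth_Q[OF g vV(1)] gv by simp
      ultimately have "key x v = key x v'" by (simp add: key_def)
      then show ?thesis by (rule inj_onD[OF C(2)[of x] _ CC])
    qed
    then show ?thesis using xv xx by simp
  qed
  have sum': "(\<Sum>y\<in>R'. card (tspan (Suc k) y) ^ j) = (\<Prod>i=1..Suc k. 1 + l ^ (i + j))" for j
  proof -
    have ts: "tspan (Suc k) (x(k := v)) = adj v (W x)" for x v
      unfolding W_def using tspan_cong[of k "x(k := v)" x] by simp
    have "(\<Sum>y\<in>R'. card (tspan (Suc k) y) ^ j) = (\<Sum>(x, v)\<in>Sigma R A. card (adj v (W x)) ^ j)"
      unfolding R'_def by (subst sum.reindex[OF inj]) (simp add: ts case_prod_unfold del: tspan.simps)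
    also have "\<dots> = (\<Sum>x\<in>R. \<Sum>v\<in>A x. card (adj v (W x)) ^ j)"
      using R finA by (simp add: sum.Sigma)
    \<comment> \<open>With \<open>w\<close> for the size of \<open>W x\<close>, the extensions
      inside contribute \<open>w * w ^ j\<close> and those outside
      \<open>l * w * (l * w) ^ j\<close>, together
      \<open>w ^ Suc j * (1 + l ^ Suc j)\<close>.\<close>
    also have "\<dots> = (\<Sum>x\<in>R. card (W x) ^ Suc j * (1 + l ^ Suc j))"
    proof (rule sum.cong[OF refl])
      fix x assume x: "x \<in> R"
      have disj: "W x \<inter> C x = {}" using C(1)[of x] by blast
      have "(\<Sum>v\<in>A x. card (adj v (W x)) ^ j) =
          (\<Sum>v\<in>W x. card (adj v (W x)) ^ j) + (\<Sum>v\<in>C x. card (adj v (W x)) ^ j)"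
        unfolding A_def using finite_subsp[OF W[OF x]] finC disj by (rule sum.union_disjoint)
      also have "(\<Sum>v\<in>W x. card (adj v (W x)) ^ j) = (\<Sum>v\<in>W x. card (W x) ^ j)"
        using adj_absorb[OF W[OF x]] by (intro sum.cong) simp_all
      also have "(\<Sum>v\<in>C x. card (adj v (W x)) ^ j) = (\<Sum>v\<in>C x. (l * card (W x)) ^ j)"
      proof (rule sum.cong[OF refl])
        fix v assume "v \<in> C x"
        then have "v \<in> carrier V" "v \<notin> W x" using C(1)[of x] by auto
        then show "card (adj v (W x)) ^ j = (l * card (W x)) ^ j" using card_adj[OF W[OF x]] by simp
      qed
      finally show "(\<Sum>v\<in>A x. card (adj v (W x)) ^ j) = card (W x) ^ Suc j * (1 + l ^ Suc j)"
        using cC[OF x] by (simp add: power_mult_distrib algebra_simps)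
    qed
    also have "\<dots> = (\<Sum>x\<in>R. card (W x) ^ Suc j) * (1 + l ^ Suc j)" by (rule sum_distrib_right[symmetric])
    \<comment> \<open>The induction hypothesis is used at the exponent \<open>Suc j\<close>. The
      factor split off above is the one for \<open>i = 1\<close> in the longer product, and the
      others are shifted by one.\<close>
    also have "(\<Sum>x\<in>R. card (W x) ^ Suc j) = (\<Prod>i=1..k. 1 + l ^ (i + Suc j))"
      unfolding W_def by (rule sum[rule_format])
    also have "(\<Prod>i=1..k. 1 + l ^ (i + Suc j)) * (1 + l ^ Suc j) = (\<Prod>i=1..Suc k. 1 + l ^ (i + j))"
    proof -
      have "(\<Prod>i=1..Suc k. 1 + l ^ (i + j)) = (1 + l ^ (1 + j)) * (\<Prod>i=Suc 1..Suc k. 1 + l ^ (i + j))"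
        by (rule prod.atLeast_Suc_atMost) simp
      also have "(\<Prod>i=Suc 1..Suc k. 1 + l ^ (i + j)) = (\<Prod>i=1..k. 1 + l ^ (Suc i + j))"
        by (rule prod.shift_bounds_cl_Suc_ivl)
      finally show ?thesis by (simp add: mult.commute)
    qed
    finally show ?thesis .
  qed
  have "finite R'" unfolding R'_def using R finA by (intro finite_imageI finite_SigmaI) auto
  then show ?case using R'T cov' uniq' sum' by (intro exI[of _ R']) blast
qed

lemma card_orbits_orth:
  assumes E: "subsp E" "tot_sing E" "card E = l ^ m"
  shows "card (orbits (orth l V Q) (tuples m V) (diag_act m)) = (\<Prod>i=1..m. 1 + l ^ i)"
proof -
  obtain R where R: "R \<subseteq> tuples m V"
    and cov: "\<forall>y\<in>tuples m V. \<exists>x\<in>R. \<exists>g\<in>Og. diag_act m g x = y"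
    and uniq: "\<forall>x\<in>R. \<forall>x'\<in>R. \<forall>g\<in>Og. diag_act m g x = x' \<longrightarrow> x = x'"
    and sum: "\<forall>j. (\<Sum>x\<in>R. card (tspan m x) ^ j) = (\<Prod>i=1..m. 1 + l ^ (i + j))"
    using ex_orbit_representatives[OF E order_refl] by blast
  let ?o = "orbit (orth l V Q) (diag_act m)"
  have self: "x \<in> ?o x" if "x \<in> tuples m V" for x
  proof -
    have "diag_act m (\<lambda>x\<in>carrier V. x) x = x"
      unfolding diag_act_eq_iff[OF that] using tuplesD[OF that] by simp
    then show ?thesis using id_orth unfolding orbit_def by force
  qed
  have "orbits (orth l V Q) (tuples m V) (diag_act m) = ?o ` R"
  proof
    show "?o ` R \<subseteq> orbits (orth l V Q) (tuples m V) (diag_act m)" using R by (auto simp: orbits_def)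
    show "orbits (orth l V Q) (tuples m V) (diag_act m) \<subseteq> ?o ` R"
    proof
      fix ob assume "ob \<in> orbits (orth l V Q) (tuples m V) (diag_act m)"
      then obtain y where y: "y \<in> tuples m V" "ob = ?o y" by (auto simp: orbits_def)
      then obtain x g where xg: "x \<in> R" "g \<in> Og" "diag_act m g x = y" using cov by blast
      then have "ob = ?o x" using orbit_eqI[of x m g] R y by auto
      then show "ob \<in> ?o ` R" using xg by simp
    qed
  qed
  moreover have "inj_on ?o R"
  proof (rule inj_onI)
    fix x x' assume x: "x \<in> R" "x' \<in> R" "?o x = ?o x'"
    then have "x' \<in> ?o x" using self[of x'] R by blast
    then obtain g where "g \<in> Og" "diag_act m g x = x'" by (auto simp: orbit_def)
    then show "x = x'" using uniq x by blast
  qed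
  \<comment> \<open>At the exponent 0 every representative has weight 1.\<close>
  moreover have "card R = (\<Prod>i=1..m. 1 + l ^ i)" using sum[rule_format, of 0] by simp
  ultimately show ?thesis by (simp add: card_image)
qed

end

subsection \<open>Bases and ranks\<close>

context zmod_module
begin

lemma lin_comb_closed:
  assumes "set bs \<subseteq> carrier V" "a \<in> {..<length bs} \<rightarrow> {0..<int n}"
  shows "lin_comb V bs a \<in> carrier V"
  unfolding lin_comb_def
proof (rule finsum_closed, rule Pi_I)
  fix i assume i: "i \<in> {..<length bs}"
  then have "a i \<odot> bs ! i = a i \<star> (bs ! i)" using assms(2) by (intro smult_eq_sc) auto
  then show "a i \<odot> bs ! i \<in> carrier V" using assms(1) i by (simp add: subset_iff)
qed

lemma lin_comb_snoc:
  assumes "set bs \<subseteq> carrier V" "b \<in> carrier V" "a \<in> {..<Suc (length bs)} \<rightarrow> {0..<int n}"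
  shows "lin_comb V (bs @ [b]) a = a (length bs) \<star> b \<oplus> lin_comb V bs a"
proof -
  have cl: "(\<lambda>i. a i \<odot> (bs @ [b]) ! i) \<in> {..<length bs} \<rightarrow> carrier V"
  proof
    fix i assume i: "i \<in> {..<length bs}"
    then have "a i \<in> {0..<int n}" using assms(3) by (auto simp: Pi_def)
    then have "a i \<odot> (bs @ [b]) ! i = a i \<star> (bs ! i)"
      using i smult_eq_sc[of "a i"] by (simp add: nth_append)
    then show "a i \<odot> (bs @ [b]) ! i \<in> carrier V" using assms(1) i by (simp add: subset_iff)
  qed
  have al: "a (length bs) \<odot> b = a (length bs) \<star> b" using assms(3) by (intro smult_eq_sc) auto
  have "lin_comb V (bs @ [b]) a = (\<Oplus>i\<in>insert (length bs) {..<length bs}. a i \<odot> (bs @ [b]) ! i)"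
    by (simp add: lin_comb_def lessThan_Suc)
  also have "\<dots> = a (length bs) \<odot> (bs @ [b]) ! length bs \<oplus> (\<Oplus>i\<in>{..<length bs}. a i \<odot> (bs @ [b]) ! i)"
    using cl al assms(2) by (intro finsum_insert) auto
  also have "(\<Oplus>i\<in>{..<length bs}. a i \<odot> (bs @ [b]) ! i) = lin_comb V bs a"
    unfolding lin_comb_def
  proof (rule finsum_cong')
    show "(\<lambda>i. a i \<odot> bs ! i) \<in> {..<length bs} \<rightarrow> carrier V"
      using cl by (auto simp: Pi_def nth_append)
  qed (simp_all add: nth_append)
  finally show ?thesis using al by simp
qed

lemma lin_comb_cong:
  assumes "set bs \<subseteq> carrier V" "a \<in> {..<length bs} \<rightarrow> {0..<int n}" "\<And>i. i < length bs \<Longrightarrow> a i = a' i"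
  shows "lin_comb V bs a = lin_comb V bs a'"
  unfolding lin_comb_def
proof (rule finsum_cong')
  show "(\<lambda>i. a' i \<odot> bs ! i) \<in> {..<length bs} \<rightarrow> carrier V"
  proof
    fix i assume i: "i \<in> {..<length bs}"
    then have "a' i \<odot> bs ! i = a i \<star> (bs ! i)" using assms(2,3) smult_eq_sc[of "a i"] by (auto simp: Pi_def)
    then show "a' i \<odot> bs ! i \<in> carrier V" using assms(1) i by (simp add: subset_iff)
  qed
qed (use assms in auto)

lemma is_basis_card: "is_basis n V bs \<Longrightarrow> card (carrier V) = n ^ length bs"
  using bij_betw_same_card[of "lin_comb V bs" "{..<length bs} \<rightarrow>\<^sub>E {0..<int n}" "carrier V"]
  by (simp add: is_basis_def card_PiE)

lemma is_basis_finite: "is_basis n V bs \<Longrightarrow> finite (carrier V)"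
  using bij_betw_finite[of "lin_comb V bs" "{..<length bs} \<rightarrow>\<^sub>E {0..<int n}" "carrier V"]
  by (simp add: is_basis_def finite_PiE)

end

context fin_space
begin

lemma tspan_subset_lin_comb:
  assumes "\<And>i. i < k \<Longrightarrow> x i \<in> carrier V" and "u \<in> tspan k x"
  shows "\<exists>a\<in>{..<k} \<rightarrow>\<^sub>E {0..<int l}. lin_comb V (map x [0..<k]) a = u"
  using assms
proof (induction k arbitrary: u)
  case 0
  then show ?case by (simp add: lin_comb_def)
next
  case (Suc k)
  from Suc.prems(2) obtain c y where u: "u = c \<star> x k \<oplus> y" "y \<in> tspan k x" by (auto elim: adjE)
  have xV: "\<And>i. i < k \<Longrightarrow> x i \<in> carrier V" "x k \<in> carrier V" using Suc.prems(1) by simp_all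
  obtain a where a: "a \<in> {..<k} \<rightarrow>\<^sub>E {0..<int l}" "lin_comb V (map x [0..<k]) a = y"
    using Suc.IH[OF xV(1) u(2)] by blast
  define a' where "a' = a(k := c mod int l)"
  have a'P: "a' \<in> {..<Suc k} \<rightarrow>\<^sub>E {0..<int l}"
    unfolding a'_def lessThan_Suc using a l_gt_1 by (intro PiE_fun_upd) auto
  have bsV: "set (map x [0..<k]) \<subseteq> carrier V" using xV by auto
  have "lin_comb V (map x [0..<k]) a' = lin_comb V (map x [0..<k]) a"
  proof (rule lin_comb_cong[OF bsV])
    show "a' \<in> {..<length (map x [0..<k])} \<rightarrow> {0..<int l}" using a'P by (auto simp: PiE_def Pi_def)
  qed (simp add: a'_def)
  then have "lin_comb V (map x [0..<Suc k]) a' = (c mod int l) \<star> x k \<oplus> y"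
    using lin_comb_snoc[OF bsV xV(2), of a'] a'P a by (auto simp: a'_def)
  then show ?case using a'P u by auto
qed

text \<open>Linear combinations map a set of size \<open>l ^ k\<close> onto one of the same size, so
  spanning implies uniqueness of coordinates.\<close>

lemma is_basis_tspan:
  assumes x: "\<And>i. i < k \<Longrightarrow> x i \<in> carrier V" and sp: "tspan k x = carrier V" and cd: "card (carrier V) = l ^ k"
  shows "is_basis l V (map x [0..<k])"
proof -
  let ?P = "{..<k} \<rightarrow>\<^sub>E {0..<int l}"
  have bsV: "set (map x [0..<k]) \<subseteq> carrier V" using x by auto
  have im: "lin_comb V (map x [0..<k]) ` ?P = carrier V"
  proof
    show "lin_comb V (map x [0..<k]) ` ?P \<subseteq> carrier V"
      using lin_comb_closed[OF bsV] by (auto simp: PiE_def)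
    show "carrier V \<subseteq> lin_comb V (map x [0..<k]) ` ?P"
      using tspan_subset_lin_comb[of k x] x unfolding sp by (auto simp: image_iff)
  qed
  have "inj_on (lin_comb V (map x [0..<k])) ?P"
    by (rule eq_card_imp_inj_on) (simp_all add: im cd card_PiE finite_PiE)
  then show ?thesis using bsV im by (simp add: is_basis_def bij_betw_def)
qed

lemma ex_basis: "\<exists>bs. is_basis l V bs"
proof -
  from ex_tspan[OF subsp_carrier_V] obtain k x
    where kx: "\<forall>i<k. x i \<in> carrier V" "tspan k x = carrier V" "card (carrier V) = l ^ k" by blast
  have "is_basis l V (map x [0..<k])" by (rule is_basis_tspan) (use kx in simp_all)
  then show ?thesis by blast
qed

text \<open>A basis always exists over a prime field, so the rank is determined by the number of
  elements. Statements on ranks thereby become counts.\<close>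

lemma free_of_rank_iff: "free_of_rank l V k \<longleftrightarrow> card (carrier V) = l ^ k"
proof
  assume "free_of_rank l V k"
  then show "card (carrier V) = l ^ k" using is_basis_card by (auto simp: free_of_rank_def)
next
  assume c: "card (carrier V) = l ^ k"
  obtain bs where bs: "is_basis l V bs" using ex_basis by blast
  then have "l ^ length bs = l ^ k" using is_basis_card[OF bs] c by simp
  then have "length bs = k" using prime_gt_1_nat[OF prime_l] by simp
  then show "free_of_rank l V k" using bs is_module by (auto simp: free_of_rank_def)
qed

lemma fin_space_subsp:
  assumes "subsp X" shows "fin_space l (V\<lparr>carrier := X\<rparr>)"
proof -
  interpret M: module "zmod l" V by (rule is_module)
  have "submodule X (zmod l) V"
  proof (rule M.submoduleI)
    show "X \<subseteq> carrier V" "\<zero> \<in> X" using assms subsp_subset subsp_zero by auto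
    show "\<And>a. a \<in> X \<Longrightarrow> \<ominus> a \<in> X" using assms by (simp add: minus_eq_sc subsp_carrier subsp_sc)
    show "\<And>a b. a \<in> X \<Longrightarrow> b \<in> X \<Longrightarrow> a \<oplus> b \<in> X" using assms subsp_add by blast
    show "\<And>a x. a \<in> carrier (zmod l) \<Longrightarrow> x \<in> X \<Longrightarrow> a \<odot> x \<in> X"
      using assms by (simp add: smult_eq_sc subsp_sc)
  qed
  then have "module (zmod l) (V\<lparr>carrier := X\<rparr>)"
    using submodule.submodule_is_module[of X "zmod l" V] is_module by blast
  then show ?thesis
    using n_pos prime_l finite_subsp[OF assms]
    by (simp add: fin_space_def zmod_module_def fin_space_axioms_def)
qed

lemma rank_subsp:
  assumes "subsp X" "card X = l ^ k"
  shows "(THE k. free_of_rank l (V\<lparr>carrier := X\<rparr>) k) = k"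
proof (rule the_equality)
  interpret X: fin_space l "V\<lparr>carrier := X\<rparr>" using fin_space_subsp[OF assms(1)] .
  show "free_of_rank l (V\<lparr>carrier := X\<rparr>) k" using X.free_of_rank_iff assms by simp
  fix j assume "free_of_rank l (V\<lparr>carrier := X\<rparr>) j"
  then have "l ^ j = l ^ k" using X.free_of_rank_iff assms by simp
  then show "j = k" using prime_gt_1_nat[OF prime_l] by simp
qed

end

subsection \<open>The effect of a reflection on the rank\<close>

context quad_space
begin

definition fixg :: "('v \<Rightarrow> 'v) \<Rightarrow> 'v set" where "fixg g = {x \<in> carrier V. g x = x}"

text \<open>The image of \<open>g - 1\<close>, whose dimension is the rank that enters the Dickson
  invariant.\<close>

definition img :: "('v \<Rightarrow> 'v) \<Rightarrow> 'v set" where "img g = (\<lambda>x. g x \<oplus> (-1) \<star> x) ` carrier V"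

lemma orth_zero: "g \<in> Og \<Longrightarrow> g \<zero> = \<zero>"
  using orth_sc[of g \<zero> 0] orth_closed[of g \<zero>] by simp

lemma subsp_fixg: "g \<in> Og \<Longrightarrow> subsp (fixg g)"
  by (rule subspI) (simp_all add: fixg_def orth_zero orth_add[of g] orth_sc[of g] subset_iff)

lemma subsp_img:
  assumes g: "g \<in> Og" shows "subsp (img g)"
proof (rule subspI)
  show "img g \<subseteq> carrier V" using orth_closed[OF g] by (auto simp: img_def)
  show "\<zero> \<in> img g" unfolding img_def using orth_zero[OF g] by (intro image_eqI[of _ _ \<zero>]) simp_all
  show "a \<star> y \<in> img g" if "y \<in> img g" for a y
  proof -
    obtain x where x: "x \<in> carrier V" "y = g x \<oplus> (-1) \<star> x" using \<open>y \<in> img g\<close> by (auto simp: img_def)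
    have "a \<star> y = g (a \<star> x) \<oplus> (-1) \<star> (a \<star> x)"
      using x orth_closed[OF g x(1)] by (simp add: orth_sc[OF g] sc_add_right sc_sc mult.commute)
    then show ?thesis unfolding img_def using x by (intro image_eqI[of _ _ "a \<star> x"]) simp_all
  qed
  show "y \<oplus> y' \<in> img g" if y: "y \<in> img g" "y' \<in> img g" for y y'
  proof -
    obtain x x' where x: "x \<in> carrier V" "y = g x \<oplus> (-1) \<star> x" "x' \<in> carrier V" "y' = g x' \<oplus> (-1) \<star> x'"
      using y by (auto simp: img_def)
    have "y \<oplus> y' = g (x \<oplus> x') \<oplus> (-1) \<star> (x \<oplus> x')"
      using x orth_closed[OF g x(1)] orth_closed[OF g x(3)] by (simp add: orth_add[OF g] sc_add_right a_ac)
    then show ?thesis unfolding img_def using x by (intro image_eqI[of _ _ "x \<oplus> x'"]) simp_all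
  qed
qed

text \<open>By invariance \<open>B y x = B (g y) (g x)\<close>. Hence \<open>x\<close> is orthogonal
  to every \<open>g y - y\<close> if and only if \<open>B z x = B z (g x)\<close> for all
  \<open>z = g y\<close>, which are all vectors.\<close>

lemma perp_img:
  assumes g: "g \<in> Og" shows "perp (img g) = fixg g"
proof
  show "fixg g \<subseteq> perp (img g)"
  proof
    fix x assume x: "x \<in> fixg g"
    then have xV: "x \<in> carrier V" "g x = x" by (auto simp: fixg_def)
    have "B (g y \<oplus> (-1) \<star> y) x = 0" if y: "y \<in> carrier V" for y
      using orth_B[OF g y xV(1)] y xV orth_closed[OF g y] by (simp add: B_simps mod_simps)
    then show "x \<in> perp (img g)" using xV by (auto simp: perp_def img_def)
  qed
  show "perp (img g) \<subseteq> fixg g"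
  proof
    fix x assume x: "x \<in> perp (img g)"
    have xV: "x \<in> carrier V" "g x \<in> carrier V" using x perp_carrier orth_closed[OF g] by auto
    have "g x = x"
    proof (rule vec_eqI[OF xV(2,1)])
      fix z assume "z \<in> carrier V"
      then obtain y where y: "y \<in> carrier V" "z = g y" using orth_surj[OF g] by blast
      have zV: "z \<in> carrier V" by fact
      have "g y \<oplus> (-1) \<star> y \<in> img g" using y by (auto simp: img_def)
      then have "B (g y \<oplus> (-1) \<star> y) x = 0" using x perp_mem by blast
      then have "(B z x - B y x) mod int l = 0" using y xV zV by (simp add: B_simps mod_simps)
      then have "B z x mod int l = B y x mod int l" using mod_eq_dvd_iff mod_eq_0_iff_dvd by blast
      then have "B z x = B z (g x)" using orth_B[OF g y(1) xV(1)] y by simp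
      then show "B (g x) z = B x z" using B_sym[OF xV(1) zV] B_sym[OF xV(2) zV] by simp
    qed
    then show "x \<in> fixg g" using xV by (simp add: fixg_def)
  qed
qed

lemma card_img_fixg: "g \<in> Og \<Longrightarrow> card (img g) * card (fixg g) = card (carrier V)"
  using card_perp[OF subsp_img] perp_img by simp

lemma reflD: "v \<in> refls \<Longrightarrow> v \<in> carrier V" "v \<in> refls \<Longrightarrow> Q v \<noteq> 0"
  by (simp_all add: refls_def)

definition rmul :: "'v \<Rightarrow> ('v \<Rightarrow> 'v) \<Rightarrow> 'v \<Rightarrow> 'v" where
  "rmul v g = compose (carrier V) (reflection l V Q v) g"

lemma rmul_orth: "v \<in> refls \<Longrightarrow> g \<in> Og \<Longrightarrow> rmul v g \<in> Og"
  unfolding rmul_def using compose_orth refl_orth by blast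

lemma rmul_apply: "x \<in> carrier V \<Longrightarrow> rmul v g x = reflection l V Q v (g x)"
  by (simp add: rmul_def compose_apply)

lemma rmul_rmul:
  assumes v: "v \<in> refls" and g: "g \<in> Og" shows "rmul v (rmul v g) = g"
  by (rule orth_eqI[OF rmul_orth[OF v rmul_orth[OF v g]] g])
    (simp add: rmul_apply refl_invol[OF v] orth_closed[OF g])

lemma refl_fix_iff:
  assumes v: "v \<in> refls" and w: "w \<in> carrier V"
  shows "reflection l V Q v w = w \<longleftrightarrow> B w v = 0"
proof
  assume eq: "reflection l V Q v w = w"
  define i where "i = inv\<^bsub>zmod l\<^esub> (Q v)"
  have vV: "v \<in> carrier V" using reflD[OF v] by simp
  have i: "(Q v * i) mod int l = 1" using refl_Q_inv[OF v w] by (simp add: i_def)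
  have "w \<oplus> (- (B w v * i)) \<star> v = w" using refl_apply[OF v w] eq by (simp add: i_def)
  then have z: "(- (B w v * i)) \<star> v = \<zero>" using w vV by simp
  have "v \<noteq> \<zero>" using reflD[OF v] by auto
  then have "(- (B w v * i)) mod int l = 0"
    using sc_mem_cancel[OF subsp_trivial, of "- (B w v * i)" v] z vV by auto
  then have "(B w v * i) mod int l = 0" by (simp add: mod_eq_0_iff_dvd)
  then have "B w v mod int l = 0 \<or> i mod int l = 0" by (rule prime_mult_mod_eq_0[OF prime_l])
  moreover have "i mod int l \<noteq> 0"
  proof
    assume "i mod int l = 0"
    then have "(Q v * i) mod int l = 0" by (simp add: mod_eq_0_iff_dvd)
    then show False using i by simp
  qed
  ultimately show "B w v = 0" by simp
qed (rule refl_fix[OF v w])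

text \<open>For \<open>v = g w - w\<close> the reflection in \<open>v\<close> takes
  \<open>g w\<close> back to \<open>w\<close>, so \<open>w\<close> becomes a fixed vector. On the
  new fixed space the functional \<open>x \<mapsto> B (g x) v\<close> is nonzero at
  \<open>w\<close>, and its kernel is the old fixed space.\<close>

lemma card_fixg_rmul_in:
  assumes g: "g \<in> Og" and v: "v \<in> refls" "v \<in> img g"
  shows "card (fixg (rmul v g)) = l * card (fixg g)"
proof -
  have vV: "v \<in> carrier V" "Q v \<noteq> 0" using reflD v by auto
  have r: "rmul v g \<in> Og" using rmul_orth g v by blast
  obtain w where w: "w \<in> carrier V" "v = g w \<oplus> (-1) \<star> w" using v(2) by (auto simp: img_def)
  have gw: "g w \<in> carrier V" "Q (g w) = Q w" using orth_closed[OF g w(1)] orth_Q[OF g w(1)] by auto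
  have gw': "w \<oplus> v = g w" unfolding w(2) using w gw by simp
  have Bwv: "B w v = (- Q v) mod int l"
  proof -
    have "Q w = (Q w + Q v + B w v) mod int l" using gw(2) gw' Q_add[OF w(1) vV(1)] by simp
    then have "(Q w + Q v + B w v) mod int l = Q w mod int l" using w by simp
    then have "int l dvd Q v + B w v" by (simp add: mod_eq_dvd_iff)
    then have "B w v mod int l = (- Q v) mod int l"
      using mod_eq_dvd_iff[of "B w v" "int l" "- Q v"] by (simp add: add.commute)
    then show ?thesis by simp
  qed
  have Bgw: "B (g w) v = Q v"
    unfolding gw'[symmetric] using w vV Bwv by (simp add: B_simps mod_simps)
  have "reflection l V Q v (g w) = w"
  proof -
    define i where "i = inv\<^bsub>zmod l\<^esub> (Q v)"
    have i: "(Q v * i) mod int l = 1" using refl_Q_inv[OF v(1) w(1)] by (simp add: i_def)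
    have "(- (Q v * i)) mod int l = (-1) mod int l" using mod_minus_cong[of "Q v * i" "int l" 1] i by simp
    then have "(- (Q v * i)) \<star> v = (-1) \<star> v" by (rule sc_cong)
    then have "reflection l V Q v (g w) = g w \<oplus> (-1) \<star> v"
      using refl_apply[OF v(1) gw(1)] Bgw by (simp add: i_def)
    also have "\<dots> = w" unfolding gw'[symmetric] using w vV by simp
    finally show ?thesis .
  qed
  then have wf: "w \<in> fixg (rmul v g)" using w by (simp add: fixg_def rmul_apply)
  define f where "f = (\<lambda>x. B (g x) v)"
  have "functional_on (carrier V) f"
    unfolding functional_on_def f_def
    using B_range vV orth_closed[OF g]
    by (auto simp: orth_add[OF g] orth_sc[OF g] B_add_left B_sc_left)
  then have ff: "functional_on (fixg (rmul v g)) f"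
    by (rule functional_on_subset) (auto simp: fixg_def)
  have "{x \<in> fixg (rmul v g). f x = 0} = fixg g"
  proof (rule Set.set_eqI, rule iffI)
    fix x assume x: "x \<in> {x \<in> fixg (rmul v g). f x = 0}"
    then have xV: "x \<in> carrier V" "reflection l V Q v (g x) = x" "B (g x) v = 0"
      by (auto simp: fixg_def rmul_apply f_def)
    then show "x \<in> fixg g" using refl_fix[OF v(1) orth_closed[OF g xV(1)]] by (simp add: fixg_def)
  next
    fix x assume x: "x \<in> fixg g"
    then have xV: "x \<in> carrier V" "g x = x" by (auto simp: fixg_def)
    have "x \<in> perp (img g)" using x perp_img[OF g] by simp
    then have "B v x = 0" using v(2) perp_mem by blast
    then have "B x v = 0" using B_sym xV vV by simp
    then show "x \<in> {x \<in> fixg (rmul v g). f x = 0}"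
      using xV refl_fix[OF v(1)] by (simp add: fixg_def rmul_apply f_def)
  qed
  then show ?thesis using card_kernel[OF subsp_fixg[OF r] ff wf] Bgw vV by (simp add: f_def)
qed

text \<open>A vector fixed by the product differs from its image under \<open>g\<close> by a
  multiple of \<open>v\<close>. As \<open>v\<close> is not in the image of \<open>g - 1\<close>,
  this multiple is zero, so the new fixed space is the part of the old one orthogonal to
  \<open>v\<close>.\<close>

lemma card_fixg_rmul_out:
  assumes g: "g \<in> Og" and v: "v \<in> refls" "v \<notin> img g"
  shows "card (fixg g) = l * card (fixg (rmul v g))"
proof -
  have vV: "v \<in> carrier V" "Q v \<noteq> 0" using reflD v by auto
  obtain p where p: "p \<in> fixg g" "B v p = 1"
    using ex_perp_not_orth[OF subsp_img[OF g] vV(1) v(2)] perp_img[OF g] by auto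
  have ff: "functional_on (fixg g) (B v)"
    using functional_B[OF vV(1)] by (rule functional_on_subset) (auto simp: fixg_def)
  have "{x \<in> fixg g. B v x = 0} = fixg (rmul v g)"
  proof (rule Set.set_eqI, rule iffI)
    fix x assume x: "x \<in> {x \<in> fixg g. B v x = 0}"
    then have xV: "x \<in> carrier V" "g x = x" "B x v = 0" using B_sym[OF vV(1)] by (auto simp: fixg_def)
    then show "x \<in> fixg (rmul v g)" using refl_fix[OF v(1)] by (simp add: fixg_def rmul_apply)
  next
    fix x assume x: "x \<in> fixg (rmul v g)"
    then have xV: "x \<in> carrier V" and r: "reflection l V Q v (g x) = x" by (auto simp: fixg_def rmul_apply)
    have gx: "g x \<in> carrier V" using orth_closed[OF g xV] .
    have gr: "g x = reflection l V Q v x" using refl_invol[OF v(1) gx] r by simp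
    obtain c where c: "g x = x \<oplus> c \<star> v" using gr refl_apply[OF v(1) xV] by auto
    have "x \<oplus> c \<star> v \<oplus> (-1) \<star> x = c \<star> v" using xV vV by (simp add: a_comm[of x])
    then have "c \<star> v \<in> img g" unfolding img_def using xV c by (intro image_eqI[of _ _ x]) simp_all
    then have "c mod int l = 0" using sc_mem_cancel[OF subsp_img[OF g] _ _ vV(1)] v(2) by blast
    then have "c \<star> v = 0 \<star> v" by (intro sc_cong) simp
    then have gxx: "g x = x" using c xV vV by simp
    then have "B x v = 0" using gr refl_fix_iff[OF v(1) xV] by simp
    then show "x \<in> {x \<in> fixg g. B v x = 0}" using gxx xV B_sym[OF vV(1) xV] by (simp add: fixg_def)
  qed
  then show ?thesis using card_kernel[OF subsp_fixg[OF g] ff p(1)] p(2) by simp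
qed

definition rk :: "('v \<Rightarrow> 'v) \<Rightarrow> nat" where "rk g = rank_minus_id l V g"

lemma rk_eqI:
  assumes "g \<in> Og" "card (img g) = l ^ k" shows "rk g = k"
proof -
  have "(\<lambda>x. g x \<ominus> x) ` carrier V = img g"
    unfolding img_def using orth_closed[OF assms(1)] by (intro image_cong) (simp_all add: a_minus_eq_sc)
  then show ?thesis using rank_subsp[OF subsp_img[OF assms(1)] assms(2)] by (simp add: rk_def rank_minus_id_def)
qed

lemma card_img:
  assumes g: "g \<in> Og" shows "card (img g) = l ^ rk g"
proof -
  obtain k where k: "card (img g) = l ^ k" using card_subsp_power[OF subsp_img[OF g]] by blast
  then show ?thesis using rk_eqI[OF g k] by simp
qed

text \<open>The sizes of the image and of the fixed space have constant product, so the factor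
  \<open>l\<close> by which the fixed space changes is inverted in the image.\<close>

lemma rk_rmul:
  assumes g: "g \<in> Og" and v: "v \<in> refls"
  shows "v \<in> img g \<Longrightarrow> rk g = Suc (rk (rmul v g))" "v \<notin> img g \<Longrightarrow> rk (rmul v g) = Suc (rk g)"
proof -
  have r: "rmul v g \<in> Og" using rmul_orth g v by blast
  have fp: "card (fixg g) > 0" "card (fixg (rmul v g)) > 0"
    using card_subsp_pos[OF subsp_fixg[OF g]] card_subsp_pos[OF subsp_fixg[OF r]] by auto
  have eq: "card (img g) * card (fixg g) = card (img (rmul v g)) * card (fixg (rmul v g))"
    using card_img_fixg[OF g] card_img_fixg[OF r] by simp
  { assume "v \<in> img g"
    then have "card (fixg (rmul v g)) = l * card (fixg g)" using card_fixg_rmul_in[OF g v] by simp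
    then have "card (img g) = card (img (rmul v g)) * l" using eq fp by simp
    then have "card (img g) = l ^ Suc (rk (rmul v g))" using card_img[OF r] by simp
    then show "rk g = Suc (rk (rmul v g))" by (rule rk_eqI[OF g]) }
  { assume "v \<notin> img g"
    then have "card (fixg g) = l * card (fixg (rmul v g))" using card_fixg_rmul_out[OF g v] by simp
    then have "card (img (rmul v g)) = card (img g) * l" using eq fp by simp
    then have "card (img (rmul v g)) = l ^ Suc (rk g)" using card_img[OF g] by simp
    then show "rk (rmul v g) = Suc (rk g)" by (rule rk_eqI[OF r]) }
qed

lemma rk_rmul_parity: "g \<in> Og \<Longrightarrow> v \<in> refls \<Longrightarrow> even (rk (rmul v g)) \<longleftrightarrow> odd (rk g)"
  using rk_rmul[of g v] by (cases "v \<in> img g") auto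

text \<open>A nonsingular vector in the image of \<open>g - 1\<close> gives a reflection that lowers
  the rank. The induction stops when the image is totally singular, possibly before the identity: in
  the split space of dimension 4 over the field with two elements reflections generate a proper
  subgroup.\<close>

lemma orth_induct [consumes 1, case_names singular refl]:
  assumes g: "g \<in> Og"
    and base: "\<And>u. u \<in> Og \<Longrightarrow> tot_sing (img u) \<Longrightarrow> P u"
    and step: "\<And>h v. h \<in> Og \<Longrightarrow> v \<in> refls \<Longrightarrow> P h \<Longrightarrow> P (rmul v h)"
  shows "P g"
  using g
proof (induction "rk g" arbitrary: g rule: less_induct)
  case less
  show ?case
  proof (cases "tot_sing (img g)")
    case True then show ?thesis using base less.prems by blast
  next
    case False
    then obtain v where v: "v \<in> img g" "Q v \<noteq> 0" by (auto simp: tot_sing_def)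
    have vr: "v \<in> refls" using v subsp_carrier[OF subsp_img[OF less.prems]] by (simp add: refls_def)
    have r: "rmul v g \<in> Og" using rmul_orth[OF vr less.prems] .
    have "rk (rmul v g) < rk g" using rk_rmul(1)[OF less.prems vr v(1)] by simp
    then have "P (rmul v g)" using less.hyps r by blast
    then have "P (rmul v (rmul v g))" using step[OF r vr] by blast
    then show ?thesis using rmul_rmul[OF vr less.prems] by simp
  qed
qed

text \<open>Conjugating the reflection in \<open>v\<close> by \<open>g\<close> gives the one in
  \<open>g v\<close>. A reflection applied before \<open>g\<close> can thus be moved behind it,
  where the rank formula applies.\<close>

lemma refl_conj:
  assumes g: "g \<in> Og" and v: "v \<in> refls"
  shows "g v \<in> refls" "compose (carrier V) g (reflection l V Q v) = rmul (g v) g"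
proof -
  have vV: "v \<in> carrier V" "Q v \<noteq> 0" using reflD v by auto
  show gv: "g v \<in> refls" using vV orth_closed[OF g vV(1)] orth_Q[OF g vV(1)] by (simp add: refls_def)
  show "compose (carrier V) g (reflection l V Q v) = rmul (g v) g"
  proof (rule orth_eqI[OF compose_orth[OF g refl_orth[OF v]] rmul_orth[OF gv g]])
    fix x assume x: "x \<in> carrier V"
    have "g (reflection l V Q v x) = g x \<oplus> (- (B x v * inv\<^bsub>zmod l\<^esub> (Q v))) \<star> g v"
      unfolding refl_apply[OF v x] using x vV by (simp add: orth_add[OF g] orth_sc[OF g])
    also have "\<dots> = reflection l V Q (g v) (g x)"
      unfolding refl_apply[OF gv orth_closed[OF g x]] using orth_B[OF g x vV(1)] orth_Q[OF g vV(1)] by simp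
    finally show "compose (carrier V) g (reflection l V Q v) x = rmul (g v) g x"
      using x by (simp add: compose_apply rmul_apply)
  qed
qed

lemma rk_id: "rk (\<lambda>x\<in>carrier V. x) = 0"
proof (rule rk_eqI[OF id_orth])
  have "img (\<lambda>x\<in>carrier V. x) = (\<lambda>x. \<zero>) ` carrier V"
    unfolding img_def by (rule image_cong) simp_all
  then have "img (\<lambda>x\<in>carrier V. x) = {\<zero>}" by auto
  then show "card (img (\<lambda>x\<in>carrier V. x)) = l ^ 0" by simp
qed

lemma reflection_product_parity:
  "is_reflection_product l V Q vs g \<Longrightarrow> g \<in> Og \<and> (even (rk g) \<longleftrightarrow> even (length vs))"
proof (induction vs arbitrary: g)
  case Nil
  then have "g = (\<lambda>x\<in>carrier V. x)" by (simp add: is_reflection_product_def orth_one)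
  then show ?case using id_orth rk_id by (simp del: restrict_apply)
next
  case (Cons v vs)
  define h where "h = foldr (\<lambda>v h. reflection l V Q v \<otimes>\<^bsub>orth l V Q\<^esub> h) vs \<one>\<^bsub>orth l V Q\<^esub>"
  have "is_reflection_product l V Q vs h" using Cons.prems by (simp add: is_reflection_product_def h_def)
  then have h: "h \<in> Og" "even (rk h) \<longleftrightarrow> even (length vs)" using Cons.IH by auto
  have v: "v \<in> refls" using Cons.prems by (simp add: is_reflection_product_def refls_def)
  have "g = reflection l V Q v \<otimes>\<^bsub>orth l V Q\<^esub> h" using Cons.prems by (simp add: is_reflection_product_def h_def)
  then have "g = rmul v h" using orth_mult[OF refl_orth[OF v] h(1)] by (simp add: rmul_def)
  then show ?case using rmul_orth[OF v h(1)] rk_rmul_parity[OF h(1) v] h(2) by simp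
qed

text \<open>Every reflection changes the parity of the rank, so the branches of the definition that
  speak of reflection products agree with the last one.\<close>

lemma dickson_even:
  assumes "even l" "g \<in> Og" shows "dickson l V Q g = rk g mod 2"
proof -
  have ev: "even (rk g)" if "\<exists>vs. is_reflection_product l V Q vs g \<and> even (length vs)"
    using that reflection_product_parity by blast
  have od: "odd (rk g)" if "\<exists>vs. is_reflection_product l V Q vs g \<and> odd (length vs)"
    using that reflection_product_parity by blast
  show ?thesis
  proof (cases "\<exists>vs. is_reflection_product l V Q vs g \<and> even (length vs)")
    case True
    then have "dickson l V Q g = 0" using assms(1) by (simp add: dickson_def)
    then show ?thesis using ev[OF True] by simp
  next
    case not_even: False
    show ?thesis
    proof (cases "\<exists>vs. is_reflection_product l V Q vs g \<and> odd (length vs)")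
      case True
      have "dickson l V Q g = 1" unfolding dickson_def if_not_P[OF not_even] if_P[OF True] using assms(1) by simp
      then show ?thesis using od[OF True] by (simp add: odd_iff_mod_2_eq_one)
    next
      case False
      show ?thesis
        unfolding dickson_def if_not_P[OF not_even] if_not_P[OF False] rk_def using assms(1) by simp
    qed
  qed
qed

end

subsection \<open>Determinants\<close>

text \<open>The matrix determinant lemma over the integers. The block matrix with rows
  \<open>(1, w)\<close> and \<open>(a, I)\<close> is factored into triangular blocks in two ways,
  with diagonal blocks \<open>1\<close>, \<open>I - a w\<close> on one side and
  \<open>1 - w a\<close>, \<open>I\<close> on the other.\<close>

lemma det_one_minus_rank_one:
  fixes a w :: "nat \<Rightarrow> int"
  shows "det (mat r r (\<lambda>(i, j). (if i = j then 1 else 0) - w j * a i)) = 1 - (\<Sum>j<r. w j * a j)"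
proof -
  define A where "A = mat r 1 (\<lambda>(i, j). a i)"
  define W where "W = mat 1 r (\<lambda>(i, j). w j)"
  define D where "D = mat r r (\<lambda>(i, j). (if i = j then 1 else 0) - w j * a i)"
  define S where "S = mat 1 1 (\<lambda>(i, j). 1 - (\<Sum>j<r. w j * a j))"
  have c: "A \<in> carrier_mat r 1" "W \<in> carrier_mat 1 r" "D \<in> carrier_mat r r" "S \<in> carrier_mat 1 1"
    by (auto simp: A_def W_def D_def S_def)
  have o: "1\<^sub>m 1 \<in> carrier_mat 1 1" "1\<^sub>m r \<in> carrier_mat r r" "0\<^sub>m 1 r \<in> carrier_mat 1 r" "0\<^sub>m r 1 \<in> carrier_mat r 1"
    by auto
  have AW: "A * W + D = 1\<^sub>m r"
    by (rule eq_matI) (auto simp: A_def W_def D_def scalar_prod_def algebra_simps)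
  have WA: "S + W * A = 1\<^sub>m 1"
    by (rule eq_matI) (auto simp: A_def W_def S_def scalar_prod_def atLeast0LessThan)
  let ?F = "four_block_mat (1\<^sub>m 1) W A (1\<^sub>m r)"
  have 1: "four_block_mat (1\<^sub>m 1) (0\<^sub>m 1 r) A (1\<^sub>m r) * four_block_mat (1\<^sub>m 1) W (0\<^sub>m r 1) D = ?F"
    by (subst mult_four_block_mat[OF o(1) o(3) c(1) o(2) o(1) c(2) o(4) c(3)])
      (use c AW in \<open>simp add: left_mult_zero_mat right_mult_zero_mat\<close>)
  have 2: "four_block_mat S W (0\<^sub>m r 1) (1\<^sub>m r) * four_block_mat (1\<^sub>m 1) (0\<^sub>m 1 r) A (1\<^sub>m r) = ?F"
    by (subst mult_four_block_mat[OF c(4) c(2) o(4) o(2) o(1) o(3) c(1) o(2)])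
      (use c WA in \<open>simp add: left_mult_zero_mat right_mult_zero_mat\<close>)
  have L: "det (four_block_mat (1\<^sub>m 1) (0\<^sub>m 1 r) A (1\<^sub>m r)) = 1"
    by (subst det_four_block_mat_upper_right_zero[OF o(1) refl c(1) o(2)]) simp
  have U1: "det (four_block_mat (1\<^sub>m 1) W (0\<^sub>m r 1) D) = det D"
    by (subst det_four_block_mat_lower_left_zero[OF o(1) c(2) refl c(3)]) simp
  have U2: "det (four_block_mat S W (0\<^sub>m r 1) (1\<^sub>m r)) = det S"
    by (subst det_four_block_mat_lower_left_zero[OF c(4) c(2) refl o(2)]) simp
  have "det ?F = det D"
    unfolding 1[symmetric]
    by (subst det_mult[of _ "1 + r"]) (use c in \<open>simp_all add: L U1 del: One_nat_def\<close>)
  moreover have "det ?F = det S"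
    unfolding 2[symmetric]
    by (subst det_mult[of _ "1 + r"]) (use c in \<open>simp_all add: L U2 del: One_nat_def\<close>)
  ultimately show ?thesis by (simp add: D_def S_def det_single)
qed

lemma det_mod_cong:
  fixes A B :: "int mat"
  assumes A: "A \<in> carrier_mat r r" and B: "B \<in> carrier_mat r r"
    and e: "\<And>i j. i < r \<Longrightarrow> j < r \<Longrightarrow> A $$ (i, j) mod m = B $$ (i, j) mod m"
  shows "det A mod m = det B mod m"
proof -
  have "[det A = det B] (mod m)"
    unfolding det_def'[OF A] det_def'[OF B]
  proof (rule cong_sum)
    fix p assume "p \<in> {p. p permutes {0..<r}}"
    then have p: "p permutes {0..<r}" by simp
    have "[(\<Prod>i = 0..<r. A $$ (i, p i)) = (\<Prod>i = 0..<r. B $$ (i, p i))] (mod m)"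
    proof (rule cong_prod)
      fix i assume i: "i \<in> {0..<r}"
      then have "p i < r" using permutes_in_image[OF p, of i] by simp
      then show "[A $$ (i, p i) = B $$ (i, p i)] (mod m)" using e i by (simp add: cong_def)
    qed
    then show "[signof p * (\<Prod>i = 0..<r. A $$ (i, p i)) = signof p * (\<Prod>i = 0..<r. B $$ (i, p i))] (mod m)"
      by (rule cong_mult[OF cong_refl])
  qed
  then show ?thesis by (simp add: cong_def)
qed

context fin_space
begin

lemma functional_finsum:
  fixes k :: nat
  assumes f: "functional_on (carrier V) f"
  shows "(\<And>j. j < k \<Longrightarrow> b j \<in> carrier V) \<Longrightarrow> (\<Oplus>j\<in>{..<k}. a j \<star> b j) \<in> carrier V \<and> f (\<Oplus>j\<in>{..<k}. a j \<star> b j) = (\<Sum>j<k. a j * f (b j)) mod int l"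
proof (induction k)
  case 0
  then show ?case using functional_on_zero[OF f subsp_carrier_V] by simp
next
  case (Suc k)
  have bV: "b j \<in> carrier V" if "j < Suc k" for j using Suc.prems that .
  have IH: "(\<Oplus>j\<in>{..<k}. a j \<star> b j) \<in> carrier V" "f (\<Oplus>j\<in>{..<k}. a j \<star> b j) = (\<Sum>j<k. a j * f (b j)) mod int l"
    using Suc.IH bV by simp_all
  have eq: "(\<Oplus>j\<in>{..<Suc k}. a j \<star> b j) = a k \<star> b k \<oplus> (\<Oplus>j\<in>{..<k}. a j \<star> b j)"
    unfolding lessThan_Suc using bV by (intro finsum_insert) auto
  have "f (a k \<star> b k \<oplus> (\<Oplus>j\<in>{..<k}. a j \<star> b j)) = (f (a k \<star> b k) + f (\<Oplus>j\<in>{..<k}. a j \<star> b j)) mod int l"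
    using f IH bV[of k] by (simp add: functional_on_def)
  also have "\<dots> = (a k * f (b k) + (\<Sum>j<k. a j * f (b j))) mod int l"
    using f IH bV[of k] by (simp add: functional_on_def mod_simps)
  finally show ?case unfolding eq using IH bV[of k] by (simp add: add.commute)
qed

lemma lin_comb_eq_finsum:
  assumes "set bs \<subseteq> carrier V" "a \<in> {..<length bs} \<rightarrow> {0..<int l}"
  shows "lin_comb V bs a = (\<Oplus>j\<in>{..<length bs}. a j \<star> (bs ! j))"
  unfolding lin_comb_def
proof (rule finsum_cong')
  show "(\<lambda>j. a j \<star> (bs ! j)) \<in> {..<length bs} \<rightarrow> carrier V"
    using assms(1) by (intro Pi_I sc_closed) (auto simp: subset_iff)
  fix i assume "i \<in> {..<length bs}"
  then have "a i \<in> {0..<int l}" using assms(2) by (auto simp: Pi_def)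
  then show "a i \<odot> bs ! i = a i \<star> (bs ! i)" by (rule smult_eq_sc)
qed simp

lemma
  assumes bs: "is_basis l V bs" and x: "x \<in> carrier V"
  shows coords_PiE: "coords l V bs x \<in> {..<length bs} \<rightarrow>\<^sub>E {0..<int l}"
    and lin_comb_coords: "lin_comb V bs (coords l V bs x) = x"
proof -
  have "x \<in> lin_comb V bs ` ({..<length bs} \<rightarrow>\<^sub>E {0..<int l})"
    using bs x by (simp add: is_basis_def bij_betw_def)
  then show "coords l V bs x \<in> {..<length bs} \<rightarrow>\<^sub>E {0..<int l}" "lin_comb V bs (coords l V bs x) = x"
    using inv_into_into[of x "lin_comb V bs" "{..<length bs} \<rightarrow>\<^sub>E {0..<int l}"]
      f_inv_into_f[of x "lin_comb V bs" "{..<length bs} \<rightarrow>\<^sub>E {0..<int l}"]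
    by (simp_all add: coords_def)
qed

lemma basis_nth: "is_basis l V bs \<Longrightarrow> j < length bs \<Longrightarrow> bs ! j \<in> carrier V"
  by (auto simp: is_basis_def)

lemma basis_expand:
  assumes bs: "is_basis l V bs" and x: "x \<in> carrier V"
  shows "(\<Oplus>j\<in>{..<length bs}. coords l V bs x j \<star> (bs ! j)) = x"
  using lin_comb_eq_finsum[of bs "coords l V bs x"] coords_PiE[OF assms] lin_comb_coords[OF assms] bs
  by (simp add: is_basis_def PiE_def)

lemma functional_expand:
  assumes bs: "is_basis l V bs" and x: "x \<in> carrier V" and f: "functional_on (carrier V) f"
  shows "f x = (\<Sum>j<length bs. coords l V bs x j * f (bs ! j)) mod int l"
  using functional_finsum[OF f, of "length bs" "\<lambda>j. bs ! j" "coords l V bs x"] basis_nth[OF bs]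
    basis_expand[OF bs x] by simp

lemma coords_eqI:
  assumes bs: "is_basis l V bs" and x: "(\<Oplus>j\<in>{..<length bs}. a j \<star> (bs ! j)) = x" and i: "i < length bs"
  shows "coords l V bs x i = a i mod int l"
proof -
  let ?P = "{..<length bs} \<rightarrow>\<^sub>E {0..<int l}"
  define a' where "a' = (\<lambda>j\<in>{..<length bs}. a j mod int l)"
  have a'P: "a' \<in> ?P" using l_gt_1 by (auto simp: a'_def)
  have bV: "set bs \<subseteq> carrier V" using bs by (simp add: is_basis_def)
  have "lin_comb V bs a' = (\<Oplus>j\<in>{..<length bs}. a' j \<star> (bs ! j))"
    using lin_comb_eq_finsum[OF bV] a'P by (simp add: PiE_def)
  also have "\<dots> = x" unfolding x[symmetric]
    by (rule finsum_cong') (use basis_nth[OF bs] in \<open>auto simp: a'_def\<close>)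
  finally have eq: "lin_comb V bs a' = x" .
  have "inj_on (lin_comb V bs) ?P" using bs by (simp add: is_basis_def bij_betw_def)
  then have "coords l V bs x = a'" unfolding coords_def using eq a'P by (simp add: inv_into_f_eq)
  then show ?thesis using i by (simp add: a'_def)
qed

lemma functional_coords:
  assumes bs: "is_basis l V bs" and i: "i < length bs"
  shows "functional_on (carrier V) (\<lambda>x. coords l V bs x i)"
  unfolding functional_on_def
proof (intro conjI ballI allI)
  fix x assume x: "x \<in> carrier V"
  show "coords l V bs x i \<in> {0..<int l}" using coords_PiE[OF bs x] i by (auto simp: PiE_def Pi_def)
  have bV: "(\<lambda>j. coords l V bs x j \<star> (bs ! j)) \<in> {..<length bs} \<rightarrow> carrier V" for x
    using basis_nth[OF bs] by auto
  show "coords l V bs (a \<star> x) i = (a * coords l V bs x i) mod int l" for a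
  proof (rule coords_eqI[OF bs _ i])
    have "a \<star> x = (a mod int l) \<odot> (\<Oplus>j\<in>{..<length bs}. coords l V bs x j \<star> (bs ! j))"
      using basis_expand[OF bs x] by (simp add: sc_def)
    also have "\<dots> = (\<Oplus>j\<in>{..<length bs}. (a mod int l) \<odot> (coords l V bs x j \<star> (bs ! j)))"
      by (rule module.finsum_smult_ldistr[OF is_module _ mod_carrier bV]) simp
    also have "\<dots> = (\<Oplus>j\<in>{..<length bs}. (a * coords l V bs x j) \<star> (bs ! j))"
      by (rule finsum_cong') (use basis_nth[OF bs] in \<open>auto simp: sc_sc simp flip: sc_def\<close>)
    finally show "(\<Oplus>j\<in>{..<length bs}. (a * coords l V bs x j) \<star> (bs ! j)) = a \<star> x" by simp
  qed
  fix y assume y: "y \<in> carrier V"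
  show "coords l V bs (x \<oplus> y) i = (coords l V bs x i + coords l V bs y i) mod int l"
  proof (rule coords_eqI[OF bs _ i])
    have "x \<oplus> y = (\<Oplus>j\<in>{..<length bs}. coords l V bs x j \<star> (bs ! j) \<oplus> coords l V bs y j \<star> (bs ! j))"
      using basis_expand[OF bs x] basis_expand[OF bs y] finsum_addf[OF bV bV, of x y] by simp
    also have "\<dots> = (\<Oplus>j\<in>{..<length bs}. (coords l V bs x j + coords l V bs y j) \<star> (bs ! j))"
      by (rule finsum_cong') (use basis_nth[OF bs] in \<open>auto simp: sc_add_left\<close>)
    finally show "(\<Oplus>j\<in>{..<length bs}. (coords l V bs x j + coords l V bs y j) \<star> (bs ! j)) = x \<oplus> y" by simp
  qed
qed

lemma coords_basis:
  assumes bs: "is_basis l V bs" and i: "i < length bs" and k: "k < length bs"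
  shows "coords l V bs (bs ! k) i = (if i = k then 1 else 0)"
proof -
  have "(\<Oplus>j\<in>{..<length bs}. (if j = k then 1 else 0) \<star> (bs ! j)) =
      (\<Oplus>j\<in>{..<length bs}. if k = j then bs ! j else \<zero>)"
    by (rule finsum_cong') (use basis_nth[OF bs] in auto)
  also have "\<dots> = bs ! k" using k basis_nth[OF bs] by (intro finsum_singleton) auto
  finally show ?thesis using coords_eqI[OF bs _ i, of "\<lambda>j. if j = k then 1 else 0" "bs ! k"] by simp
qed

end

section \<open>Determinants of orthogonal maps and the Dickson invariant\<close>

context quad_space
begin

text \<open>The very basis chosen inside \<open>lin_det\<close>, so that \<open>matg g\<close> is
  the matrix whose determinant is taken there.\<close>

definition base :: "'v list" where "base = (SOME bs. is_basis l V bs)"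

definition matg :: "('v \<Rightarrow> 'v) \<Rightarrow> int mat" where
  "matg g = mat (length base) (length base) (\<lambda>(i, j). coords l V base (g (base ! j)) i)"

lemma is_basis_base: "is_basis l V base"
  unfolding base_def using ex_basis by (rule someI_ex)

lemma lin_det_eq: "lin_det l V g = det (matg g) mod int l"
  by (simp add: lin_det_def Let_def matg_def base_def)

lemma matg_carrier [simp]: "matg g \<in> carrier_mat (length base) (length base)"
  by (simp add: matg_def)

lemma functional_orth:
  assumes g: "g \<in> Og" and f: "functional_on (carrier V) f" shows "functional_on (carrier V) (\<lambda>x. f (g x))"
  using f orth_closed[OF g] by (simp add: functional_on_def orth_add[OF g] orth_sc[OF g])

lemma lin_det_mult:
  assumes g: "g \<in> Og" and h: "h \<in> Og"
  shows "lin_det l V (compose (carrier V) g h) = (lin_det l V g * lin_det l V h) mod int l"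
proof -
  let ?r = "length base"
  have "det (matg (compose (carrier V) g h)) mod int l = det (matg g * matg h) mod int l"
  proof (rule det_mod_cong)
    fix i j assume ij: "i < ?r" "j < ?r"
    have bV: "base ! j \<in> carrier V" using basis_nth[OF is_basis_base] ij by blast
    have "matg (compose (carrier V) g h) $$ (i, j) = coords l V base (g (h (base ! j))) i"
      using ij bV by (simp add: matg_def compose_apply)
    also have "\<dots> = (\<Sum>k<?r. coords l V base (h (base ! j)) k * coords l V base (g (base ! k)) i) mod int l"
      using functional_expand[OF is_basis_base orth_closed[OF h bV]
          functional_orth[OF g functional_coords[OF is_basis_base ij(1)]]] .
    also have "(\<Sum>k<?r. coords l V base (h (base ! j)) k * coords l V base (g (base ! k)) i) = (matg g * matg h) $$ (i, j)"
      using ij by (simp add: matg_def scalar_prod_def atLeast0LessThan mult.commute)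
    finally show "matg (compose (carrier V) g h) $$ (i, j) mod int l = (matg g * matg h) $$ (i, j) mod int l"
      by simp
  qed (use mult_carrier_mat[OF matg_carrier matg_carrier] in simp_all)
  also have "det (matg g * matg h) = det (matg g) * det (matg h)" by (rule det_mult[OF matg_carrier matg_carrier])
  finally show ?thesis by (simp add: lin_det_eq mod_mult_eq)
qed

lemma lin_det_id: "lin_det l V (\<lambda>x\<in>carrier V. x) = 1"
proof -
  have "matg (\<lambda>x\<in>carrier V. x) = 1\<^sub>m (length base)"
    by (rule eq_matI) (simp_all add: matg_def coords_basis[OF is_basis_base] basis_nth[OF is_basis_base])
  then show ?thesis by (simp add: lin_det_eq)
qed

text \<open>The matrix of the reflection is the identity minus a matrix of rank one, with column the
  coordinates of \<open>v\<close> and row the values \<open>B (base ! j) v / Q v\<close>. Their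
  product is \<open>B v v / Q v = 2\<close>, and \<open>1 - 2 = -1\<close>.\<close>

lemma lin_det_refl:
  assumes v: "v \<in> refls" shows "lin_det l V (reflection l V Q v) = (-1) mod int l"
proof -
  let ?r = "length base"
  have vV: "v \<in> carrier V" using reflD[OF v] by simp
  define iv where "iv = inv\<^bsub>zmod l\<^esub> (Q v)"
  have iv: "(Q v * iv) mod int l = 1" using refl_Q_inv[OF v vV] by (simp add: iv_def)
  define a where "a = coords l V base v"
  define w where "w = (\<lambda>j. B (base ! j) v * iv)"
  have "det (matg (reflection l V Q v)) mod int l =
      det (mat ?r ?r (\<lambda>(i, j). (if i = j then 1 else 0) - w j * a i)) mod int l"
  proof (rule det_mod_cong)
    fix i j assume ij: "i < ?r" "j < ?r"
    have bV: "base ! j \<in> carrier V" using basis_nth[OF is_basis_base] ij by blast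
    have f: "functional_on (carrier V) (\<lambda>x. coords l V base x i)"
      using functional_coords[OF is_basis_base ij(1)] .
    have "matg (reflection l V Q v) $$ (i, j) = coords l V base (base ! j \<oplus> (- w j) \<star> v) i"
      using ij refl_apply[OF v bV] by (simp add: matg_def w_def iv_def)
    also have "\<dots> = (coords l V base (base ! j) i + (- w j * a i) mod int l) mod int l"
      using f bV vV by (simp add: functional_on_def a_def)
    also have "\<dots> = ((if i = j then 1 else 0) - w j * a i) mod int l"
      using coords_basis[OF is_basis_base ij] by (simp add: mod_simps)
    finally show "matg (reflection l V Q v) $$ (i, j) mod int l =
        mat ?r ?r (\<lambda>(i, j). (if i = j then 1 else 0) - w j * a i) $$ (i, j) mod int l"
      using ij by simp
  qed simp_all
  also have "\<dots> = (1 - (\<Sum>j<?r. a j * B (base ! j) v) * iv) mod int l"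
    unfolding det_one_minus_rank_one by (simp add: w_def sum_distrib_left mult_ac)
  also have "\<dots> = (1 - ((\<Sum>j<?r. a j * B (base ! j) v) mod int l) * iv) mod int l"
    by (rule mod_strip, (rule cong_strip)+, simp)
  also have "(\<Sum>j<?r. a j * B (base ! j) v) mod int l = (2 * Q v) mod int l"
    using functional_expand[OF is_basis_base vV functional_B'[OF vV]] B_self[OF vV] by (simp add: a_def)
  also have "(1 - (2 * Q v) mod int l * iv) mod int l = (1 - 2 * ((Q v * iv) mod int l)) mod int l"
    by (rule mod_strip, (rule cong_strip)+, simp)
  finally show ?thesis unfolding iv by (simp add: lin_det_eq)
qed

lemma lin_det_range: "lin_det l V g \<in> {0..<int l}"
  using l_gt_1 by (simp add: lin_det_eq)

text \<open>A totally singular image of \<open>N = u - 1\<close> lies in its own complement, the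
  fixed space of \<open>u\<close>; hence \<open>u\<close> acts on it trivially,
  \<open>u ^ k = 1 + k N\<close> and \<open>u ^ l = 1\<close>. The determinant \<open>d\<close>
  satisfies \<open>d ^ l = 1\<close> and, by Fermat, \<open>d ^ (l - 1) = 1\<close>, so
  \<open>d = 1\<close>.\<close>

lemma lin_det_unipotent:
  assumes u: "u \<in> Og" and ts: "tot_sing (img u)"
  shows "lin_det l V u = 1"
proof -
  define N where "N = (\<lambda>x. u x \<oplus> (-1) \<star> x)"
  have NV: "N x \<in> carrier V" and Nu: "u (N x) = N x" and uN: "u x = N x \<oplus> x" if x: "x \<in> carrier V" for x
  proof -
    have "N x \<in> img u" using x by (auto simp: N_def img_def)
    moreover have "img u \<subseteq> fixg u" using tot_sing_subset_perp[OF subsp_img[OF u] ts] perp_img[OF u] by simp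
    ultimately show "N x \<in> carrier V" "u (N x) = N x" by (auto simp: fixg_def)
    show "u x = N x \<oplus> x" using x orth_closed[OF u x] by (simp add: N_def)
  qed
  define pw where "pw = (\<lambda>k::nat. \<lambda>x\<in>carrier V. int k \<star> N x \<oplus> x)"
  have pw0: "pw 0 = (\<lambda>x\<in>carrier V. x)" unfolding pw_def by (rule restrict_ext) (simp add: NV)
  have pwS: "pw (Suc k) = compose (carrier V) u (pw k)" for k
  proof (rule extensionalityI[of _ "carrier V"])
    fix x assume x: "x \<in> carrier V"
    have "u (int k \<star> N x \<oplus> x) = int k \<star> N x \<oplus> (N x \<oplus> x)"
      using x NV[OF x] Nu[OF x] uN[OF x] by (simp add: orth_add[OF u] orth_sc[OF u])
    also have "\<dots> = (int k \<star> N x \<oplus> 1 \<star> N x) \<oplus> x" using x NV[OF x] by (simp add: a_assoc)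
    also have "int k \<star> N x \<oplus> 1 \<star> N x = int (Suc k) \<star> N x"
      unfolding sc_add_left[OF NV[OF x], symmetric] by (simp add: add.commute)
    finally show "pw (Suc k) x = compose (carrier V) u (pw k) x" using x by (simp add: pw_def compose_apply)
  qed (simp_all add: pw_def)
  have pw: "pw k \<in> Og \<and> lin_det l V (pw k) = (lin_det l V u ^ k) mod int l" for k
  proof (induction k)
    case 0 then show ?case unfolding pw0 using id_orth lin_det_id by (simp del: restrict_apply)
  next
    case (Suc k)
    then show ?case unfolding pwS
      using compose_orth[OF u] lin_det_mult[OF u, of "pw k"] by (simp add: mod_simps)
  qed
  have "pw l = (\<lambda>x\<in>carrier V. x)"
  proof (rule extensionalityI[of _ "carrier V"])
    fix x assume x: "x \<in> carrier V"
    have "int l \<star> N x = 0 \<star> N x" by (rule sc_cong) simp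
    then show "pw l x = (\<lambda>x\<in>carrier V. x) x" using x NV[OF x] by (simp add: pw_def)
  qed (simp_all add: pw_def)
  then have p1: "(lin_det l V u ^ l) mod int l = 1" using pw[of l] lin_det_id by simp
  define d where "d = nat (lin_det l V u)"
  have d: "int d = lin_det l V u" using lin_det_range[of u] by (simp add: d_def)
  have nd: "\<not> l dvd d"
  proof
    assume "l dvd d"
    then have "int l dvd lin_det l V u ^ l" using d prime_gt_0_nat[OF prime_l]
      by (metis dvd_power_le dvd_refl int_dvd_int_iff power_one_right dvd_power dvd_trans)
    then show False using p1 by (simp add: mod_eq_0_iff_dvd[symmetric])
  qed
  have "[d ^ (l - 1) = 1] (mod l)" by (rule fermat_theorem[OF prime_l nd])
  then have "[int (d ^ (l - 1)) = int 1] (mod int l)" by (simp only: cong_int_iff)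
  then have f: "[lin_det l V u ^ (l - 1) = 1] (mod int l)" by (simp add: d)
  have "lin_det l V u ^ l = lin_det l V u ^ (l - 1) * lin_det l V u"
    using prime_gt_0_nat[OF prime_l] by (metis Suc_pred' mult.commute power_Suc)
  then have "[lin_det l V u ^ l = 1 * lin_det l V u] (mod int l)"
    using cong_mult[OF f cong_refl] by simp
  then show ?thesis using p1 lin_det_range[of u] by (simp add: cong_def)
qed

lemma lin_det_rmul:
  assumes "v \<in> refls" "g \<in> Og" shows "lin_det l V (rmul v g) = (- lin_det l V g) mod int l"
proof -
  have "lin_det l V (rmul v g) = ((-1) mod int l * lin_det l V g) mod int l"
    unfolding rmul_def using lin_det_mult[OF refl_orth[OF assms(1)] assms(2)] lin_det_refl[OF assms(1)] by simp
  also have "\<dots> = (- lin_det l V g) mod int l" by (rule mod_strip, (rule cong_strip)+, simp)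
  finally show ?thesis .
qed

lemma lin_det_cases:
  assumes "g \<in> Og" shows "lin_det l V g = 1 \<or> lin_det l V g = int l - 1"
  using assms
proof (induction rule: orth_induct)
  case (singular u)
  then show ?case using lin_det_unipotent by simp
next
  case (refl h v)
  have m: "(- 1) mod int l = int l - 1" using l_gt_1 by (simp add: zmod_zminus1_eq_if)
  have "(- (int l - 1)) mod int l = 1" using mod_add_self1[of "int l" "- (int l - 1)"] by simp
  then show ?case using lin_det_rmul[OF refl(2,1)] refl(3) m by auto
qed

text \<open>The difference \<open>1 - dickson l V Q g\<close> is a truncated one; it is the
  complement in \<open>{0, 1}\<close> because of the bound proved along with it.\<close>

lemma dickson_rmul:
  assumes g: "g \<in> Og" and v: "v \<in> refls"
  shows "dickson l V Q (rmul v g) = 1 - dickson l V Q g" and "dickson l V Q g \<le> 1"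
proof -
  have r: "rmul v g \<in> Og" using rmul_orth[OF v g] .
  have "dickson l V Q (rmul v g) = 1 - dickson l V Q g \<and> dickson l V Q g \<le> 1"
  proof (cases "even l")
    case True
    have "rk (rmul v g) mod 2 = 1 - rk g mod 2"
      using rk_rmul_parity[OF g v] by (cases "even (rk g)") (auto simp: odd_iff_mod_2_eq_one even_iff_mod_2_eq_zero)
    then show ?thesis using dickson_even[OF True g] dickson_even[OF True r] by simp
  next
    case False
    have "int l \<noteq> 2" using False by auto
    then have ne: "int l - 1 \<noteq> 1" by linarith
    have m: "(- 1) mod int l = int l - 1" using l_gt_1 by (simp add: zmod_zminus1_eq_if)
    have m': "(- (int l - 1)) mod int l = 1" using mod_add_self1[of "int l" "- (int l - 1)"] by simp
    show ?thesis using lin_det_cases[OF g] lin_det_rmul[OF v g] ne m m' False by (auto simp: dickson_def)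
  qed
  then show "dickson l V Q (rmul v g) = 1 - dickson l V Q g" and "dickson l V Q g \<le> 1" by auto
qed

lemma dickson_id: "dickson l V Q (\<lambda>x\<in>carrier V. x) = 0"
proof (cases "even l")
  case True then show ?thesis using dickson_even[OF True id_orth] rk_id by (simp del: restrict_apply)
next
  case False then show ?thesis using lin_det_id by (simp add: dickson_def del: restrict_apply)
qed

end

subsection \<open>Alternating forms\<close>

context fin_space
begin

lemma functional_add: "functional_on X f \<Longrightarrow> x \<in> X \<Longrightarrow> y \<in> X \<Longrightarrow> f (x \<oplus> y) = (f x + f y) mod int l"
  by (simp add: functional_on_def)

lemma functional_sc: "functional_on X f \<Longrightarrow> x \<in> X \<Longrightarrow> f (a \<star> x) = (a * f x) mod int l"
  by (simp add: functional_on_def)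

lemma functional_mod: "functional_on X f \<Longrightarrow> x \<in> X \<Longrightarrow> f x mod int l = f x"
  by (simp add: functional_on_def)

text \<open>The rank of an alternating form is even. If \<open>b x y\<close> is not zero, the
  vectors orthogonal to \<open>x\<close> and \<open>y\<close> form a subspace \<open>X'\<close> of
  index \<open>l ^ 2\<close>, and passing to \<open>X'\<close> does not change the radical.\<close>

lemma card_alternating:
  assumes "subsp X" and "\<And>x. x \<in> X \<Longrightarrow> functional_on X (b x)" and "\<And>x. x \<in> X \<Longrightarrow> functional_on X (\<lambda>y. b y x)"
    and "\<And>x. x \<in> X \<Longrightarrow> b x x = 0"
  shows "\<exists>k. card X = card {x \<in> X. \<forall>y\<in>X. b x y = 0} * l ^ (2 * k)"
  using assms
proof (induction "card X" arbitrary: X rule: less_induct)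
  case less
  note X = less.prems(1) and fr = less.prems(2) and fl = less.prems(3) and alt = less.prems(4)
  define R where "R = {x \<in> X. \<forall>y\<in>X. b x y = 0}"
  have anti: "b x y = (- b y x) mod int l" if xy: "x \<in> X" "y \<in> X" for x y
  proof -
    have s: "x \<oplus> y \<in> X" using X xy subsp_add by blast
    have "0 = b (x \<oplus> y) (x \<oplus> y)" using alt[OF s] by simp
    also have "\<dots> = ((b x x + b x y) mod int l + (b y x + b y y) mod int l) mod int l"
      using functional_add[OF fl[OF s] xy] functional_add[OF fr[OF xy(1)] xy] functional_add[OF fr[OF xy(2)] xy] by simp
    also have "\<dots> = (b x y + b y x) mod int l" using alt xy by (simp add: mod_simps)
    finally have "int l dvd b x y - (- b y x)" by (simp add: mod_eq_0_iff_dvd)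
    then have "b x y mod int l = (- b y x) mod int l" by (simp only: mod_eq_dvd_iff)
    then show ?thesis using functional_mod[OF fr[OF xy(1)] xy(2)] by simp
  qed
  have b0: "b x y = 0 \<longleftrightarrow> b y x = 0" if "x \<in> X" "y \<in> X" for x y
    using anti[OF that] anti[OF that(2,1)] by auto
  show ?case
  proof (cases "R = X")
    case True
    then show ?thesis unfolding R_def by (intro exI[of _ 0]) simp
  next
    case False
    then obtain x y where xy: "x \<in> X" "y \<in> X" "b x y \<noteq> 0" unfolding R_def by blast
    define K where "K = {z \<in> X. b x z = 0}"
    define X' where "X' = {z \<in> K. b y z = 0}"
    have K: "subsp K" unfolding K_def by (rule subsp_kernel[OF X fr[OF xy(1)]])
    have KX: "K \<subseteq> X" by (auto simp: K_def)
    have fyK: "functional_on K (b y)" by (rule functional_on_subset[OF fr[OF xy(2)] KX])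
    have X': "subsp X'" unfolding X'_def by (rule subsp_kernel[OF K fyK])
    have X'X: "X' \<subseteq> X" using KX by (auto simp: X'_def)
    have xK: "x \<in> K" "b y x \<noteq> 0" using xy alt b0 by (auto simp: K_def)
    have "card X = l * card K" unfolding K_def by (rule card_kernel[OF X fr[OF xy(1)] xy(2,3)])
    moreover have "card K = l * card X'" unfolding X'_def by (rule card_kernel[OF K fyK xK])
    ultimately have cX: "card X = card X' * l ^ 2" by (simp add: power2_eq_square)
    have "card X' < card X"
      unfolding cX using card_subsp_pos[OF X'] one_less_power[OF prime_gt_1_nat[OF prime_l], of 2] by simp
    moreover have "functional_on X' (b z)" "functional_on X' (\<lambda>y. b y z)" "b z z = 0" if "z \<in> X'" for z
      using functional_on_subset[OF fr X'X] functional_on_subset[OF fl X'X] alt that X'X by auto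
    ultimately obtain k where k: "card X' = card {z \<in> X'. \<forall>y\<in>X'. b z y = 0} * l ^ (2 * k)"
      using less.hyps[OF _ X'] by blast
    have "{z \<in> X'. \<forall>y\<in>X'. b z y = 0} = R"
    proof (rule Set.set_eqI, rule iffI)
      fix z assume "z \<in> R"
      then have z: "z \<in> X" "\<And>y. y \<in> X \<Longrightarrow> b z y = 0" by (auto simp: R_def)
      then have "z \<in> X'" using b0 xy z by (auto simp: X'_def K_def)
      then show "z \<in> {z \<in> X'. \<forall>y\<in>X'. b z y = 0}" using z X'X by auto
    next
      fix z assume "z \<in> {z \<in> X'. \<forall>y\<in>X'. b z y = 0}"
      then have z: "z \<in> X'" "z \<in> X" "\<And>y. y \<in> X' \<Longrightarrow> b z y = 0" using X'X by auto
      have zx: "b z x = 0" "b z y = 0" using z b0 xy by (auto simp: X'_def K_def)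
      have "b z w = 0" if w: "w \<in> X" for w
      proof -
        have "b x y mod int l \<noteq> 0" using functional_mod[OF fr[OF xy(1)] xy(2)] xy(3) by simp
        then obtain i where i: "(b x y * i) mod int l = 1" using prime_inverse_mod[OF prime_l] by blast
        then obtain t where t: "b x y * i = 1 + int l * t" by (metis mult_div_mod_eq add.commute)
        \<comment> \<open>The coefficients that make \<open>w + c x + d y\<close> orthogonal to
          \<open>x\<close> and \<open>y\<close>, with \<open>i\<close> the inverse of
          \<open>b x y\<close>. So \<open>w\<close> lies in \<open>X'\<close> up to a vector of the
          plane spanned by \<open>x\<close> and \<open>y\<close>, to which \<open>z\<close> is
          orthogonal.\<close>
        define c where "c = b y w * i"
        define d where "d = - (b x w * i)"
        define w' where "w' = (w \<oplus> c \<star> x) \<oplus> d \<star> y"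
        have mem: "c \<star> x \<in> X" "d \<star> y \<in> X" "w \<oplus> c \<star> x \<in> X" "w' \<in> X"
          unfolding w'_def using X xy w by (auto intro: subsp_add subsp_sc)
        have ev: "b u w' = (b u w + c * b u x + d * b u y) mod int l" if u: "u \<in> X" for u
        proof -
          have "b u w' = ((b u w + (c * b u x) mod int l) mod int l + (d * b u y) mod int l) mod int l"
            unfolding w'_def using functional_add[OF fr[OF u] mem(3,2)] functional_add[OF fr[OF u] w mem(1)]
              functional_sc[OF fr[OF u] xy(1)] functional_sc[OF fr[OF u] xy(2)] by simp
          also have "\<dots> = (b u w + c * b u x + d * b u y) mod int l"
            by (rule mod_strip, (rule cong_strip)+, simp)
          finally show ?thesis .
        qed
        have "b x w' = (b x w + d * b x y) mod int l" using ev[OF xy(1)] alt[OF xy(1)] by simp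
        also have "b x w + d * b x y = int l * (- t * b x w)" unfolding d_def using t by Groebner_Basis.algebra
        finally have bx: "b x w' = 0" by simp
        have "b y w' = (b y w + c * b y x) mod int l" using ev[OF xy(2)] alt[OF xy(2)] by simp
        also have "\<dots> = (b y w - c * b x y) mod int l"
          unfolding anti[OF xy(2,1)] by (rule mod_strip, (rule cong_strip)+, simp)
        also have "b y w - c * b x y = int l * (- t * b y w)" unfolding c_def using t by Groebner_Basis.algebra
        finally have by0: "b y w' = 0" by simp
        have "w' \<in> X'" using bx by0 mem by (simp add: X'_def K_def)
        then have "b z w' = 0" using z by blast
        then have "b z w mod int l = 0" using ev[OF z(2)] zx by simp
        then show ?thesis using functional_mod[OF fr[OF z(2)] w] by simp
      qed
      then show "z \<in> R" using z by (simp add: R_def)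
    qed
    then have "card X = card R * l ^ (2 * Suc k)" using cX k by (simp add: power_add power2_eq_square)
    then show ?thesis unfolding R_def by blast
  qed
qed

definition ldim :: "'v set \<Rightarrow> nat" where "ldim X = (THE k. card X = l ^ k)"

lemma ldim_eqI: "card X = l ^ k \<Longrightarrow> ldim X = k"
  unfolding ldim_def using prime_gt_1_nat[OF prime_l] by (intro the_equality) simp_all

lemma card_ldim: "subsp X \<Longrightarrow> card X = l ^ ldim X"
  using card_subsp_power[of X] ldim_eqI by fastforce

lemma ldim_splus:
  assumes "subsp X" "subsp Y" shows "ldim (splus X Y) + ldim (X \<inter> Y) = ldim X + ldim Y"
proof -
  have "l ^ (ldim (splus X Y) + ldim (X \<inter> Y)) = l ^ (ldim X + ldim Y)"
    using card_splus[OF assms] card_ldim[OF assms(1)] card_ldim[OF assms(2)]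
      card_ldim[OF subsp_Int[OF assms]] card_ldim[OF subsp_splus[OF assms]] by (simp add: power_add)
  then show ?thesis using prime_gt_1_nat[OF prime_l] by simp
qed

lemma ldim_mono_eq: "subsp X \<Longrightarrow> subsp Y \<Longrightarrow> X \<subseteq> Y \<Longrightarrow> ldim X = ldim Y \<Longrightarrow> X = Y"
  using card_subset_eq[OF finite_subsp, of Y X] card_ldim by simp

end

subsection \<open>Lagrangians\<close>

context quad_space
begin

lemma ldim_perp: "subsp X \<Longrightarrow> ldim X + ldim (perp X) = ldim (carrier V)"
proof -
  assume X: "subsp X"
  have "l ^ (ldim X + ldim (perp X)) = l ^ ldim (carrier V)"
    using card_perp[OF X] card_ldim[OF X] card_ldim[OF subsp_perp[OF subsp_subset[OF X]]]
      card_ldim[OF subsp_carrier_V] by (simp add: power_add)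
  then show ?thesis using prime_gt_1_nat[OF prime_l] by simp
qed

text \<open>The Wall form \<open>(u w - w, t) \<mapsto> B(w, t)\<close> on the image of \<open>u - 1\<close> is alternating and nondegenerate.\<close>

lemma even_rk_singular:
  assumes u: "u \<in> Og" and ts: "tot_sing (img u)"
  shows "even (rk u)"
proof -
  define I where "I = img u"
  define N where "N = (\<lambda>x. u x \<oplus> (-1) \<star> x)"
  have I: "subsp I" and pI: "perp I = fixg u" unfolding I_def using subsp_img[OF u] perp_img[OF u] by auto
  have NI: "N x \<in> I" if "x \<in> carrier V" for x using that by (auto simp: I_def img_def N_def)
  have NV: "N x \<in> carrier V" if "x \<in> carrier V" for x using NI[OF that] I subsp_carrier by blast
  have Nadd: "N (x \<oplus> y) = N x \<oplus> N y" if "x \<in> carrier V" "y \<in> carrier V" for x y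
    using that orth_closed[OF u] by (simp add: N_def orth_add[OF u] sc_add_right a_ac)
  have Nsc: "N (a \<star> x) = a \<star> N x" if "x \<in> carrier V" for a x
    using that orth_closed[OF u] by (simp add: N_def orth_sc[OF u] sc_add_right sc_sc mult.commute)
  have N0: "x \<in> fixg u \<longleftrightarrow> N x = \<zero>" if "x \<in> carrier V" for x
    using that orth_closed[OF u that] add_sc_minus_eq_zero_iff by (auto simp: fixg_def N_def)
  define pre where "pre = (\<lambda>s. SOME w. w \<in> carrier V \<and> N w = s)"
  have pre: "pre s \<in> carrier V" "N (pre s) = s" if "s \<in> I" for s
  proof -
    have "\<exists>w. w \<in> carrier V \<and> N w = s" using that by (auto simp: I_def img_def N_def)
    then have "pre s \<in> carrier V \<and> N (pre s) = s" unfolding pre_def by (rule someI_ex)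
    then show "pre s \<in> carrier V" "N (pre s) = s" by auto
  qed
  define b where "b = (\<lambda>s t. B (pre s) t)"
  \<comment> \<open>Two preimages under \<open>N\<close> differ by a fixed vector of
    \<open>u\<close>, which is orthogonal to \<open>I\<close>. The form is therefore independent of
    the choice in \<open>pre\<close>.\<close>
  have bN: "b (N w) t = B w t" if w: "w \<in> carrier V" and t: "t \<in> I" for w t
  proof -
    have tV: "t \<in> carrier V" using t I subsp_carrier by blast
    have p: "pre (N w) \<in> carrier V" "N (pre (N w)) = N w" using pre[OF NI[OF w]] by auto
    have "N (pre (N w) \<oplus> (-1) \<star> w) = \<zero>" using p w NV[OF w] by (simp add: Nadd Nsc)
    then have "pre (N w) \<oplus> (-1) \<star> w \<in> perp I" using N0 pI p w by simp
    then have "B t (pre (N w) \<oplus> (-1) \<star> w) = 0" using t perp_mem by blast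
    then have "(B (pre (N w)) t - B w t) mod int l = 0"
      using p w tV by (simp add: B_simps mod_simps B_sym[of t])
    then have "B (pre (N w)) t mod int l = B w t mod int l" using mod_eq_dvd_iff mod_eq_0_iff_dvd by blast
    then show ?thesis by (simp add: b_def)
  qed
  have "\<exists>k. card I = card {x \<in> I. \<forall>y\<in>I. b x y = 0} * l ^ (2 * k)"
  proof (rule card_alternating[OF I])
    fix s assume s: "s \<in> I"
    show "functional_on I (b s)" unfolding b_def
      by (rule functional_on_subset[OF functional_B[OF pre(1)[OF s]] subsp_subset[OF I]])
    have sV: "s \<in> carrier V" using s I subsp_carrier by blast
    show "functional_on I (\<lambda>t. b t s)" unfolding functional_on_def
    proof (intro conjI ballI allI)
      fix t assume t: "t \<in> I"
      show "b t s \<in> {0..<int l}" unfolding b_def by (rule B_range)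
      have "b (N (a \<star> pre t)) s = (a * B (pre t) s) mod int l" for a
        using bN[OF sc_closed[OF pre(1)[OF t]] s] pre(1)[OF t] sV by (simp add: B_sc_left)
      then show "b (a \<star> t) s = (a * b t s) mod int l" for a
        using Nsc[OF pre(1)[OF t]] pre(2)[OF t] by (simp add: b_def)
      fix t' assume t': "t' \<in> I"
      have "b (N (pre t \<oplus> pre t')) s = (B (pre t) s + B (pre t') s) mod int l"
        using bN[OF _ s, of "pre t \<oplus> pre t'"] pre(1)[OF t] pre(1)[OF t'] sV by (simp add: B_add_left)
      then show "b (t \<oplus> t') s = (b t s + b t' s) mod int l"
        using Nadd[OF pre(1)[OF t] pre(1)[OF t']] pre(2)[OF t] pre(2)[OF t'] by (simp add: b_def)
    qed
    define w where "w = pre s"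
    have w: "w \<in> carrier V" "N w = s" unfolding w_def using pre[OF s] by auto
    have uw: "u w \<in> carrier V" "Q (u w) = Q w" using orth_closed[OF u w(1)] orth_Q[OF u w(1)] by auto
    \<comment> \<open>The diagonal value is \<open>B w (u w - w) = B w (u w) - 2 * Q w\<close>,
      which is the negative of the norm of \<open>u w - w\<close> and so vanishes.\<close>
    have "Q (N w) = (2 * Q w - B w (u w)) mod int l"
      unfolding N_def using w uw by (simp add: B_simps mod_simps B_sym[of "u w" w])
    moreover have "Q (N w) = 0" using ts NI[OF w(1)] by (simp add: tot_sing_def I_def)
    ultimately have d: "int l dvd 2 * Q w - B w (u w)" by (simp add: mod_eq_0_iff_dvd)
    have "B w (N w) = (B w (u w) - 2 * Q w) mod int l"
      unfolding N_def using w uw by (simp add: B_simps mod_simps)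
    also have "\<dots> = 0" using d by (simp add: mod_eq_0_iff_dvd dvd_diff_commute)
    finally show "b s s = 0" using w by (simp add: b_def w_def)
  qed
  then obtain k where k: "card I = card {x \<in> I. \<forall>y\<in>I. b x y = 0} * l ^ (2 * k)" by blast
  \<comment> \<open>If \<open>s = N w\<close> is in the radical, then \<open>w\<close> is orthogonal
    to \<open>I\<close>, hence fixed by \<open>u\<close>, and \<open>s\<close> is zero.\<close>
  have "{x \<in> I. \<forall>y\<in>I. b x y = 0} = {\<zero>}"
  proof (rule Set.set_eqI, rule iffI)
    fix s assume "s \<in> {x \<in> I. \<forall>y\<in>I. b x y = 0}"
    then have s: "s \<in> I" "\<And>t. t \<in> I \<Longrightarrow> B (pre s) t = 0" by (auto simp: b_def)
    have "pre s \<in> perp I" unfolding perp_def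
      using s pre(1)[OF s(1)] I subsp_carrier B_sym by simp
    then show "s \<in> {\<zero>}" using N0[OF pre(1)[OF s(1)]] pI pre(2)[OF s(1)] by simp
  next
    fix s assume "s \<in> {\<zero>}"
    then have s: "s = \<zero>" by simp
    have Z: "\<zero> = N \<zero>" using orth_zero[OF u] by (simp add: N_def)
    have "b \<zero> t = 0" if "t \<in> I" for t
      using bN[OF zero_closed that] Z subsp_carrier[OF I that] by simp
    then show "s \<in> {x \<in> I. \<forall>y\<in>I. b x y = 0}" using s I subsp_zero by simp
  qed
  then have "card I = l ^ (2 * k)" using k by simp
  then have "rk u = 2 * k" using rk_eqI[OF u] by (simp add: I_def)
  then show ?thesis by simp
qed

lemma dickson_singular:
  assumes "u \<in> Og" "tot_sing (img u)" shows "dickson l V Q u = 0"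
proof (cases "even l")
  case True then show ?thesis using dickson_even[OF True assms(1)] even_rk_singular[OF assms] by simp
next
  case False then show ?thesis using lin_det_unipotent[OF assms] by (simp add: dickson_def)
qed

section \<open>The two families of Lagrangians\<close>

definition lagr :: "'v set \<Rightarrow> bool" where
  "lagr A \<longleftrightarrow> subsp A \<and> tot_sing A \<and> 2 * ldim A = ldim (carrier V)"

lemma lagrD: "lagr A \<Longrightarrow> subsp A" "lagr A \<Longrightarrow> tot_sing A" "lagr A \<Longrightarrow> 2 * ldim A = ldim (carrier V)"
  by (simp_all add: lagr_def)

lemma perp_lagr:
  assumes A: "lagr A" shows "perp A = A"
proof -
  have "ldim (perp A) = ldim A" using ldim_perp[OF lagrD(1)[OF A]] lagrD(3)[OF A] by simp
  then show ?thesis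
    using ldim_mono_eq[OF lagrD(1)[OF A] subsp_perp[OF subsp_subset[OF lagrD(1)[OF A]]]]
      tot_sing_subset_perp[OF lagrD(1,2)[OF A]] A by simp
qed

text \<open>Lagrangians fall into two families, and this relation says that \<open>A\<close> and
  \<open>C\<close> lie in different ones: the codimension of the intersection in \<open>A\<close> is
  odd. The sum has the parity of the difference and avoids subtraction.\<close>

definition opp :: "'v set \<Rightarrow> 'v set \<Rightarrow> bool" where "opp A C \<longleftrightarrow> odd (ldim A + ldim (A \<inter> C))"

lemma opp_self: "\<not> opp A A"
  by (simp add: opp_def)

text \<open>
  On \<open>(A + C) \<inter> D\<close> the form \<open>(a + c, a' + c') \<mapsto> B(a, c')\<close> is alternating with radical
  \<open>(A \<inter> D) + (C \<inter> D)\<close>; the evenness of its rank is the claim.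
\<close>

lemma opp_trans:
  assumes A: "lagr A" and C: "lagr C" and D: "lagr D"
  shows "opp A D \<longleftrightarrow> (opp A C \<noteq> opp C D)"
proof -
  note sA = lagrD(1)[OF A] and sC = lagrD(1)[OF C] and sD = lagrD(1)[OF D]
  note tA = lagrD(2)[OF A] and tC = lagrD(2)[OF C] and tD = lagrD(2)[OF D]
  define X where "X = splus A C \<inter> D"
  have X: "subsp X" unfolding X_def by (rule subsp_Int[OF subsp_splus[OF sA sC] sD])
  have XV: "x \<in> carrier V" if "x \<in> X" for x using subsp_carrier[OF X that] .
  define pa where "pa = (\<lambda>d. SOME a. a \<in> A \<and> (\<exists>c\<in>C. d = a \<oplus> c))"
  have pa: "pa d \<in> A" "\<exists>c\<in>C. d = pa d \<oplus> c" if "d \<in> X" for d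
  proof -
    have "\<exists>a. a \<in> A \<and> (\<exists>c\<in>C. d = a \<oplus> c)" using that by (auto simp: X_def splus_def)
    then have "pa d \<in> A \<and> (\<exists>c\<in>C. d = pa d \<oplus> c)" unfolding pa_def by (rule someI_ex)
    then show "pa d \<in> A" "\<exists>c\<in>C. d = pa d \<oplus> c" by auto
  qed
  have paV: "pa d \<in> carrier V" if "d \<in> X" for d using pa(1)[OF that] sA subsp_carrier by blast
  define b where "b = (\<lambda>d d'. B (pa d) d')"
  \<comment> \<open>The choice made in \<open>pa\<close> is ambiguous by a vector of
    \<open>A \<inter> C\<close>, which is orthogonal to \<open>A + C\<close>, so the form does not
    depend on it.\<close>
  have bI: "b (a \<oplus> c) d' = B a d'" if a: "a \<in> A" and c: "c \<in> C" and m: "a \<oplus> c \<in> X" and d': "d' \<in> X" for a c d'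
  proof -
    obtain c1 where c1: "c1 \<in> C" "a \<oplus> c = pa (a \<oplus> c) \<oplus> c1" using pa(2)[OF m] by blast
    define p where "p = pa (a \<oplus> c)"
    have p: "p \<in> A" "p \<in> carrier V" unfolding p_def using pa(1)[OF m] paV[OF m] by auto
    have V: "a \<in> carrier V" "c \<in> carrier V" "c1 \<in> carrier V" using a c c1 sA sC subsp_carrier by auto
    define e where "e = p \<oplus> (-1) \<star> a"
    have eA: "e \<in> A" unfolding e_def using p a sA by (intro subsp_add subsp_sc)
    have "c = (-1) \<star> a \<oplus> (p \<oplus> c1)" using c1(2) V p unfolding p_def[symmetric]
      by (metis add_sc_minus_cancel(5))
    then have "c = e \<oplus> c1" using V p by (simp add: e_def a_ac)
    then have "e = c \<oplus> (-1) \<star> c1" using V p by (simp add: e_def)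
    then have eC: "e \<in> C" using c c1(1) sC by (simp add: subsp_add subsp_sc)
    have eV: "e \<in> carrier V" using eA sA subsp_carrier by blast
    obtain a' c' where d'eq: "d' = a' \<oplus> c'" "a' \<in> A" "c' \<in> C" using d' by (auto simp: X_def splus_def)
    have V': "a' \<in> carrier V" "c' \<in> carrier V" using d'eq sA sC subsp_carrier by auto
    have "B e a' = 0" "B e c' = 0"
      using tot_sing_B[OF sA tA eA d'eq(2)] tot_sing_B[OF sC tC eC d'eq(3)] by auto
    then have "B e d' = 0" using d'eq(1) V' eV by (simp add: B_add_right)
    moreover have "p = e \<oplus> a" unfolding e_def using V p by simp
    ultimately show ?thesis unfolding b_def p_def[symmetric] using eV V XV[OF d'] by (simp add: B_add_left)
  qed
  have "\<exists>k. card X = card {x \<in> X. \<forall>y\<in>X. b x y = 0} * l ^ (2 * k)"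
  proof (rule card_alternating[OF X])
    fix d assume d: "d \<in> X"
    show "functional_on X (b d)" unfolding b_def
      by (rule functional_on_subset[OF functional_B[OF paV[OF d]] subsp_subset[OF X]])
    show "functional_on X (\<lambda>t. b t d)" unfolding functional_on_def
    proof (intro conjI ballI allI)
      fix t assume t: "t \<in> X"
      show "b t d \<in> {0..<int l}" unfolding b_def by (rule B_range)
      obtain c where c: "c \<in> C" "t = pa t \<oplus> c" using pa(2)[OF t] by blast
      have cV: "c \<in> carrier V" using c sC subsp_carrier by blast
      show "b (x \<star> t) d = (x * b t d) mod int l" for x
      proof -
        have e: "x \<star> t = x \<star> pa t \<oplus> x \<star> c" using c(2) cV paV[OF t] sc_add_right by metis
        have m: "x \<star> pa t \<oplus> x \<star> c \<in> X" unfolding e[symmetric] by (rule subsp_sc[OF X t])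
        have "b (x \<star> pa t \<oplus> x \<star> c) d = B (x \<star> pa t) d"
          by (rule bI[OF subsp_sc[OF sA pa(1)[OF t]] subsp_sc[OF sC c(1)] m d])
        then show ?thesis unfolding e using B_sc_left[OF paV[OF t] XV[OF d]] by (simp add: b_def)
      qed
      fix t' assume t': "t' \<in> X"
      obtain c' where c': "c' \<in> C" "t' = pa t' \<oplus> c'" using pa(2)[OF t'] by blast
      have c'V: "c' \<in> carrier V" using c' sC subsp_carrier by blast
      have e: "t \<oplus> t' = (pa t \<oplus> pa t') \<oplus> (c \<oplus> c')"
      proof -
        have "t \<oplus> t' = (pa t \<oplus> c) \<oplus> (pa t' \<oplus> c')" using c(2) c'(2) by simp
        also have "\<dots> = (pa t \<oplus> pa t') \<oplus> (c \<oplus> c')" using cV c'V paV[OF t] paV[OF t'] by (simp only: a_ac a_closed)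
        finally show ?thesis .
      qed
      have m: "(pa t \<oplus> pa t') \<oplus> (c \<oplus> c') \<in> X" unfolding e[symmetric] by (rule subsp_add[OF X t t'])
      have "b ((pa t \<oplus> pa t') \<oplus> (c \<oplus> c')) d = B (pa t \<oplus> pa t') d"
        by (rule bI[OF subsp_add[OF sA pa(1)[OF t] pa(1)[OF t']] subsp_add[OF sC c(1) c'(1)] m d])
      then show "b (t \<oplus> t') d = (b t d + b t' d) mod int l"
        unfolding e using B_add_left[OF paV[OF t] paV[OF t'] XV[OF d]] by (simp add: b_def)
    qed
    obtain c where c: "c \<in> C" "d = pa d \<oplus> c" using pa(2)[OF d] by blast
    have cV: "c \<in> carrier V" using c sC subsp_carrier by blast
    have z: "Q d = 0" "Q (pa d) = 0" "Q c = 0" using d tD tA tC pa(1)[OF d] c by (auto simp: X_def tot_sing_def)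
    \<comment> \<open>For \<open>d = a + c\<close> all three of \<open>d\<close>, \<open>a\<close>,
      \<open>c\<close> are singular, so \<open>B a c = 0\<close>, and the form vanishes on the
      diagonal.\<close>
    have "B (pa d) c = (Q d - Q (pa d) - Q c) mod int l" using c(2) by (simp add: polar_def)
    then have "B (pa d) c = 0" using z by simp
    then have "B (pa d) (pa d \<oplus> c) = 0" using cV paV[OF d] z by (simp add: B_add_right B_self)
    then show "b d d = 0" using c(2) by (simp add: b_def)
  qed
  then obtain k where k: "card X = card {x \<in> X. \<forall>y\<in>X. b x y = 0} * l ^ (2 * k)" by blast
  define R where "R = splus (A \<inter> D) (C \<inter> D)"
  have sAD: "subsp (A \<inter> D)" and sCD: "subsp (C \<inter> D)" and sAC: "subsp (A \<inter> C)"
    using subsp_Int sA sC sD by auto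
  have R: "subsp R" unfolding R_def by (rule subsp_splus[OF sAD sCD])
  have pX: "perp X = splus (A \<inter> C) D"
  proof -
    have "X = perp (splus (A \<inter> C) D)"
    proof -
      have "perp (splus A C) = A \<inter> C" using perp_splus[OF sA sC] perp_lagr A C by simp
      then have "splus A C = perp (A \<inter> C)" using perp_perp[OF subsp_splus[OF sA sC]] by simp
      then show ?thesis unfolding X_def using perp_splus[OF sAC sD] perp_lagr[OF D] by simp
    qed
    then show ?thesis using perp_perp[OF subsp_splus[OF sAC sD]] by simp
  qed
  have "{x \<in> X. \<forall>y\<in>X. b x y = 0} = R"
  proof (rule Set.set_eqI, rule iffI)
    fix d assume "d \<in> {x \<in> X. \<forall>y\<in>X. b x y = 0}"
    then have d: "d \<in> X" "\<And>y. y \<in> X \<Longrightarrow> B (pa d) y = 0" by (auto simp: b_def)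
    obtain c where c: "c \<in> C" "d = pa d \<oplus> c" using pa(2)[OF d(1)] by blast
    have cV: "c \<in> carrier V" using c sC subsp_carrier by blast
    \<comment> \<open>In the radical the component in \<open>A\<close> is orthogonal to
      \<open>X\<close>, hence in \<open>(A \<inter> C) + D\<close>. Moving its part in
      \<open>A \<inter> C\<close> over to the other component puts both components into
      \<open>D\<close>.\<close>
    have "pa d \<in> perp X" unfolding perp_def using d(2) B_sym paV[OF d(1)] XV by simp
    then obtain e f where ef: "pa d = e \<oplus> f" "e \<in> A \<inter> C" "f \<in> D" unfolding pX by (auto simp: splus_def)
    have V: "e \<in> carrier V" "f \<in> carrier V" using ef sAC sD subsp_carrier by auto
    have fA: "f \<in> A"
    proof -
      have "(-1) \<star> e \<oplus> pa d \<in> A" using ef pa(1)[OF d(1)] sA by (intro subsp_add subsp_sc) auto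
      then show ?thesis using ef(1) V by simp
    qed
    have dV: "d \<in> carrier V" and dD: "d \<in> D" using d(1) XV by (auto simp: X_def)
    have dd: "d = f \<oplus> (e \<oplus> c)" using c(2) ef(1) V cV by (metis a_assoc a_comm)
    then have "e \<oplus> c = (-1) \<star> f \<oplus> d" using V cV by simp
    then have "e \<oplus> c \<in> D" using dD ef(3) sD by (simp add: subsp_add subsp_sc)
    moreover have "e \<oplus> c \<in> C" using ef c(1) sC by (auto intro: subsp_add)
    ultimately show "d \<in> R" unfolding R_def dd using fA ef(3) by (intro splus_memI) auto
  next
    fix d assume "d \<in> R"
    then obtain a c where ac: "d = a \<oplus> c" "a \<in> A" "a \<in> D" "c \<in> C" "c \<in> D" by (auto simp: R_def splus_def)
    have dX: "a \<oplus> c \<in> X" unfolding X_def using ac sD by (auto intro: splus_memI subsp_add)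
    have "b (a \<oplus> c) y = 0" if y: "y \<in> X" for y
      using bI[OF ac(2,4) dX y] tot_sing_B[OF sD tD ac(3), of y] y by (simp add: X_def)
    then show "d \<in> {x \<in> X. \<forall>y\<in>X. b x y = 0}" using dX ac(1) by simp
  qed
  then have "card X = card R * l ^ (2 * k)" using k by simp
  then have "card X = l ^ (ldim R + 2 * k)" using card_ldim[OF R] by (simp add: power_add)
  then have 1: "ldim X = ldim R + 2 * k" by (rule ldim_eqI)
  have 2: "ldim X + ldim (splus (A \<inter> C) D) = ldim (carrier V)" using ldim_perp[OF X] pX by simp
  have 3: "ldim (splus (A \<inter> C) D) + ldim (A \<inter> C \<inter> D) = ldim (A \<inter> C) + ldim D" by (rule ldim_splus[OF sAC sD])
  have "A \<inter> D \<inter> (C \<inter> D) = A \<inter> C \<inter> D" by blast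
  then have 4: "ldim R + ldim (A \<inter> C \<inter> D) = ldim (A \<inter> D) + ldim (C \<inter> D)"
    using ldim_splus[OF sAD sCD] by (simp add: R_def)
  have 5: "ldim A = ldim D" "ldim C = ldim D" "ldim (carrier V) = 2 * ldim D"
    using lagrD(3)[OF A] lagrD(3)[OF C] lagrD(3)[OF D] by auto
  \<comment> \<open>All Lagrangians have the same dimension, so modulo 2 the three intersection
    dimensions add up to that of one Lagrangian. This is the claimed relation between the three
    parities.\<close>
  have "ldim (A \<inter> D) + ldim (C \<inter> D) + ldim (A \<inter> C) + 2 * k = ldim D + 2 * ldim (A \<inter> C \<inter> D)"
    using 1 2 3 4 5 by linarith
  then have "even (ldim (A \<inter> D) + ldim (C \<inter> D) + ldim (A \<inter> C) + ldim D)" by presburger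
  then show ?thesis unfolding opp_def 5 by auto
qed

lemma opp_sym: "lagr A \<Longrightarrow> lagr C \<Longrightarrow> opp A C \<longleftrightarrow> opp C A"
  using opp_trans[of A C A] opp_self by blast

lemma subsp_orth_image:
  assumes g: "g \<in> Og" and X: "subsp X"
  shows "subsp (g ` X)" "card (g ` X) = card X" "tot_sing X \<Longrightarrow> tot_sing (g ` X)"
proof -
  have XV: "x \<in> carrier V" if "x \<in> X" for x using subsp_carrier[OF X that] .
  show "subsp (g ` X)"
  proof (rule subspI)
    show "g ` X \<subseteq> carrier V" using orth_closed[OF g] XV by auto
    show "\<zero> \<in> g ` X" using orth_zero[OF g] subsp_zero[OF X] by (metis image_eqI)
    show "y \<oplus> z \<in> g ` X" if yz: "y \<in> g ` X" "z \<in> g ` X" for y z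
    proof -
      obtain y' z' where "y' \<in> X" "z' \<in> X" "y = g y'" "z = g z'" using yz by blast
      then have "y \<oplus> z = g (y' \<oplus> z')" "y' \<oplus> z' \<in> X" using orth_add[OF g] XV subsp_add[OF X] by auto
      then show ?thesis by blast
    qed
    show "a \<star> y \<in> g ` X" if y: "y \<in> g ` X" for a y
    proof -
      obtain y' where "y' \<in> X" "y = g y'" using y by blast
      then have "a \<star> y = g (a \<star> y')" "a \<star> y' \<in> X" using orth_sc[OF g] XV subsp_sc[OF X] by auto
      then show ?thesis by blast
    qed
  qed
  show "card (g ` X) = card X"
    using orth_inj[OF g] XV by (intro card_image inj_onI) blast
  show "tot_sing X \<Longrightarrow> tot_sing (g ` X)" using orth_Q[OF g] XV by (auto simp: tot_sing_def)
qed

lemma ldim_orth_image: "g \<in> Og \<Longrightarrow> subsp X \<Longrightarrow> ldim (g ` X) = ldim X"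
  by (simp add: ldim_def subsp_orth_image(2))

lemma lagr_orth_image: "g \<in> Og \<Longrightarrow> lagr A \<Longrightarrow> lagr (g ` A)"
  using subsp_orth_image ldim_orth_image unfolding lagr_def by simp

lemma opp_orth_image:
  assumes g: "g \<in> Og" and A: "lagr A" and C: "lagr C"
  shows "opp (g ` A) (g ` C) \<longleftrightarrow> opp A C"
proof -
  have "inj_on g (carrier V)" using orth_inj[OF g] by (intro inj_onI) blast
  then have "g ` A \<inter> g ` C = g ` (A \<inter> C)"
    using inj_on_image_Int[of g "carrier V" A C] subsp_subset lagrD(1) A C by blast
  then show ?thesis
    unfolding opp_def using ldim_orth_image[OF g] subsp_Int lagrD(1) A C by simp
qed

text \<open>A vector common to \<open>A\<close> and its mirror image is orthogonal to
  \<open>v\<close>, because \<open>v\<close> is not in \<open>A\<close>. As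
  \<open>A = perp A\<close>, the functional \<open>B v\<close> is nonzero on \<open>A\<close>, so
  the intersection is a hyperplane of \<open>A\<close>.\<close>

lemma opp_refl:
  assumes v: "v \<in> refls" and A: "lagr A" shows "opp A (reflection l V Q v ` A)"
proof -
  note sA = lagrD(1)[OF A] and tA = lagrD(2)[OF A]
  have vV: "v \<in> carrier V" "Q v \<noteq> 0" using reflD[OF v] by auto
  have vA: "v \<notin> A" using tA vV by (auto simp: tot_sing_def)
  have AV: "a \<in> carrier V" if "a \<in> A" for a using subsp_carrier[OF sA that] .
  have eq: "A \<inter> reflection l V Q v ` A = {a \<in> A. B v a = 0}"
  proof (rule Set.set_eqI, rule iffI)
    fix x assume "x \<in> A \<inter> reflection l V Q v ` A"
    then obtain a where a: "x \<in> A" "a \<in> A" "x = reflection l V Q v a" by blast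
    obtain c where c: "x = a \<oplus> c \<star> v" using a(3) refl_apply[OF v AV[OF a(2)]] by auto
    have "(-1) \<star> a \<oplus> x \<in> A" using a sA by (intro subsp_add subsp_sc)
    then have "c \<star> v \<in> A" using c AV[OF a(2)] vV by simp
    then have "c mod int l = 0" using sc_mem_cancel[OF sA _ _ vV(1)] vA by blast
    then have "c \<star> v = 0 \<star> v" by (intro sc_cong) simp
    then have "x = a" using c AV[OF a(2)] vV by simp
    then have "B x v = 0" using a(3) refl_fix_iff[OF v AV[OF a(2)]] by simp
    then show "x \<in> {a \<in> A. B v a = 0}" using a(1) B_sym[OF vV(1) AV[OF a(1)]] by simp
  next
    fix x assume x: "x \<in> {a \<in> A. B v a = 0}"
    then have xV: "x \<in> carrier V" using AV by blast
    have "B x v = 0" using x B_sym[OF vV(1) xV] by simp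
    then have "reflection l V Q v x = x" by (rule refl_fix[OF v xV])
    then show "x \<in> A \<inter> reflection l V Q v ` A" using x by (metis (no_types, lifting) IntI image_eqI mem_Collect_eq)
  qed
  obtain a where a: "a \<in> A" "B v a \<noteq> 0"
  proof (rule ccontr)
    assume "\<not> thesis"
    then have "\<forall>a\<in>A. B v a = 0" using that by blast
    then have "v \<in> perp A" using vV AV B_sym by (simp add: perp_def)
    then show False using vA perp_lagr[OF A] by simp
  qed
  have f: "functional_on A (B v)" by (rule functional_on_subset[OF functional_B[OF vV(1)] subsp_subset[OF sA]])
  have "card A = l * card {a \<in> A. B v a = 0}" by (rule card_kernel[OF sA f a])
  then have "card A = l ^ Suc (ldim {a \<in> A. B v a = 0})" using card_ldim[OF subsp_kernel[OF sA f]] by simp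
  then have "ldim A = Suc (ldim {a \<in> A. B v a = 0})" by (rule ldim_eqI)
  then show ?thesis unfolding opp_def eq by simp
qed

text \<open>The space \<open>(E \<inter> perp I) + I\<close> is totally singular. What is lost in
  cutting \<open>E\<close> down to \<open>perp I\<close> is regained by adding \<open>I\<close>, so
  its dimension is that of \<open>E\<close>.\<close>

lemma ex_lagr_supset:
  assumes E: "lagr E" and I: "subsp I" "tot_sing I"
  shows "\<exists>A. lagr A \<and> I \<subseteq> A"
proof -
  note sE = lagrD(1)[OF E] and tE = lagrD(2)[OF E]
  have pI: "subsp (perp I)" using subsp_perp[OF subsp_subset[OF I(1)]] .
  have Ip: "I \<subseteq> perp I" by (rule tot_sing_subset_perp[OF I])
  define A where "A = splus (E \<inter> perp I) I"
  have sEp: "subsp (E \<inter> perp I)" by (rule subsp_Int[OF sE pI])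
  have sA: "subsp A" unfolding A_def by (rule subsp_splus[OF sEp I(1)])
  have "tot_sing A" unfolding tot_sing_def
  proof
    fix x assume "x \<in> A"
    then obtain e i where x: "x = e \<oplus> i" "e \<in> E" "e \<in> perp I" "i \<in> I" by (auto simp: A_def splus_def)
    have V: "e \<in> carrier V" "i \<in> carrier V" using x sE I(1) subsp_carrier by auto
    have "B i e = 0" "Q e = 0" "Q i = 0" using x tE I(2) perp_mem by (auto simp: tot_sing_def)
    then show "Q x = 0" using x V by (simp add: Q_add B_sym[of e i])
  qed
  moreover have "2 * ldim A = ldim (carrier V)"
  proof -
    have "E \<inter> perp I = perp (splus E I)" using perp_splus[OF sE I(1)] perp_lagr[OF E] by simp
    then have "ldim (splus E I) + ldim (E \<inter> perp I) = ldim (carrier V)"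
      using ldim_perp[OF subsp_splus[OF sE I(1)]] by simp
    moreover have "ldim (splus E I) + ldim (E \<inter> I) = ldim E + ldim I" by (rule ldim_splus[OF sE I(1)])
    moreover have "E \<inter> perp I \<inter> I = E \<inter> I" using Ip by blast
    then have "ldim A + ldim (E \<inter> I) = ldim (E \<inter> perp I) + ldim I"
      using ldim_splus[OF sEp I(1)] by (simp add: A_def)
    ultimately show ?thesis using lagrD(3)[OF E] by linarith
  qed
  moreover have "I \<subseteq> A" unfolding A_def by (rule splus_upper(2)[OF sEp I(1)])
  ultimately show ?thesis using sA by (auto simp: lagr_def)
qed

text \<open>A map with totally singular image of \<open>u - 1\<close> fixes pointwise every
  Lagrangian that contains this image, so it preserves the families. Every reflection exchanges
  them. Both facts match the behaviour of the Dickson invariant along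
  \<open>orth_induct\<close>.\<close>

lemma dickson_eq_opp:
  assumes E: "lagr E" and g: "g \<in> Og"
  shows "dickson l V Q g = (if opp E (g ` E) then 1 else 0)"
  using g
proof (induction rule: orth_induct)
  case (singular u)
  note u = singular(1) and ts = singular(2)
  obtain A where A: "lagr A" "img u \<subseteq> A" using ex_lagr_supset[OF E subsp_img[OF u] ts] by blast
  have "A \<subseteq> fixg u" using perp_antimono[OF A(2)] perp_lagr[OF A(1)] perp_img[OF u] by simp
  then have "u ` A = A" by (auto simp: fixg_def image_iff subset_iff)
  then have "opp A (u ` E) \<longleftrightarrow> opp A E" using opp_orth_image[OF u A(1) E] by simp
  then have "\<not> opp E (u ` E)"
    using opp_trans[OF E A(1) lagr_orth_image[OF u E]] opp_sym[OF E A(1)] by blast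
  then show ?case using dickson_singular[OF u ts] by simp
next
  case (refl h v)
  note h = refl(1) and v = refl(2)
  have hE: "lagr (h ` E)" by (rule lagr_orth_image[OF h E])
  have im: "rmul v h ` E = reflection l V Q v ` (h ` E)"
    using subsp_carrier[OF lagrD(1)[OF E]] by (auto simp: rmul_apply image_image intro!: image_cong)
  have rE: "lagr (reflection l V Q v ` (h ` E))" by (rule lagr_orth_image[OF refl_orth[OF v] hE])
  have "opp E (rmul v h ` E) \<longleftrightarrow> \<not> opp E (h ` E)"
    unfolding im using opp_trans[OF E hE rE] opp_refl[OF v hE] by blast
  then show ?case using dickson_rmul(1)[OF h v] refl(3) by simp
qed

text \<open>Multiplicativity is not visible from ranks. It follows from the action on the two
  families of Lagrangians.\<close>

lemma dickson_compose:
  assumes E: "lagr E" and g: "g \<in> Og" and h: "h \<in> Og"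
  shows "dickson l V Q (compose (carrier V) g h) = 0 \<longleftrightarrow> dickson l V Q g = dickson l V Q h"
proof -
  have im: "compose (carrier V) g h ` E = g ` (h ` E)"
    using subsp_carrier[OF lagrD(1)[OF E]] by (auto simp: compose_apply image_image intro!: image_cong)
  have "opp E (g ` (h ` E)) \<longleftrightarrow> (opp E (g ` E) \<noteq> opp E (h ` E))"
    using opp_trans[OF E lagr_orth_image[OF g E] lagr_orth_image[OF g lagr_orth_image[OF h E]]]
      opp_orth_image[OF g E lagr_orth_image[OF h E]] by simp
  then show ?thesis
    using dickson_eq_opp[OF E g] dickson_eq_opp[OF E h] dickson_eq_opp[OF E compose_orth[OF g h]] im by simp
qed

end

subsection \<open>Orbits of the special orthogonal group\<close>

context quad_space
begin

lemma special_orth_carrier: "carrier (special_orth l V Q) = {g \<in> Og. dickson l V Q g = 0}"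
  by (simp add: special_orth_def)

lemma orth_adj_image:
  assumes g: "g \<in> Og" and X: "subsp X" and x: "x \<in> carrier V"
  shows "adj (g x) (g ` X) = g ` adj x X"
proof
  have XV: "y \<in> carrier V" if "y \<in> X" for y using subsp_carrier[OF X that] .
  show "adj (g x) (g ` X) \<subseteq> g ` adj x X"
  proof
    fix z assume "z \<in> adj (g x) (g ` X)"
    then obtain a y' where z: "z = a \<star> g x \<oplus> y'" "y' \<in> g ` X" by (rule adjE)
    then obtain y where y: "y \<in> X" "y' = g y" by blast
    have "z = g (a \<star> x \<oplus> y)" using z y XV[OF y(1)] x by (simp add: orth_add[OF g] orth_sc[OF g])
    then show "z \<in> g ` adj x X" using adjI[OF y(1)] by blast
  qed
  show "g ` adj x X \<subseteq> adj (g x) (g ` X)"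
  proof
    fix z assume "z \<in> g ` adj x X"
    then obtain w where w: "z = g w" "w \<in> adj x X" by blast
    obtain a y where wy: "w = a \<star> x \<oplus> y" "y \<in> X" using w(2) by (rule adjE)
    have "z = a \<star> g x \<oplus> g y" using w wy XV[OF wy(2)] x by (simp add: orth_add[OF g] orth_sc[OF g])
    then show "z \<in> adj (g x) (g ` X)" using adjI[of "g y" "g ` X"] wy(2) by blast
  qed
qed

lemma tspan_orth_image:
  assumes g: "g \<in> Og"
  shows "(\<And>i. i < k \<Longrightarrow> x i \<in> carrier V) \<Longrightarrow> (\<And>i. i < k \<Longrightarrow> y i = g (x i)) \<Longrightarrow> tspan k y = g ` tspan k x"
proof (induction k)
  case 0 then show ?case using orth_zero[OF g] by simp
next
  case (Suc k)
  then have "tspan k y = g ` tspan k x" by simp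
  then show ?case using orth_adj_image[OF g subsp_tspan, of k x "x k"] Suc.prems by simp
qed

text \<open>Each adjoined vector multiplies the size by at most \<open>l\<close>, so a span of the
  maximal size leaves no room for a step that adds nothing.\<close>

lemma tspan_independent_step:
  assumes x: "\<And>i. i < Suc k \<Longrightarrow> x i \<in> carrier V" and c: "card (tspan (Suc k) x) = l ^ Suc k"
  shows "card (tspan k x) = l ^ k" "x k \<notin> tspan k x"
proof -
  have xk: "\<And>i. i < k \<Longrightarrow> x i \<in> carrier V" "x k \<in> carrier V" using x by simp_all
  have W: "subsp (tspan k x)" using subsp_tspan[of k x] xk by simp
  have le: "card (tspan k x) \<le> l ^ k" using card_tspan_le[of k x] xk by simp
  have l1: "l > 1" using prime_gt_1_nat[OF prime_l] .
  show xn: "x k \<notin> tspan k x"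
  proof
    assume "x k \<in> tspan k x"
    then have "l ^ Suc k \<le> l ^ k" using c adj_absorb[OF W] le by simp
    then show False using l1 power_strict_increasing[of k "Suc k" l] by simp
  qed
  have "card (tspan (Suc k) x) = l * card (tspan k x)" using card_adj[OF W xk(2) xn] by simp
  then show "card (tspan k x) = l ^ k" using c l1 by simp
qed

lemma tot_sing_mono: "tot_sing Y \<Longrightarrow> X \<subseteq> Y \<Longrightarrow> tot_sing X"
  by (auto simp: tot_sing_def)

text \<open>Inside a totally singular span all norms and products vanish, so the hypotheses of
  \<open>witt_step\<close> hold automatically at every entry.\<close>

lemma transitive_on_frames:
  assumes "\<And>i. i < k \<Longrightarrow> x i \<in> carrier V" "\<And>i. i < k \<Longrightarrow> y i \<in> carrier V"
    "card (tspan k x) = l ^ k" "card (tspan k y) = l ^ k" "tot_sing (tspan k x)" "tot_sing (tspan k y)"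
  shows "\<exists>g\<in>Og. \<forall>i<k. g (x i) = y i"
  using assms
proof (induction k)
  case 0 then show ?case using id_orth by blast
next
  case (Suc k)
  note x = Suc.prems(1) and y = Suc.prems(2)
  have xk: "\<And>i. i < k \<Longrightarrow> x i \<in> carrier V" "x k \<in> carrier V" using x by simp_all
  have yk: "\<And>i. i < k \<Longrightarrow> y i \<in> carrier V" "y k \<in> carrier V" using y by simp_all
  have X: "card (tspan k x) = l ^ k" "x k \<notin> tspan k x"
    using tspan_independent_step[of k x] x Suc.prems(3) by simp_all
  have Y: "card (tspan k y) = l ^ k" "y k \<notin> tspan k y"
    using tspan_independent_step[of k y] y Suc.prems(4) by simp_all
  have Wx: "subsp (tspan k x)" "subsp (tspan (Suc k) x)" using subsp_tspan[of k x] subsp_tspan[of "Suc k" x] xk x by simp_all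
  have Wy: "subsp (tspan k y)" "subsp (tspan (Suc k) y)" using subsp_tspan[of k y] subsp_tspan[of "Suc k" y] yk y by simp_all
  have sx: "tspan k x \<subseteq> tspan (Suc k) x" "x k \<in> tspan (Suc k) x" using adj_upper[OF Wx(1) xk(2)] adj_self[OF Wx(1) xk(2)] by simp_all
  have sy: "tspan k y \<subseteq> tspan (Suc k) y" "y k \<in> tspan (Suc k) y" using adj_upper[OF Wy(1) yk(2)] adj_self[OF Wy(1) yk(2)] by simp_all
  obtain g where g: "g \<in> Og" "\<forall>i<k. g (x i) = y i"
    using Suc.IH[OF xk(1) yk(1) X(1) Y(1) tot_sing_mono[OF Suc.prems(5) sx(1)] tot_sing_mono[OF Suc.prems(6) sy(1)]] by blast
  have im: "tspan k y = g ` tspan k x" using tspan_orth_image[OF g(1), of k x y] xk g(2) by simp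
  have gx: "g (x k) \<in> carrier V" using orth_closed[OF g(1) xk(2)] .
  have gn: "g (x k) \<notin> tspan k y"
  proof
    assume "g (x k) \<in> tspan k y"
    then obtain u where u: "u \<in> tspan k x" "g (x k) = g u" unfolding im by blast
    then have "x k = u" using orth_inj[OF g(1) xk(2)] subsp_carrier[OF Wx(1)] by blast
    then show False using u X by simp
  qed
  have "Q (g (x k)) = Q (y k)"
    using orth_Q[OF g(1) xk(2)] Suc.prems(5,6) sx(2) sy(2) unfolding tot_sing_def by simp
  moreover have "B (g (x k)) u = B (y k) u" if u: "u \<in> tspan k y" for u
  proof -
    obtain u' where u': "u' \<in> tspan k x" "u = g u'" using u unfolding im by blast
    have "B (x k) u' = 0" using tot_sing_B[OF Wx(2) Suc.prems(5) sx(2)] u'(1) sx(1) by blast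
    then have "B (g (x k)) u = 0" using orth_B[OF g(1) xk(2) subsp_carrier[OF Wx(1) u'(1)]] u'(2) by simp
    moreover have "B (y k) u = 0" using tot_sing_B[OF Wy(2) Suc.prems(6) sy(2)] u sy(1) by blast
    ultimately show ?thesis by simp
  qed
  ultimately obtain h where h: "h \<in> Og" "\<forall>u\<in>tspan k y. h u = u" "h (g (x k)) = y k"
    using witt_step[OF Wy(1) gx gn yk(2) Y(2)] by blast
  have "compose (carrier V) h g (x i) = y i" if i: "i < Suc k" for i
  proof (cases "i = k")
    case True then show ?thesis using h(3) xk(2) by (simp add: compose_apply)
  next
    case False
    then have ik: "i < k" using i by simp
    have "y i \<in> tspan k y" using tspan_mem[of k y i] yk ik by simp
    then show ?thesis using h(2) g(2) ik xk(1)[OF ik] by (simp add: compose_apply)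
  qed
  then show ?case using compose_orth[OF h(1) g(1)] by blast
qed

lemma diag_act_compose:
  "x \<in> tuples m V \<Longrightarrow> diag_act m (compose (carrier V) g h) x = diag_act m g (diag_act m h x)"
  using tuplesD[of x m] by (auto simp: diag_act_def compose_apply)

lemma diag_act_id: "x \<in> tuples m V \<Longrightarrow> diag_act m (\<lambda>x\<in>carrier V. x) x = x"
  using tuplesD[of x m] by (simp add: diag_act_eq_iff)

lemma diag_act_fix_refl:
  assumes x: "x \<in> tuples m V" and v: "v \<in> refls" "v \<in> perp (tspan m x)"
  shows "diag_act m (reflection l V Q v) x = x"
proof -
  have xV: "x i \<in> carrier V" if "i < m" for i using tuplesD[OF x that] .
  have "reflection l V Q v (x i) = x i" if i: "i < m" for i
  proof (rule refl_fix[OF v(1) xV[OF i]])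
    have "x i \<in> tspan m x" using tspan_mem[of m x i] xV i by blast
    then show "B (x i) v = 0" using v(2) perp_mem by blast
  qed
  then show ?thesis by (simp add: diag_act_eq_iff[OF x])
qed

lemma card_orbits_special_orth:
  assumes E: "subsp E" "tot_sing E" "card E = l ^ m" and V: "card (carrier V) = l ^ (2 * m)" and m: "m > 0"
  shows "card (orbits (special_orth l V Q) (tuples m V) (diag_act m)) =
    card (orbits (orth l V Q) (tuples m V) (diag_act m)) + 1"
proof -
  let ?T = "tuples m V"
  define ob where "ob = orbit (orth l V Q) (diag_act m)"
  define so where "so = orbit (special_orth l V Q) (diag_act m)"
  have obs: "orbits (orth l V Q) ?T (diag_act m) = ob ` ?T" "orbits (special_orth l V Q) ?T (diag_act m) = so ` ?T"
    by (auto simp: orbits_def ob_def so_def)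
  have ob: "ob x = {diag_act m g x | g. g \<in> Og}" for x by (simp add: ob_def orbit_def)
  have so: "so x = {diag_act m g x | g. g \<in> Og \<and> dickson l V Q g = 0}" for x
    by (simp add: so_def orbit_def special_orth_carrier)
  have soI: "diag_act m g x \<in> so x" if "g \<in> Og" "dickson l V Q g = 0" for g x
    using that unfolding so by blast
  have lV: "ldim (carrier V) = 2 * m" using V by (rule ldim_eqI)
  have lE: "lagr E" using E lV ldim_eqI[OF E(3)] by (simp add: lagr_def)
  \<comment> \<open>The tuples that span a Lagrangian and hence are bases of it. They form a single
    orbit of the orthogonal group, the only one that splits.\<close>
  define F where "F = {x \<in> ?T. tot_sing (tspan m x) \<and> card (tspan m x) = l ^ m}"
  have xV: "x i \<in> carrier V" if "x \<in> ?T" "i < m" for x i using tuplesD[OF that] .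
  have sT: "subsp (tspan m x)" if "x \<in> ?T" for x using subsp_tspan[of m x] xV[OF that] by blast
  have lagF: "lagr (tspan m x)" if "x \<in> F" for x
    using that sT lV ldim_eqI[of "tspan m x" m] by (simp add: lagr_def F_def)
  have obN: "so x = ob x" if x: "x \<in> ?T" "x \<notin> F" for x
  proof
    show "so x \<subseteq> ob x" unfolding so ob by blast
    show "ob x \<subseteq> so x"
    proof
      fix y assume "y \<in> ob x"
      then obtain g where g: "g \<in> Og" "y = diag_act m g x" unfolding ob by blast
      have le: "card (tspan m x) \<le> l ^ m" using card_tspan_le[of m x] xV[OF x(1)] by blast
      have V2: "card (carrier V) = l ^ m * l ^ m" using V by (simp add: power_add mult_2)
      have c1: "card (tspan m x) * card (tspan m x) \<le> card (carrier V)"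
        unfolding V2 using le by (rule mult_le_mono) (rule le)
      have c2: "\<not> (tot_sing (tspan m x) \<and> card (tspan m x) * card (tspan m x) = card (carrier V))"
      proof
        assume a: "tot_sing (tspan m x) \<and> card (tspan m x) * card (tspan m x) = card (carrier V)"
        then have "(card (tspan m x))\<^sup>2 = (l ^ m)\<^sup>2" unfolding V2 by (simp add: power2_eq_square)
        then have "card (tspan m x) = l ^ m" by simp
        then show False using x a by (simp add: F_def)
      qed
      obtain v where v: "v \<in> perp (tspan m x)" "Q v \<noteq> 0" using ex_nonsingular_perp[OF sT[OF x(1)] c1 c2] by blast
      have vr: "v \<in> refls" using v perp_carrier by (simp add: refls_def)
      show "y \<in> so x"
      proof (cases "dickson l V Q g = 0")
        case True then show ?thesis unfolding so using g by blast
      next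
        case False
        define h where "h = compose (carrier V) g (reflection l V Q v)"
        have h: "h \<in> Og" unfolding h_def by (rule compose_orth[OF g(1) refl_orth[OF vr]])
        have "dickson l V Q h = 0"
          unfolding h_def refl_conj(2)[OF g(1) vr]
          using dickson_rmul[OF g(1) refl_conj(1)[OF g(1) vr]] False by simp
        moreover have "diag_act m h x = y"
          unfolding h_def diag_act_compose[OF x(1)] diag_act_fix_refl[OF x(1) vr v(1)] using g by simp
        ultimately show ?thesis unfolding so using h by blast
      qed
    qed
  qed
  have FF: "diag_act m g x \<in> F \<longleftrightarrow> x \<in> F" if x: "x \<in> ?T" and g: "g \<in> Og" for g x
  proof -
    have im: "tspan m (diag_act m g x) = g ` tspan m x"
      by (rule tspan_orth_image[OF g]) (use xV[OF x] in \<open>simp_all add: diag_act_apply\<close>)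
    have "tot_sing (g ` tspan m x) \<longleftrightarrow> tot_sing (tspan m x)"
      using orth_Q[OF g] subsp_carrier[OF sT[OF x]] by (simp add: tot_sing_def)
    then show ?thesis
      unfolding F_def using im subsp_orth_image(2)[OF g sT[OF x]] diag_act_tuples[OF g x] x by simp
  qed
  have obF: "ob x = F" if x: "x \<in> F" for x
  proof
    have xT: "x \<in> ?T" using x by (simp add: F_def)
    show "ob x \<subseteq> F" unfolding ob using FF[OF xT] x by blast
    show "F \<subseteq> ob x"
    proof
      fix y assume y: "y \<in> F"
      then have yT: "y \<in> ?T" by (simp add: F_def)
      have "\<exists>g\<in>Og. \<forall>i<m. g (x i) = y i"
        by (rule transitive_on_frames) (use x y xV[OF xT] xV[OF yT] in \<open>simp_all add: F_def\<close>)
      then obtain g where "g \<in> Og" "diag_act m g x = y" unfolding diag_act_eq_iff[OF yT] by blast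
      then show "y \<in> ob x" unfolding ob by blast
    qed
  qed
  obtain x0 where x0: "x0 \<in> F"
  proof -
    obtain k x where kx: "\<forall>i<k. x i \<in> carrier V" "tspan k x = E" "card E = l ^ k" using ex_tspan[OF E(1)] by blast
    have "k = m" using kx(3) E(3) prime_gt_1_nat[OF prime_l] by simp
    then have x: "\<forall>i<m. x i \<in> carrier V" "tspan m x = E" using kx by auto
    define x' where "x' = restrict x {..<m}"
    have "tspan m x' = E" using tspan_cong[of m x' x] x by (simp add: x'_def)
    moreover have "x' \<in> ?T" using x by (auto simp: x'_def tuples_def)
    ultimately show thesis using that[of x'] E by (simp add: F_def)
  qed
  have x0T: "x0 \<in> ?T" using x0 by (simp add: F_def)
  \<comment> \<open>The second half of \<open>F\<close>: the images of \<open>x0\<close> under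
    elements with nontrivial invariant.\<close>
  define F1 where "F1 = {diag_act m g x0 | g. g \<in> Og \<and> dickson l V Q g \<noteq> 0}"
  have dick: "dickson l V Q (compose (carrier V) g h) = 0 \<longleftrightarrow> (dickson l V Q g = 0 \<longleftrightarrow> dickson l V Q h = 0)"
    if "g \<in> Og" "h \<in> Og" for g h
    using dickson_compose[OF lE that] dickson_eq_opp[OF lE that(1)] dickson_eq_opp[OF lE that(2)] by auto
  have soF: "so x = (if dickson l V Q h = 0 then so x0 else F1)" if h: "h \<in> Og" "x = diag_act m h x0" for x h
  proof -
    obtain h' where h': "h' \<in> Og" "\<forall>y\<in>carrier V. h' (h y) = y" using orth_inverse[OF h(1)] by blast
    have hh: "compose (carrier V) h' h = (\<lambda>x\<in>carrier V. x)"
      by (rule orth_eqI[OF compose_orth[OF h'(1) h(1)] id_orth]) (use h'(2) in \<open>simp add: compose_apply\<close>)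
    have dh': "dickson l V Q h' = 0 \<longleftrightarrow> dickson l V Q h = 0"
      using dick[OF h'(1) h(1)] dickson_id hh by simp
    have "y \<in> so x \<longleftrightarrow> (\<exists>k\<in>Og. (dickson l V Q k = 0 \<longleftrightarrow> dickson l V Q h = 0) \<and> y = diag_act m k x0)" for y
    proof
      assume "y \<in> so x"
      then obtain g where g: "g \<in> Og" "dickson l V Q g = 0" "y = diag_act m g x" unfolding so by blast
      have "y = diag_act m (compose (carrier V) g h) x0" using g h diag_act_compose[OF x0T] by simp
      then show "\<exists>k\<in>Og. (dickson l V Q k = 0 \<longleftrightarrow> dickson l V Q h = 0) \<and> y = diag_act m k x0"
        using dick[OF g(1) h(1)] g(2)
        by (intro bexI[of _ "compose (carrier V) g h"] compose_orth[OF g(1) h(1)]) simp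
    next
      assume "\<exists>k\<in>Og. (dickson l V Q k = 0 \<longleftrightarrow> dickson l V Q h = 0) \<and> y = diag_act m k x0"
      then obtain k where k: "k \<in> Og" "dickson l V Q k = 0 \<longleftrightarrow> dickson l V Q h = 0" "y = diag_act m k x0"
        by (elim bexE conjE) (rule that)
      have xT: "x \<in> ?T" using h diag_act_tuples[OF h(1) x0T] by simp
      have "diag_act m h' x = x0"
        unfolding h(2) diag_act_compose[OF x0T, symmetric] hh by (rule diag_act_id[OF x0T])
      then have "diag_act m (compose (carrier V) k h') x = y" using diag_act_compose[OF xT] k by simp
      moreover have "dickson l V Q (compose (carrier V) k h') = 0" using dick[OF k(1) h'(1)] dh' k(2) by simp
      ultimately show "y \<in> so x" using soI[OF compose_orth[OF k(1) h'(1)], of x] by simp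
    qed
    then have S: "so x = {diag_act m k x0 | k. k \<in> Og \<and> (dickson l V Q k = 0 \<longleftrightarrow> dickson l V Q h = 0)}"
      by (intro Set.set_eqI) (simp add: Bex_def conj_ac)
    show ?thesis
    proof (cases "dickson l V Q h = 0")
      case True
      show ?thesis unfolding S so[of x0] using True by simp
    next
      case False
      show ?thesis unfolding S F1_def using False by simp
    qed
  qed
  have F1ne: "F1 \<noteq> {}" and F01: "so x0 \<noteq> F1"
  proof -
    \<comment> \<open>A reflection exists because the space is not zero, which is where
      \<open>m > 0\<close> is used; for \<open>m = 0\<close> both groups are trivial.\<close>
    have "card {\<zero>} * card {\<zero>} < card (carrier V)"
      using V m one_less_power[OF prime_gt_1_nat[OF prime_l], of "2 * m"] by simp
    then obtain v where v: "v \<in> perp {\<zero>}" "Q v \<noteq> 0" using ex_nonsingular_perp[OF subsp_trivial] by auto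
    have vr: "v \<in> refls" using v perp_carrier by (simp add: refls_def)
    have "dickson l V Q (rmul v (\<lambda>x\<in>carrier V. x)) \<noteq> 0"
      using dickson_rmul(1)[OF id_orth vr] dickson_id by simp
    then show "F1 \<noteq> {}" unfolding F1_def using rmul_orth[OF vr id_orth] by blast
    show "so x0 \<noteq> F1"
    proof
      assume "so x0 = F1"
      moreover have "x0 \<in> so x0"
        unfolding so using id_orth dickson_id diag_act_id[OF x0T] by force
      ultimately have "x0 \<in> F1" by simp
      then obtain g where g: "g \<in> Og" "dickson l V Q g \<noteq> 0" "x0 = diag_act m g x0"
        unfolding F1_def mem_Collect_eq by (elim exE conjE) (rule that)
      \<comment> \<open>An element that fixes \<open>x0\<close> maps the Lagrangian spanned by
        \<open>x0\<close> to itself, so its invariant, computed with this Lagrangian, is 0.\<close>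
      have "g (x0 i) = x0 i" if "i < m" for i using g(3) diag_act_apply[OF that, of g x0] by simp
      then have "g ` tspan m x0 = tspan m x0"
        using tspan_orth_image[OF g(1), of m x0 x0] xV[OF x0T] by simp
      then show False using dickson_eq_opp[OF lagF[OF x0] g(1)] opp_self g(2) by simp
    qed
  qed
  have so_F: "so ` F = {so x0, F1}"
  proof
    show "so ` F \<subseteq> {so x0, F1}"
    proof
      fix y assume "y \<in> so ` F"
      then obtain x where x: "x \<in> F" "y = so x" by blast
      then obtain h where "h \<in> Og" "x = diag_act m h x0" using obF[OF x0] unfolding ob by blast
      then show "y \<in> {so x0, F1}" using soF x by auto
    qed
    obtain g where g: "g \<in> Og" "dickson l V Q g \<noteq> 0" using F1ne unfolding F1_def by blast
    have "so (diag_act m g x0) = F1" using soF[OF g(1) refl] g(2) by simp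
    moreover have "diag_act m g x0 \<in> F" using FF[OF x0T g(1)] x0 by simp
    ultimately show "{so x0, F1} \<subseteq> so ` F" using x0 by blast
  qed
  have self: "x \<in> ob x" "x \<in> so x" if "x \<in> ?T" for x
    unfolding ob so using id_orth dickson_id diag_act_id[OF that] by force+
  define N where "N = ?T - F"
  have T: "?T = N \<union> F" by (auto simp: N_def F_def)
  have finN: "finite (ob ` N)" unfolding N_def tuples_def using finite_V by (intro finite_imageI finite_Diff finite_PiE) auto
  have disj: "X \<inter> F = {}" if "X \<in> ob ` N" for X
    using that FF unfolding N_def ob by blast
  have soN: "so ` N = ob ` N" using obN by (intro image_cong) (auto simp: N_def)
  have obT: "ob ` ?T = insert F (ob ` N)" unfolding T image_Un using obF x0 by blast
  have soT: "so ` ?T = insert (so x0) (insert F1 (ob ` N))" unfolding T image_Un soN so_F by blast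
  have sub: "F1 \<subseteq> F" "so x0 \<subseteq> F" using obF[OF x0] unfolding F1_def so ob by blast+
  have "F \<notin> ob ` N" "F1 \<notin> ob ` N" "so x0 \<notin> ob ` N"
    using disj x0 F1ne sub self(2)[OF x0T] by blast+
  then show ?thesis unfolding obs obT soT using finN F01 by simp
qed

end

subsection \<open>Square classes\<close>

lemma mod_unit_range:
  assumes "1 < int l" "a mod int l \<noteq> 0" shows "a mod int l \<in> {1..<int l}"
proof -
  have "0 \<le> a mod int l" "a mod int l < int l" using assms(1) by simp_all
  moreover from this assms(2) have "1 \<le> a mod int l" by linarith
  ultimately show ?thesis by simp
qed

lemma QuadRes_mult:
  assumes l: "prime l" "odd l" and a: "\<not> int l dvd a" and b: "\<not> int l dvd b"
  shows "QuadRes (int l) (a * b) \<longleftrightarrow> (QuadRes (int l) a \<longleftrightarrow> QuadRes (int l) b)"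
proof -
  have "l \<noteq> 2" using l(2) by auto
  then have l2: "2 < l" using prime_gt_1_nat[OF l(1)] by linarith
  have ab: "\<not> int l dvd a * b" using a b l(1) prime_dvd_mult_iff[of "int l" a b] by simp
  have L: "Legendre x (int l) = (if QuadRes (int l) x then 1 else -1)" if "\<not> int l dvd x" for x
    using that by (simp add: Legendre_def cong_0_iff)
  have "[Legendre (a * b) (int l) = Legendre a (int l) * Legendre b (int l)] (mod int l)"
    using euler_criterion[OF l(1) l2] cong_mult[OF euler_criterion[OF l(1) l2, of a] euler_criterion[OF l(1) l2, of b]]
    by (metis cong_sym cong_trans power_mult_distrib)
  moreover have "\<not> [1 = -1] (mod int l)" "\<not> [-1 = 1] (mod int l)"
    using l2 zdvd_not_zless[of 2 "int l"] by (auto simp: cong_iff_dvd_diff)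
  ultimately show ?thesis unfolding L[OF a] L[OF b] L[OF ab] by (auto split: if_splits)
qed

text \<open>If every unit were a square, squaring would be onto and therefore injective on the
  units, although \<open>1\<close> and \<open>-1\<close> have the same square.\<close>

lemma ex_nonsquare:
  assumes l: "prime l" "odd l"
  shows "\<exists>n\<in>{1..<int l}. \<not> QuadRes (int l) n"
proof (rule ccontr)
  assume "\<not> ?thesis"
  then have sq: "QuadRes (int l) n" if "n \<in> {1..<int l}" for n using that by blast
  have "l \<noteq> 2" using l(2) by auto
  then have l2: "2 < l" using prime_gt_1_nat[OF l(1)] by linarith
  let ?U = "{1..<int l}"
  let ?f = "\<lambda>x. x\<^sup>2 mod int l"
  have "?U \<subseteq> ?f ` ?U"
  proof
    fix n assume n: "n \<in> ?U"
    then obtain y where y: "[y\<^sup>2 = n] (mod int l)" using sq by (auto simp: QuadRes_def)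
    have e: "?f (y mod int l) = n" using y n by (simp add: cong_def power_mod)
    have "y mod int l \<noteq> 0" using e n by auto
    then have "y mod int l \<in> ?U" using l2 by (intro mod_unit_range) simp_all
    then show "n \<in> ?f ` ?U" using e by (metis image_eqI)
  qed
  then have "card ?U \<le> card (?f ` ?U)" by (intro card_mono) auto
  then have "card (?f ` ?U) = card ?U" using card_image_le[of ?U ?f] by simp
  then have "inj_on ?f ?U" by (intro eq_card_imp_inj_on) simp_all
  moreover have "?f (int l - 1) = ?f 1"
  proof -
    have "(int l - 1)\<^sup>2 = 1 + int l * (int l - 2)" by (simp add: power2_eq_square algebra_simps)
    then show ?thesis by simp
  qed
  moreover have "int l - 1 \<in> ?U" "1 \<in> ?U" using l2 by auto
  ultimately have "int l - 1 = 1" by (rule inj_onD)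
  then show False using l2 by simp
qed

subsection \<open>The sign of an involution\<close>

text \<open>Each moved point is exchanged with its image. Splitting off these transpositions one by
  one removes two moved points and changes the sign each time.\<close>

lemma sign_involution:
  assumes "finite {x. p x \<noteq> x}" and "\<And>x. p (p x) = x"
  shows "permutation p \<and> even (card {x. p x \<noteq> x}) \<and>
    sign p = (if even (card {x. p x \<noteq> x} div 2) then 1 else -1)"
  using assms
proof (induction "card {x. p x \<noteq> x}" arbitrary: p rule: less_induct)
  case less
  let ?M = "{x. p x \<noteq> x}"
  show ?case
  proof (cases "?M = {}")
    case True
    then have "p = id" by (auto simp: fun_eq_iff)
    then show ?thesis by simp
  next
    case False
    then obtain a where a: "p a \<noteq> a" by blast
    define b where "b = p a"
    have ab: "a \<noteq> b" "p a = b" "p b = a" "p b \<noteq> b" using a less.prems(2)[of a] by (auto simp: b_def)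
    define q where "q = transpose a b \<circ> p"
    have pinj: "x = y" if "p x = p y" for x y using arg_cong[OF that, of p] less.prems(2) by simp
    have qa: "q a = a" "q b = b" using ab by (simp_all add: q_def)
    have qo: "q x = p x" if "x \<noteq> a" "x \<noteq> b" for x
    proof -
      have "p x \<noteq> a" "p x \<noteq> b" using that ab pinj by metis+
      then show ?thesis by (simp add: q_def transpose_def)
    qed
    have Mq: "{x. q x \<noteq> x} = ?M - {a, b}"
    proof (rule Set.set_eqI)
      fix x show "x \<in> {x. q x \<noteq> x} \<longleftrightarrow> x \<in> ?M - {a, b}" using qa qo[of x] by (cases "x = a \<or> x = b") auto
    qed
    have fin: "finite {x. q x \<noteq> x}" unfolding Mq using less.prems(1) by simp
    have qq: "q (q x) = x" for x
    proof (cases "x = a \<or> x = b")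
      case True then show ?thesis using qa by auto
    next
      case False
      then have x: "x \<noteq> a" "x \<noteq> b" by auto
      have "p x \<noteq> a" "p x \<noteq> b" using x ab pinj by metis+
      then show ?thesis using qo[OF x] qo[of "p x"] less.prems(2) by simp
    qed
    have abM: "a \<in> ?M" "b \<in> ?M" using ab by auto
    have cM: "card ?M = card {x. q x \<noteq> x} + 2"
    proof -
      have "card (?M - {a, b}) = card ?M - card {a, b}" using abM by (intro card_Diff_subset) auto
      moreover have "card {a, b} \<le> card ?M" using abM less.prems(1) by (intro card_mono) auto
      ultimately show ?thesis unfolding Mq using ab by simp
    qed
    have IH: "permutation q" "even (card {x. q x \<noteq> x})" "sign q = (if even (card {x. q x \<noteq> x} div 2) then 1 else -1)"
      using less.hyps[OF _ fin qq] cM by auto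
    have pq: "p = transpose a b \<circ> q" unfolding q_def by (auto simp: fun_eq_iff)
    have "permutation p" unfolding pq by (rule permutation_compose[OF permutation_swap_id IH(1)])
    moreover have "sign p = - sign q"
      unfolding pq using sign_compose[OF permutation_swap_id IH(1), of a b] ab(1) by (simp add: sign_swap_id)
    ultimately show ?thesis using IH(2,3) cM by auto
  qed
qed

subsection \<open>The spinor norm\<close>

lemma zmod_cring: "prime l \<Longrightarrow> cring (zmod l)"
  using residues.cring[of "int l"] prime_gt_1_nat[of l] by (simp add: zmod_prime_eq residues_def)

lemma zmod_uminus:
  assumes "prime l" "a \<in> {0..<int l}" shows "\<ominus>\<^bsub>zmod l\<^esub> a = (- a) mod int l"
proof -
  interpret R: cring "zmod l" by (rule zmod_cring[OF assms(1)])
  show ?thesis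
    using prime_gt_0_nat[OF assms(1)] assms(2) by (intro R.minus_equality) (simp_all add: mod_simps)
qed

lemma Units_zmod:
  assumes l: "prime l" shows "Units (zmod l) = {1..<int l}"
proof (rule Set.set_eqI, rule iffI)
  have l1: "1 < int l" using prime_gt_1_nat[OF l] by simp
  fix a assume "a \<in> Units (zmod l)"
  then obtain x where "a \<in> {0..<int l}" "(x * a) mod int l = 1 mod int l" by (auto simp: Units_def)
  moreover have "a \<noteq> 0" using calculation l1 by auto
  ultimately show "a \<in> {1..<int l}" by auto
next
  have l1: "1 < int l" using prime_gt_1_nat[OF l] by simp
  fix a assume a: "a \<in> {1..<int l}"
  then have "a mod int l \<noteq> 0" by simp
  then obtain i where i: "(a * i) mod int l = 1" using prime_inverse_mod[OF l] by blast
  have "i mod int l \<in> carrier (zmod l)" using l1 by simp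
  moreover have "(i mod int l) \<otimes>\<^bsub>zmod l\<^esub> a = \<one>\<^bsub>zmod l\<^esub>" "a \<otimes>\<^bsub>zmod l\<^esub> (i mod int l) = \<one>\<^bsub>zmod l\<^esub>"
    using i l1 by (simp_all add: mod_simps mult.commute)
  ultimately show "a \<in> Units (zmod l)" using a unfolding Units_def by auto
qed

locale square_class_group =
  fixes l :: nat assumes l: "prime l"
begin

abbreviation K where "K \<equiv> units_of (zmod l)"
abbreviation S where "S \<equiv> unit_squares l"
abbreviation cls where "cls a \<equiv> S #>\<^bsub>K\<^esub> a"

lemma l1: "1 < int l" using prime_gt_1_nat[OF l] by simp

lemma K_carrier: "carrier K = {1..<int l}"
  by (simp add: units_of_carrier Units_zmod[OF l])

lemma K_mult: "a \<otimes>\<^bsub>K\<^esub> b = (a * b) mod int l"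
  by (simp add: units_of_mult)

lemma K_comm_group: "comm_group K"
  using comm_monoid.units_comm_group[OF cring.axioms(2)[OF zmod_cring[OF l]]] .

lemma K_mem: "\<not> int l dvd a \<Longrightarrow> a mod int l \<in> carrier K"
  unfolding K_carrier by (rule mod_unit_range[OF l1]) (simp add: mod_eq_0_iff_dvd)

lemma S_eq: "S = {(x * x) mod int l | x. x \<in> {1..<int l}}"
  by (simp add: unit_squares_def Units_zmod[OF l])

lemma S_QuadRes:
  assumes "a \<in> {1..<int l}" shows "a \<in> S \<longleftrightarrow> QuadRes (int l) a"
proof
  assume "a \<in> S"
  then obtain x where "a = (x * x) mod int l" by (auto simp: S_eq)
  then show "QuadRes (int l) a" by (auto simp: QuadRes_def cong_def power2_eq_square)
next
  assume "QuadRes (int l) a"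
  then obtain y where y: "[y\<^sup>2 = a] (mod int l)" by (auto simp: QuadRes_def)
  have e: "((y mod int l) * (y mod int l)) mod int l = a"
    using y assms by (simp add: cong_def power2_eq_square mod_mult_eq)
  have "y mod int l \<noteq> 0" using e assms by auto
  then have "y mod int l \<in> {1..<int l}" by (rule mod_unit_range[OF l1])
  then show "a \<in> S" unfolding S_eq using e by blast
qed

lemma S_subgroup: "subgroup S K"
proof -
  interpret K: comm_group K by (rule K_comm_group)
  have cl: "S \<subseteq> carrier K"
  proof
    fix s assume "s \<in> S"
    then obtain x where x: "s = x \<otimes>\<^bsub>K\<^esub> x" "x \<in> carrier K" by (auto simp: S_eq K_mult K_carrier)
    then show "s \<in> carrier K" by simp
  qed
  have SK: "S = {x \<otimes>\<^bsub>K\<^esub> x | x. x \<in> carrier K}" by (auto simp: S_eq K_mult K_carrier)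
  show ?thesis
  proof (rule K.subgroupI[OF cl])
    have "\<one>\<^bsub>K\<^esub> \<otimes>\<^bsub>K\<^esub> \<one>\<^bsub>K\<^esub> \<in> S" unfolding SK using K.one_closed by blast
    then show "S \<noteq> {}" by blast
    show "inv\<^bsub>K\<^esub> a \<in> S" if a: "a \<in> S" for a
    proof -
      obtain x where x: "a = x \<otimes>\<^bsub>K\<^esub> x" "x \<in> carrier K" using a unfolding SK by blast
      then have "inv\<^bsub>K\<^esub> a = inv\<^bsub>K\<^esub> x \<otimes>\<^bsub>K\<^esub> inv\<^bsub>K\<^esub> x" by (simp add: K.inv_mult)
      then show ?thesis unfolding SK using K.inv_closed[OF x(2)] by blast
    qed
    show "a \<otimes>\<^bsub>K\<^esub> b \<in> S" if ab: "a \<in> S" "b \<in> S" for a b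
    proof -
      obtain x y where x: "a = x \<otimes>\<^bsub>K\<^esub> x" "x \<in> carrier K" and y: "b = y \<otimes>\<^bsub>K\<^esub> y" "y \<in> carrier K"
        using ab unfolding SK by blast
      have "a \<otimes>\<^bsub>K\<^esub> b = (x \<otimes>\<^bsub>K\<^esub> y) \<otimes>\<^bsub>K\<^esub> (x \<otimes>\<^bsub>K\<^esub> y)" using x y by (simp add: K.m_ac)
      then show ?thesis unfolding SK using K.m_closed[OF x(2) y(2)] by blast
    qed
  qed
qed

lemma S_normal: "S \<lhd> K"
  by (rule comm_group.subgroup_imp_normal[OF K_comm_group S_subgroup])

lemma group_classes: "group (square_classes l)"
  unfolding square_classes_def by (rule normal.factorgroup_is_group[OF S_normal])

lemma classes_carrier: "carrier (square_classes l) = cls ` carrier K"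
  by (auto simp: square_classes_def FactGroup_def RCOSETS_def)

lemma classes_one: "\<one>\<^bsub>square_classes l\<^esub> = S"
  by (simp add: square_classes_def FactGroup_def)

lemma classes_mult:
  "a \<in> carrier K \<Longrightarrow> b \<in> carrier K \<Longrightarrow> cls a \<otimes>\<^bsub>square_classes l\<^esub> cls b = cls (a \<otimes>\<^bsub>K\<^esub> b)"
  using normal.rcos_sum[OF S_normal] by (simp add: square_classes_def FactGroup_def)

lemma cls_square: "a \<in> S \<Longrightarrow> cls a = S"
  using group.coset_join2[OF comm_group.axioms(2)[OF K_comm_group] _ S_subgroup]
    subgroup.mem_carrier[OF S_subgroup] by blast

text \<open>The product of two nonsquares is a square, so the group of square classes has only one
  class other than the trivial one.\<close>

lemma cls_nonsquares:
  assumes "odd l" and a: "a \<in> carrier K" "a \<notin> S" and b: "b \<in> carrier K" "b \<notin> S"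
  shows "cls a = cls b" and "cls a \<otimes>\<^bsub>square_classes l\<^esub> cls b = S"
proof -
  interpret C: group "square_classes l" by (rule group_classes)
  have prod: "x \<otimes>\<^bsub>K\<^esub> y \<in> S" if x: "x \<in> carrier K" "x \<notin> S" and y: "y \<in> carrier K" "y \<notin> S" for x y
  proof -
    interpret K: comm_group K by (rule K_comm_group)
    have nd: "\<not> int l dvd x" "\<not> int l dvd y" using x y zdvd_not_zless by (auto simp: K_carrier)
    have "QuadRes (int l) (x * y)"
      using QuadRes_mult[OF l assms(1) nd] S_QuadRes x y by (simp add: K_carrier)
    then have "QuadRes (int l) ((x * y) mod int l)" by (simp add: QuadRes_def cong_def)
    moreover have "(x * y) mod int l \<in> {1..<int l}"
      using K.m_closed[OF x(1) y(1)] by (simp only: K_mult K_carrier)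
    ultimately show ?thesis using S_QuadRes by (simp add: K_mult)
  qed
  show ab: "cls a \<otimes>\<^bsub>square_classes l\<^esub> cls b = S"
    using classes_mult[OF a(1) b(1)] cls_square[OF prod[OF a b]] by simp
  have bb: "cls b \<otimes>\<^bsub>square_classes l\<^esub> cls b = S"
    using classes_mult[OF b(1) b(1)] cls_square[OF prod[OF b b]] by simp
  have "cls a \<in> carrier (square_classes l)" "cls b \<in> carrier (square_classes l)"
    using a b by (simp_all add: classes_carrier)
  then show "cls a = cls b" using ab bb C.right_cancel[of "cls b" "cls a" "cls b"] by simp
qed

end

text \<open>The choice in \<open>spinor_norm\<close> obeys its specification once some solution is
  exhibited. Here the target is trivial and the constant map is one.\<close>

lemma spinor_norm_two:
  assumes Q: "\<And>v. v \<in> carrier V \<Longrightarrow> Q v \<in> {0..<2}" and g: "g \<in> carrier (orth 2 V Q)"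
  shows "spinor_norm 2 V Q g = \<one>\<^bsub>square_classes 2\<^esub>"
proof -
  interpret C: square_class_group 2 by unfold_locales simp
  interpret SC: group "square_classes 2" by (rule C.group_classes)
  have K1: "carrier C.K = {1}" by (auto simp: C.K_carrier)
  have S1: "1 \<in> C.S" unfolding C.S_eq by (auto intro!: exI[of _ 1])
  have triv: "carrier (square_classes 2) = {\<one>\<^bsub>square_classes 2\<^esub>}"
    unfolding C.classes_carrier K1 C.classes_one using C.cls_square[OF S1] by simp
  let ?P = "\<lambda>\<theta>. \<theta> \<in> hom (orth 2 V Q) (square_classes 2) \<and>
     (\<forall>v\<in>carrier V. Q v \<noteq> 0 \<longrightarrow> \<theta> (reflection 2 V Q v) = C.cls (\<ominus>\<^bsub>zmod 2\<^esub> Q v))"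
  have "?P (\<lambda>_. \<one>\<^bsub>square_classes 2\<^esub>)"
  proof (intro conjI ballI impI)
    show "(\<lambda>_. \<one>\<^bsub>square_classes 2\<^esub>) \<in> hom (orth 2 V Q) (square_classes 2)" by (rule homI) simp_all
    fix v assume v: "v \<in> carrier V" "Q v \<noteq> 0"
    then have "Q v = 1" using Q[OF v(1)] by auto
    then have "\<ominus>\<^bsub>zmod 2\<^esub> Q v = 1" using zmod_uminus[of 2 1] by simp
    then show "\<one>\<^bsub>square_classes 2\<^esub> = C.cls (\<ominus>\<^bsub>zmod 2\<^esub> Q v)" using C.cls_square[OF S1] C.classes_one by simp
  qed
  then have "?P (spinor_norm 2 V Q)" unfolding spinor_norm_def by (rule someI[where P = ?P])
  then have "spinor_norm 2 V Q g \<in> carrier (square_classes 2)" using g by (auto simp: hom_def)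
  then show ?thesis using triv by simp
qed

context quad_space
begin

lemma refl_self:
  assumes v: "v \<in> refls" shows "reflection l V Q v v = (-1) \<star> v"
proof -
  have vV: "v \<in> carrier V" using reflD[OF v] by simp
  define i where "i = inv\<^bsub>zmod l\<^esub> (Q v)"
  have i: "(Q v * i) mod int l = 1" using refl_Q_inv[OF v vV] by (simp add: i_def)
  have "(1 + - (B v v * i)) mod int l = (1 - 2 * ((Q v * i) mod int l)) mod int l"
    unfolding B_self[OF vV] by (rule mod_strip, (rule cong_strip)+, simp)
  then have e: "(1 + - (B v v * i)) mod int l = (-1) mod int l" using i by simp
  have "reflection l V Q v v = 1 \<star> v \<oplus> (- (B v v * i)) \<star> v"
    using refl_apply[OF v vV] vV by (simp add: i_def)
  also have "\<dots> = (1 + - (B v v * i)) \<star> v" by (rule sc_add_left[OF vV, symmetric])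
  also have "\<dots> = (-1) \<star> v" by (rule sc_cong[OF e])
  finally show ?thesis .
qed

text \<open>
  The reflection \<open>r\<close> in \<open>v\<close> and \<open>-1\<close> generate a group of order 4 acting on the vectors of norm
  \<open>c\<close> moved by \<open>r\<close>, freely except on the multiples of \<open>v\<close>; hence only the latter matter modulo 4.
\<close>

lemma card_moved_mod_4:
  assumes odd_l: "odd l" and v: "v \<in> refls" and c: "c \<in> {1..<int l}"
  shows "\<exists>k. card {x \<in> carrier V. Q x = c \<and> B x v \<noteq> 0} =
     4 * k + (if \<exists>t. (t\<^sup>2 * Q v) mod int l = c then 2 else 0)"
proof -
  define r where "r = reflection l V Q v"
  have rO: "r \<in> Og" unfolding r_def by (rule refl_orth[OF v])
  have vV: "v \<in> carrier V" "Q v \<noteq> 0" using reflD[OF v] by auto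
  have rr: "r (r x) = x" if "x \<in> carrier V" for x unfolding r_def by (rule refl_invol[OF v that])
  have rv: "r v = (-1) \<star> v" unfolding r_def by (rule refl_self[OF v])
  have rV: "r x \<in> carrier V" if "x \<in> carrier V" for x by (rule orth_closed[OF rO that])
  have two: "2 mod int l \<noteq> 0"
  proof
    assume "2 mod int l = 0"
    then have "int l dvd int 2" by (simp add: mod_eq_0_iff_dvd)
    then have "l dvd 2" using int_dvd_int_iff by blast
    then have "l = 2" using primes_dvd_imp_eq[OF prime_l two_is_prime_nat] by blast
    then show False using odd_l by simp
  qed
  define M where "M = {x \<in> carrier V. Q x = c \<and> B x v \<noteq> 0}"
  define M0 where "M0 = M \<inter> line v"
  define M1 where "M1 = M - line v"
  have finM: "finite M" unfolding M_def using finite_V by simp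
  have MV: "x \<in> carrier V" if "x \<in> M" for x using that by (simp add: M_def)
  have Brv: "B (r x) v = (- B x v) mod int l" if x: "x \<in> carrier V" for x
  proof -
    have "B (r x) v = B (r (r x)) (r v)" using orth_B[OF rO rV[OF x] vV(1)] by simp
    also have "\<dots> = B x ((-1) \<star> v)" using rr[OF x] rv by simp
    finally show ?thesis using x vV by (simp add: B_sc_right)
  qed
  have neg: "(- a) mod int l \<noteq> 0" if "a mod int l \<noteq> 0" for a using that by (simp add: mod_eq_0_iff_dvd)
  have rM: "r x \<in> M" if x: "x \<in> M" for x
    using x rV orth_Q[OF rO] Brv neg[of "B x v"] by (simp add: M_def)
  have nM: "(-1) \<star> x \<in> M" if x: "x \<in> M" for x
    using x c vV neg[of "B x v"] by (simp add: M_def Q_sc B_sc_left)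
  have nl: "y \<in> line v" if "(-1) \<star> y \<in> line v" "y \<in> carrier V" for y
    using subsp_sc[OF subsp_line[OF vV(1)] that(1), of "-1"] that(2) by (simp add: sc_sc)
  have rl: "r y \<in> line v" if y: "y \<in> line v" for y
  proof -
    obtain t where "y = t \<star> v" using y by (auto simp: line_def)
    then have "r y = t \<star> (-1) \<star> v" using orth_sc[OF rO vV(1)] rv by simp
    then show ?thesis using subsp_sc[OF subsp_line[OF vV(1)]] line_self[OF vV(1)] by simp
  qed
  have rM1: "r x \<in> M1" if x: "x \<in> M1" for x
    using x rM rl[of "r x"] rr MV by (auto simp: M1_def)
  have nM1: "(-1) \<star> x \<in> M1" if x: "x \<in> M1" for x
    using x nM nl MV by (auto simp: M1_def)
  have nn: "(-1) \<star> (-1) \<star> x = x" if "x \<in> carrier V" for x using that by (simp add: sc_sc)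
  have rn: "r ((-1) \<star> x) = (-1) \<star> r x" if "x \<in> carrier V" for x by (rule orth_sc[OF rO that])
  \<comment> \<open>The orbits of the group of order 4 generated by \<open>r\<close> and
    \<open>-1\<close>.\<close>
  define ob where "ob = (\<lambda>x. {x, r x, (-1) \<star> x, (-1) \<star> r x})"
  have halve: "y \<in> line v" if "y \<oplus> y \<in> line v" "y \<in> carrier V" for y
  proof -
    have "2 \<star> y = y \<oplus> y" using sc_add_left[OF that(2), of 1 1] that(2) by simp
    then show ?thesis using sc_mem_cancel[OF subsp_line[OF vV(1)] two] that by simp
  qed
  have ob4: "card (ob x) = 4" if x: "x \<in> M1" for x
  proof -
    have xV: "x \<in> carrier V" "B x v \<noteq> 0" "x \<notin> line v" using x by (auto simp: M1_def M_def)
    have 1: "r x \<noteq> x" using refl_fix_iff[OF v xV(1)] xV(2) by (simp add: r_def)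
    have neq: "y \<noteq> (-1) \<star> y" if y: "y \<in> M1" for y
    proof
      assume e: "y = (-1) \<star> y"
      have yV: "y \<in> carrier V" "y \<notin> line v" using y MV by (auto simp: M1_def)
      have "y \<oplus> y = y \<oplus> (-1) \<star> y" using e by simp
      then have "y \<oplus> y = \<zero>" using yV by simp
      then show False using halve[of y] yV subsp_zero[OF subsp_line[OF vV(1)]] by simp
    qed
    have 2: "x \<noteq> (-1) \<star> x" "r x \<noteq> (-1) \<star> r x" using neq[OF x] neq[OF rM1[OF x]] by auto
    \<comment> \<open>If \<open>x = - r x\<close>, then \<open>2 x\<close> would be a multiple of
      \<open>v\<close>, and so would \<open>x\<close>, since 2 is invertible.\<close>
    have 3: "x \<noteq> (-1) \<star> r x"
    proof
      assume e: "x = (-1) \<star> r x"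
      obtain s where s: "r x = x \<oplus> s \<star> v" unfolding r_def using refl_apply[OF v xV(1)] by auto
      have "x \<oplus> x = x \<oplus> (-1) \<star> (x \<oplus> s \<star> v)" using e s by simp
      also have "\<dots> = (-1) \<star> s \<star> v" using xV(1) vV(1) by (simp add: sc_add_right a_assoc[symmetric])
      finally have "x \<oplus> x \<in> line v" using vV(1) by (simp add: sc_sc line_def)
      then show False using halve[of x] xV by simp
    qed
    have 4: "r x \<noteq> (-1) \<star> x" using 3 nn[OF xV(1)] nn[OF rV[OF xV(1)]] by metis
    have 5: "(-1) \<star> x \<noteq> (-1) \<star> r x" using 1 nn[OF xV(1)] nn[OF rV[OF xV(1)]] by metis
    show ?thesis unfolding ob_def using 1 2 3 4 5 by simp
  qed
  have obM: "ob x \<subseteq> M1" if x: "x \<in> M1" for x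
    unfolding ob_def using x rM1 nM1 by auto
  have obeq: "ob y = ob x" if x: "x \<in> M1" and y: "y \<in> ob x" for x y
  proof -
    have xV: "x \<in> carrier V" using x MV by (auto simp: M1_def)
    have e: "r (r x) = x" "(-1) \<star> (-1) \<star> x = x" "(-1) \<star> (-1) \<star> r x = r x" "r ((-1) \<star> x) = (-1) \<star> r x"
      "r ((-1) \<star> r x) = (-1) \<star> x"
      using rr[OF xV] nn[OF xV] nn[OF rV[OF xV]] rn[OF xV] rn[OF rV[OF xV]] by simp_all
    show ?thesis using y unfolding ob_def using e by auto
  qed
  have "card M1 = card (ob ` M1) * 4"
  proof (rule card_eq_card_image_mult)
    show "finite M1" using finM by (simp add: M1_def)
    fix d assume "d \<in> ob ` M1"
    then obtain x where x: "x \<in> M1" "d = ob x" by blast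
    have "{y \<in> M1. ob y = d} = ob x"
    proof (rule Set.set_eqI, rule iffI)
      fix y assume "y \<in> {y \<in> M1. ob y = d}"
      then have "ob y = ob x" using x by simp
      moreover have "y \<in> ob y" by (simp add: ob_def)
      ultimately show "y \<in> ob x" by simp
    next
      fix y assume "y \<in> ob x"
      then show "y \<in> {y \<in> M1. ob y = d}" using obM[OF x(1)] obeq[OF x(1)] x(2) by auto
    qed
    then show "card {y \<in> M1. ob y = d} = 4" using ob4[OF x(1)] by simp
  qed
  \<comment> \<open>A multiple \<open>t v\<close> has norm \<open>c\<close> if and only if
    \<open>t ^ 2 = c / Q v\<close>, and then exactly \<open>t v\<close> and \<open>- t v\<close>
    qualify.\<close>
  moreover have "card M0 = (if \<exists>t. (t\<^sup>2 * Q v) mod int l = c then 2 else 0)"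
  proof (cases "\<exists>t. (t\<^sup>2 * Q v) mod int l = c")
    case True
    then obtain t where t: "(t\<^sup>2 * Q v) mod int l = c" by blast
    have tn: "t mod int l \<noteq> 0"
    proof
      assume "t mod int l = 0"
      then have "int l dvd t\<^sup>2 * Q v" by (simp add: mod_eq_0_iff_dvd power2_eq_square)
      then show False using t c by (simp add: mod_eq_0_iff_dvd[symmetric])
    qed
    have Qv: "Q v mod int l \<noteq> 0" using vV by simp
    have mem: "s \<star> v \<in> M0" if s: "(s\<^sup>2 * Q v) mod int l = c" "s mod int l \<noteq> 0" for s
    proof -
      have "B (s \<star> v) v = (s * (2 * Q v)) mod int l" using vV by (simp add: B_sc_left B_self mod_simps)
      moreover have "(s * (2 * Q v)) mod int l \<noteq> 0"
        using prime_mult_mod_eq_0[OF prime_l, of s "2 * Q v"] prime_mult_mod_eq_0[OF prime_l, of 2 "Q v"] s(2) two Qv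
        by auto
      ultimately show ?thesis using s(1) vV by (auto simp: M0_def M_def Q_sc line_def)
    qed
    have "M0 = {t \<star> v, (- t) \<star> v}"
    proof (rule Set.set_eqI, rule iffI)
      fix x assume x: "x \<in> M0"
      then obtain s where s: "x = s \<star> v" by (auto simp: M0_def line_def)
      have "(s\<^sup>2 * Q v) mod int l = c" using x s vV by (simp add: M0_def M_def Q_sc)
      then have "(s\<^sup>2 * Q v) mod int l = (t\<^sup>2 * Q v) mod int l" using t by simp
      then have "((s - t) * ((s + t) * Q v)) mod int l = 0"
        by (simp add: mod_eq_dvd_iff mod_eq_0_iff_dvd power2_eq_square algebra_simps)
      then have "(s - t) mod int l = 0 \<or> (s + t) mod int l = 0"
        using prime_mult_mod_eq_0[OF prime_l, of "s - t" "(s + t) * Q v"]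
          prime_mult_mod_eq_0[OF prime_l, of "s + t" "Q v"] Qv by auto
      then have "s mod int l = t mod int l \<or> s mod int l = (- t) mod int l"
        by (simp add: mod_eq_dvd_iff mod_eq_0_iff_dvd)
      then show "x \<in> {t \<star> v, (- t) \<star> v}" unfolding s using sc_cong by blast
    next
      fix x assume "x \<in> {t \<star> v, (- t) \<star> v}"
      then show "x \<in> M0" using mem[of t] mem[of "- t"] t tn neg[OF tn] by auto
    qed
    moreover have "t \<star> v \<noteq> (- t) \<star> v"
    proof
      assume e: "t \<star> v = (- t) \<star> v"
      have "(t + t) \<star> v = (- t + t) \<star> v" using e sc_add_left[OF vV(1), of t t] sc_add_left[OF vV(1), of "- t" t] by simp
      also have "- t + t = 0" by simp
      finally have "(2 * t) \<star> v = 0 \<star> v" by (simp only: mult_2)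
      then have "(2 * t) \<star> v \<in> {\<zero>}" using sc_zero[OF vV(1)] by (simp only: singleton_iff)
      moreover have "(2 * t) mod int l \<noteq> 0" using prime_mult_mod_eq_0[OF prime_l, of 2 t] two tn by auto
      ultimately have "v \<in> {\<zero>}" using sc_mem_cancel[OF subsp_trivial] vV(1) by blast
      then show False using vV by simp
    qed
    ultimately have "card M0 = 2" by simp
    then show ?thesis using True by simp
  next
    case False
    have "M0 = {}"
    proof (rule ccontr)
      assume "M0 \<noteq> {}"
      then obtain s where s: "s \<star> v \<in> M0" by (auto simp: M0_def line_def)
      then have "(s\<^sup>2 * Q v) mod int l = c" using vV by (simp add: M0_def M_def Q_sc)
      then show False using False by blast
    qed
    then show ?thesis using False by simp
  qed
  moreover have "card M = card M0 + card M1"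
  proof -
    have "M = M0 \<union> M1" "M0 \<inter> M1 = {}" by (auto simp: M0_def M1_def)
    moreover have "finite M0" "finite M1" using finM by (auto simp: M0_def M1_def)
    ultimately show ?thesis using card_Un_disjoint by metis
  qed
  ultimately have "card M = 4 * card (ob ` M1) + (if \<exists>t. (t\<^sup>2 * Q v) mod int l = c then 2 else 0)" by simp
  then show ?thesis unfolding M_def by blast
qed

text \<open>The sign of the permutation of the vectors of norm \<open>c\<close> is a character. By
  the count modulo 4 a reflection in \<open>v\<close> is odd exactly when \<open>c / Q v\<close> is
  a square, that is, when \<open>(- c) * (- Q v)\<close> is one. For nonsquare \<open>- c\<close>
  this says that \<open>- Q v\<close> is a nonsquare.\<close>

lemma ex_spinor_norm:
  assumes odd_l: "odd l"
  shows "\<exists>\<theta>. \<theta> \<in> hom (orth l V Q) (square_classes l) \<and>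
     (\<forall>v\<in>carrier V. Q v \<noteq> 0 \<longrightarrow>
        \<theta> (reflection l V Q v) = unit_squares l #>\<^bsub>units_of (zmod l)\<^esub> (\<ominus>\<^bsub>zmod l\<^esub> Q v))"
proof -
  interpret C: square_class_group l by unfold_locales (rule prime_l)
  interpret SC: group "square_classes l" by (rule C.group_classes)
  obtain n where n: "n \<in> {1..<int l}" "\<not> QuadRes (int l) n" using ex_nonsquare[OF prime_l odd_l] by blast
  have nK: "n \<in> carrier C.K" "n \<notin> C.S" using n C.S_QuadRes by (simp_all add: C.K_carrier)
  \<comment> \<open>The sign in \<open>-n\<close> produces the normalization by \<open>- Q v\<close>
    in place of \<open>Q v\<close>.\<close>
  define c where "c = (- n) mod int l"
  have nl: "\<not> int l dvd n" using n zdvd_not_zless[of n "int l"] by auto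
  have c: "c \<in> {1..<int l}" unfolding c_def using nl l_gt_1 by (intro mod_unit_range) (simp_all add: mod_eq_0_iff_dvd)
  have cl: "\<not> int l dvd c" "\<not> int l dvd - c" using c zdvd_not_zless[of c "int l"] by auto
  have mc: "(- c) mod int l = n mod int l" unfolding c_def by (simp add: mod_minus_eq)
  have QRc: "\<not> QuadRes (int l) (- c)" using n(2) mc by (simp add: QuadRes_def cong_def)
  define X where "X = {x \<in> carrier V. Q x = c}"
  define pm where "pm = (\<lambda>g x. if x \<in> X then g x else x)"
  have finX: "finite X" unfolding X_def using finite_V by simp
  have pmX: "pm g permutes X" if g: "g \<in> Og" for g
  proof (rule bij_imp_permutes)
    have sub: "pm g ` X \<subseteq> X" using orth_closed[OF g] orth_Q[OF g] by (auto simp: pm_def X_def)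
    have inj: "inj_on (pm g) X" using orth_inj[OF g] by (intro inj_onI) (auto simp: pm_def X_def)
    show "bij_betw (pm g) X X" using inj endo_inj_surj[OF finX sub inj] by (simp add: bij_betw_def)
  qed (simp add: pm_def)
  have perm: "permutation (pm g)" if "g \<in> Og" for g by (rule permutes_imp_permutation[OF finX pmX[OF that]])
  have pmc: "pm (compose (carrier V) g h) = pm g \<circ> pm h" if g: "g \<in> Og" and h: "h \<in> Og" for g h
  proof
    fix x show "pm (compose (carrier V) g h) x = (pm g \<circ> pm h) x"
      using orth_closed[OF h, of x] orth_Q[OF h, of x] by (auto simp: pm_def X_def compose_apply)
  qed
  define \<theta> where "\<theta> = (\<lambda>g. if sign (pm g) = 1 then C.S else C.cls n)"
  have S1: "1 \<in> C.S" using C.S_QuadRes[of 1] l_gt_1 by (auto simp: QuadRes_def cong_def intro!: exI[of _ 1])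
  have Sc: "C.S \<in> carrier (square_classes l)" using SC.one_closed by (simp add: C.classes_one)
  have nc: "C.cls n \<in> carrier (square_classes l)" using nK by (simp add: C.classes_carrier)
  have nn: "C.cls n \<otimes>\<^bsub>square_classes l\<^esub> C.cls n = C.S" by (rule C.cls_nonsquares(2)[OF odd_l nK nK])
  have one: "C.S \<otimes>\<^bsub>square_classes l\<^esub> y = y" "y \<otimes>\<^bsub>square_classes l\<^esub> C.S = y"
    if "y \<in> carrier (square_classes l)" for y
    using SC.l_one[OF that] SC.r_one[OF that] by (simp_all add: C.classes_one)
  have "\<theta> \<in> hom (orth l V Q) (square_classes l)"
  proof (rule homI)
    fix g assume g: "g \<in> Og"
    show "\<theta> g \<in> carrier (square_classes l)" using Sc nc by (simp add: \<theta>_def)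
    fix h assume h: "h \<in> Og"
    have sg: "sign (pm (compose (carrier V) g h)) = sign (pm g) * sign (pm h)"
      unfolding pmc[OF g h] by (rule sign_compose[OF perm[OF g] perm[OF h]])
    have pm1: "sign (pm g) = 1 \<or> sign (pm g) = -1" "sign (pm h) = 1 \<or> sign (pm h) = -1"
      by (simp_all add: sign_def)
    show "\<theta> (g \<otimes>\<^bsub>orth l V Q\<^esub> h) = \<theta> g \<otimes>\<^bsub>square_classes l\<^esub> \<theta> h"
      unfolding orth_mult[OF g h] \<theta>_def sg using pm1 one[OF Sc] one[OF nc] nn by auto
  qed
  moreover have "\<theta> (reflection l V Q v) = C.cls (\<ominus>\<^bsub>zmod l\<^esub> Q v)" if v: "v \<in> carrier V" "Q v \<noteq> 0" for v
  proof -
    have vr: "v \<in> refls" using v by (simp add: refls_def)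
    let ?p = "pm (reflection l V Q v)"
    have M: "{x. ?p x \<noteq> x} = {x \<in> carrier V. Q x = c \<and> B x v \<noteq> 0}"
      using refl_fix_iff[OF vr] by (auto simp: pm_def X_def)
    have fin: "finite {x. ?p x \<noteq> x}" unfolding M using finite_V by simp
    have inv: "?p (?p x) = x" for x
      using refl_invol[OF vr, of x] orth_closed[OF refl_orth[OF vr], of x] orth_Q[OF refl_orth[OF vr], of x]
      by (auto simp: pm_def X_def)
    obtain k where k: "card {x. ?p x \<noteq> x} = 4 * k + (if \<exists>t. (t\<^sup>2 * Q v) mod int l = c then 2 else 0)"
      unfolding M using card_moved_mod_4[OF odd_l vr c] by blast
    have "even (card {x. ?p x \<noteq> x} div 2) \<longleftrightarrow> \<not> (\<exists>t. (t\<^sup>2 * Q v) mod int l = c)"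
    proof (cases "\<exists>t. (t\<^sup>2 * Q v) mod int l = c")
      case True
      then have "card {x. ?p x \<noteq> x} = 2 * (2 * k + 1)" using k by simp
      then show ?thesis using True by simp
    next
      case False
      then have "card {x. ?p x \<noteq> x} = 2 * (2 * k)" using k by simp
      then show ?thesis using False by simp
    qed
    then have sg: "sign ?p = 1 \<longleftrightarrow> \<not> (\<exists>t. (t\<^sup>2 * Q v) mod int l = c)"
      using sign_involution[OF fin inv] by simp
    have Ql: "\<not> int l dvd Q v" "\<not> int l dvd - Q v" using v Q_range[OF v(1)] zdvd_not_zless[of "Q v" "int l"] by auto
    have "(\<exists>t. (t\<^sup>2 * Q v) mod int l = c) \<longleftrightarrow> QuadRes (int l) (c * Q v)"
    proof
      assume "\<exists>t. (t\<^sup>2 * Q v) mod int l = c"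
      then obtain t where t: "(t\<^sup>2 * Q v) mod int l = c" by blast
      have "((t * Q v)\<^sup>2) mod int l = (((t\<^sup>2 * Q v) mod int l) * Q v) mod int l"
        by (rule mod_strip, (rule cong_strip)+, simp add: power2_eq_square algebra_simps)
      then show "QuadRes (int l) (c * Q v)" unfolding t QuadRes_def cong_def by blast
    next
      assume "QuadRes (int l) (c * Q v)"
      then obtain s where s: "s\<^sup>2 mod int l = (c * Q v) mod int l" by (auto simp: QuadRes_def cong_def)
      obtain i where i: "(Q v * i) mod int l = 1" using prime_inverse_mod[OF prime_l, of "Q v"] v by auto
      have "((s * i)\<^sup>2 * Q v) mod int l = ((s\<^sup>2 mod int l) * (i * i * Q v)) mod int l"
        by (rule mod_strip, (rule cong_strip)+, simp add: power2_eq_square algebra_simps)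
      also have "\<dots> = (c * ((Q v * i) mod int l) * ((Q v * i) mod int l)) mod int l"
        unfolding s by (rule mod_strip, (rule cong_strip)+, simp add: algebra_simps)
      also have "\<dots> = c" using i c by simp
      finally show "\<exists>t. (t\<^sup>2 * Q v) mod int l = c" by blast
    qed
    also have "\<dots> \<longleftrightarrow> QuadRes (int l) (- c * - Q v)" by simp
    also have "\<dots> \<longleftrightarrow> \<not> QuadRes (int l) (- Q v)"
      using QuadRes_mult[OF prime_l odd_l cl(2) Ql(2)] QRc by simp
    finally have sq: "sign ?p = 1 \<longleftrightarrow> QuadRes (int l) (- Q v)" using sg by simp
    define a where "a = (- Q v) mod int l"
    have aK: "a \<in> carrier C.K" unfolding a_def by (rule C.K_mem[OF Ql(2)])
    have "a \<in> C.S \<longleftrightarrow> QuadRes (int l) a" using C.S_QuadRes[of a] aK by (simp add: C.K_carrier)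
    also have "\<dots> \<longleftrightarrow> QuadRes (int l) (- Q v)" by (simp add: a_def QuadRes_def cong_def)
    finally have aS: "a \<in> C.S \<longleftrightarrow> sign ?p = 1" using sq by simp
    have "\<ominus>\<^bsub>zmod l\<^esub> Q v = a" unfolding a_def by (rule zmod_uminus[OF prime_l Q_range[OF v(1)]])
    then show ?thesis
      using aS C.cls_square[of a] C.cls_nonsquares(1)[OF odd_l aK _ nK] by (auto simp: \<theta>_def)
  qed
  ultimately show ?thesis by blast
qed

text \<open>Reflections in vectors of \<open>perp W\<close>, applied before \<open>g\<close>, do not
  change the image of \<open>x\<close>. One of them corrects the Dickson invariant, and a pair of
  them the spinor norm without disturbing the former.\<close>

lemma orbit_omega_eq:
  assumes x: "x \<in> tuples m V" and big: "l ^ (2 * m + 2) \<le> card (carrier V)"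
  shows "orbit (omega l V Q) (diag_act m) x = orbit (orth l V Q) (diag_act m) x"
proof
  show "orbit (omega l V Q) (diag_act m) x \<subseteq> orbit (orth l V Q) (diag_act m) x"
    by (auto simp: orbit_def omega_def)
  interpret C: square_class_group l by unfold_locales (rule prime_l)
  interpret SC: group "square_classes l" by (rule C.group_classes)
  interpret K: comm_group C.K by (rule C.K_comm_group)
  have xV: "x i \<in> carrier V" if "i < m" for i using tuplesD[OF x that] .
  define W where "W = tspan m x"
  have W: "subsp W" unfolding W_def using subsp_tspan[of m x] xV by blast
  have "card W \<le> l ^ m" unfolding W_def using card_tspan_le[of m x] xV by blast
  then have "card W * card W * l ^ 2 \<le> l ^ m * l ^ m * l ^ 2" by (intro mult_le_mono) auto
  also have "\<dots> = l ^ (2 * m + 2)" by (simp add: power_add mult_2 power2_eq_square)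
  finally have cW: "card W * card W * l ^ 2 \<le> card (carrier V)" using big by linarith
  have rep: "\<exists>v\<in>refls. v \<in> perp W \<and> Q v = c" if c: "c \<in> {1..<int l}" for c
  proof -
    obtain v where v: "v \<in> perp W" "Q v = c" using perp_represents[OF W cW c] by blast
    have "Q v \<noteq> 0" using v(2) c by auto
    then have "v \<in> refls" using perp_carrier[OF v(1)] by (simp add: refls_def)
    then show ?thesis using v by blast
  qed
  have one: "1 \<in> {1..<int l}" using l_gt_1 by simp
  have fixr: "diag_act m (compose (carrier V) g (reflection l V Q v)) x = diag_act m g x"
    if "v \<in> refls" "v \<in> perp W" for g v
    using diag_act_compose[OF x] diag_act_fix_refl[OF x that(1)] that(2) by (simp add: W_def)
  have dflip: "dickson l V Q (compose (carrier V) g (reflection l V Q v)) = 1 - dickson l V Q g"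
      "dickson l V Q g \<le> 1" if "g \<in> Og" "v \<in> refls" for g v
    unfolding refl_conj(2)[OF that] using dickson_rmul[OF that(1) refl_conj(1)[OF that]] by auto
  show "orbit (orth l V Q) (diag_act m) x \<subseteq> orbit (omega l V Q) (diag_act m) x"
  proof
    fix y assume "y \<in> orbit (orth l V Q) (diag_act m) x"
    then obtain g where g: "g \<in> Og" "y = diag_act m g x" by (auto simp: orbit_def)
    obtain v where v: "v \<in> refls" "v \<in> perp W" "Q v = 1" using rep[OF one] by blast
    define g1 where "g1 = (if dickson l V Q g = 0 then g else compose (carrier V) g (reflection l V Q v))"
    have g1: "g1 \<in> Og" "diag_act m g1 x = y" "dickson l V Q g1 = 0"
      unfolding g1_def using g compose_orth[OF g(1) refl_orth[OF v(1)]] fixr[OF v(1,2)] dflip[OF g(1) v(1)] by auto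
    have "\<exists>h\<in>Og. diag_act m h x = y \<and> dickson l V Q h = 0 \<and> spinor_norm l V Q h = \<one>\<^bsub>square_classes l\<^esub>"
    proof (cases "even l")
      case True
      then have l2: "l = 2" by (rule even_l)
      have "spinor_norm l V Q g1 = \<one>\<^bsub>square_classes l\<^esub>"
        using spinor_norm_two[of V Q g1] Q_range g1(1) unfolding l2 by simp
      then show ?thesis using g1 by blast
    next
      case False
      define \<theta> where "\<theta> = spinor_norm l V Q"
      have "\<theta> \<in> hom (orth l V Q) (square_classes l) \<and> (\<forall>v\<in>carrier V. Q v \<noteq> 0 \<longrightarrow>
          \<theta> (reflection l V Q v) = C.cls (\<ominus>\<^bsub>zmod l\<^esub> Q v))"
        unfolding \<theta>_def spinor_norm_def using ex_spinor_norm[OF False] by (rule someI_ex)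
      then have hom: "\<theta> \<in> hom (orth l V Q) (square_classes l)"
        and refl: "\<And>v. v \<in> refls \<Longrightarrow> \<theta> (reflection l V Q v) = C.cls ((- Q v) mod int l)"
        using zmod_uminus[OF prime_l Q_range] by (auto simp: refls_def)
      have hm: "\<theta> (compose (carrier V) g h) = \<theta> g \<otimes>\<^bsub>square_classes l\<^esub> \<theta> h" if "g \<in> Og" "h \<in> Og" for g h
        using hom_mult[OF hom that] orth_mult[OF that] by simp
      have "\<theta> g1 \<in> carrier (square_classes l)" using hom g1(1) by (auto simp: hom_def)
      then obtain a where a: "a \<in> carrier C.K" "\<theta> g1 = C.cls a" unfolding C.classes_carrier by blast
      then have a': "a \<in> {1..<int l}" by (simp add: C.K_carrier)
      obtain u where u: "u \<in> refls" "u \<in> perp W" "Q u = a" using rep[OF a'] by blast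
      \<comment> \<open>The spinor norm of \<open>g1\<close> is the class of \<open>a\<close>.
        Reflections in vectors of norms \<open>1\<close> and \<open>a\<close> contribute the classes
        of \<open>-1\<close> and \<open>-a\<close>, and \<open>a * (-1) * (-a) = a ^ 2\<close> is a
        square.\<close>
      define h1 where "h1 = compose (carrier V) g1 (reflection l V Q v)"
      define h where "h = compose (carrier V) h1 (reflection l V Q u)"
      have h1: "h1 \<in> Og" unfolding h1_def by (rule compose_orth[OF g1(1) refl_orth[OF v(1)]])
      have h: "h \<in> Og" unfolding h_def by (rule compose_orth[OF h1 refl_orth[OF u(1)]])
      have hx: "diag_act m h x = y" unfolding h_def h1_def fixr[OF u(1,2)] fixr[OF v(1,2)] by (rule g1(2))
      have dh: "dickson l V Q h = 0"
        unfolding h_def dflip(1)[OF h1 u(1)] unfolding h1_def dflip(1)[OF g1(1) v(1)] g1(3) by simp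
      have nd: "\<not> int l dvd - 1" "\<not> int l dvd - a"
        using l_gt_1 a' zdvd_not_zless[of 1 "int l"] zdvd_not_zless[of a "int l"] by auto
      have m1: "(- 1) mod int l \<in> carrier C.K" "(- a) mod int l \<in> carrier C.K" using C.K_mem nd by auto
      have "\<theta> h = (C.cls a \<otimes>\<^bsub>square_classes l\<^esub> C.cls ((- 1) mod int l)) \<otimes>\<^bsub>square_classes l\<^esub> C.cls ((- a) mod int l)"
        unfolding h_def hm[OF h1 refl_orth[OF u(1)]] unfolding h1_def hm[OF g1(1) refl_orth[OF v(1)]]
        using refl[OF v(1)] refl[OF u(1)] v(3) u(3) a(2) by simp
      also have "\<dots> = C.cls ((a \<otimes>\<^bsub>C.K\<^esub> ((- 1) mod int l)) \<otimes>\<^bsub>C.K\<^esub> ((- a) mod int l))"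
        using C.classes_mult a(1) m1 by simp
      also have "(a \<otimes>\<^bsub>C.K\<^esub> ((- 1) mod int l)) \<otimes>\<^bsub>C.K\<^esub> ((- a) mod int l) = (a * a) mod int l"
        unfolding C.K_mult by (rule mod_strip, (rule cong_strip)+, simp)
      also have "C.cls ((a * a) mod int l) = C.S" using a' by (intro C.cls_square) (auto simp: C.S_eq)
      finally have "\<theta> h = \<one>\<^bsub>square_classes l\<^esub>" by (simp add: C.classes_one)
      then show ?thesis using h hx dh by (auto simp: \<theta>_def)
    qed
    then show "y \<in> orbit (omega l V Q) (diag_act m) x" by (auto simp: orbit_def omega_def)
  qed
qed

end

subsection \<open>Smooth quadrics and split spaces\<close>

lemma finsum_zmod:
  assumes l: "prime l" and f: "\<And>i. i < k \<Longrightarrow> f i \<in> {0..<int l}"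
  shows "finsum (zmod l) f {..<k::nat} = (\<Sum>i<k. f i) mod int l"
proof -
  interpret R: cring "zmod l" by (rule zmod_cring[OF l])
  show ?thesis using f
  proof (induction k)
    case 0 then show ?case by simp
  next
    case (Suc k)
    have "finsum (zmod l) f {..<Suc k} = f k \<oplus>\<^bsub>zmod l\<^esub> finsum (zmod l) f {..<k}"
      unfolding lessThan_Suc using Suc.prems by (intro R.finsum_insert) auto
    also have "\<dots> = (\<Sum>i<Suc k. f i) mod int l" using Suc by (simp add: mod_simps add.commute)
    finally show ?case .
  qed
qed

lemma field_zmod: "prime l \<Longrightarrow> field (zmod l)"
  using residues_prime.is_field[of l] by (simp add: zmod_prime_eq residues_prime_def)

lemma id_ring_hom_zmod: "id \<in> Ring.ring_hom (zmod l) (zmod l)"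
  by (simp add: Ring.ring_hom_def)

context form_space
begin

text \<open>The expansion has the shape of \<open>form_at\<close>: norms on the diagonal and polar
  values strictly above it, which is correct in characteristic 2 as well.\<close>

lemma Q_finsum:
  fixes k :: nat
  shows "(\<And>j. j < k \<Longrightarrow> b j \<in> carrier V) \<Longrightarrow> Q (\<Oplus>j\<in>{..<k}. a j \<star> b j) =
    ((\<Sum>j<k. Q (b j) * (a j * a j)) + (\<Sum>j<k. \<Sum>i<j. B (b i) (b j) * (a i * a j))) mod int l"
proof (induction k)
  case 0 then show ?case by simp
next
  case (Suc k)
  have bV: "b j \<in> carrier V" if "j < Suc k" for j using Suc.prems that .
  have bk: "b k \<in> carrier V" "\<And>j. j < k \<Longrightarrow> b j \<in> carrier V" using bV by simp_all
  let ?s = "\<Oplus>j\<in>{..<k}. a j \<star> b j"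
  have s: "?s \<in> carrier V" "B (b k) ?s = (\<Sum>j<k. a j * B (b k) (b j)) mod int l"
    using functional_finsum[OF functional_B[OF bk(1)], of k b a] bk(2) by simp_all
  have eq: "(\<Oplus>j\<in>{..<Suc k}. a j \<star> b j) = a k \<star> b k \<oplus> ?s"
    unfolding lessThan_Suc using bV by (intro finsum_insert) auto
  have sym: "(\<Sum>j<k. a j * B (b k) (b j)) = (\<Sum>i<k. B (b i) (b k) * a i)"
    using bk B_sym by (intro sum.cong) (simp_all add: mult.commute)
  have IH: "Q ?s = ((\<Sum>j<k. Q (b j) * (a j * a j)) + (\<Sum>j<k. \<Sum>i<j. B (b i) (b j) * (a i * a j))) mod int l"
    using Suc.IH bk(2) by simp
  have "Q (a k \<star> b k \<oplus> ?s) = ((a k)\<^sup>2 * Q (b k) mod int l + Q ?s + (a k * B (b k) ?s) mod int l) mod int l"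
    using bk(1) s(1) by (simp add: Q_add Q_sc B_sc_left)
  also have "\<dots> = ((a k)\<^sup>2 * Q (b k) + ((\<Sum>j<k. Q (b j) * (a j * a j)) + (\<Sum>j<k. \<Sum>i<j. B (b i) (b j) * (a i * a j)))
      + a k * (\<Sum>i<k. B (b i) (b k) * a i)) mod int l"
    unfolding IH s(2) sym by (rule mod_strip, (rule cong_strip)+, simp)
  also have "a k * (\<Sum>i<k. B (b i) (b k) * a i) = (\<Sum>i<k. B (b i) (b k) * (a i * a k))"
    by (simp add: sum_distrib_left algebra_simps)
  finally show ?case unfolding eq by (simp add: power2_eq_square algebra_simps)
qed

text \<open>A singular vector in the radical is a rational point at which the equation and all its
  partial derivatives vanish. It suffices to use smoothness for the prime field itself, with the
  identity as embedding.\<close>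

lemma smooth_radical:
  assumes sm: "smooth_quadric l V Q" and x: "x \<in> carrier V" "Q x = 0" and B0: "\<And>y. y \<in> carrier V \<Longrightarrow> B x y = 0"
  shows "x = \<zero>"
proof -
  obtain bs where bs: "is_basis l V bs" and sm': "\<forall>(K :: int ring) \<phi>. field K \<longrightarrow> \<phi> \<in> Ring.ring_hom (zmod l) K \<longrightarrow>
       (\<forall>x\<in>{..<length bs} \<rightarrow> carrier K. form_at K \<phi> l V Q bs x = \<zero>\<^bsub>K\<^esub> \<longrightarrow>
          (\<forall>k<length bs. partial_at K \<phi> l V Q bs k x = \<zero>\<^bsub>K\<^esub>) \<longrightarrow> (\<forall>i<length bs. x i = \<zero>\<^bsub>K\<^esub>))"
    using sm unfolding smooth_quadric_def by blast
  define a where "a = coords l V bs x"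
  define r where "r = length bs"
  have aP: "a \<in> {..<r} \<rightarrow> {0..<int l}" using coords_PiE[OF bs x(1)] by (auto simp: a_def r_def PiE_def)
  have bV: "bs ! j \<in> carrier V" if "j < r" for j using basis_nth[OF bs] that by (simp add: r_def)
  have ex: "(\<Oplus>j\<in>{..<r}. a j \<star> (bs ! j)) = x" unfolding a_def r_def by (rule basis_expand[OF bs x(1)])
  have m: "y mod int l \<in> {0..<int l}" for y using l_gt_1 by simp
  interpret K: cring "zmod l" by (rule zmod_cring[OF prime_l])
  have f1: "finsum (zmod l) (\<lambda>i. id (Q (bs ! i)) \<otimes>\<^bsub>zmod l\<^esub> (a i \<otimes>\<^bsub>zmod l\<^esub> a i)) {..<r} =
      (\<Sum>i<r. (Q (bs ! i) * ((a i * a i) mod int l)) mod int l) mod int l"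
    by (subst finsum_zmod[OF prime_l]) (use l_gt_1 in simp_all)
  have f2: "finsum (zmod l) (\<lambda>i. id (B (bs ! i) (bs ! j)) \<otimes>\<^bsub>zmod l\<^esub> (a i \<otimes>\<^bsub>zmod l\<^esub> a j)) {..<j} =
      (\<Sum>i<j. (B (bs ! i) (bs ! j) * ((a i * a j) mod int l)) mod int l) mod int l" for j
    by (subst finsum_zmod[OF prime_l]) (use l_gt_1 in simp_all)
  have f3: "finsum (zmod l) (\<lambda>j. finsum (zmod l) (\<lambda>i. id (B (bs ! i) (bs ! j)) \<otimes>\<^bsub>zmod l\<^esub> (a i \<otimes>\<^bsub>zmod l\<^esub> a j)) {..<j}) {..<r} =
      (\<Sum>j<r. (\<Sum>i<j. (B (bs ! i) (bs ! j) * ((a i * a j) mod int l)) mod int l) mod int l) mod int l"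
    unfolding f2 by (rule finsum_zmod[OF prime_l]) (rule m)
  have "form_at (zmod l) id l V Q bs a =
     ((\<Sum>i<r. (Q (bs ! i) * ((a i * a i) mod int l)) mod int l) mod int l +
      (\<Sum>j<r. (\<Sum>i<j. (B (bs ! i) (bs ! j) * ((a i * a j) mod int l)) mod int l) mod int l) mod int l) mod int l"
    unfolding form_at_def r_def[symmetric] f1 f3 by simp
  also have "\<dots> = ((\<Sum>j<r. Q (bs ! j) * (a j * a j)) + (\<Sum>j<r. \<Sum>i<j. B (bs ! i) (bs ! j) * (a i * a j))) mod int l"
    by (simp add: mod_simps mod_sum_eq)
  also have "\<dots> = Q x" using Q_finsum[of r "\<lambda>j. bs ! j" a] bV ex by simp
  finally have form: "form_at (zmod l) id l V Q bs a = \<zero>\<^bsub>zmod l\<^esub>" using x(2) by simp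
  have part: "partial_at (zmod l) id l V Q bs k a = \<zero>\<^bsub>zmod l\<^esub>" if k: "k < length bs" for k
  proof -
    have bk: "bs ! k \<in> carrier V" using bV k by (simp add: r_def)
    have "partial_at (zmod l) id l V Q bs k a = (\<Sum>j<r. (B (bs ! k) (bs ! j) * a j) mod int l) mod int l"
      unfolding partial_at_def r_def[symmetric] by (subst finsum_zmod[OF prime_l]) (use l_gt_1 in simp_all)
    also have "\<dots> = (\<Sum>j<r. a j * B (bs ! k) (bs ! j)) mod int l" by (simp add: mod_sum_eq mult.commute)
    also have "\<dots> = B (bs ! k) x"
      using functional_finsum[OF functional_B[OF bk], of r "\<lambda>j. bs ! j" a] bV ex by simp
    finally show ?thesis using B0[OF bk] B_sym[OF x(1) bk] by simp
  qed
  have "\<forall>i<length bs. a i = \<zero>\<^bsub>zmod l\<^esub>"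
    using sm'[rule_format, OF field_zmod[OF prime_l] id_ring_hom_zmod, of a] aP form part by (simp add: r_def)
  then have a0: "a j \<star> (bs ! j) = \<zero>" if "j < r" for j using that bV by (simp add: r_def)
  have "(\<Oplus>j\<in>{..<r}. a j \<star> (bs ! j)) = (\<Oplus>j\<in>{..<r}. \<zero>)" by (rule finsum_cong') (use a0 in simp_all)
  then show ?thesis using ex by simp
qed

text \<open>For odd \<open>l\<close> a radical vector is singular because
  \<open>B x x = 2 * Q x\<close>. For \<open>l = 2\<close> the form \<open>B\<close> is alternating,
  so the radical has even dimension. On it \<open>Q\<close> is additive and 1 at every nonzero
  vector, which leaves at most one nonzero vector; a radical of even dimension is then zero.\<close>

lemma quad_space_of_smooth:
  assumes sm: "smooth_quadric l V Q" and par: "odd l \<or> card (carrier V) = l ^ (2 * k)"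
  shows "quad_space l V Q"
proof -
  have "x = \<zero>" if x: "x \<in> carrier V" and B0: "\<And>y. y \<in> carrier V \<Longrightarrow> B x y = 0" for x
  proof (cases "odd l")
    case True
    have "(2 * Q x) mod int l = 0" using B0[OF x] B_self[OF x] by simp
    moreover have "2 mod int l \<noteq> 0"
    proof
      assume "2 mod int l = 0"
      then have "int l dvd int 2" by (simp add: mod_eq_0_iff_dvd)
      then have "l dvd 2" using int_dvd_int_iff by blast
      then have "l = 2" using primes_dvd_imp_eq[OF prime_l two_is_prime_nat] by blast
      then show False using True by simp
    qed
    ultimately have "Q x = 0" using prime_mult_mod_eq_0[OF prime_l, of 2 "Q x"] x by auto
    then show ?thesis by (rule smooth_radical[OF sm x _ B0])
  next
    case False
    then have l2: "l = 2" using prime_l primes_dvd_imp_eq two_is_prime_nat by blast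
    define R where "R = {x \<in> carrier V. \<forall>y\<in>carrier V. B x y = 0}"
    have "\<exists>j. card (carrier V) = card {x \<in> carrier V. \<forall>y\<in>carrier V. B x y = 0} * l ^ (2 * j)"
    proof (rule card_alternating[OF subsp_carrier_V])
      fix z assume z: "z \<in> carrier V"
      show "functional_on (carrier V) (B z)" by (rule functional_B[OF z])
      show "functional_on (carrier V) (\<lambda>y. B y z)" by (rule functional_B'[OF z])
      have "(2 * Q z) mod int l = 0" by (simp add: l2)
      then show "B z z = 0" using B_self[OF z] by simp
    qed
    then obtain j where j: "card (carrier V) = card R * l ^ (2 * j)" by (auto simp: R_def)
    have R: "subsp R" unfolding R_def
      by (rule subspI) (auto simp: B_add_left B_sc_left)
    obtain i where i: "card R = l ^ i" using card_subsp_power[OF R] by blast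
    have "l ^ (2 * k) = l ^ (i + 2 * j)" using par False j i by (simp add: power_add)
    then have "2 * k = i + 2 * j" using prime_gt_1_nat[OF prime_l] by simp
    then have ie: "even i" by presburger
    have R0: "z = \<zero>" if "z \<in> R" "Q z = 0" for z
      using smooth_radical[OF sm _ that(2)] that(1) by (auto simp: R_def)
    have Q1: "Q z = 1" if "z \<in> R" "z \<noteq> \<zero>" for z
    proof -
      have "z \<in> carrier V" using that R subsp_carrier by blast
      then have "Q z \<in> {0..<2}" using Q_range[of z] l2 by simp
      moreover have "Q z \<noteq> 0" using R0[OF that(1)] that(2) by blast
      ultimately show ?thesis by simp
    qed
    show ?thesis
    proof (rule ccontr)
      assume xn: "x \<noteq> \<zero>"
      have xR: "x \<in> R" using x B0 by (simp add: R_def)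
      have sub: "{\<zero>, x} \<subseteq> R" using xR subsp_zero[OF R] by simp
      have "card {\<zero>, x} \<le> card R" using sub finite_subsp[OF R] by (intro card_mono) auto
      then have "(2::nat) \<le> 2 ^ i" using xn i l2 by simp
      then have "i \<noteq> 0" by (intro notI) simp
      moreover have "i \<noteq> 1" using ie by auto
      ultimately have "2 \<le> i" by linarith
      then have "(2::nat) ^ 2 \<le> 2 ^ i" by (intro power_increasing) auto
      then have "card {\<zero>, x} < card R" using xn i l2 by simp
      then have "\<not> R \<subseteq> {\<zero>, x}" using card_mono[of "{\<zero>, x}" R] by auto
      then obtain y where y: "y \<in> R" "y \<noteq> \<zero>" "y \<noteq> x" by blast
      have yV: "y \<in> carrier V" using y R subsp_carrier by blast
      have "Q (x \<oplus> y) = 0" using Q_add[OF x yV] Q1[OF xR xn] Q1[OF y(1,2)] B0[OF yV] l2 by simp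
      then have z: "x \<oplus> y = \<zero>" using R0 subsp_add[OF R xR y(1)] by blast
      have "(-1) \<star> x = 1 \<star> x" by (rule sc_cong) (simp add: l2)
      then have "x \<oplus> x = \<zero>" using add_sc_minus[OF x] x by simp
      then have "x \<oplus> y = x \<oplus> x" using z by simp
      then show False using y(3) x yV by simp
    qed
  qed
  then show ?thesis by (intro quad_space.intro form_space_axioms quad_space_axioms.intro) blast
qed

end

lemma (in quad_space) orbit_self:
  assumes "x \<in> tuples m V" shows "x \<in> orbit (orth l V Q) (diag_act m) x"
  using id_orth diag_act_id[OF assms] unfolding orbit_def by force

text \<open>Nondegeneracy of \<open>B\<close> is known unless \<open>l = 2\<close> and
  \<open>r\<close> is odd. By the parity hypothesis this leaves only \<open>m = 0\<close>, where
  there is a single empty tuple.\<close>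

lemma orbits_prime_field:
  fixes V :: "(int, 'v) module"
  assumes "form_space l V Q" and sm: "smooth_quadric l V Q" and card: "card (carrier V) = l ^ r"
    and r: "2 * m + 2 \<le> r" and par: "even l \<Longrightarrow> m > 0 \<Longrightarrow> even r"
  defines "ob \<equiv> orbit (orth l V Q) (diag_act m)"
  shows "\<And>x. x \<in> tuples m V \<Longrightarrow> x \<in> ob x"
    and "\<And>x y. x \<in> tuples m V \<Longrightarrow> y \<in> ob x \<Longrightarrow> y \<in> tuples m V \<and> ob y = ob x"
    and "card (ob ` tuples m V) = (\<Prod>i=1..m. 1 + l ^ i)"
    and "\<And>x. x \<in> tuples m V \<Longrightarrow> orbit (omega l V Q) (diag_act m) x = ob x"
proof -
  interpret form_space l V Q by fact
  have "(\<forall>x\<in>tuples m V. x \<in> ob x) \<and> (\<forall>x\<in>tuples m V. \<forall>y\<in>ob x. y \<in> tuples m V \<and> ob y = ob x) \<and>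
    card (ob ` tuples m V) = (\<Prod>i=1..m. 1 + l ^ i) \<and>
    (\<forall>x\<in>tuples m V. orbit (omega l V Q) (diag_act m) x = ob x)"
  proof (cases "odd l \<or> even r")
    case True
    have "odd l \<or> card (carrier V) = l ^ (2 * (r div 2))" using True card by auto
    then interpret quad_space l V Q by (rule quad_space_of_smooth[OF sm])
    have big: "l ^ (2 * m + 2) \<le> card (carrier V)"
      unfolding card using r prime_gt_0_nat[OF prime_l] by (intro power_increasing) auto
    obtain E where E: "subsp E" "tot_sing E" "card E = l ^ m" using ex_tot_sing[OF big] by blast
    have "orbits (orth l V Q) (tuples m V) (diag_act m) = ob ` tuples m V" by (auto simp: orbits_def ob_def)
    then have C: "card (ob ` tuples m V) = (\<Prod>i=1..m. 1 + l ^ i)" using card_orbits_orth[OF E] by simp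
    have D: "orbit (omega l V Q) (diag_act m) x = ob x" if "x \<in> tuples m V" for x
      unfolding ob_def by (rule orbit_omega_eq[OF that big])
    have A: "x \<in> ob x" if "x \<in> tuples m V" for x unfolding ob_def by (rule orbit_self[OF that])
    have Bo: "y \<in> tuples m V \<and> ob y = ob x" if x: "x \<in> tuples m V" and y: "y \<in> ob x" for x y
    proof -
      obtain g where g: "g \<in> carrier (orth l V Q)" "y = diag_act m g x" using y unfolding ob_def orbit_def by blast
      then show ?thesis unfolding ob_def using orbit_eqI[OF x g(1)] diag_act_tuples[OF g(1) x] by simp
    qed
    show ?thesis using A Bo C D by blast
  next
    case False
    then have l2: "l = 2" using prime_l primes_dvd_imp_eq two_is_prime_nat by blast
    have m0: "m = 0" using False par by auto
    let ?x = "(\<lambda>_. undefined) :: nat \<Rightarrow> 'v"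
    have T: "tuples m V = {?x}" by (simp add: tuples_def m0)
    have act: "diag_act m g x = ?x" for g and x :: "nat \<Rightarrow> 'v" by (simp add: diag_act_def m0 restrict_def)
    \<comment> \<open>The identity is shown by hand to lie in both groups, since \<open>B\<close>
      may be degenerate here. Its Dickson invariant is read off from the empty product of
      reflections.\<close>
    define e where "e = (\<lambda>x\<in>carrier V. x)"
    have eO: "e \<in> carrier (orth l V Q)"
    proof -
      have "(a \<odot>\<^bsub>V\<^esub> x) \<in> carrier V" if "a \<in> carrier (zmod l)" "x \<in> carrier V" for a x
        using module.smult_closed[OF is_module that] .
      then show ?thesis using id_Bij[of "carrier V"] by (simp add: orth_def lin_auts_def e_def)
    qed
    have "is_reflection_product l V Q [] e" by (simp add: is_reflection_product_def orth_def BijGroup_def e_def)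
    then have "\<exists>vs. is_reflection_product l V Q vs e \<and> even (length vs)" by (intro exI[of _ "[]"]) simp
    then have "dickson l V Q e = 0" using l2 by (simp add: dickson_def)
    moreover have "spinor_norm l V Q e = \<one>\<^bsub>square_classes l\<^esub>"
      using spinor_norm_two[of V Q e] Q_range eO unfolding l2 by simp
    ultimately have eW: "e \<in> carrier (omega l V Q)" using eO by (simp add: omega_def)
    have o: "ob x = {?x}" for x using eO act unfolding ob_def orbit_def by auto
    have w: "orbit (omega l V Q) (diag_act m) x = {?x}" for x using eW act unfolding orbit_def by auto
    show ?thesis unfolding T o w by (simp add: m0)
  qed
  then show "\<And>x. x \<in> tuples m V \<Longrightarrow> x \<in> ob x"
    and "\<And>x y. x \<in> tuples m V \<Longrightarrow> y \<in> ob x \<Longrightarrow> y \<in> tuples m V \<and> ob y = ob x"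
    and "card (ob ` tuples m V) = (\<Prod>i=1..m. 1 + l ^ i)"
    and "\<And>x. x \<in> tuples m V \<Longrightarrow> orbit (omega l V Q) (diag_act m) x = ob x" by blast+
qed

lemma (in fin_space) finsum_mem_subsp:
  fixes k :: nat
  assumes X: "subsp X"
  shows "(\<And>j. j < k \<Longrightarrow> b j \<in> X) \<Longrightarrow> (\<Oplus>j\<in>{..<k}. a j \<star> b j) \<in> X"
proof (induction k)
  case 0 then show ?case using subsp_zero[OF X] by simp
next
  case (Suc k)
  have bX: "b j \<in> X" if "j < Suc k" for j using Suc.prems that .
  have "(\<Oplus>j\<in>{..<Suc k}. a j \<star> b j) = a k \<star> b k \<oplus> (\<Oplus>j\<in>{..<k}. a j \<star> b j)"
    unfolding lessThan_Suc using subsp_carrier[OF X bX] by (intro finsum_insert) auto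
  then show ?case using Suc.IH bX X by (simp add: subsp_add subsp_sc)
qed

text \<open>In a hyperbolic basis the coordinates of a vector are its products with the partners of
  the basis vectors, so \<open>B\<close> is nondegenerate. The first half of the basis spans the
  required totally singular space.\<close>

lemma card_orbits_split_space:
  fixes V :: "(int, 'w) module"
  assumes l: "prime l" and sp: "split_space l V Q m"
  shows "card (orbits (orth l V Q) (tuples m V) (diag_act m)) = (\<Prod>i=1..m. 1 + l ^ i)"
    and "m > 0 \<Longrightarrow> card (orbits (special_orth l V Q) (tuples m V) (diag_act m)) =
       card (orbits (orth l V Q) (tuples m V) (diag_act m)) + 1"
proof -
  have mod: "module (zmod l) V" and qf: "quadratic_form l V Q" using sp by (simp_all add: split_space_def)
  obtain bs where bs: "is_basis l V bs" "length bs = 2 * m"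
    and Qbs: "\<And>x. x \<in> {..<2 * m} \<rightarrow>\<^sub>E {0..<int l} \<Longrightarrow> Q (lin_comb V bs x) = (\<Sum>i<m. x i * x (m + i)) mod int l"
    using sp by (auto simp: split_space_def)
  have "zmod_module l V" using mod prime_gt_0_nat[OF l] by (simp add: zmod_module_def)
  then interpret zmod_module l V .
  interpret form_space l V Q
    by unfold_locales (use l qf is_basis_finite[OF bs(1)] in auto)
  define co where "co = coords l V bs"
  have coP: "co x \<in> {..<2 * m} \<rightarrow>\<^sub>E {0..<int l}" if "x \<in> carrier V" for x
    using coords_PiE[OF bs(1) that] bs(2) by (simp add: co_def)
  have Qc: "Q x = (\<Sum>i<m. co x i * co x (m + i)) mod int l" if x: "x \<in> carrier V" for x
    using Qbs[OF coP[OF x]] lin_comb_coords[OF bs(1) x] by (simp add: co_def)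
  have coadd: "co (x \<oplus>\<^bsub>V\<^esub> y) i = (co x i + co y i) mod int l" if "x \<in> carrier V" "y \<in> carrier V" "i < 2 * m" for x y i
    using functional_coords[OF bs(1), of i] that bs(2) by (simp add: functional_on_def co_def)
  have comod: "co x i mod int l = co x i" if "x \<in> carrier V" "i < 2 * m" for x i
    using coP[OF that(1)] that(2) by (auto simp: PiE_def Pi_def)
  have Bc: "B x y = (\<Sum>i<m. co x i * co y (m + i) + co y i * co x (m + i)) mod int l"
    if xy: "x \<in> carrier V" "y \<in> carrier V" for x y
  proof -
    have "Q (x \<oplus>\<^bsub>V\<^esub> y) = (\<Sum>i<m. ((co x i + co y i) mod int l) * ((co x (m + i) + co y (m + i)) mod int l)) mod int l"
      using Qc[of "x \<oplus>\<^bsub>V\<^esub> y"] coadd[OF xy] xy by simp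
    also have "\<dots> = (\<Sum>i<m. (co x i + co y i) * (co x (m + i) + co y (m + i))) mod int l"
      by (rule mod_strip[OF cong_sum cong_refl refl]) (intro cong_mult cong_mod_drop cong_refl)
    finally have Qxy: "Q (x \<oplus>\<^bsub>V\<^esub> y) = (\<Sum>i<m. (co x i + co y i) * (co x (m + i) + co y (m + i))) mod int l" .
    have "B x y = ((\<Sum>i<m. (co x i + co y i) * (co x (m + i) + co y (m + i))) -
        (\<Sum>i<m. co x i * co x (m + i)) - (\<Sum>i<m. co y i * co y (m + i))) mod int l"
      unfolding polar_def Qxy Qc[OF xy(1)] Qc[OF xy(2)] by (rule mod_strip, (rule cong_strip)+, simp)
    also have "(\<Sum>i<m. (co x i + co y i) * (co x (m + i) + co y (m + i))) -
        (\<Sum>i<m. co x i * co x (m + i)) - (\<Sum>i<m. co y i * co y (m + i)) =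
        (\<Sum>i<m. co x i * co y (m + i) + co y i * co x (m + i))"
      by (simp add: sum.distrib algebra_simps)
    finally show ?thesis .
  qed
  have bV: "bs ! k \<in> carrier V" if "k < 2 * m" for k using basis_nth[OF bs(1)] that bs(2) by simp
  have cob: "co (bs ! k) i = (if i = k then 1 else 0)" if "k < 2 * m" "i < 2 * m" for i k
    using coords_basis[OF bs(1)] that bs(2) by (simp add: co_def)
  have B1: "B x (bs ! k) = co x (m + k)" if x: "x \<in> carrier V" and k: "k < m" for x k
  proof -
    have "(\<Sum>i<m. co x i * co (bs ! k) (m + i) + co (bs ! k) i * co x (m + i)) = (\<Sum>i<m. if i = k then co x (m + i) else 0)"
      using cob[of k] k by (intro sum.cong) auto
    also have "\<dots> = co x (m + k)" using k by simp
    finally show ?thesis using Bc[OF x bV[of k]] k comod[OF x, of "m + k"] by simp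
  qed
  have B2: "B x (bs ! (m + k)) = co x k" if x: "x \<in> carrier V" and k: "k < m" for x k
  proof -
    have "(\<Sum>i<m. co x i * co (bs ! (m + k)) (m + i) + co (bs ! (m + k)) i * co x (m + i)) = (\<Sum>i<m. if i = k then co x i else 0)"
      using cob[of "m + k"] k by (intro sum.cong) auto
    also have "\<dots> = co x k" using k by simp
    finally show ?thesis using Bc[OF x bV[of "m + k"]] k comod[OF x, of k] by simp
  qed
  have "x = \<zero>\<^bsub>V\<^esub>" if x: "x \<in> carrier V" and B0: "\<And>y. y \<in> carrier V \<Longrightarrow> B x y = 0" for x
  proof -
    have c0: "co x j = 0" if j: "j < 2 * m" for j
    proof (cases "j < m")
      case True then show ?thesis using B2[OF x True] B0[OF bV[of "m + j"]] by simp
    next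
      case False
      then have jm: "j - m < m" "m + (j - m) = j" using j by auto
      then show ?thesis using B1[OF x jm(1)] B0[OF bV[of "j - m"]] by simp
    qed
    have "x = (\<Oplus>\<^bsub>V\<^esub>j\<in>{..<length bs}. coords l V bs x j \<star> (bs ! j))" using basis_expand[OF bs(1) x] by simp
    also have "\<dots> = (\<Oplus>\<^bsub>V\<^esub>j\<in>{..<length bs}. \<zero>\<^bsub>V\<^esub>)"
      by (rule finsum_cong') (use c0 bV bs(2) in \<open>auto simp: co_def\<close>)
    finally show ?thesis by simp
  qed
  then have "quad_space l V Q"
    by (intro quad_space.intro form_space_axioms quad_space_axioms.intro) blast
  then interpret quad_space l V Q .
  define b where "b = (\<lambda>j. bs ! j)"
  have bV': "b j \<in> carrier V" if "j < 2 * m" for j unfolding b_def by (rule bV[OF that])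
  have cV: "card (carrier V) = l ^ (2 * m)" using is_basis_card[OF bs(1)] bs(2) by simp
  have "tspan (2 * m) b = carrier V"
  proof
    have s: "subsp (tspan (2 * m) b)" using subsp_tspan[of "2 * m" b] bV' by blast
    show "tspan (2 * m) b \<subseteq> carrier V" by (rule subsp_subset[OF s])
    show "carrier V \<subseteq> tspan (2 * m) b"
    proof
      fix x assume x: "x \<in> carrier V"
      have "(\<Oplus>\<^bsub>V\<^esub>j\<in>{..<2 * m}. coords l V bs x j \<star> b j) \<in> tspan (2 * m) b"
        by (rule finsum_mem_subsp[OF s]) (use tspan_mem[of "2 * m" b] bV' in blast)
      then show "x \<in> tspan (2 * m) b" using basis_expand[OF bs(1) x] bs(2) by (simp add: b_def)
    qed
  qed
  then have full: "card (tspan (2 * m) b) = l ^ (2 * m)" using cV by simp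
  \<comment> \<open>The sizes of the spans of initial segments are obtained downwards from the full
    basis, whose span is known.\<close>
  have "card (tspan (2 * m - j) b) = l ^ (2 * m - j)" if "j \<le> 2 * m" for j
    using that
  proof (induction j)
    case 0 then show ?case using full by simp
  next
    case (Suc j)
    then have e: "2 * m - j = Suc (2 * m - Suc j)" by simp
    have "card (tspan (2 * m - j) b) = l ^ (2 * m - j)" using Suc by simp
    moreover have "b i \<in> carrier V" if "i < Suc (2 * m - Suc j)" for i using bV'[of i] that e Suc.prems by simp
    ultimately show ?case using tspan_independent_step(1)[of "2 * m - Suc j" b] unfolding e by blast
  qed
  from this[of m] have cE: "card (tspan m b) = l ^ m" by simp
  have sE: "subsp (tspan k b)" if "k \<le> m" for k using subsp_tspan[of k b] bV' that by simp
  have Bb: "B (b i) (b j) = 0" if "i < m" "j < m" for i j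
    using B1[OF bV'[of i] that(2)] cob[of i "m + j"] that by (simp add: b_def)
  have Qb: "Q (b i) = 0" if "i < m" for i
  proof -
    have "(\<Sum>j<m. co (b i) j * co (b i) (m + j)) = 0"
      using cob[of i] that by (intro sum.neutral) (auto simp: b_def)
    then show ?thesis using Qc[OF bV'[of i]] that by simp
  qed
  have "tot_sing (tspan k b)" if "k \<le> m" for k
    using that
  proof (induction k)
    case 0 then show ?case by (simp add: tot_sing_def)
  next
    case (Suc k)
    have bk: "b k \<in> carrier V" using bV' Suc.prems by simp
    have "tspan k b \<subseteq> perp {b k}"
      by (rule tspan_least[OF subsp_perp]) (use bk bV' Bb Suc.prems in \<open>auto simp: perp_def\<close>)
    then have "b k \<in> perp (tspan k b)" using bk B_sym by (auto simp: perp_def subset_iff)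
    then show ?case using tot_sing_adj[OF sE _ _ Qb] Suc by simp
  qed
  then have tE: "tot_sing (tspan m b)" by simp
  show "card (orbits (orth l V Q) (tuples m V) (diag_act m)) = (\<Prod>i=1..m. 1 + l ^ i)"
    by (rule card_orbits_orth[OF sE[OF order_refl] tE cE])
  show "m > 0 \<Longrightarrow> card (orbits (special_orth l V Q) (tuples m V) (diag_act m)) =
       card (orbits (orth l V Q) (tuples m V) (diag_act m)) + 1"
    by (rule card_orbits_special_orth[OF sE[OF order_refl] tE cE cV])
qed

subsection \<open>Reduction modulo the primes dividing \<open>n\<close>\<close>

lemma squarefree_dvdI:
  fixes n :: nat and a :: int
  assumes n: "squarefree n" and d: "\<And>l. prime l \<Longrightarrow> l dvd n \<Longrightarrow> int l dvd a"
  shows "int n dvd a"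
proof -
  define b where "b = nat \<bar>a\<bar>"
  have "int b = \<bar>a\<bar>" by (simp add: b_def)
  then have ab: "int k dvd a \<longleftrightarrow> k dvd b" for k by (metis dvd_abs_iff int_dvd_int_iff)
  have n0: "n \<noteq> 0" using n by (intro notI) simp
  have "n dvd b"
  proof (cases "b = 0")
    case False
    show ?thesis
    proof (rule multiplicity_le_imp_dvd[OF n0])
      fix p :: nat assume p: "prime p"
      show "multiplicity p n \<le> multiplicity p b"
      proof (cases "p dvd n")
        case True
        then have "p dvd b" using d[OF p True] ab by simp
        then have "multiplicity p b \<ge> 1" using False p by (simp add: Suc_le_eq prime_multiplicity_gt_zero_iff prime_imp_prime_elem)
        moreover have "multiplicity p n \<le> 1" using n squarefree_factorial_semiring''[OF n0] p by blast
        ultimately show ?thesis by linarith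
      next
        case False then show ?thesis by (simp add: not_dvd_imp_multiplicity_0)
      qed
    qed
  qed simp
  then show ?thesis using ab by simp
qed

lemma prod_prime_factors_squarefree:
  fixes n :: nat assumes n: "squarefree n" shows "\<Prod>(prime_factors n) = n"
proof -
  have n0: "n \<noteq> 0" using n by (intro notI) simp
  have "(\<Prod>p\<in>prime_factors n. p) = (\<Prod>p\<in>prime_factors n. p ^ multiplicity p n)"
    using n squarefree_factorial_semiring'[OF n0] by (intro prod.cong) auto
  also have "\<dots> = n" using prod_prime_factors[OF n0] by simp
  finally show ?thesis .
qed

section \<open>Coordinates of a free module and classes modulo \<open>l\<close>\<close>

context zmod_module
begin

lemma finsum_sc:
  fixes k :: nat
  assumes b: "\<And>j. j < k \<Longrightarrow> b j \<in> carrier V"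
  shows "(\<Oplus>j\<in>{..<k}. (c * a j + d * a' j) \<star> b j) =
    c \<star> (\<Oplus>j\<in>{..<k}. a j \<star> b j) \<oplus> d \<star> (\<Oplus>j\<in>{..<k}. a' j \<star> b j)"
proof -
  have cl: "(\<lambda>j. (x j) \<star> b j) \<in> {..<k} \<rightarrow> carrier V" for x using b by auto
  have sc: "c \<star> (\<Oplus>j\<in>{..<k}. a j \<star> b j) = (\<Oplus>j\<in>{..<k}. (c * a j) \<star> b j)" for c a
  proof -
    have "c \<star> (\<Oplus>j\<in>{..<k}. a j \<star> b j) = (\<Oplus>j\<in>{..<k}. c \<star> (a j \<star> b j))"
      unfolding sc_def[of c] by (rule module.finsum_smult_ldistr[OF is_module _ mod_carrier cl]) simp
    also have "\<dots> = (\<Oplus>j\<in>{..<k}. (c * a j) \<star> b j)"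
      by (rule finsum_cong') (use b in \<open>auto simp: sc_sc\<close>)
    finally show ?thesis .
  qed
  have "(\<Oplus>j\<in>{..<k}. (c * a j + d * a' j) \<star> b j) = (\<Oplus>j\<in>{..<k}. (c * a j) \<star> b j \<oplus> (d * a' j) \<star> b j)"
    by (rule finsum_cong') (use b in \<open>auto simp: sc_add_left\<close>)
  also have "\<dots> = (\<Oplus>j\<in>{..<k}. (c * a j) \<star> b j) \<oplus> (\<Oplus>j\<in>{..<k}. (d * a' j) \<star> b j)"
    by (rule finsum_addf[OF cl cl])
  finally show ?thesis unfolding sc .
qed

lemma lin_comb_finsum:
  assumes bs: "is_basis n V bs" and a: "a \<in> {..<length bs} \<rightarrow>\<^sub>E {0..<int n}"
  shows "lin_comb V bs a = (\<Oplus>j\<in>{..<length bs}. a j \<star> (bs ! j))"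
  unfolding lin_comb_def
proof (rule finsum_cong')
  show "(\<lambda>j. a j \<star> (bs ! j)) \<in> {..<length bs} \<rightarrow> carrier V"
    using bs by (intro Pi_I sc_closed) (auto simp: is_basis_def)
  fix i assume "i \<in> {..<length bs}"
  then have "a i \<in> {0..<int n}" using a by (auto simp: PiE_def Pi_def)
  then show "a i \<odot> bs ! i = a i \<star> (bs ! i)" by (rule smult_eq_sc)
qed simp

lemma basis_finsum_surj:
  assumes bs: "is_basis n V bs" and x: "x \<in> carrier V"
  shows "\<exists>a. x = (\<Oplus>j\<in>{..<length bs}. a j \<star> (bs ! j))"
proof -
  have "x \<in> lin_comb V bs ` ({..<length bs} \<rightarrow>\<^sub>E {0..<int n})" using bs x by (simp add: is_basis_def bij_betw_def)
  then show ?thesis using lin_comb_finsum[OF bs] by blast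
qed

lemma basis_finsum_inj:
  assumes bs: "is_basis n V bs"
    and eq: "(\<Oplus>j\<in>{..<length bs}. a j \<star> (bs ! j)) = (\<Oplus>j\<in>{..<length bs}. a' j \<star> (bs ! j))"
    and j: "j < length bs"
  shows "a j mod int n = a' j mod int n"
proof -
  let ?P = "{..<length bs} \<rightarrow>\<^sub>E {0..<int n}"
  define r where "r = (\<lambda>a. \<lambda>j\<in>{..<length bs}. a j mod int n)"
  have rP: "r a \<in> ?P" for a using n_pos by (auto simp: r_def)
  have bV: "bs ! j \<in> carrier V" if "j < length bs" for j using bs that by (auto simp: is_basis_def)
  have "lin_comb V bs (r a) = (\<Oplus>j\<in>{..<length bs}. a j \<star> (bs ! j))" for a
    unfolding lin_comb_finsum[OF bs rP] by (rule finsum_cong') (use bV in \<open>auto simp: r_def\<close>)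
  then have "lin_comb V bs (r a) = lin_comb V bs (r a')" using eq by simp
  then have "r a = r a'" using bs inj_onD[of "lin_comb V bs" ?P "r a" "r a'"] rP by (simp add: is_basis_def bij_betw_def)
  from fun_cong[OF this, of j] show ?thesis using j by (simp add: r_def)
qed

definition red :: "nat \<Rightarrow> 'v \<Rightarrow> 'v set" where "red l x = multiples l V +> x"

lemma multiples_eq: "multiples l V = {int l \<star> x | x. x \<in> carrier V}"
proof -
  have pow: "[k] \<cdot>\<^bsub>V\<^esub> x = int k \<star> x" if x: "x \<in> carrier V" for k :: nat and x
  proof (induction k)
    case 0 then show ?case using x by simp
  next
    case (Suc k)
    have "[Suc k] \<cdot>\<^bsub>V\<^esub> x = [k] \<cdot>\<^bsub>V\<^esub> x \<oplus> x" using add.nat_pow_Suc[of k x] by simp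
    also have "\<dots> = int k \<star> x \<oplus> 1 \<star> x" using Suc x by simp
    also have "\<dots> = int (Suc k) \<star> x" unfolding sc_add_left[OF x, symmetric] by (simp add: add.commute)
    finally show ?case .
  qed
  show ?thesis unfolding multiples_def by (intro Collect_cong ex_cong1) (auto simp: pow)
qed

lemma subsp_multiples: "subsp (multiples l V)"
proof (rule subspI)
  show "multiples l V \<subseteq> carrier V" by (auto simp: multiples_eq)
  show "\<zero> \<in> multiples l V" unfolding multiples_eq by (force intro: exI[of _ \<zero>])
  show "x \<oplus> y \<in> multiples l V" if xy: "x \<in> multiples l V" "y \<in> multiples l V" for x y
  proof -
    obtain x' y' where "x = int l \<star> x'" "y = int l \<star> y'" "x' \<in> carrier V" "y' \<in> carrier V"
      using xy by (auto simp: multiples_eq)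
    then have "x \<oplus> y = int l \<star> (x' \<oplus> y')" "x' \<oplus> y' \<in> carrier V" by (simp_all add: sc_add_right)
    then show ?thesis unfolding multiples_eq by blast
  qed
  show "a \<star> x \<in> multiples l V" if x: "x \<in> multiples l V" for a x
  proof -
    obtain x' where "x = int l \<star> x'" "x' \<in> carrier V" using x by (auto simp: multiples_eq)
    then have "a \<star> x = int l \<star> (a \<star> x')" "a \<star> x' \<in> carrier V" by (simp_all add: sc_sc mult.commute)
    then show ?thesis unfolding multiples_eq by blast
  qed
qed

lemma red_mem: "y \<in> red l x \<longleftrightarrow> (\<exists>h\<in>multiples l V. y = h \<oplus> x)"
  by (auto simp: red_def a_r_coset_def')

lemma red_self: "x \<in> carrier V \<Longrightarrow> x \<in> red l x"
  using subsp_zero[OF subsp_multiples] by (auto simp: red_mem intro!: bexI[of _ \<zero>])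

lemma red_eqI: "h \<in> multiples l V \<Longrightarrow> x \<in> carrier V \<Longrightarrow> red l (h \<oplus> x) = red l x"
proof (rule Set.set_eqI, rule iffI)
  assume h: "h \<in> multiples l V" and x: "x \<in> carrier V"
  have hV: "h \<in> carrier V" using subsp_carrier[OF subsp_multiples h] .
  fix y
  { assume "y \<in> red l (h \<oplus> x)"
    then obtain h' where h': "h' \<in> multiples l V" "y = h' \<oplus> (h \<oplus> x)" by (auto simp: red_mem)
    have "y = (h' \<oplus> h) \<oplus> x" using h' hV x subsp_carrier[OF subsp_multiples h'(1)] by (simp add: a_assoc)
    then show "y \<in> red l x" using subsp_add[OF subsp_multiples h'(1) h] by (auto simp: red_mem) }
  { assume "y \<in> red l x"
    then obtain h' where h': "h' \<in> multiples l V" "y = h' \<oplus> x" by (auto simp: red_mem)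
    have h'V: "h' \<in> carrier V" using subsp_carrier[OF subsp_multiples h'(1)] .
    have "(h' \<oplus> (-1) \<star> h) \<oplus> (h \<oplus> x) = y"
      using h' h'V hV x by (simp add: a_assoc)
    moreover have "h' \<oplus> (-1) \<star> h \<in> multiples l V"
      by (rule subsp_add[OF subsp_multiples h'(1) subsp_sc[OF subsp_multiples h]])
    ultimately show "y \<in> red l (h \<oplus> x)" unfolding red_mem by blast }
qed

lemma red_eq_iff:
  assumes "x \<in> carrier V" "y \<in> carrier V"
  shows "red l x = red l y \<longleftrightarrow> x \<oplus> (-1) \<star> y \<in> multiples l V"
proof
  assume "red l x = red l y"
  then have "x \<in> red l y" using red_self[OF assms(1), of l] by simp
  then obtain h where h: "h \<in> multiples l V" "x = h \<oplus> y" by (auto simp: red_mem)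
  then show "x \<oplus> (-1) \<star> y \<in> multiples l V" using subsp_carrier[OF subsp_multiples h(1)] assms by simp
next
  assume "x \<oplus> (-1) \<star> y \<in> multiples l V"
  from red_eqI[OF this assms(2)] show "red l x = red l y" using assms by simp
qed

lemma red_carrier_iff: "carrier (reduced_module l V) = red l ` carrier V"
  by (auto simp: reduced_module_def A_RCOSETS_def' red_def)

lemma red_zero: "\<zero>\<^bsub>reduced_module l V\<^esub> = red l \<zero>"
  using a_coset_add_zero[OF subsp_subset[OF subsp_multiples]] by (simp add: reduced_module_def red_def)

lemma red_add:
  assumes x: "x \<in> carrier V" and y: "y \<in> carrier V"
  shows "red l x \<oplus>\<^bsub>reduced_module l V\<^esub> red l y = red l (x \<oplus> y)"
proof -
  have "set_add V (red l x) (red l y) = red l (x \<oplus> y)"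
  proof (rule Set.set_eqI, rule iffI)
    fix z assume "z \<in> set_add V (red l x) (red l y)"
    then obtain h k where hk: "h \<in> multiples l V" "k \<in> multiples l V" "z = (h \<oplus> x) \<oplus> (k \<oplus> y)"
      by (auto simp: set_add_def' red_mem)
    have V: "h \<in> carrier V" "k \<in> carrier V" using hk subsp_carrier[OF subsp_multiples] by auto
    have "z = (h \<oplus> k) \<oplus> (x \<oplus> y)" using hk(3) V x y by (simp add: a_ac)
    then show "z \<in> red l (x \<oplus> y)" using subsp_add[OF subsp_multiples hk(1,2)] by (auto simp: red_mem)
  next
    fix z assume "z \<in> red l (x \<oplus> y)"
    then obtain h where h: "h \<in> multiples l V" "z = h \<oplus> (x \<oplus> y)" by (auto simp: red_mem)
    have "z = (h \<oplus> x) \<oplus> y" using h x y subsp_carrier[OF subsp_multiples h(1)] by (simp add: a_assoc)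
    moreover have "h \<oplus> x \<in> red l x" using h(1) by (auto simp: red_mem)
    ultimately show "z \<in> set_add V (red l x) (red l y)" using red_self[OF y] by (auto simp: set_add_def')
  qed
  then show ?thesis by (simp add: reduced_module_def)
qed

end

section \<open>The quadratic space over one prime field\<close>

locale prime_reduction = zmod_module n V for n :: nat and V :: "(int, 'v) module" (structure) +
  fixes l :: nat
  assumes prime_l: "prime l" and l_dvd: "l dvd n"
begin

notation sc (infixr \<open>\<star>\<close> 75)

abbreviation W :: "(int, 'v set) module" where "W \<equiv> reduced_module l V"

lemma mod_mod_l [simp]: "(a mod int n) mod int l = a mod int l"
  using l_dvd by (simp add: mod_mod_cancel)

lemma red_sc_cong:
  assumes x: "x \<in> carrier V" and ab: "a mod int l = b mod int l"
  shows "red l (a \<star> x) = red l (b \<star> x)"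
proof -
  obtain k where k: "a = b + int l * k" using ab by (metis mod_eqE mult.commute)
  have "a \<star> x = int l \<star> (k \<star> x) \<oplus> b \<star> x" unfolding k using x by (simp add: sc_add_left sc_sc a_comm)
  moreover have "int l \<star> (k \<star> x) \<in> multiples l V" unfolding multiples_eq using x by blast
  ultimately show ?thesis using red_eqI[of "int l \<star> (k \<star> x)" l "b \<star> x"] x by simp
qed

lemma red_smult:
  assumes x: "x \<in> carrier V" and a: "a \<in> {0..<int l}"
  shows "a \<odot>\<^bsub>W\<^esub> red l x = red l (a \<star> x)"
proof -
  have "int l \<le> int n" using l_dvd n_pos by (simp add: dvd_imp_le)
  then have an: "a \<in> {0..<int n}" using a by auto
  have "red l (a \<odot> y) = red l (a \<star> x)" if y: "y \<in> red l x" for y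
  proof -
    obtain h where h: "h \<in> multiples l V" "y = h \<oplus> x" using y by (auto simp: red_mem)
    have "a \<odot> y = a \<star> h \<oplus> a \<star> x"
      using smult_eq_sc[OF an] h subsp_carrier[OF subsp_multiples h(1)] x by (simp add: sc_add_right)
    then show ?thesis using red_eqI[OF subsp_sc[OF subsp_multiples h(1)]] x by simp
  qed
  then have "(\<Union>y\<in>red l x. red l (a \<odot> y)) = red l (a \<star> x)" using red_self[OF x, of l] by blast
  then show ?thesis by (simp add: reduced_module_def red_def)
qed

lemma module_W: "module (zmod l) W"
proof (rule moduleI)
  show "cring (zmod l)" by (rule zmod_cring[OF prime_l])
  have l0: "0 < int l" using prime_gt_0_nat[OF prime_l] by simp
  show "abelian_group W"
  proof (rule abelian_groupI)
    fix X Y Z assume "X \<in> carrier W" "Y \<in> carrier W" "Z \<in> carrier W"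
    then obtain x y z where xyz: "X = red l x" "Y = red l y" "Z = red l z" "x \<in> carrier V" "y \<in> carrier V" "z \<in> carrier V"
      by (auto simp: red_carrier_iff)
    show "X \<oplus>\<^bsub>W\<^esub> Y \<in> carrier W" using xyz by (simp add: red_add red_carrier_iff)
    show "X \<oplus>\<^bsub>W\<^esub> Y \<oplus>\<^bsub>W\<^esub> Z = X \<oplus>\<^bsub>W\<^esub> (Y \<oplus>\<^bsub>W\<^esub> Z)" using xyz by (simp add: red_add a_assoc)
    show "X \<oplus>\<^bsub>W\<^esub> Y = Y \<oplus>\<^bsub>W\<^esub> X" using xyz by (simp add: red_add a_comm)
  next
    show "\<zero>\<^bsub>W\<^esub> \<in> carrier W" by (simp add: red_zero red_carrier_iff)
    fix X assume "X \<in> carrier W"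
    then obtain x where x: "X = red l x" "x \<in> carrier V" by (auto simp: red_carrier_iff)
    show "\<zero>\<^bsub>W\<^esub> \<oplus>\<^bsub>W\<^esub> X = X" using x by (simp add: red_zero red_add)
    have "red l ((-1) \<star> x) \<oplus>\<^bsub>W\<^esub> X = \<zero>\<^bsub>W\<^esub>" using x by (simp add: red_zero red_add a_comm)
    moreover have "red l ((-1) \<star> x) \<in> carrier W" using x by (simp add: red_carrier_iff)
    ultimately show "\<exists>Y\<in>carrier W. Y \<oplus>\<^bsub>W\<^esub> X = \<zero>\<^bsub>W\<^esub>" by blast
  qed
  fix a X assume a: "a \<in> carrier (zmod l)" and "X \<in> carrier W"
  then obtain x where x: "X = red l x" "x \<in> carrier V" by (auto simp: red_carrier_iff)
  have al: "a \<in> {0..<int l}" using a by simp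
  show "a \<odot>\<^bsub>W\<^esub> X \<in> carrier W" using x red_smult[OF x(2) al] by (simp add: red_carrier_iff)
  { fix b assume b: "b \<in> carrier (zmod l)"
    then have bl: "b \<in> {0..<int l}" by simp
    have m: "(a + b) mod int l \<in> {0..<int l}" "(a * b) mod int l \<in> {0..<int l}" using l0 by auto
    have "(a \<oplus>\<^bsub>zmod l\<^esub> b) \<odot>\<^bsub>W\<^esub> X = red l (((a + b) mod int l) \<star> x)" using x red_smult[OF x(2) m(1)] by simp
    also have "\<dots> = red l ((a + b) \<star> x)" by (rule red_sc_cong[OF x(2)]) simp
    also have "\<dots> = a \<odot>\<^bsub>W\<^esub> X \<oplus>\<^bsub>W\<^esub> b \<odot>\<^bsub>W\<^esub> X"
      using x red_smult[OF x(2) al] red_smult[OF x(2) bl] by (simp add: red_add sc_add_left)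
    finally show "(a \<oplus>\<^bsub>zmod l\<^esub> b) \<odot>\<^bsub>W\<^esub> X = a \<odot>\<^bsub>W\<^esub> X \<oplus>\<^bsub>W\<^esub> b \<odot>\<^bsub>W\<^esub> X" .
    have "(a \<otimes>\<^bsub>zmod l\<^esub> b) \<odot>\<^bsub>W\<^esub> X = red l (((a * b) mod int l) \<star> x)" using x red_smult[OF x(2) m(2)] by simp
    also have "\<dots> = red l ((a * b) \<star> x)" by (rule red_sc_cong[OF x(2)]) simp
    also have "\<dots> = a \<odot>\<^bsub>W\<^esub> (b \<odot>\<^bsub>W\<^esub> X)"
      using x red_smult[OF x(2) bl] red_smult[OF sc_closed[OF x(2)] al] by (simp add: sc_sc)
    finally show "(a \<otimes>\<^bsub>zmod l\<^esub> b) \<odot>\<^bsub>W\<^esub> X = a \<odot>\<^bsub>W\<^esub> (b \<odot>\<^bsub>W\<^esub> X)" . }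
  { fix Y assume "Y \<in> carrier W"
    then obtain y where y: "Y = red l y" "y \<in> carrier V" by (auto simp: red_carrier_iff)
    show "a \<odot>\<^bsub>W\<^esub> (X \<oplus>\<^bsub>W\<^esub> Y) = a \<odot>\<^bsub>W\<^esub> X \<oplus>\<^bsub>W\<^esub> a \<odot>\<^bsub>W\<^esub> Y"
      using x y red_smult[OF x(2) al] red_smult[OF y(2) al] red_smult[OF a_closed[OF x(2) y(2)] al]
      by (simp add: red_add sc_add_right) }
next
  fix X assume "X \<in> carrier W"
  then obtain x where x: "X = red l x" "x \<in> carrier V" by (auto simp: red_carrier_iff)
  have "1 mod int l = 1" "1 \<in> {0..<int l}" using prime_gt_1_nat[OF prime_l] by auto
  then show "\<one>\<^bsub>zmod l\<^esub> \<odot>\<^bsub>W\<^esub> X = X" using x red_smult[OF x(2), of 1] by simp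
qed

sublocale W: zmod_module l W
  by (intro zmod_module.intro module_W prime_gt_0_nat prime_l)

lemma W_sc: "x \<in> carrier V \<Longrightarrow> W.sc a (red l x) = red l (a \<star> x)"
proof -
  assume x: "x \<in> carrier V"
  have "a mod int l \<in> {0..<int l}" using prime_gt_0_nat[OF prime_l] by simp
  then have "W.sc a (red l x) = red l ((a mod int l) \<star> x)" unfolding W.sc_def by (rule red_smult[OF x])
  also have "\<dots> = red l (a \<star> x)" by (rule red_sc_cong[OF x]) simp
  finally show ?thesis .
qed

text \<open>Reduction acts on coordinates. Since \<open>l\<close> divides \<open>n\<close>,
  coordinates known modulo \<open>n\<close> are known modulo \<open>l\<close>; conversely,
  coordinates of a difference that are divisible by \<open>l\<close> can be divided by
  \<open>l\<close>.\<close>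

lemma red_finsum_iff:
  assumes bs: "is_basis n V bs"
    and x: "x = (\<Oplus>j\<in>{..<length bs}. a j \<star> (bs ! j))" and y: "y = (\<Oplus>j\<in>{..<length bs}. b j \<star> (bs ! j))"
  shows "red l x = red l y \<longleftrightarrow> (\<forall>j<length bs. a j mod int l = b j mod int l)"
proof -
  have bV: "bs ! j \<in> carrier V" if "j < length bs" for j using bs that by (auto simp: is_basis_def)
  have cl: "(\<Oplus>j\<in>{..<length bs}. c j \<star> (bs ! j)) \<in> carrier V" for c by (rule finsum_closed) (use bV in auto)
  have V: "x \<in> carrier V" "y \<in> carrier V" using x y cl by auto
  have diff: "x \<oplus> (-1) \<star> y = (\<Oplus>j\<in>{..<length bs}. (1 * a j + (-1) * b j) \<star> (bs ! j))"
    using finsum_sc[of "length bs" "\<lambda>j. bs ! j" 1 a "-1" b] bV x y V by simp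
  show ?thesis unfolding red_eq_iff[OF V]
  proof
    assume "x \<oplus> (-1) \<star> y \<in> multiples l V"
    then obtain z where z: "x \<oplus> (-1) \<star> y = int l \<star> z" "z \<in> carrier V" by (auto simp: multiples_eq)
    obtain c where c: "z = (\<Oplus>j\<in>{..<length bs}. c j \<star> (bs ! j))" using basis_finsum_surj[OF bs z(2)] by blast
    have lz: "int l \<star> z = (\<Oplus>j\<in>{..<length bs}. (int l * c j + 0 * c j) \<star> (bs ! j))"
      using finsum_sc[of "length bs" "\<lambda>j. bs ! j" "int l" c 0 c] bV c z(2) by simp
    show "\<forall>j<length bs. a j mod int l = b j mod int l"
    proof (intro allI impI)
      fix j assume j: "j < length bs"
      have "(1 * a j + (-1) * b j) mod int n = (int l * c j + 0 * c j) mod int n"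
        using basis_finsum_inj[OF bs _ j, of "\<lambda>j. 1 * a j + (-1) * b j" "\<lambda>j. int l * c j + 0 * c j"] diff lz z(1) by simp
      then have "(a j - b j) mod int n mod int l = (int l * c j) mod int n mod int l" by simp
      then have "(a j - b j) mod int l = 0" by (simp only: mod_mod_l) simp
      then show "a j mod int l = b j mod int l" by (simp add: mod_eq_dvd_iff mod_eq_0_iff_dvd)
    qed
  next
    assume "\<forall>j<length bs. a j mod int l = b j mod int l"
    then have d: "int l dvd a j - b j" if "j < length bs" for j using that by (simp add: mod_eq_dvd_iff)
    define c where "c = (\<lambda>j. (a j - b j) div int l)"
    have c: "1 * a j + (-1) * b j = int l * c j + 0 * c j" if "j < length bs" for j using d[OF that] by (simp add: c_def)
    have "x \<oplus> (-1) \<star> y = (\<Oplus>j\<in>{..<length bs}. (int l * c j + 0 * c j) \<star> (bs ! j))"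
      unfolding diff by (rule finsum_cong') (use bV c in auto)
    also have "\<dots> = int l \<star> (\<Oplus>j\<in>{..<length bs}. c j \<star> (bs ! j))"
      using finsum_sc[of "length bs" "\<lambda>j. bs ! j" "int l" c 0 c] bV cl by simp
    finally show "x \<oplus> (-1) \<star> y \<in> multiples l V" unfolding multiples_eq using cl by blast
  qed
qed

lemma card_W:
  assumes bs: "is_basis n V bs" shows "card (carrier W) = l ^ length bs" "finite (carrier W)"
proof -
  let ?r = "length bs"
  let ?P = "{..<?r} \<rightarrow>\<^sub>E {0..<int l}"
  define fs where "fs = (\<lambda>a. \<Oplus>j\<in>{..<?r}. a j \<star> (bs ! j))"
  have bV: "bs ! j \<in> carrier V" if "j < ?r" for j using bs that by (auto simp: is_basis_def)
  have fsV: "fs a \<in> carrier V" for a unfolding fs_def by (rule finsum_closed) (use bV in auto)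
  have "bij_betw (\<lambda>a. red l (fs a)) ?P (carrier W)"
  proof (rule bij_betw_imageI)
    show "inj_on (\<lambda>a. red l (fs a)) ?P"
    proof (rule inj_onI)
      fix a b assume ab: "a \<in> ?P" "b \<in> ?P" "red l (fs a) = red l (fs b)"
      have e: "a j mod int l = b j mod int l" if "j < ?r" for j
        using red_finsum_iff[OF bs fs_def[THEN fun_cong] fs_def[THEN fun_cong]] ab(3) that by blast
      show "a = b"
      proof (rule PiE_ext[OF ab(1,2)])
        fix j assume j: "j \<in> {..<?r}"
        then have "a j \<in> {0..<int l}" "b j \<in> {0..<int l}" using ab PiE_mem by blast+
        then show "a j = b j" using e[of j] j by simp
      qed
    qed
    show "(\<lambda>a. red l (fs a)) ` ?P = carrier W"
    proof
      show "(\<lambda>a. red l (fs a)) ` ?P \<subseteq> carrier W" using fsV by (auto simp: red_carrier_iff)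
      show "carrier W \<subseteq> (\<lambda>a. red l (fs a)) ` ?P"
      proof
        fix X assume "X \<in> carrier W"
        then obtain x where x: "X = red l x" "x \<in> carrier V" by (auto simp: red_carrier_iff)
        obtain a where a: "x = fs a" unfolding fs_def using basis_finsum_surj[OF bs x(2)] by blast
        define b where "b = (\<lambda>j\<in>{..<?r}. a j mod int l)"
        have "red l (fs a) = red l (fs b)"
          unfolding red_finsum_iff[OF bs fs_def[THEN fun_cong] fs_def[THEN fun_cong]] by (simp add: b_def)
        moreover have "b \<in> ?P" using prime_gt_0_nat[OF prime_l] by (auto simp: b_def)
        ultimately show "X \<in> (\<lambda>a. red l (fs a)) ` ?P" using x a by blast
      qed
    qed
  qed
  then show "card (carrier W) = l ^ ?r" "finite (carrier W)"
    using bij_betw_same_card[of _ ?P "carrier W"] bij_betw_finite[of _ ?P "carrier W"]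
    by (simp_all add: card_PiE finite_PiE)
qed

text \<open>The reduced form is well defined on a class \<open>x + l z\<close>, because
  \<open>Q (l z)\<close> and the product of \<open>l z\<close> with \<open>x\<close> are divisible
  by \<open>l\<close>. The image under \<open>Q mod l\<close> is then a singleton, as
  \<open>reduced_form\<close> expects.\<close>

lemma form_space_W:
  assumes bs: "is_basis n V bs" and qf: "quadratic_form n V Q"
  shows "form_space l W (reduced_form l Q)"
proof -
  let ?q = "reduced_form l Q"
  have Qsc: "Q (a \<star> x) = (a\<^sup>2 * Q x) mod int n" if x: "x \<in> carrier V" for a x
  proof -
    have "Q ((a mod int n) \<odot> x) = ((a mod int n)\<^sup>2 * Q x) mod int n"
      using qf x mod_carrier[of a] unfolding quadratic_form_def by blast
    also have "\<dots> = (a\<^sup>2 * Q x) mod int n" by (rule mod_strip, (rule cong_strip)+, simp)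
    finally show ?thesis by (simp add: sc_def)
  qed
  have Psc: "polar n V Q (a \<star> x) z = (a * polar n V Q x z) mod int n" if "x \<in> carrier V" "z \<in> carrier V" for a x z
  proof -
    have "polar n V Q ((a mod int n) \<odot> x) z = ((a mod int n) * polar n V Q x z) mod int n"
      using qf that mod_carrier[of a] unfolding quadratic_form_def by blast
    then show ?thesis by (simp add: sc_def mod_simps)
  qed
  have Padd: "polar n V Q (x \<oplus> y) z = (polar n V Q x z + polar n V Q y z) mod int n"
    if "x \<in> carrier V" "y \<in> carrier V" "z \<in> carrier V" for x y z
    using qf that unfolding quadratic_form_def by blast
  have qred: "?q (red l x) = Q x mod int l" if x: "x \<in> carrier V" for x
  proof -
    have Qy: "Q y mod int l = Q x mod int l" if y: "y \<in> red l x" for y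
    proof -
      obtain z where z: "y = int l \<star> z \<oplus> x" "z \<in> carrier V" using y by (auto simp: red_mem multiples_eq)
      have "(Q (int l \<star> z \<oplus> x) - Q (int l \<star> z) - Q x) mod int n = (int l * polar n V Q z x) mod int n"
        using Psc[OF z(2) x, of "int l"] by (simp add: polar_def)
      then have "(Q y - Q (int l \<star> z) - Q x) mod int n mod int l = (int l * polar n V Q z x) mod int n mod int l"
        using z(1) by simp
      then have 1: "int l dvd Q y - Q (int l \<star> z) - Q x" by (simp add: mod_eq_0_iff_dvd)
      have "Q (int l \<star> z) mod int l = ((int l)\<^sup>2 * Q z) mod int l" using Qsc[OF z(2), of "int l"] by simp
      then have "int l dvd Q (int l \<star> z)" by (simp add: power2_eq_square mod_eq_0_iff_dvd mult.assoc)
      then have "int l dvd Q y - Q x" using dvd_add[OF 1] by fastforce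
      then show ?thesis by (simp add: mod_eq_dvd_iff)
    qed
    have "(\<lambda>y. Q y mod int l) ` red l x = {Q x mod int l}"
    proof (rule equalityI)
      show "(\<lambda>y. Q y mod int l) ` red l x \<subseteq> {Q x mod int l}"
        by (rule image_subsetI) (simp only: Qy singleton_iff)
      show "{Q x mod int l} \<subseteq> (\<lambda>y. Q y mod int l) ` red l x"
        using imageI[OF red_self[OF x, of l], of "\<lambda>y. Q y mod int l"] by (simp only: insert_subset empty_subsetI simp_thms)
    qed
    then show ?thesis by (simp add: reduced_form_def)
  qed
  have pred: "polar l W ?q (red l x) (red l y) = polar n V Q x y mod int l"
    if x: "x \<in> carrier V" and y: "y \<in> carrier V" for x y
  proof -
    have "polar l W ?q (red l x) (red l y) = (Q (x \<oplus> y) mod int l - Q x mod int l - Q y mod int l) mod int l"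
      using x y by (simp add: polar_def red_add qred)
    also have "\<dots> = (Q (x \<oplus> y) - Q x - Q y) mod int l" by (rule mod_strip, (rule cong_strip)+, simp)
    finally show ?thesis by (simp add: polar_def)
  qed
  have "quadratic_form l W ?q"
    unfolding quadratic_form_def
  proof (intro conjI ballI)
    show "?q \<in> carrier W \<rightarrow> carrier (zmod l)"
      using qred prime_gt_0_nat[OF prime_l] by (auto simp: red_carrier_iff)
    fix X assume "X \<in> carrier W"
    then obtain x where x: "X = red l x" "x \<in> carrier V" by (auto simp: red_carrier_iff)
    { fix a assume a: "a \<in> carrier (zmod l)"
      have ax: "a \<odot>\<^bsub>W\<^esub> X = red l (a \<star> x)" using x red_smult[OF x(2)] a by simp
      have "(a\<^sup>2 * Q x) mod int l = (a\<^sup>2 * (Q x mod int l)) mod int l" by (rule mod_strip, (rule cong_strip)+, simp)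
      then show "?q (a \<odot>\<^bsub>W\<^esub> X) = (a\<^sup>2 * ?q X) mod int l" unfolding ax using x Qsc[OF x(2)] by (simp add: qred)
      fix Z assume "Z \<in> carrier W"
      then obtain z where z: "Z = red l z" "z \<in> carrier V" by (auto simp: red_carrier_iff)
      show "polar l W ?q (a \<odot>\<^bsub>W\<^esub> X) Z = (a * polar l W ?q X Z) mod int l"
        unfolding ax using x z Psc[OF x(2) z(2)] by (simp add: pred mod_simps) }
    fix Y Z assume "Y \<in> carrier W" "Z \<in> carrier W"
    then obtain y z where yz: "Y = red l y" "y \<in> carrier V" "Z = red l z" "z \<in> carrier V" by (auto simp: red_carrier_iff)
    show "polar l W ?q (X \<oplus>\<^bsub>W\<^esub> Y) Z = (polar l W ?q X Z + polar l W ?q Y Z) mod int l"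
      using x yz Padd[OF x(2) yz(2,4)] by (simp add: red_add pred mod_simps)
  qed
  then show ?thesis
    using prime_l card_W(2)[OF bs] W.zmod_module_axioms
    by (simp add: form_space_def fin_space_def fin_space_axioms_def form_space_axioms_def)
qed

text \<open>Linearity maps a class into the class of \<open>g x\<close>. That it covers this class
  uses the surjectivity of \<open>g\<close>, which provides preimages of the multiples of
  \<open>l\<close>.\<close>

lemma lin_auts_red:
  assumes g: "g \<in> lin_auts n V" and x: "x \<in> carrier V"
  shows "reduced_map l V g (red l x) = red l (g x)"
proof -
  have gV: "g y \<in> carrier V" if "y \<in> carrier V" for y
    using g that by (auto simp: lin_auts_def Bij_def bij_betw_def)
  have gs: "g ` carrier V = carrier V" using g by (auto simp: lin_auts_def Bij_def bij_betw_def)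
  have gadd: "g (y \<oplus> z) = g y \<oplus> g z" if "y \<in> carrier V" "z \<in> carrier V" for y z
    using g that by (auto simp: lin_auts_def)
  have gsc: "g (a \<star> y) = a \<star> g y" if "y \<in> carrier V" for a y
    using g that mod_carrier[of a] unfolding sc_def by (auto simp: lin_auts_def)
  have "g ` red l x = red l (g x)"
  proof (rule Set.set_eqI, rule iffI)
    fix y assume "y \<in> g ` red l x"
    then obtain z where z: "z \<in> carrier V" "y = g (int l \<star> z \<oplus> x)" by (auto simp: red_mem multiples_eq)
    then have "y = int l \<star> g z \<oplus> g x" using gadd gsc x by simp
    then show "y \<in> red l (g x)" using gV[OF z(1)] by (auto simp: red_mem multiples_eq)
  next
    fix y assume "y \<in> red l (g x)"
    then obtain z where z: "z \<in> carrier V" "y = int l \<star> z \<oplus> g x" by (auto simp: red_mem multiples_eq)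
    obtain z' where z': "z' \<in> carrier V" "z = g z'" using gs z(1) by blast
    then have "y = g (int l \<star> z' \<oplus> x)" using z gadd gsc x by simp
    moreover have "int l \<star> z' \<oplus> x \<in> red l x" unfolding red_mem multiples_eq using z'(1) by blast
    ultimately show "y \<in> g ` red l x" by blast
  qed
  then show ?thesis using x by (simp add: reduced_map_def red_carrier_iff)
qed

end

section \<open>The Chinese remainder theorem for vectors, automorphisms and orbits\<close>

locale squarefree_reduction = zmod_module n V for n :: nat and V :: "(int, 'v) module" (structure) +
  fixes bs :: "'v list"
  assumes sqf: "squarefree n" and basis: "is_basis n V bs"
begin

notation sc (infixr \<open>\<star>\<close> 75)

abbreviation red_mod :: "nat \<Rightarrow> (int, 'v set) module" where "red_mod l \<equiv> reduced_module l V"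

lemma primes_iff: "l \<in> prime_factors n \<longleftrightarrow> prime l \<and> l dvd n"
  using n_pos by (auto simp: prime_factors_dvd)

lemma reduction: "l \<in> prime_factors n \<Longrightarrow> prime_reduction n V l"
  using zmod_module_axioms by (simp add: prime_reduction_def prime_reduction_axioms_def primes_iff)

text \<open>Coordinates that agree modulo every prime divisor of a squarefree \<open>n\<close> agree
  modulo \<open>n\<close>.\<close>

lemma red_inj:
  assumes x: "x \<in> carrier V" and y: "y \<in> carrier V" and eq: "\<And>l. l \<in> prime_factors n \<Longrightarrow> red l x = red l y"
  shows "x = y"
proof -
  have bV: "bs ! j \<in> carrier V" if "j < length bs" for j using basis that by (auto simp: is_basis_def)
  obtain a where a: "x = (\<Oplus>j\<in>{..<length bs}. a j \<star> (bs ! j))" using basis_finsum_surj[OF basis x] by blast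
  obtain b where b: "y = (\<Oplus>j\<in>{..<length bs}. b j \<star> (bs ! j))" using basis_finsum_surj[OF basis y] by blast
  have ab: "a j mod int n = b j mod int n" if j: "j < length bs" for j
  proof -
    have "int n dvd a j - b j"
    proof (rule squarefree_dvdI[OF sqf])
      fix l assume "prime l" "l dvd n"
      then have l: "l \<in> prime_factors n" by (simp add: primes_iff)
      interpret prime_reduction n V l by (rule reduction[OF l])
      have "a j mod int l = b j mod int l" using red_finsum_iff[OF basis a b] eq[OF l] j by blast
      then show "int l dvd a j - b j" by (simp add: mod_eq_dvd_iff)
    qed
    then show ?thesis by (simp add: mod_eq_dvd_iff)
  qed
  show ?thesis unfolding a b by (rule finsum_cong') (use bV sc_cong[OF ab] in auto)
qed

text \<open>Surjectivity by counting: reduction is injective, and the product of the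
  \<open>l ^ length bs\<close> over the primes is \<open>n ^ length bs\<close>.\<close>

lemma red_surj:
  assumes X: "\<And>l. l \<in> prime_factors n \<Longrightarrow> X l \<in> carrier (red_mod l)"
  shows "\<exists>x\<in>carrier V. \<forall>l\<in>prime_factors n. red l x = X l"
proof -
  let ?P = "prime_factors n"
  define F where "F = (\<lambda>x. \<lambda>l\<in>?P. red l x)"
  let ?T = "\<Pi>\<^sub>E l\<in>?P. carrier (red_mod l)"
  have W: "card (carrier (red_mod l)) = l ^ length bs" "finite (carrier (red_mod l))" if "l \<in> ?P" for l
    using prime_reduction.card_W[OF reduction[OF that] basis] by auto
  have cT: "card ?T = card (carrier V)"
  proof -
    have "card ?T = (\<Prod>l\<in>?P. l ^ length bs)" using W by (simp add: card_PiE)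
    also have "\<dots> = (\<Prod>?P) ^ length bs" by (simp add: prod_power_distrib)
    also have "\<dots> = card (carrier V)" using prod_prime_factors_squarefree[OF sqf] is_basis_card[OF basis] by simp
    finally show ?thesis .
  qed
  have inj: "inj_on F (carrier V)"
  proof (rule inj_onI)
    fix x y assume xy: "x \<in> carrier V" "y \<in> carrier V" "F x = F y"
    have "red l x = red l y" if "l \<in> ?P" for l using fun_cong[OF xy(3), of l] that by (simp add: F_def)
    then show "x = y" by (rule red_inj[OF xy(1,2)])
  qed
  have sub: "F ` carrier V \<subseteq> ?T" by (auto simp: F_def red_carrier_iff)
  have fT: "finite ?T" using W by (intro finite_PiE) auto
  have "F ` carrier V = ?T" by (rule card_subset_eq[OF fT sub]) (simp add: card_image[OF inj] cT)
  moreover have "restrict X ?P \<in> ?T" using X by auto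
  ultimately obtain x where x: "x \<in> carrier V" "restrict X ?P = F x" by blast
  have "red l x = X l" if "l \<in> ?P" for l using fun_cong[OF x(2), of l] that by (simp add: F_def)
  then show ?thesis using x(1) by blast
qed

definition redt :: "nat \<Rightarrow> nat \<Rightarrow> (nat \<Rightarrow> 'v) \<Rightarrow> nat \<Rightarrow> 'v set" where
  "redt m l x = (\<lambda>i\<in>{..<m}. red l (x i))"

lemma redt_tuples: "x \<in> tuples m V \<Longrightarrow> redt m l x \<in> tuples m (red_mod l)"
  by (auto simp: redt_def tuples_def red_carrier_iff)

lemma redt_surj:
  assumes X: "\<And>l. l \<in> prime_factors n \<Longrightarrow> X l \<in> tuples m (red_mod l)"
  shows "\<exists>x\<in>tuples m V. \<forall>l\<in>prime_factors n. redt m l x = X l"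
proof -
  have ex: "\<exists>z\<in>carrier V. \<forall>l\<in>prime_factors n. red l z = X l i" if "i < m" for i
    using X that by (intro red_surj) (auto simp: tuples_def)
  define x where "x = (\<lambda>i\<in>{..<m}. SOME z. z \<in> carrier V \<and> (\<forall>l\<in>prime_factors n. red l z = X l i))"
  have x: "x i \<in> carrier V \<and> (\<forall>l\<in>prime_factors n. red l (x i) = X l i)" if i: "i < m" for i
  proof -
    have "\<exists>z. z \<in> carrier V \<and> (\<forall>l\<in>prime_factors n. red l z = X l i)" using ex[OF i] by blast
    from someI_ex[OF this] show ?thesis using i by (simp add: x_def)
  qed
  have "x \<in> tuples m V" using x by (auto simp: tuples_def x_def)
  moreover have "redt m l x = X l" if l: "l \<in> prime_factors n" for l
  proof (rule PiE_ext)
    show "redt m l x \<in> {..<m} \<rightarrow>\<^sub>E carrier (red_mod l)" using redt_tuples[OF calculation] by (simp add: tuples_def)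
    show "X l \<in> {..<m} \<rightarrow>\<^sub>E carrier (red_mod l)" using X[OF l] by (simp add: tuples_def)
  qed (use x l in \<open>simp add: redt_def\<close>)
  ultimately show ?thesis by blast
qed

text \<open>The automorphism is built vector by vector from its prescribed reductions. Each of its
  properties is checked prime by prime, because reductions determine a vector.\<close>

lemma lin_autsI_red:
  assumes h: "\<And>l. l \<in> prime_factors n \<Longrightarrow> h l \<in> lin_auts l (red_mod l)"
  shows "\<exists>g\<in>lin_auts n V. \<forall>l\<in>prime_factors n. reduced_map l V g = h l"
proof -
  let ?P = "prime_factors n"
  have hW: "h l (red l v) \<in> carrier (red_mod l)" if "l \<in> ?P" "v \<in> carrier V" for l v
    using h[OF that(1)] that(2) by (auto simp: lin_auts_def Bij_def bij_betw_def red_carrier_iff)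
  have hinj: "red l v = red l w" if "l \<in> ?P" "v \<in> carrier V" "w \<in> carrier V" "h l (red l v) = h l (red l w)" for l v w
    using h[OF that(1)] that(2-4) inj_onD[of "h l" "carrier (red_mod l)" "red l v" "red l w"]
    by (auto simp: lin_auts_def Bij_def bij_betw_def red_carrier_iff)
  have hadd: "h l (red l (v \<oplus> w)) = h l (red l v) \<oplus>\<^bsub>red_mod l\<^esub> h l (red l w)"
    if "l \<in> ?P" "v \<in> carrier V" "w \<in> carrier V" for l v w
    using h[OF that(1)] that(2,3) red_add[OF that(2,3), of l, symmetric] by (auto simp: lin_auts_def red_carrier_iff)
  define g where "g = (\<lambda>v\<in>carrier V. SOME z. z \<in> carrier V \<and> (\<forall>l\<in>?P. red l z = h l (red l v)))"
  have g: "g v \<in> carrier V" "\<And>l. l \<in> ?P \<Longrightarrow> red l (g v) = h l (red l v)" if v: "v \<in> carrier V" for v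
  proof -
    have "\<exists>z\<in>carrier V. \<forall>l\<in>?P. red l z = h l (red l v)" using hW v by (intro red_surj) auto
    then have "\<exists>z. z \<in> carrier V \<and> (\<forall>l\<in>?P. red l z = h l (red l v))" by blast
    from someI_ex[OF this] have "g v \<in> carrier V \<and> (\<forall>l\<in>?P. red l (g v) = h l (red l v))" using v by (simp add: g_def)
    then show "g v \<in> carrier V" "\<And>l. l \<in> ?P \<Longrightarrow> red l (g v) = h l (red l v)" by auto
  qed
  have gI: "g v = z" if "v \<in> carrier V" "z \<in> carrier V" "\<And>l. l \<in> ?P \<Longrightarrow> red l z = h l (red l v)" for v z
    using g[OF that(1)] that by (intro red_inj) auto
  have "inj_on g (carrier V)"
  proof (rule inj_onI)
    fix v w assume vw: "v \<in> carrier V" "w \<in> carrier V" "g v = g w"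
    have "red l v = red l w" if l: "l \<in> ?P" for l
      using g(2)[OF vw(1) l] g(2)[OF vw(2) l] vw(3) by (intro hinj[OF l vw(1,2)]) simp
    then show "v = w" by (rule red_inj[OF vw(1,2)])
  qed
  moreover have "g ` carrier V = carrier V"
    using endo_inj_surj[OF is_basis_finite[OF basis] _ calculation] g(1) by blast
  ultimately have "g \<in> Bij (carrier V)" by (simp add: Bij_def bij_betw_def g_def)
  moreover have "g (v \<oplus> w) = g v \<oplus> g w" if vw: "v \<in> carrier V" "w \<in> carrier V" for v w
  proof (rule gI)
    fix l assume l: "l \<in> ?P"
    show "red l (g v \<oplus> g w) = h l (red l (v \<oplus> w))"
      using hadd[OF l vw] g(2)[OF vw(1) l] g(2)[OF vw(2) l] red_add[OF g(1)[OF vw(1)] g(1)[OF vw(2)], of l] by simp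
  qed (use vw g(1) in auto)
  moreover have "g (a \<odot> v) = a \<odot> g v" if a: "a \<in> carrier (zmod n)" and v: "v \<in> carrier V" for a v
  proof -
    have "g (a \<star> v) = a \<star> g v"
    proof (rule gI)
      fix l assume l: "l \<in> ?P"
      interpret prime_reduction n V l by (rule reduction[OF l])
      have al: "a mod int l \<in> {0..<int l}" using prime_gt_0_nat[OF prime_l] by simp
      have "h l (red l (a \<star> v)) = h l ((a mod int l) \<odot>\<^bsub>red_mod l\<^esub> red l v)"
        using W_sc[OF v, of a] by (simp add: W.sc_def)
      also have "\<dots> = (a mod int l) \<odot>\<^bsub>red_mod l\<^esub> h l (red l v)"
        using h[OF l] al v by (simp add: lin_auts_def red_carrier_iff)
      also have "\<dots> = red l (a \<star> g v)"
        using W_sc[OF g(1)[OF v], of a] g(2)[OF v l] by (simp add: W.sc_def)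
      finally show "red l (a \<star> g v) = h l (red l (a \<star> v))" by simp
    qed (use v g(1) in auto)
    then show ?thesis using a by (simp add: smult_eq_sc)
  qed
  ultimately have gL: "g \<in> lin_auts n V" by (simp add: lin_auts_def)
  have "reduced_map l V g = h l" if l: "l \<in> ?P" for l
  proof (rule extensionalityI[of _ "carrier (red_mod l)"])
    interpret prime_reduction n V l by (rule reduction[OF l])
    show "reduced_map l V g \<in> extensional (carrier (red_mod l))" by (simp add: reduced_map_def)
    show "h l \<in> extensional (carrier (red_mod l))" using h[OF l] by (simp add: lin_auts_def Bij_def)
    fix C assume "C \<in> carrier (red_mod l)"
    then obtain v where v: "C = red l v" "v \<in> carrier V" by (auto simp: red_carrier_iff)
    show "reduced_map l V g C = h l C" using lin_auts_red[OF gL v(2)] g(2)[OF v(2) l] v(1) by simp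
  qed
  then show ?thesis using gL by blast
qed

text \<open>The local group elements can be chosen independently of one another and glue to one
  automorphism, so an orbit is cut out by local conditions.\<close>

lemma orbit_product:
  assumes G: "\<And>l. l \<in> prime_factors n \<Longrightarrow> carrier (G l) \<subseteq> lin_auts l (red_mod l)" and x: "x \<in> tuples m V"
  shows "orbit (product_over_primes n V G) (diag_act m) x =
    {y \<in> tuples m V. \<forall>l\<in>prime_factors n. redt m l y \<in> orbit (G l) (diag_act m) (redt m l x)}"
proof (rule Set.set_eqI, rule iffI)
  let ?P = "prime_factors n"
  have xV: "x i \<in> carrier V" if "i < m" for i using tuplesD[OF x that] .
  have car: "carrier (product_over_primes n V G) = {g \<in> lin_auts n V. \<forall>l\<in>?P. reduced_map l V g \<in> carrier (G l)}"
    by (auto simp: product_over_primes_def primes_iff)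
  have act: "redt m l (diag_act m g x) = diag_act m (reduced_map l V g) (redt m l x)"
    if l: "l \<in> ?P" and g: "g \<in> lin_auts n V" for l g
  proof -
    interpret prime_reduction n V l by (rule reduction[OF l])
    show ?thesis unfolding redt_def diag_act_def
      by (intro restrict_ext) (simp add: lin_auts_red[OF g xV])
  qed
  { fix y assume "y \<in> orbit (product_over_primes n V G) (diag_act m) x"
    then obtain g where g: "g \<in> lin_auts n V" "\<forall>l\<in>?P. reduced_map l V g \<in> carrier (G l)" "y = diag_act m g x"
      unfolding orbit_def car by blast
    have "y \<in> tuples m V" using g(1,3) xV by (auto simp: tuples_def diag_act_def lin_auts_def Bij_def bij_betw_def)
    moreover have "redt m l y \<in> orbit (G l) (diag_act m) (redt m l x)" if l: "l \<in> ?P" for l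
      using act[OF l g(1)] g(2,3) l unfolding orbit_def by blast
    ultimately show "y \<in> {y \<in> tuples m V. \<forall>l\<in>?P. redt m l y \<in> orbit (G l) (diag_act m) (redt m l x)}" by blast }
  { fix y assume "y \<in> {y \<in> tuples m V. \<forall>l\<in>?P. redt m l y \<in> orbit (G l) (diag_act m) (redt m l x)}"
    then have y: "y \<in> tuples m V" "\<And>l. l \<in> ?P \<Longrightarrow> redt m l y \<in> orbit (G l) (diag_act m) (redt m l x)" by auto
    define h where "h = (\<lambda>l. SOME g. g \<in> carrier (G l) \<and> redt m l y = diag_act m g (redt m l x))"
    have h: "h l \<in> carrier (G l) \<and> redt m l y = diag_act m (h l) (redt m l x)" if l: "l \<in> ?P" for l
    proof -
      have "\<exists>g. g \<in> carrier (G l) \<and> redt m l y = diag_act m g (redt m l x)" using y(2)[OF l] unfolding orbit_def by blast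
      then show ?thesis unfolding h_def by (rule someI_ex)
    qed
    have "h l \<in> lin_auts l (red_mod l)" if "l \<in> ?P" for l using h[OF that] G[OF that] by blast
    then obtain g where g: "g \<in> lin_auts n V" "\<forall>l\<in>?P. reduced_map l V g = h l" using lin_autsI_red[of h] by blast
    have gV: "g v \<in> carrier V" if "v \<in> carrier V" for v using g(1) that by (auto simp: lin_auts_def Bij_def bij_betw_def)
    have "g (x i) = y i" if i: "i < m" for i
    proof (rule red_inj[OF gV[OF xV[OF i]] tuplesD[OF y(1) i]])
      fix l assume l: "l \<in> ?P"
      have "redt m l (diag_act m g x) = redt m l y" using act[OF l g(1)] g(2) h[OF l] l by simp
      from fun_cong[OF this, of i] show "red l (g (x i)) = red l (y i)" using i by (simp add: redt_def diag_act_def)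
    qed
    then have "diag_act m g x = y" by (simp add: diag_act_eq_iff[OF y(1)])
    moreover have "g \<in> carrier (product_over_primes n V G)" unfolding car using g h by simp
    ultimately show "y \<in> orbit (product_over_primes n V G) (diag_act m) x" unfolding orbit_def by blast }
qed

text \<open>That local orbits partition the tuples enters through \<open>self\<close> and
  \<open>eq\<close>. The map from a tuple to its family of local orbits has the same fibres as the
  orbit map, and it is onto the product because tuples can be prescribed modulo each prime.\<close>

lemma card_orbits_product:
  assumes G: "\<And>l. l \<in> prime_factors n \<Longrightarrow> carrier (G l) \<subseteq> lin_auts l (red_mod l)"
    and self: "\<And>l x. l \<in> prime_factors n \<Longrightarrow> x \<in> tuples m (red_mod l) \<Longrightarrow> x \<in> orbit (G l) (diag_act m) x"
    and eq: "\<And>l x y. l \<in> prime_factors n \<Longrightarrow> x \<in> tuples m (red_mod l) \<Longrightarrow> y \<in> orbit (G l) (diag_act m) x \<Longrightarrow>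
        orbit (G l) (diag_act m) y = orbit (G l) (diag_act m) x"
  shows "card (orbits (product_over_primes n V G) (tuples m V) (diag_act m)) =
    (\<Prod>l\<in>prime_factors n. card (orbit (G l) (diag_act m) ` tuples m (red_mod l)))"
proof -
  let ?P = "prime_factors n" and ?T = "tuples m V"
  define f where "f = orbit (product_over_primes n V G) (diag_act m)"
  define h where "h = (\<lambda>x. \<lambda>l\<in>?P. orbit (G l) (diag_act m) (redt m l x))"
  have f: "f x = {y \<in> ?T. \<forall>l\<in>?P. redt m l y \<in> h x l}" if "x \<in> ?T" for x
    unfolding f_def h_def using orbit_product[OF G that] by auto
  have "orbits (product_over_primes n V G) ?T (diag_act m) = f ` ?T" by (auto simp: orbits_def f_def)
  also have "card (f ` ?T) = card (h ` ?T)"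
  proof (rule card_image_eq_card_image)
    fix x y assume x: "x \<in> ?T" and y: "y \<in> ?T"
    show "f x = f y \<longleftrightarrow> h x = h y"
    proof
      assume fxy: "f x = f y"
      have "y \<in> f y" unfolding f[OF y] using y self[OF _ redt_tuples[OF y]] by (simp add: h_def)
      then have "y \<in> f x" using fxy by simp
      then have yx: "redt m l y \<in> orbit (G l) (diag_act m) (redt m l x)" if "l \<in> ?P" for l
        using that unfolding f[OF x] by (simp add: h_def)
      show "h x = h y" unfolding h_def
      proof (rule restrict_ext)
        fix l assume l: "l \<in> ?P"
        show "orbit (G l) (diag_act m) (redt m l x) = orbit (G l) (diag_act m) (redt m l y)"
          using eq[OF l redt_tuples[OF x] yx[OF l]] by simp
      qed
    qed (simp add: f[OF x] f[OF y])
  qed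
  also have "h ` ?T = (\<Pi>\<^sub>E l\<in>?P. orbit (G l) (diag_act m) ` tuples m (red_mod l))"
  proof
    show "h ` ?T \<subseteq> (\<Pi>\<^sub>E l\<in>?P. orbit (G l) (diag_act m) ` tuples m (red_mod l))"
      using redt_tuples by (auto simp: h_def)
    show "(\<Pi>\<^sub>E l\<in>?P. orbit (G l) (diag_act m) ` tuples m (red_mod l)) \<subseteq> h ` ?T"
    proof
      fix Z assume Z: "Z \<in> (\<Pi>\<^sub>E l\<in>?P. orbit (G l) (diag_act m) ` tuples m (red_mod l))"
      define X where "X = (\<lambda>l. SOME t. t \<in> tuples m (red_mod l) \<and> Z l = orbit (G l) (diag_act m) t)"
      have X: "X l \<in> tuples m (red_mod l) \<and> Z l = orbit (G l) (diag_act m) (X l)" if l: "l \<in> ?P" for l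
      proof -
        have "Z l \<in> orbit (G l) (diag_act m) ` tuples m (red_mod l)" using Z l by (rule PiE_mem)
        then have "\<exists>t. t \<in> tuples m (red_mod l) \<and> Z l = orbit (G l) (diag_act m) t" by blast
        then show ?thesis unfolding X_def by (rule someI_ex)
      qed
      then obtain x where x: "x \<in> ?T" "\<forall>l\<in>?P. redt m l x = X l" using redt_surj[of X m] by blast
      have "Z = h x"
      proof (rule extensionalityI[of _ ?P])
        show "Z \<in> extensional ?P" using Z by (simp add: PiE_def)
        show "h x \<in> extensional ?P" by (simp add: h_def)
        show "Z l = h x l" if "l \<in> ?P" for l using X[OF that] x(2) that by (simp add: h_def)
      qed
      then show "Z \<in> h ` ?T" using x(1) by blast
    qed
  qed
  also have "card (\<Pi>\<^sub>E l\<in>?P. orbit (G l) (diag_act m) ` tuples m (red_mod l)) =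
      (\<Prod>l\<in>?P. card (orbit (G l) (diag_act m) ` tuples m (red_mod l)))" by (simp add: card_PiE)
  finally show ?thesis .
qed

end

section \<open>Orbit counts for squarefree \<open>n\<close> and the final statement\<close>

lemma orbits_squarefree:
  fixes V :: "(int, 'v) module"
  assumes sqf: "squarefree n" and free: "free_of_rank n V r" and qf: "quadratic_form n V Q"
    and nd: "nondegenerate n V Q" and r: "r \<ge> 2 * m + 2" and par: "even n \<and> m > 0 \<longrightarrow> even r"
  shows "card (orbits (orth_n n V Q) (tuples m V) (diag_act m)) =
      (\<Prod>l\<in>prime_factors n. \<Prod>i=1..m. 1 + l ^ i)"
    and "orbits (omega_n n V Q) (tuples m V) (diag_act m) = orbits (orth_n n V Q) (tuples m V) (diag_act m)"
proof -
  obtain bs where bs: "is_basis n V bs" "length bs = r" and mod: "module (zmod n) V"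
    using free by (auto simp: free_of_rank_def)
  have n0: "n > 0" using sqf by (intro Nat.gr0I notI) simp
  interpret squarefree_reduction n V bs
    by (intro squarefree_reduction.intro zmod_module.intro squarefree_reduction_axioms.intro n0 mod sqf bs(1))
  let ?P = "prime_factors n"
  define G where "G = (\<lambda>l. orth l (red_mod l) (reduced_form l Q))"
  define H where "H = (\<lambda>l. omega l (red_mod l) (reduced_form l Q))"
  have case_l: "form_space l (red_mod l) (reduced_form l Q)" "smooth_quadric l (red_mod l) (reduced_form l Q)"
    "card (carrier (red_mod l)) = l ^ r" "even l \<Longrightarrow> m > 0 \<Longrightarrow> even r" if l: "l \<in> ?P" for l
  proof -
    interpret prime_reduction n V l by (rule reduction[OF l])
    show "form_space l (red_mod l) (reduced_form l Q)" by (rule form_space_W[OF bs(1) qf])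
    show "smooth_quadric l (red_mod l) (reduced_form l Q)" using nd prime_l l_dvd by (simp add: nondegenerate_def)
    show "card (carrier (red_mod l)) = l ^ r" using card_W(1)[OF bs(1)] bs(2) by simp
    show "even l \<Longrightarrow> m > 0 \<Longrightarrow> even r" using par l_dvd dvd_trans by blast
  qed
  note pc = orbits_prime_field[OF case_l(1) case_l(2) case_l(3) r]
  have GL: "carrier (G l) \<subseteq> lin_auts l (red_mod l)" "carrier (H l) \<subseteq> lin_auts l (red_mod l)" for l
    by (auto simp: G_def H_def orth_def omega_def)
  have "card (orbits (product_over_primes n V G) (tuples m V) (diag_act m)) =
      (\<Prod>l\<in>?P. card (orbit (G l) (diag_act m) ` tuples m (red_mod l)))"
  proof (rule card_orbits_product[OF GL(1)])
    fix l x assume l: "l \<in> ?P" and x: "x \<in> tuples m (red_mod l)"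
    show "x \<in> orbit (G l) (diag_act m) x" unfolding G_def using pc(1)[OF l l l case_l(4)[OF l] x] by simp
    show "orbit (G l) (diag_act m) y = orbit (G l) (diag_act m) x" if "y \<in> orbit (G l) (diag_act m) x" for y
      using pc(2)[OF l l l case_l(4)[OF l] x] that unfolding G_def by simp
  qed
  also have "\<dots> = (\<Prod>l\<in>?P. \<Prod>i=1..m. 1 + l ^ i)"
    unfolding G_def by (intro prod.cong refl pc(3) case_l(4))
  finally show "card (orbits (orth_n n V Q) (tuples m V) (diag_act m)) = (\<Prod>l\<in>?P. \<Prod>i=1..m. 1 + l ^ i)"
    by (simp add: orth_n_def G_def)
  have "orbit (product_over_primes n V H) (diag_act m) x = orbit (product_over_primes n V G) (diag_act m) x"
    if x: "x \<in> tuples m V" for x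
  proof -
    have "orbit (H l) (diag_act m) (redt m l x) = orbit (G l) (diag_act m) (redt m l x)" if l: "l \<in> ?P" for l
      unfolding G_def H_def using pc(4)[OF l l l case_l(4)[OF l] redt_tuples[OF x]] by simp
    then show ?thesis using orbit_product[OF GL(1) x] orbit_product[OF GL(2) x] by auto
  qed
  then show "orbits (omega_n n V Q) (tuples m V) (diag_act m) = orbits (orth_n n V Q) (tuples m V) (diag_act m)"
    unfolding orbits_def omega_n_def orth_n_def G_def[symmetric] H_def[symmetric] by (intro Collect_cong ex_cong1) auto
qed

theorem theorem4p10:
  fixes m :: nat
  shows
    "(\<forall>(n :: nat) (r :: nat) (V :: (int, 'v) module) (Q :: 'v \<Rightarrow> int).
        squarefree n \<and> free_of_rank n V r \<and> quadratic_form n V Q \<and> nondegenerate n V Q \<and>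
        r \<ge> 2 * m + 2 \<and> (even n \<and> m > 0 \<longrightarrow> even r) \<longrightarrow>
          card (orbits (orth_n n V Q) (tuples m V) (diag_act m)) =
            (\<Prod>l\<in>prime_factors n. \<Prod>i=1..m. 1 + l ^ i) \<and>
          orbits (omega_n n V Q) (tuples m V) (diag_act m) =
            orbits (orth_n n V Q) (tuples m V) (diag_act m)) \<and>
     (\<forall>(l :: nat) (V :: (int, 'w) module) (Q :: 'w \<Rightarrow> int).
        prime l \<and> split_space l V Q m \<longrightarrow>
          card (orbits (orth l V Q) (tuples m V) (diag_act m)) = (\<Prod>i=1..m. 1 + l ^ i) \<and>
          (m > 0 \<longrightarrow>
            card (orbits (special_orth l V Q) (tuples m V) (diag_act m)) =
              card (orbits (orth l V Q) (tuples m V) (diag_act m)) + 1))"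
proof (intro conjI allI impI; elim conjE)
  fix n r and V :: "(int, 'v) module" and Q :: "'v \<Rightarrow> int"
  assume *: "squarefree n" "free_of_rank n V r" "quadratic_form n V Q" "nondegenerate n V Q" "r \<ge> 2 * m + 2"
    "even n \<and> m > 0 \<longrightarrow> even r"
  show "card (orbits (orth_n n V Q) (tuples m V) (diag_act m)) = (\<Prod>l\<in>prime_factors n. \<Prod>i=1..m. 1 + l ^ i)"
    by (rule orbits_squarefree(1)[OF *])
  show "orbits (omega_n n V Q) (tuples m V) (diag_act m) = orbits (orth_n n V Q) (tuples m V) (diag_act m)"
    by (rule orbits_squarefree(2)[OF *])
next
  fix l and V :: "(int, 'w) module" and Q :: "'w \<Rightarrow> int"
  assume l: "prime l" "split_space l V Q m"
  show "card (orbits (orth l V Q) (tuples m V) (diag_act m)) = (\<Prod>i=1..m. 1 + l ^ i)"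
    by (rule card_orbits_split_space(1)[OF l])
  assume "m > 0"
  then show "card (orbits (special_orth l V Q) (tuples m V) (diag_act m)) =
      card (orbits (orth l V Q) (tuples m V) (diag_act m)) + 1"
    by (rule card_orbits_split_space(2)[OF l])
qed

end
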